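(* Let $\nu$ be a non-negative Borel measure on $[0,\infty)$ and let $$g(x)=x_+^0\int_0^\infty e^{-\pi\lambda x^2}\,d\nu(\lambda)\qquad(x\in\mathbb{R}).$$ (i) (Extremal minorant) Suppose $\int_0^\infty\frac{1}{1+\sqrt\lambda}\,d\nu(\lambda)<\infty$. Then there exists a unique extremal minorant $l$ of exponential type $2\pi$ for $g$. The function $l$ interpolates the values of $g$ and its derivative at $\mathbb{Z}\setminus\{0\}$ (that is, $l(n)=g(n)$ and $l'(n)=g'(n)$ for all $n\in\mathbb{Z}\setminus\{0\}$) and satisfies $$\int_{-\infty}^\infty\{g(x)-l(x)\}\,dx=\int_0^\infty\left\{-\frac{\theta_3(0,i\lambda)}{2}+\frac12+\frac{1}{2\sqrt\lambda}\right\}d\nu(\lambda).$$ (ii) (Extremal majorant) Suppose $\int_0^\infty d\nu(\lambda)<\infty$. Then there exists a unique extremal majorant $m$ of exponential type $2\pi$ for $g$. The function $m$ interpolates the values of $g$ and its derivative at $\mathbb{Z}\setminus\{0\}$ (that is, $m(n)=g(n)$ and $m'(n)=g'(n)$ for all $n\in\mathbb{Z}\setminus\{0\}$) and satisfies $$\int_{-\infty}^\infty\{m(x)-g(x)\}\,dx=\int_0^\infty\left\{\frac{\theta_3(0,i\lambda)}{2}+\frac12-\frac{1}{2\sqrt\lambda}\right\}d\nu(\lambda).$$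
   Context: An entire function $K$ is of exponential type at most $2\pi\delta$ if for every $\epsilon>0$ there is $C_\epsilon>0$ with $|K(z)|\le C_\epsilon e^{(2\pi\delta+\epsilon)|z|}$ for all $z\in\mathbb{C}$. An extremal minorant of exponential type $2\pi$ for $g$ is an entire function $l$ of exponential type at most $2\pi$, real-valued on $\mathbb{R}$, with $l(x)\le g(x)$ for all real $x$, that minimizes $\int_{-\infty}^\infty|g(x)-L(x)|\,dx$ among all entire functions $L$ of exponential type at most $2\pi$ that are real-valued on $\mathbb{R}$ and satisfy $L(x)\le g(x)$ for all real $x$. Extremal majorants are defined analogously with the inequality $L(x)\ge g(x)$. $x_+^0=\tfrac12(1+\mathrm{sgn}(x))$, i.e. $x_+^0=1$ for $x>0$, $\tfrac12$ for $x=0$, $0$ for $x<0$. Integrals $\int_0^\infty\cdots d\nu$ are over $[0,\infty)$. If $\nu$ is an infinite measure, the formula for $g$ gives $+\infty$ at the single point $x=0$. For $\Im\tau>0$, with $q=e^{\pi i\tau}$, $\theta_3(z,\tau)=\sum_{n=-\infty}^\infty q^{n^2}e^{2\pi inz}$. Each of the two integrands in braces, defined for $\lambda>0$, is given at $\lambda=0$ its limiting value $\tfrac12$ (relevant only if $\nu(\{0\})>0$). *)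

theory Defs
  imports "HOL-Probability.Probability" "HOL-Complex_Analysis.Complex_Analysis"
begin

definition exp_type_at_most :: "real \<Rightarrow> (complex \<Rightarrow> complex) \<Rightarrow> bool" where
  "exp_type_at_most \<sigma> K \<longleftrightarrow> K holomorphic_on UNIV \<and>
     (\<forall>\<epsilon>>0. \<exists>C>0. \<forall>z. norm (K z) \<le> C * exp ((\<sigma> + \<epsilon>) * norm z))"

definition real_on_reals :: "(complex \<Rightarrow> complex) \<Rightarrow> bool" where
  "real_on_reals K \<longleftrightarrow> (\<forall>x::real. K (complex_of_real x) \<in> \<real>)"

text \<open>Target functions are extended-real valued because the Gaussian mixture below takes the
  value \<open>\<infinity>\<close> at the origin when the mixing measure is infinite. Where \<open>real_of_ereal\<close> is applied to
  such a function (inside a derivative at a nonzero integer, or an integral over the line), the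
  resulting change of value at the origin is immaterial.\<close>

definition minorant_of :: "real \<Rightarrow> (real \<Rightarrow> ereal) \<Rightarrow> (complex \<Rightarrow> complex) \<Rightarrow> bool" where
  "minorant_of \<sigma> g L \<longleftrightarrow> exp_type_at_most \<sigma> L \<and> real_on_reals L \<and>
     (\<forall>x::real. ereal (Re (L (complex_of_real x))) \<le> g x)"

definition majorant_of :: "real \<Rightarrow> (real \<Rightarrow> ereal) \<Rightarrow> (complex \<Rightarrow> complex) \<Rightarrow> bool" where
  "majorant_of \<sigma> g L \<longleftrightarrow> exp_type_at_most \<sigma> L \<and> real_on_reals L \<and>
     (\<forall>x::real. g x \<le> ereal (Re (L (complex_of_real x))))"

text \<open>The \<open>L\<^sup>1\<close> distance on the real line, with value \<open>\<infinity>\<close> if the difference is not integrable.\<close>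

definition L1_dist :: "(real \<Rightarrow> ereal) \<Rightarrow> (complex \<Rightarrow> complex) \<Rightarrow> ennreal" where
  "L1_dist g L = (\<integral>\<^sup>+x. e2ennreal \<bar>g x - ereal (Re (L (complex_of_real x)))\<bar> \<partial>lborel)"

definition extremal_minorant :: "real \<Rightarrow> (real \<Rightarrow> ereal) \<Rightarrow> (complex \<Rightarrow> complex) \<Rightarrow> bool" where
  "extremal_minorant \<sigma> g l \<longleftrightarrow> minorant_of \<sigma> g l \<and>
     (\<forall>L. minorant_of \<sigma> g L \<longrightarrow> L1_dist g l \<le> L1_dist g L)"

definition extremal_majorant :: "real \<Rightarrow> (real \<Rightarrow> ereal) \<Rightarrow> (complex \<Rightarrow> complex) \<Rightarrow> bool" where
  "extremal_majorant \<sigma> g m \<longleftrightarrow> majorant_of \<sigma> g m \<and>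
     (\<forall>L. majorant_of \<sigma> g L \<longrightarrow> L1_dist g m \<le> L1_dist g L)"

text \<open>Equality of values and of first derivatives at the nonzero integers; this includes that \<open>g\<close>
  is finite and differentiable there.\<close>

definition interpolates_off_zero :: "(real \<Rightarrow> ereal) \<Rightarrow> (complex \<Rightarrow> complex) \<Rightarrow> bool" where
  "interpolates_off_zero g K \<longleftrightarrow> (\<forall>n::int. n \<noteq> 0 \<longrightarrow>
     (\<exists>y d::real. g (of_int n) = ereal y \<and> K (of_int n) = complex_of_real y \<and>
        ((\<lambda>x. real_of_ereal (g x)) has_real_derivative d) (at (of_int n)) \<and>
        (K has_field_derivative complex_of_real d) (at (of_int n))))"

definition xplus0 :: "real \<Rightarrow> real" where
  "xplus0 x = (1 + sgn x) / 2"

definition truncated_gaussian_mixture :: "real measure \<Rightarrow> real \<Rightarrow> ereal" where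
  "truncated_gaussian_mixture \<nu> x =
     ereal (xplus0 x) * enn2ereal (\<integral>\<^sup>+t. ennreal (exp (- pi * t * x\<^sup>2)) \<partial>\<nu>)"

definition theta3 :: "complex \<Rightarrow> complex \<Rightarrow> complex" where
  "theta3 z \<tau> = (let q = exp (complex_of_real pi * \<i> * \<tau>) in
     \<Sum>\<^sub>\<infinity>n::int. q powi (n\<^sup>2) * exp (2 * complex_of_real pi * \<i> * of_int n * z))"

text \<open>The value \<open>1/2\<close> at \<open>0\<close> is the limit from the right. Taking the real part loses nothing, since
  \<open>theta3 0 (\<i> * t)\<close> is real for real \<open>t > 0\<close>.\<close>

definition minorant_weight :: "real \<Rightarrow> real" where
  "minorant_weight t = (if t = 0 then 1 / 2
     else - Re (theta3 0 (\<i> * complex_of_real t)) / 2 + 1 / 2 + 1 / (2 * sqrt t))"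

definition majorant_weight :: "real \<Rightarrow> real" where
  "majorant_weight t = (if t = 0 then 1 / 2
     else Re (theta3 0 (\<i> * complex_of_real t)) / 2 + 1 / 2 - 1 / (2 * sqrt t))"

end

theory Submission
  imports Defs "HOL-Real_Asymp.Real_Asymp"
begin

text \<open>Everything is superposed from single Gaussians. For one Gaussian the minorant is the unique
  function of type \<open>2\<pi>\<close> with the values and slopes of the truncated Gaussian at the nonzero
  integers and, at the origin, the value \<open>0\<close> and the slope \<open>c\<close> cancelling the sum of all the other
  slopes. That it lies between the truncated Gaussian minus \<open>(sin \<pi>x / \<pi>x)\<^sup>2\<close> and the truncated
  Gaussian is an inequality for an explicit partial-fraction series. On the negative axis the series is the Laplace
  transform of a theta-like sum with values in \<open>[0,1]\<close>. On the positive axis it follows, for wide Gaussians,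
  from the two-sided interpolation formula for the Gaussian, whose defect is an explicit sum of
  cosine transforms of convex functions; for narrow Gaussians it is checked term by term.

  Extremality and uniqueness come from Poisson summation: an integrable function of type \<open>2\<pi>\<close>
  has integral equal to the sum of its values at the integers, and it vanishes if it has
  double zeros at the nonzero integers and a zero at the origin.\<close>

section \<open>Growth of entire functions of exponential type\<close>

text \<open>The value at the origin is forced: a minorant is at most 0 there, by continuity from the
  left, and a majorant at least the total mass, by continuity from the right. So the majorant is the
  minorant plus \<open>mass\<close> times \<open>(sin \<pi>x / \<pi>x)^2\<close>, and one pair of
  inequalities \<open>0 \<le> gap \<le> 1 / x^2\<close> serves both halves. The obstacle is to have
  it for every width \<open>a = 2 \<pi> t\<close>. On the positive axis the two-sided formula writes
  the gap as \<open>1 / x^2 - left_error - defect\<close>: the negative-axis error and the defect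
  compete for the same budget \<open>1 / x^2\<close>, and the bound 1 for the theta-like sum would
  leave nothing for the defect. Hence 97/100 and 63/100 instead, matched with defects 3/100 for
  \<open>a \<le> 2\<close> and 37/100 for \<open>a \<le> 4\<close>. The sign of the defect is
  obtained as long as the spectral Gaussian is convex beyond the frequency \<open>2 \<pi>\<close>;
  this covers the upper inequality up to \<open>a = 36\<close>. Past 4 and 36 respectively the poles
  of \<open>\<pi>^2 / sin^2\<close> are compared with the series directly.\<close>

lemma entire_affine:
  assumes "f holomorphic_on UNIV"
  shows "(\<lambda>z. f (a * z + b)) holomorphic_on UNIV"
  using holomorphic_on_compose_gen[of "\<lambda>z. a * z + b" UNIV f UNIV] assms
  by (simp add: o_def holomorphic_intros)

text \<open>Supplies the damping exponent for Phragmen-Lindelof. For \<open>w\<close> within 45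
  degrees of the positive axis the principal root \<open>p + iq\<close> lies within 22.5 degrees, so
  \<open>\<bar>q\<bar> \<le> p / 2\<close>; hence the real part of \<open>w^(3/2)\<close> is still
  of the order \<open>p^3\<close>, while \<open>w\<close> itself is of the order
  \<open>p^2\<close>.\<close>

lemma csqrt_cube_lower_bound:
  assumes "\<bar>Im w\<bar> \<le> Re w"
  shows "(Re (csqrt w)) ^ 3 / 4 \<le> Re (w * csqrt w)"
    and "cmod w \<le> 5 / 4 * (Re (csqrt w))\<^sup>2"
proof -
  define r where "r = csqrt w"
  define p q where "p = Re r" and "q = Im r"
  have p0: "p \<ge> 0" unfolding p_def r_def by (metis Re_csqrt)
  have sq: "w = r\<^sup>2" by (simp add: r_def)
  have re: "Re w = p\<^sup>2 - q\<^sup>2" by (simp add: sq p_def q_def power2_eq_square)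
  have im: "Im w = 2 * p * q" by (simp add: sq p_def q_def power2_eq_square)
  have *: "2 * p * \<bar>q\<bar> \<le> p\<^sup>2 - q\<^sup>2"
    using assms p0 unfolding re im by (simp add: abs_mult)
  have q: "\<bar>q\<bar> \<le> p / 2"
  proof (rule ccontr)
    assume "\<not> \<bar>q\<bar> \<le> p / 2"
    then have "p < 2 * \<bar>q\<bar>" by simp
    then have "p * p \<le> p * (2 * \<bar>q\<bar>)" "q\<^sup>2 > 0" using p0 by (auto intro!: mult_left_mono)
    with * show False by (simp add: power2_eq_square)
  qed
  have q2: "q\<^sup>2 \<le> p\<^sup>2 / 4"
    using power_mono[OF q, of 2] by (simp add: power_divide)
  have "Re (w * r) = p * (p\<^sup>2 - 3 * q\<^sup>2)"
    by (simp add: sq p_def q_def power2_eq_square algebra_simps)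
  moreover have "p * (p\<^sup>2 / 4) \<le> p * (p\<^sup>2 - 3 * q\<^sup>2)"
    using p0 q2 by (intro mult_left_mono) auto
  ultimately show "(Re (csqrt w)) ^ 3 / 4 \<le> Re (w * csqrt w)"
    by (simp add: r_def[symmetric] p_def power2_eq_square power3_eq_cube)
  have "cmod w = p\<^sup>2 + q\<^sup>2"
    by (simp add: sq norm_power cmod_power2 p_def q_def)
  then show "cmod w \<le> 5 / 4 * (Re (csqrt w))\<^sup>2" using q2 by (simp add: p_def r_def)
qed

text \<open>An opening of \<pi>/2 makes growth of order one subcritical. The factor
  \<open>exp (- \<delta> r z)\<close> with \<open>r z = (z + 1)^(3/2)\<close> has an exponent of
  order strictly between 1 and 2 and beats the growth; the maximum principle on a large truncated
  sector and then the limit \<delta> to 0 finish.\<close>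

lemma Phragmen_Lindelof_right_angle:
  assumes hol: "f holomorphic_on UNIV"
    and growth: "\<And>z. cmod (f z) \<le> C * exp (B * cmod z)"
    and bd: "\<And>z. \<bar>Im z\<bar> = Re z \<Longrightarrow> cmod (f z) \<le> M" and M: "M > 0"
    and z: "\<bar>Im z\<bar> \<le> Re z"
  shows "cmod (f z) \<le> M"
proof -
  define S where "S = {z. \<bar>Im z\<bar> \<le> Re z}"
  \<comment> \<open>The shift by 1 keeps the argument off the cut of \<open>csqrt\<close> on the
    whole closed sector, vertex included.\<close>
  define r where "r = (\<lambda>z. (z + 1) * csqrt (z + 1))"
  have C: "C \<ge> 0" using growth[of 0] norm_ge_zero[of "f 0"] by (simp del: norm_ge_zero)
  have Bpos: "cmod (f z) \<le> C * exp (\<bar>B\<bar> * cmod z)" for z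
    by (rule order_trans[OF growth]) (use C in \<open>auto intro!: mult_left_mono mult_right_mono\<close>)
  have inS: "(Re (csqrt (z+1))) ^ 3 / 4 \<le> Re (r z)" "cmod (z + 1) \<le> 5 / 4 * (Re (csqrt (z + 1)))\<^sup>2"
    if "z \<in> S" for z
    using csqrt_cube_lower_bound[of "z+1"] that by (auto simp: S_def r_def)
  have Re_r: "Re (r z) \<ge> 0" if "z \<in> S" for z
    using inS(1)[OF that] zero_le_power[of "Re (csqrt (z+1))" 3] Re_csqrt[of "z+1"]
    by linarith
  have key: "cmod (f z) * exp (- \<delta> * Re (r z)) \<le> M" if \<delta>: "\<delta> > 0" for \<delta>
  proof -
    have "((\<lambda>p. C * exp (\<bar>B\<bar> * (5/4 * p\<^sup>2 + 1) - \<delta> * (p ^ 3 / 4))) \<longlongrightarrow> 0) at_top"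
      using \<delta> by real_asymp
    then have "eventually (\<lambda>p. C * exp (\<bar>B\<bar> * (5/4 * p\<^sup>2 + 1) - \<delta> * (p ^ 3 / 4)) < M) at_top"
      using M by (rule order_tendstoD)
    then obtain p0 where p0: "\<And>p. p \<ge> p0 \<Longrightarrow> C * exp (\<bar>B\<bar> * (5/4 * p\<^sup>2 + 1) - \<delta> * (p ^ 3 / 4)) < M"
      by (auto simp: eventually_at_top_linorder)
    \<comment> \<open>On the outer arc \<open>cmod w = R\<close> this choice forces
      \<open>Re (csqrt (w + 1)) \<ge> p0\<close>, where the damping already wins.\<close>
    define R where "R = max (cmod z + 1) (1 + 5/4 * p0\<^sup>2)"
    define SR where "SR = S \<inter> cball 0 R"
    define h where "h = (\<lambda>z. f z * exp (- of_real \<delta> * r z))"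
    have norm_h: "cmod (h z) = cmod (f z) * exp (- \<delta> * Re (r z))" for z
      by (simp add: h_def norm_mult)
    have clS: "closed S" unfolding S_def by (intro closed_Collect_le continuous_intros)
    have oU: "open {z. \<bar>Im z\<bar> < Re z \<and> cmod z < R}"
      by (intro open_Collect_conj open_Collect_less continuous_intros)
    have nonneg: "z + 1 \<notin> \<real>\<^sub>\<le>\<^sub>0" if "z \<in> S" for z
      using that by (auto simp: S_def complex_nonpos_Reals_iff)
    have hol_h: "h holomorphic_on S"
      unfolding h_def r_def using nonneg
      by (intro holomorphic_intros holomorphic_on_subset[OF hol]) auto
    have "cmod (h z) \<le> M"
    proof (rule maximum_modulus_frontier[where S = SR and f = h and \<xi> = z])
      show "h holomorphic_on interior SR"
        by (rule holomorphic_on_subset[OF hol_h]) (use interior_subset in \<open>auto simp: SR_def\<close>)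
      have "closed SR" unfolding SR_def using clS by auto
      then show "continuous_on (closure SR) h"
        using hol_h by (auto simp: SR_def intro!: holomorphic_on_imp_continuous_on elim!: holomorphic_on_subset)
      show "bounded SR" unfolding SR_def by (auto intro: bounded_subset[OF bounded_cball])
      show "z \<in> SR" using z by (auto simp: SR_def S_def R_def)
      fix w assume "w \<in> frontier SR"
      then have w: "w \<in> SR" "w \<notin> interior SR"
        using \<open>closed SR\<close> by (auto simp: frontier_def)
      then have wS: "w \<in> S" by (simp add: SR_def)
      have "\<not> (\<bar>Im w\<bar> < Re w \<and> cmod w < R)"
        using w(2) oU interior_maximal[of "{z. \<bar>Im z\<bar> < Re z \<and> cmod z < R}" SR]
        by (force simp: SR_def S_def simp del: interior_Int)
      with w(1) consider "\<bar>Im w\<bar> = Re w" | "cmod w = R"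
        by (fastforce simp: SR_def S_def)
      then show "cmod (h w) \<le> M"
      proof cases
        case 1
        have "cmod (h w) \<le> cmod (f w) * 1"
          unfolding norm_h using Re_r[OF wS] \<delta> by (intro mult_left_mono) auto
        then show ?thesis using bd[OF 1] by simp
      next
        case 2
        define p where "p = Re (csqrt (w + 1))"
        have p: "p \<ge> 0" unfolding p_def by (metis Re_csqrt)
        have b: "cmod (w + 1) \<le> 5 / 4 * p\<^sup>2" "p ^ 3 / 4 \<le> Re (r w)"
          using inS[OF wS] by (auto simp: p_def)
        have "R \<le> cmod (w + 1) + 1" using 2 norm_triangle_ineq4[of "w+1" 1] by simp
        then have "R \<le> 5/4 * p\<^sup>2 + 1" using b by simp
        then have "p0\<^sup>2 \<le> p\<^sup>2" by (simp add: R_def)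
        then have "p \<ge> p0" using p by (simp add: power2_le_iff_abs_le)
        have "cmod (h w) \<le> (C * exp (\<bar>B\<bar> * R)) * exp (- \<delta> * (p ^ 3 / 4))"
          unfolding norm_h using Bpos[of w] 2 \<delta> b C by (intro mult_mono) auto
        also have "\<dots> \<le> (C * exp (\<bar>B\<bar> * (5/4 * p\<^sup>2 + 1))) * exp (- \<delta> * (p ^ 3 / 4))"
          using C \<open>R \<le> 5/4 * p\<^sup>2 + 1\<close> by (intro mult_right_mono mult_left_mono) (auto intro!: mult_left_mono)
        also have "\<dots> = C * exp (\<bar>B\<bar> * (5/4 * p\<^sup>2 + 1) - \<delta> * (p ^ 3 / 4))"
          by (simp add: mult.assoc exp_add[symmetric] algebra_simps)
        also have "\<dots> < M" using p0[OF \<open>p \<ge> p0\<close>] .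
        finally show ?thesis by simp
      qed
    qed
    then show ?thesis by (simp add: norm_h)
  qed
  have "((\<lambda>\<delta>. cmod (f z) * exp (- \<delta> * Re (r z))) \<longlongrightarrow> cmod (f z) * exp (- 0 * Re (r z))) (at_right 0)"
    by (intro tendsto_intros)
  then have "cmod (f z) * exp (- 0 * Re (r z)) \<le> M"
    by (rule tendsto_upperbound) (use key in \<open>auto intro!: eventually_mono[OF eventually_at_right_less]\<close>)
  then show ?thesis by simp
qed

text \<open>The bound \<open>K\<close> only says that \<open>g\<close> is bounded; it makes
  \<open>g^n / (z + i)\<close> decay at infinity, so the maximum principle applies on large half
  discs and sees the axis alone. The price is a factor \<open>\<bar>z + i\<bar>\<close> that does
  not depend on \<open>n\<close>, and n-th roots remove it.\<close>

lemma bounded_upper_half_plane: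
  assumes hol: "g holomorphic_on UNIV"
    and K: "\<And>z. Im z \<ge> 0 \<Longrightarrow> cmod (g z) \<le> K"
    and bd: "\<And>x. cmod (g (of_real x)) \<le> M" and M: "M > 0"
    and z: "Im z \<ge> 0"
  shows "cmod (g z) \<le> M"
proof -
  have pow: "(cmod (g z) / M) ^ n \<le> cmod (z + \<i>)" for n
  proof -
    define R where "R = max (cmod z + 1) (1 + K ^ n / M ^ n)"
    define SR where "SR = {z. Im z \<ge> 0} \<inter> cball 0 R"
    define h where "h = (\<lambda>z. g z ^ n / (z + \<i>))"
    have nz: "z + \<i> \<noteq> 0" if "Im z \<ge> 0" for z using that by (auto simp: complex_eq_iff)
    have hol_h: "h holomorphic_on {z. Im z \<ge> 0}"
      unfolding h_def using nz by (intro holomorphic_intros holomorphic_on_subset[OF hol]) auto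
    have "cmod (h z) \<le> M ^ n"
    proof (rule maximum_modulus_frontier[where S = SR and f = h and \<xi> = z])
      show "h holomorphic_on interior SR"
        by (rule holomorphic_on_subset[OF hol_h]) (use interior_subset in \<open>auto simp: SR_def\<close>)
      have "closed SR" unfolding SR_def by (intro closed_Int closed_Collect_le continuous_intros) auto
      then show "continuous_on (closure SR) h"
        using hol_h by (auto simp: SR_def intro!: holomorphic_on_imp_continuous_on elim!: holomorphic_on_subset)
      show "bounded SR" unfolding SR_def by (auto intro: bounded_subset[OF bounded_cball])
      show "z \<in> SR" using z by (auto simp: SR_def R_def)
      fix w assume "w \<in> frontier SR"
      then have w: "w \<in> SR" "w \<notin> interior SR"
        using \<open>closed SR\<close> by (auto simp: frontier_def)
      have "open {z. 0 < Im z \<and> cmod z < R}"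
        by (intro open_Collect_conj open_Collect_less continuous_intros)
      then have "\<not> (0 < Im w \<and> cmod w < R)"
        using w(2) interior_maximal[of "{z. 0 < Im z \<and> cmod z < R}" SR]
        by (force simp: SR_def simp del: interior_Int)
      with w(1) consider "Im w = 0" | "cmod w = R" "Im w \<ge> 0"
        by (fastforce simp: SR_def)
      then show "cmod (h w) \<le> M ^ n"
      proof cases
        case 1
        then have "w = of_real (Re w)" by (simp add: complex_eq_iff)
        then have "cmod (g w) \<le> M" by (metis bd)
        moreover have "1 \<le> cmod (w + \<i>)" using 1 abs_Im_le_cmod[of "w + \<i>"] by simp
        ultimately have "cmod (g w) ^ n / cmod (w + \<i>) \<le> M ^ n / 1"
          using M by (intro frac_le power_mono) auto
        then show ?thesis by (simp add: h_def norm_divide norm_power)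
      next
        case 2
        have "R - 1 \<le> cmod (w + \<i>)" using 2 norm_triangle_ineq4[of "w+\<i>" \<i>] by simp
        moreover have "K ^ n / M ^ n \<le> R - 1" by (simp add: R_def)
        ultimately have "K ^ n / M ^ n \<le> cmod (w + \<i>)" by simp
        then have "K ^ n \<le> M ^ n * cmod (w + \<i>)"
          using M by (simp add: pos_divide_le_eq mult.commute)
        moreover have "cmod (g w) ^ n \<le> K ^ n" using K[OF 2(2)] by (intro power_mono) auto
        ultimately have "cmod (g w) ^ n \<le> M ^ n * cmod (w + \<i>)" by simp
        then show ?thesis using nz[OF 2(2)] by (simp add: h_def norm_divide norm_power field_simps)
      qed
    qed
    then show ?thesis using nz[OF z] M by (simp add: h_def norm_divide norm_power field_simps)
  qed
  show ?thesis
  proof (rule ccontr)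
    assume "\<not> ?thesis"
    then have "1 < cmod (g z) / M" using M by (simp add: field_simps)
    from real_arch_pow[OF this, of "cmod (z + \<i>)"] pow show False
      by (meson not_less)
  qed
qed

text \<open>The modulated function \<open>f z exp (i (\<sigma> + \<epsilon>) z)\<close> is bounded
  on the real axis by \<open>M\<close> and on the positive imaginary axis by the type constant,
  hence on each quadrant by their maximum. The half-plane lemma replaces this \<epsilon>-dependent
  maximum by \<open>M\<close>, and only then can \<epsilon> tend to 0.\<close>

lemma exp_type_upper_half_plane_bound:
  assumes et: "exp_type_at_most \<sigma> f"
    and bd: "\<And>x. cmod (f (of_real x)) \<le> M" and M: "M > 0" and z: "Im z \<ge> 0"
  shows "cmod (f z) \<le> M * exp (\<sigma> * Im z)"
proof -
  have hol: "f holomorphic_on UNIV" using et by (simp add: exp_type_at_most_def)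
  have key: "cmod (f z) \<le> M * exp ((\<sigma> + \<epsilon>) * Im z)" if \<epsilon>: "\<epsilon> > 0" for \<epsilon>
  proof -
    obtain C where C: "C > 0" "\<And>z. cmod (f z) \<le> C * exp ((\<sigma> + \<epsilon>) * cmod z)"
      using et \<epsilon> unfolding exp_type_at_most_def by blast
    define g where "g = (\<lambda>z. f z * exp (\<i> * of_real (\<sigma> + \<epsilon>) * z))"
    have ng: "cmod (g z) = cmod (f z) * exp (- (\<sigma> + \<epsilon>) * Im z)" for z
      by (simp add: g_def norm_mult algebra_simps)
    have hg: "g holomorphic_on UNIV" unfolding g_def using hol by (intro holomorphic_intros)
    define K where "K = max M C"
    have K: "K > 0" using M by (simp add: K_def)
    have real_bd: "cmod (g w) \<le> K" if "Im w = 0" for w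
    proof -
      have "w = of_real (Re w)" using that by (simp add: complex_eq_iff)
      then have "cmod (f w) \<le> M" by (metis bd)
      then show ?thesis using that by (simp add: ng K_def)
    qed
    have imag_bd: "cmod (g w) \<le> K" if "Re w = 0" "Im w \<ge> 0" for w
    proof -
      have cw: "cmod w = Im w" using that by (simp add: cmod_def)
      have "cmod (g w) \<le> (C * exp ((\<sigma> + \<epsilon>) * cmod w)) * exp (- (\<sigma> + \<epsilon>) * Im w)"
        unfolding ng by (intro mult_right_mono C) auto
      also have "\<dots> = C" unfolding cw by (simp add: mult.assoc exp_add[symmetric] algebra_simps)
      finally show ?thesis by (simp add: K_def)
    qed
    have gr: "cmod (g z) \<le> C * exp ((\<sigma> + \<epsilon> + \<bar>\<sigma> + \<epsilon>\<bar>) * cmod z)" for z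
    proof -
      have "- (\<sigma> + \<epsilon>) * Im z \<le> \<bar>\<sigma> + \<epsilon>\<bar> * cmod z"
      proof -
        have "- (\<sigma> + \<epsilon>) * Im z \<le> \<bar>(\<sigma> + \<epsilon>) * Im z\<bar>"
          using abs_ge_minus_self[of "(\<sigma> + \<epsilon>) * Im z"] by (simp only: mult_minus_left)
        also have "\<dots> \<le> \<bar>\<sigma> + \<epsilon>\<bar> * cmod z"
          unfolding abs_mult by (intro mult_left_mono abs_Im_le_cmod) auto
        finally show ?thesis .
      qed
      then have "cmod (g z) \<le> (C * exp ((\<sigma> + \<epsilon>) * cmod z)) * exp (\<bar>\<sigma> + \<epsilon>\<bar> * cmod z)"
        unfolding ng using C by (intro mult_mono) auto
      then show ?thesis by (simp add: distrib_right exp_add mult.assoc)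
    qed
    \<comment> \<open>Multiplication by \<open>1 + i\<close> carries the sector about the positive
      axis onto the first quadrant, multiplication by \<open>-1 + i\<close> onto the second.\<close>
    have sector: "cmod (g (\<omega> * w)) \<le> K"
      if \<omega>: "\<omega> = 1 + \<i> \<or> \<omega> = -1 + \<i>" and w: "\<bar>Im w\<bar> \<le> Re w" for \<omega> w
    proof (rule Phragmen_Lindelof_right_angle[where f = "\<lambda>w. g (\<omega> * w)" and M = K and z = w])
      show "(\<lambda>w. g (\<omega> * w)) holomorphic_on UNIV"
        using entire_affine[OF hg, of \<omega> 0] by simp
      show "cmod (g (\<omega> * w)) \<le> C * exp (((\<sigma> + \<epsilon> + \<bar>\<sigma> + \<epsilon>\<bar>) * cmod \<omega>) * cmod w)" for w
        using gr[of "\<omega> * w"] by (simp add: norm_mult mult.assoc)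
      show "cmod (g (\<omega> * w)) \<le> K" if "\<bar>Im w\<bar> = Re w" for w
      proof -
        have "Im (\<omega> * w) = 0 \<or> (Re (\<omega> * w) = 0 \<and> Im (\<omega> * w) \<ge> 0)"
          using that \<omega> by (cases "Im w \<ge> 0") auto
        then show ?thesis using real_bd imag_bd by blast
      qed
    qed (use K w in auto)
    have upper: "cmod (g z) \<le> K" if "Im z \<ge> 0" for z
    proof (cases "Re z \<ge> 0")
      case True
      have "cmod (g ((1 + \<i>) * (z * (1 - \<i>) / 2))) \<le> K"
        using that True by (intro sector) auto
      moreover have "(1 + \<i>) * (z * (1 - \<i>) / 2) = z"
        by (simp add: algebra_simps)
      ultimately show ?thesis by (simp only:)
    next
      case False
      have "cmod (g ((-1 + \<i>) * (z * (-1 - \<i>) / 2))) \<le> K"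
        using that False by (intro sector) auto
      moreover have "(-1 + \<i>) * (z * (-1 - \<i>) / 2) = z"
        by (simp add: algebra_simps)
      ultimately show ?thesis by (simp only:)
    qed
    have "cmod (g z) \<le> M"
      by (rule bounded_upper_half_plane[OF hg upper _ M z]) (use bd in \<open>auto simp: ng\<close>)
    then show ?thesis by (simp add: ng exp_minus exp_diff exp_add distrib_right left_diff_distrib field_simps)
  qed
  have "((\<lambda>\<epsilon>. M * exp ((\<sigma> + \<epsilon>) * Im z)) \<longlongrightarrow> M * exp ((\<sigma> + 0) * Im z)) (at_right 0)"
    by (intro tendsto_intros)
  then have "cmod (f z) \<le> M * exp ((\<sigma> + 0) * Im z)"
    by (rule tendsto_lowerbound) (auto intro!: eventually_mono[OF eventually_at_right_less] key)
  then show ?thesis by simp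
qed

theorem exp_type_horizontal_bound:
  assumes et: "exp_type_at_most \<sigma> f"
    and bd: "\<And>x. cmod (f (of_real x)) \<le> M"
  shows "cmod (f z) \<le> M * exp (\<sigma> * \<bar>Im z\<bar>)"
proof -
  have M: "M \<ge> 0" using bd[of 0] norm_ge_zero[of "f 0"] by (simp del: norm_ge_zero)
  \<comment> \<open>A strictly larger \<open>M'\<close> is used because \<open>M\<close> may be 0,
    while the half-plane bound wants a positive constant.\<close>
  have key: "cmod (f z) \<le> M' * exp (\<sigma> * \<bar>Im z\<bar>)" if "M' > M" for M'
  proof (cases "Im z \<ge> 0")
    case True
    then show ?thesis
      using exp_type_upper_half_plane_bound[OF et _ _ True, of M'] bd M that by (smt (verit))
  next
    case False
    have "exp_type_at_most \<sigma> (\<lambda>z. f (- z))"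
      unfolding exp_type_at_most_def
    proof (intro conjI allI impI)
      show "(\<lambda>z. f (- z)) holomorphic_on UNIV"
        using entire_affine[of f "-1" 0] et by (simp add: exp_type_at_most_def)
      fix \<epsilon> :: real assume "\<epsilon> > 0"
      then obtain C where "C > 0" "\<And>z. cmod (f z) \<le> C * exp ((\<sigma> + \<epsilon>) * cmod z)"
        using et unfolding exp_type_at_most_def by blast
      then show "\<exists>C>0. \<forall>z. cmod (f (- z)) \<le> C * exp ((\<sigma> + \<epsilon>) * cmod z)"
        by (metis norm_minus_cancel)
    qed
    moreover have "cmod (f (- of_real x)) \<le> M'" for x
      using bd[of "- x"] that by simp
    ultimately show ?thesis
      using exp_type_upper_half_plane_bound[of \<sigma> "\<lambda>z. f (- z)" M' "- z"] M that False by simp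
  qed
  show ?thesis
  proof (rule field_le_epsilon)
    fix e :: real assume e: "e > 0"
    define E where "E = exp (\<sigma> * \<bar>Im z\<bar>)"
    have "E > 0" by (simp add: E_def)
    then have "cmod (f z) \<le> (M + e / E) * E" using e key[of "M + e / E"] by (simp add: E_def)
    also have "\<dots> = M * E + e" using \<open>E > 0\<close> by (simp add: field_simps)
    finally show "cmod (f z) \<le> M * exp (\<sigma> * \<bar>Im z\<bar>) + e" by (simp add: E_def)
  qed
qed

section \<open>Entire functions with zeros at all integers, and limits of bounded sequences\<close>

lemma sin_pi_eq_0_iff: "sin (of_real pi * z) = 0 \<longleftrightarrow> (z::complex) \<in> \<int>"
proof -
  have "sin (of_real pi * z) = 0 \<longleftrightarrow> (\<exists>n::int. of_real pi * z = of_real (of_int n * pi))"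
    by (simp add: sin_eq_0)
  also have "\<dots> \<longleftrightarrow> (\<exists>n::int. z = of_int n)" by (simp add: mult.commute)
  finally show ?thesis by (auto elim: Ints_cases)
qed

lemma cos_pi_int_nonzero: "z \<in> \<int> \<Longrightarrow> cos (of_real pi * z :: complex) \<noteq> 0"
  using sin_cos_squared_add[of "of_real pi * z"] sin_pi_eq_0_iff[of z]
  by (auto simp: power2_eq_square)

lemma holomorphic_divided_difference:
  assumes "f holomorphic_on S" "open S" "f a = 0"
  shows "(\<lambda>z. if z = a then deriv f a else f z / (z - a)) holomorphic_on S"
  by (rule pole_theorem_open_0[OF assms(1,2)]) (use assms in auto)

text \<open>Near an integer both \<open>f\<close> and the sine have holomorphic divided differences,
  and that of the sine does not vanish because its zeros are simple; their quotient is the local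
  form of \<open>q\<close>.\<close>

lemma entire_divide_sin:
  assumes hol: "f holomorphic_on UNIV" and zero: "\<And>n::int. f (of_int n) = 0"
  obtains q where "q holomorphic_on UNIV" "\<And>z. f z = q z * sin (of_real pi * z)"
proof -
  define q where "q = (\<lambda>z. if z \<in> \<int> then deriv f z / (of_real pi * cos (of_real pi * z))
                          else f z / sin (of_real pi * z))"
  have "q field_differentiable at a" for a
  proof (cases "a \<in> \<int>")
    case False
    have "(\<lambda>z. f z / sin (of_real pi * z)) holomorphic_on (- \<int>)"
      by (intro holomorphic_intros holomorphic_on_subset[OF hol]) (auto simp: sin_pi_eq_0_iff)
    then have "q holomorphic_on (- \<int>)"
      by (rule holomorphic_transform) (auto simp: q_def)
    then show ?thesis
      using False by (auto intro!: holomorphic_on_imp_differentiable_at[of q "- \<int>"] simp: open_Compl)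
  next
    case True
    define S where "S = ball a 1"
    define s where "s = (\<lambda>z. sin (complex_of_real pi * z))"
    have ds: "deriv s a = of_real pi * cos (of_real pi * a)"
      unfolding s_def by (rule DERIV_imp_deriv) (auto intro!: derivative_eq_intros)
    have sa: "s a = 0" using True by (simp add: s_def sin_pi_eq_0_iff)
    have fa: "f a = 0" using True zero by (auto elim: Ints_cases)
    have nint: "z \<notin> \<int>" if "z \<in> S" "z \<noteq> a" for z
    proof
      assume "z \<in> \<int>"
      then obtain k l :: int where "z = of_int k" "a = of_int l" using True by (auto elim!: Ints_cases)
      then have "dist a z = \<bar>real_of_int (l - k)\<bar>"
        by (metis dist_norm norm_of_int of_int_diff)
      moreover have "l \<noteq> k" using that \<open>z = of_int k\<close> \<open>a = of_int l\<close> by auto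
      ultimately show False using that by (simp add: S_def del: of_int_diff)
    qed
    define F where "F = (\<lambda>z. if z = a then deriv f a else f z / (z - a))"
    define G where "G = (\<lambda>z. if z = a then deriv s a else s z / (z - a))"
    have "F holomorphic_on S" unfolding F_def
      by (rule holomorphic_divided_difference) (use hol fa in \<open>auto simp: S_def elim: holomorphic_on_subset\<close>)
    moreover have "G holomorphic_on S" unfolding G_def
      by (rule holomorphic_divided_difference) (use sa in \<open>auto simp: S_def s_def intro!: holomorphic_intros\<close>)
    moreover have "G z \<noteq> 0" if "z \<in> S" for z
      using nint[OF that] cos_pi_int_nonzero[OF True]
      by (cases "z = a") (simp_all add: G_def ds, simp add: s_def sin_pi_eq_0_iff)
    ultimately have "(\<lambda>z. F z / G z) holomorphic_on S" by (intro holomorphic_intros) auto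
    then have "q holomorphic_on S"
      by (rule holomorphic_transform)
         (use True nint in \<open>auto simp: q_def F_def G_def ds, auto simp: s_def\<close>)
    then show ?thesis by (rule holomorphic_on_imp_differentiable_at) (auto simp: S_def)
  qed
  then have "q holomorphic_on UNIV" by (auto simp: holomorphic_on_def intro: field_differentiable_at_within)
  moreover have "f z = q z * sin (of_real pi * z)" for z
    using zero by (cases "z \<in> \<int>") (auto simp: q_def sin_pi_eq_0_iff elim: Ints_cases)
  ultimately show ?thesis using that by blast
qed

text \<open>Read off from \<open>4 \<bar>sin w\<bar>^2 = e^(2y) + e^(-2y) - 2 cos (2x)\<close>: away
  from the real axis the exponential dominates, and on vertical lines through half-integers the
  cosine has the favourable sign. Such lines frame the boxes that trap the integers.\<close>

lemma norm_sin_pi_lower_bound: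
  assumes "\<bar>Im z\<bar> \<ge> 1 \<or> cos (2 * pi * Re z) = -1"
  shows "exp (2 * pi * \<bar>Im z\<bar>) \<le> 8 * (cmod (sin (of_real pi * z)))\<^sup>2"
proof -
  define y where "y = \<bar>Im z\<bar>"
  define e where "e = exp (2 * pi * y)"
  have e: "e \<ge> 1" by (simp add: e_def y_def)
  have "(cmod (sin (of_real pi * z)))\<^sup>2 = (exp (2 * (pi * Im z)) + inverse (exp (2 * (pi * Im z))) - 2 * cos (2 * (pi * Re z))) / 4"
    by (subst norm_sin_squared) simp
  also have "exp (2 * (pi * Im z)) + inverse (exp (2 * (pi * Im z))) = e + inverse e"
    by (auto simp: e_def y_def abs_if exp_minus mult.assoc)
  finally have *: "(cmod (sin (of_real pi * z)))\<^sup>2 = (e + inverse e - 2 * cos (2 * pi * Re z)) / 4"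
    by (simp add: mult.assoc)
  show ?thesis
  proof (cases "cos (2 * pi * Re z) = -1")
    case True
    have "inverse e > 0" using e by simp
    with e have "e \<le> 2 * (e + inverse e + 2)" by argo
    then show ?thesis unfolding * True by (simp add: e_def y_def)
  next
    case False
    then have "y \<ge> 1" using assms by (simp add: y_def)
    then have "2 * pi * y \<ge> 2 * 3 * 1" using pi_gt3 by (intro mult_mono) auto
    then have "e \<ge> 1 + 6" using exp_ge_add_one_self[of "2 * pi * y"] unfolding e_def by linarith
    moreover have "cos (2 * pi * Re z) \<le> 1" by simp
    moreover have "inverse e > 0" using e by simp
    ultimately have "e \<le> 2 * (e + inverse e - 2 * cos (2 * pi * Re z))" by argo
    then have "e \<le> 8 * (cmod (sin (of_real pi * z)))\<^sup>2" unfolding * by simp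
    then show ?thesis by (simp add: e_def y_def)
  qed
qed

text \<open>Away from the integers \<open>\<bar>sin \<pi>z\<bar>\<close> is comparable to \<open>exp (\<pi>\<bar>Im z\<bar>)\<close>, so the quotient by
  \<open>sin\<^sup>2 \<pi>z\<close> grows at most linearly.\<close>

theorem double_zeros_at_integers:
  assumes hol: "f holomorphic_on UNIV"
    and zero: "\<And>n::int. f (of_int n) = 0" and dzero: "\<And>n::int. deriv f (of_int n) = 0"
    and growth: "\<And>z. cmod (f z) \<le> C * (1 + cmod z) * exp (2 * pi * \<bar>Im z\<bar>)"
  obtains \<alpha> \<beta> where "\<And>z. f z = (\<alpha> + \<beta> * z) * (sin (of_real pi * z))\<^sup>2"
proof -
  define s where "s = (\<lambda>z. sin (complex_of_real pi * z))"
  obtain q1 where q1: "q1 holomorphic_on UNIV" "\<And>z. f z = q1 z * s z"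
    using entire_divide_sin[OF hol zero] unfolding s_def by blast
  have "q1 (of_int n) = 0" for n :: int
  proof -
    have "(q1 has_field_derivative deriv q1 (of_int n)) (at (of_int n))"
      using q1(1) holomorphic_derivI by blast
    then have **: "((\<lambda>z. q1 z * s z) has_field_derivative
         q1 (of_int n) * (of_real pi * cos (of_real pi * of_int n))) (at (of_int n))"
      unfolding s_def by (auto intro!: derivative_eq_intros simp: sin_pi_eq_0_iff)
    have "deriv f (of_int n) = q1 (of_int n) * (of_real pi * cos (of_real pi * of_int n))"
    proof -
      have "f = (\<lambda>z. q1 z * s z)" using q1(2) by (rule ext)
      then show ?thesis using DERIV_imp_deriv[OF **] by simp
    qed
    then show ?thesis using dzero[of n] cos_pi_int_nonzero[of "of_int n"] by simp
  qed
  then obtain q where q: "q holomorphic_on UNIV" "\<And>z. q1 z = q z * s z"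
    using entire_divide_sin[OF q1(1)] unfolding s_def by blast
  have f: "f z = q z * (s z)\<^sup>2" for z by (simp add: q1(2) q(2) power2_eq_square)
  have C: "C \<ge> 0" using growth[of 0] norm_ge_zero[of "f 0"] by (simp del: norm_ge_zero)
  have good: "cmod (q z) \<le> 8 * C * (1 + cmod z)" if "\<bar>Im z\<bar> \<ge> 1 \<or> cos (2 * pi * Re z) = -1" for z
  proof -
    define E where "E = exp (2 * pi * \<bar>Im z\<bar>)"
    have "cmod (q z) * E \<le> cmod (q z) * (8 * (cmod (s z))\<^sup>2)"
      using norm_sin_pi_lower_bound[OF that] unfolding s_def E_def by (intro mult_left_mono) auto
    also have "\<dots> = 8 * cmod (f z)" by (simp add: f norm_mult norm_power)
    also have "\<dots> \<le> (8 * C * (1 + cmod z)) * E" using growth[of z] by (simp add: E_def)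
    finally show ?thesis by (rule mult_right_le_imp_le) (simp add: E_def)
  qed
  have bound: "cmod (q z) \<le> 8 * C * (4 + cmod z)" for z
  proof (cases "\<bar>Im z\<bar> \<ge> 1")
    case True
    then show ?thesis
      using good[of z] C by (intro order_trans[OF good] mult_left_mono) auto
  next
    case False
    \<comment> \<open>The integer nearest to \<open>Re z\<close>. The box around it has vertical
      sides on half-integer lines and horizontal sides at height 1 and -1, so the good bound holds
      on the whole frontier; its width 1 and height 2 account for the 3 added to
      \<open>1 + cmod z\<close>.\<close>
    define n where "n = \<lfloor>Re z + 1/2\<rfloor>"
    define a b where "a = Complex (of_int n - 1/2) (-1)" and "b = Complex (of_int n + 1/2) 1"
    have n: "of_int n - 1/2 \<le> Re z" "Re z \<le> of_int n + 1/2"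
      using floor_correct[of "Re z + 1/2"] unfolding n_def by linarith+
    have "cmod (q z) \<le> 8 * C * (4 + cmod z)"
    proof (rule maximum_modulus_frontier[where S = "cbox a b" and f = q and \<xi> = z])
      show "z \<in> cbox a b" using n False by (auto simp: in_cbox_complex_iff a_def b_def)
      fix w assume "w \<in> frontier (cbox a b)"
      then have w: "w \<in> cbox a b" "w \<notin> box a b" by (auto simp: frontier_def interior_cbox)
      then have "\<bar>Im w\<bar> \<ge> 1 \<or> Re w = of_int n + 1/2 \<or> Re w = of_int n - 1/2"
        by (auto simp: in_cbox_complex_iff in_box_complex_iff a_def b_def)
      moreover have "cos (2 * pi * (of_int n + 1/2)) = -1" "cos (2 * pi * (of_int n - 1/2)) = -1"
        by (simp_all add: distrib_left right_diff_distrib cos_add cos_diff)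
      ultimately have "\<bar>Im w\<bar> \<ge> 1 \<or> cos (2 * pi * Re w) = -1" by metis
      from good[OF this] have "cmod (q w) \<le> 8 * C * (1 + cmod w)" .
      also have "cmod w \<le> cmod z + cmod (w - z)" using norm_triangle_ineq[of z "w - z"] by simp
      also have "cmod (w - z) \<le> \<bar>Re (w - z)\<bar> + \<bar>Im (w - z)\<bar>" by (rule cmod_le)
      also have "\<dots> \<le> 1 + 2" using w(1) n False
        by (intro add_mono) (auto simp: in_cbox_complex_iff a_def b_def)
      finally show "cmod (q w) \<le> 8 * C * (4 + cmod z)" using C by (simp add: mult_left_mono)
    qed (use q(1) in \<open>auto intro!: holomorphic_on_imp_continuous_on elim: holomorphic_on_subset\<close>)
    then show ?thesis .
  qed
  have lin: "q z = (\<Sum>k\<le>1. (deriv ^^ k) q 0 / fact k * z ^ k)" for z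
  proof (rule Liouville_polynomial[OF q(1)])
    fix z :: complex assume "1 \<le> cmod z"
    then have "8 * C * (4 + cmod z) \<le> 8 * C * (5 * cmod z)" using C by (intro mult_left_mono) auto
    then show "cmod (q z) \<le> (40 * C) * cmod z ^ 1" using bound[of z] by simp
  qed
  have qz: "q z = q 0 + deriv q 0 * z" for z by (subst lin) simp
  have "f z = (q 0 + deriv q 0 * z) * (sin (of_real pi * z))\<^sup>2" for z
    using f[of z] unfolding qz[of z] s_def .
  then show ?thesis by (rule that)
qed

text \<open>The bound is uniform on compact sets, so Montel gives a locally uniformly convergent
  subsequence, whose limit must be \<open>G\<close>. The second claim carries over a derivative that
  is eventually constant along the sequence: this is how the slope of an interpolation series at a
  node is read off from its partial sums.\<close>

lemma entire_bounded_limit: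
  assumes hol: "\<And>N::nat. F N holomorphic_on UNIV"
    and lim: "\<And>z. (\<lambda>N. F N z) \<longlonglongrightarrow> G z"
    and bd: "\<And>N z. cmod (F N z) \<le> C * exp (c * \<bar>Im z\<bar>)"
  shows "G holomorphic_on UNIV"
    and "\<And>z d. (\<And>N. N \<ge> N0 \<Longrightarrow> deriv (F N) z = d) \<Longrightarrow> deriv G z = d"
proof -
  have C: "C \<ge> 0" using bd[of 0 0] norm_ge_zero[of "F 0 0"] by (simp del: norm_ge_zero)
  obtain g r where g: "g holomorphic_on UNIV" "strict_mono (r :: nat \<Rightarrow> nat)"
      "\<And>x. x \<in> UNIV \<Longrightarrow> (\<lambda>n. F (r n) x) \<longlonglongrightarrow> g x"
      "\<And>K. \<lbrakk>compact K; K \<subseteq> UNIV\<rbrakk> \<Longrightarrow> uniform_limit K (F \<circ> r) g sequentially"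
  proof (rule Montel[of UNIV "range F" F])
    fix K :: "complex set" assume "compact K" "K \<subseteq> UNIV"
    then obtain R where R: "\<And>z. z \<in> K \<Longrightarrow> cmod z \<le> R"
      using compact_imp_bounded bounded_iff by metis
    show "\<exists>B. \<forall>h\<in>range F. \<forall>z\<in>K. cmod (h z) \<le> B"
    proof (intro exI ballI)
      fix h z assume "h \<in> range F" "z \<in> K"
      then obtain N where "h = F N" by auto
      then have "cmod (h z) \<le> C * exp (c * \<bar>Im z\<bar>)" using bd by simp
      also have "c * \<bar>Im z\<bar> \<le> \<bar>c\<bar> * R"
        using R[OF \<open>z \<in> K\<close>] abs_Im_le_cmod[of z] by (intro mult_mono) auto
      finally show "cmod (h z) \<le> C * exp (\<bar>c\<bar> * R)" using C by (simp add: mult_left_mono)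
    qed
  qed (use hol in auto)
  have "g = G"
    using g(3) LIMSEQ_subseq_LIMSEQ[OF lim g(2)] LIMSEQ_unique by (fastforce simp: o_def)
  then show "G holomorphic_on UNIV" using g(1) by simp
  fix z d assume d: "\<And>N. N \<ge> N0 \<Longrightarrow> deriv (F N) z = d"
  have "\<exists>d>0. cball x d \<subseteq> UNIV \<and> uniform_limit (cball x d) (\<lambda>n. F (r n)) g sequentially" for x
    using g(4)[of "cball x 1"] by (intro exI[of _ 1]) (auto simp: o_def)
  then have "\<exists>g'. \<forall>x\<in>UNIV. (g has_field_derivative g' x) (at x) \<and> (\<lambda>n. deriv (F (r n)) x) \<longlonglongrightarrow> g' x"
    by (intro has_complex_derivative_uniform_sequence)
       (use hol in \<open>auto intro!: holomorphic_derivI\<close>)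
  then obtain g' where g'': "\<forall>x\<in>UNIV. (g has_field_derivative g' x) (at x) \<and> (\<lambda>n. deriv (F (r n)) x) \<longlonglongrightarrow> g' x"
    by (elim exE)
  have g': "(g has_field_derivative g' z) (at z)" "(\<lambda>n. deriv (F (r n)) z) \<longlonglongrightarrow> g' z"
    using g''[rule_format, of z] by simp_all
  have "(\<lambda>n. deriv (F (r n)) z) \<longlonglongrightarrow> d"
  proof (rule tendsto_eventually)
    show "eventually (\<lambda>n. deriv (F (r n)) z = d) sequentially"
      using d seq_suble[OF g(2)] by (intro eventually_sequentiallyI[of N0]) (meson order_trans)
  qed
  then have "g' z = d" using LIMSEQ_unique[OF g'(2)] by simp
  then show "deriv G z = d" using DERIV_imp_deriv[OF g'(1)] \<open>g = G\<close> by simp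
qed

section \<open>Summation over the integers\<close>

lemma summable_on_int:
  fixes f :: "int \<Rightarrow> real"
  assumes nonneg: "\<And>n. f n \<ge> 0" and "summable (\<lambda>n. f (int n))" "summable (\<lambda>n. f (- int n))"
  shows "f summable_on UNIV"
proof -
  have 1: "f summable_on range int"
    using assms by (subst summable_on_reindex) (auto simp: o_def summable_on_UNIV_nonneg_real_iff)
  have 2: "f summable_on range (\<lambda>n. - int n)"
    using assms by (subst summable_on_reindex)
      (auto simp: o_def summable_on_UNIV_nonneg_real_iff inj_on_def)
  have "f summable_on (range int \<union> (range (\<lambda>n. - int n) - range int))"
    by (intro summable_on_Un_disjoint 1 summable_on_subset_banach[OF 2]) auto
  moreover have "range int \<union> (range (\<lambda>n. - int n) - range int) = UNIV"
  proof -
    have "k \<in> range int \<or> k \<in> range (\<lambda>n. - int n)" for k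
      by (cases k rule: int_cases2) auto
    then show ?thesis by blast
  qed
  ultimately show ?thesis by simp
qed

lemma has_sum_int_tendsto:
  assumes "(f has_sum S) (UNIV :: int set)"
  shows "(\<lambda>N. \<Sum>n\<in>{- int N..int N}. f n) \<longlonglongrightarrow> S"
proof -
  have "filterlim (\<lambda>N. {- int N..int N}) (finite_subsets_at_top UNIV) sequentially"
    unfolding filterlim_finite_subsets_at_top
  proof (intro allI impI)
    fix X :: "int set" assume X: "finite X \<and> X \<subseteq> UNIV"
    show "\<forall>\<^sub>F N in sequentially. finite {- int N..int N} \<and> X \<subseteq> {- int N..int N} \<and> {- int N..int N} \<subseteq> UNIV"
    proof (rule eventually_sequentiallyI)
      fix N assume N: "nat (\<Sum>x\<in>X. \<bar>x\<bar>) \<le> N"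
      have "\<bar>x\<bar> \<le> (\<Sum>x\<in>X. \<bar>x\<bar>)" if "x \<in> X" for x
        using X that by (intro member_le_sum) auto
      then show "finite {- int N..int N} \<and> X \<subseteq> {- int N..int N} \<and> {- int N..int N} \<subseteq> UNIV"
        using N by (auto simp: abs_le_iff) (smt (verit) nat_le_iff)+
    qed
  qed
  then show ?thesis using assms unfolding has_sum_def by (rule filterlim_compose[rotated])
qed

lemma abs_summable_onI_bounded:
  fixes f :: "'a \<Rightarrow> complex"
  assumes "\<And>F. finite F \<Longrightarrow> (\<Sum>x\<in>F. cmod (f x)) \<le> B"
  shows "(\<lambda>x. cmod (f x)) summable_on UNIV" "f summable_on UNIV" "cmod (infsum f UNIV) \<le> B"
proof -
  show 1: "(\<lambda>x. cmod (f x)) summable_on UNIV"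
    by (rule nonneg_bdd_above_summable_on) (auto intro!: bdd_aboveI2 assms)
  then show "f summable_on UNIV" by (rule abs_summable_summable)
  have "cmod (infsum f UNIV) \<le> (\<Sum>\<^sub>\<infinity>x. cmod (f x))" using 1 by (rule norm_infsum_bound)
  also have "\<dots> \<le> B" using 1 by (rule infsum_le_finite_sums) (use assms in auto)
  finally show "cmod (infsum f UNIV) \<le> B" .
qed

section \<open>Interpolation at the integers\<close>

definition csinc :: "complex \<Rightarrow> complex" where
  "csinc z = (if z = 0 then 1 else sin (of_real pi * z) / (of_real pi * z))"

lemma csinc_0 [simp]: "csinc 0 = 1" by (simp add: csinc_def)

lemma holomorphic_csinc: "csinc holomorphic_on UNIV"
proof -
  define g where "g = (\<lambda>z. sin (of_real pi * z) / complex_of_real pi)"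
  have "(g has_field_derivative 1) (at 0)" unfolding g_def by (auto intro!: derivative_eq_intros)
  then have d: "deriv g 0 = 1" by (rule DERIV_imp_deriv)
  have "(\<lambda>z. if z = 0 then deriv g 0 else g z / (z - 0)) holomorphic_on UNIV"
    by (rule holomorphic_divided_difference) (auto simp: g_def intro!: holomorphic_intros)
  then show ?thesis
    by (rule holomorphic_transform) (unfold d, auto simp: csinc_def g_def)
qed

lemma csinc_of_int: "csinc (of_int n) = (if n = 0 then 1 else 0)"
  using sin_pi_eq_0_iff[of "of_int n"] by (simp add: csinc_def)

lemma csinc_minus: "csinc (- z) = csinc z"
  by (simp add: csinc_def)

lemma has_field_derivative_csinc_0: "(csinc has_field_derivative 0) (at 0)"
proof -
  have d: "(csinc has_field_derivative deriv csinc 0) (at 0)"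
    using holomorphic_csinc holomorphic_derivI by blast
  have "((\<lambda>z. csinc (- z)) has_field_derivative deriv csinc 0 * (-1)) (at 0)"
    by (rule DERIV_chain2[of csinc]) (use d in \<open>auto intro!: derivative_eq_intros\<close>)
  then have "(csinc has_field_derivative - deriv csinc 0) (at 0)"
    by (simp add: csinc_minus)
  then have "deriv csinc 0 = - deriv csinc 0"
    by (rule DERIV_unique[OF d])
  moreover have "x = 0" if "x = - x" for x :: complex
  proof -
    have "2 * x = 0" using that by (metis add.right_inverse mult_2)
    then show "x = 0" by simp
  qed
  ultimately show ?thesis using d by metis
qed

lemma sin_pi_eq_csinc: "sin (of_real pi * z) = of_real pi * z * csinc z"
  by (simp add: csinc_def)

lemma csinc_sq_shift:
  "z \<noteq> of_int n \<Longrightarrow> (csinc (z - of_int n))\<^sup>2 = (sin (of_real pi * z))\<^sup>2 / (of_real pi * (z - of_int n))\<^sup>2"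
proof -
  assume "z \<noteq> of_int n"
  have s0: "sin (of_real pi * of_int n :: complex) = 0" by (simp add: sin_pi_eq_0_iff)
  then have "sin (of_real pi * (z - of_int n)) = sin (of_real pi * z) * cos (of_real pi * of_int n)"
    by (simp add: right_diff_distrib sin_diff)
  moreover have "(cos (of_real pi * of_int n :: complex))\<^sup>2 = 1"
    by (simp add: cos_squared_eq s0)
  ultimately have "(sin (of_real pi * (z - of_int n)))\<^sup>2 = (sin (of_real pi * z))\<^sup>2"
    by (simp add: power_mult_distrib)
  then show ?thesis using \<open>z \<noteq> of_int n\<close>
    by (simp add: csinc_def power_divide)
qed

lemma cmod_csinc_le: "cmod (csinc z) \<le> exp (pi * \<bar>Im z\<bar>)"
proof (cases "z = 0")
  case False
  define w where "w = complex_of_real pi * z"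
  have "cmod (sin w - sin 0) \<le> exp \<bar>Im w\<bar> * cmod (w - 0)"
  proof (rule field_differentiable_bound[where S = "closed_segment 0 w" and f' = cos])
    fix u assume "u \<in> closed_segment 0 w"
    then obtain t where "0 \<le> t" "t \<le> 1" "u = t *\<^sub>R w" by (auto simp: in_segment)
    then show "cmod (cos u) \<le> exp \<bar>Im w\<bar>" using cmod_cos_le_exp by simp
    show "(sin has_field_derivative cos u) (at u within closed_segment 0 w)"
      by (rule DERIV_subset[OF DERIV_sin]) simp
  qed auto
  moreover have "\<bar>Im w\<bar> = pi * \<bar>Im z\<bar>" by (simp add: w_def abs_mult)
  moreover have "csinc z = sin w / w" using False by (simp add: csinc_def w_def)
  moreover have "cmod w > 0" using False by (simp add: w_def)
  ultimately show ?thesis by (simp add: norm_divide pos_divide_le_eq)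
qed simp

lemma cmod_mult_csinc_le: "pi * (cmod z * cmod (csinc z)) \<le> exp (pi * \<bar>Im z\<bar>)"
proof -
  have "pi * (cmod z * cmod (csinc z)) = cmod (sin (of_real pi * z))"
    by (simp add: sin_pi_eq_csinc norm_mult)
  also have "\<dots> \<le> exp \<bar>Im (of_real pi * z)\<bar>"
    using cmod_sin_le_exp[of 1 "of_real pi * z"] by simp
  finally show ?thesis by (simp add: abs_mult)
qed

lemma cmod_csinc_sq_le:
  "(cmod (csinc z))\<^sup>2 * (1 + (cmod z)\<^sup>2) \<le> 2 * exp (2 * pi * \<bar>Im z\<bar>)"
  "cmod z * (cmod (csinc z))\<^sup>2 \<le> exp (2 * pi * \<bar>Im z\<bar>)"
proof -
  define e where "e = exp (pi * \<bar>Im z\<bar>)"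
  have e: "exp (2 * pi * \<bar>Im z\<bar>) = e * e" by (simp add: e_def exp_add[symmetric])
  have 1: "cmod (csinc z) \<le> e" unfolding e_def by (rule cmod_csinc_le)
  have "1 * (cmod z * cmod (csinc z)) \<le> pi * (cmod z * cmod (csinc z))"
    using pi_gt3 by (intro mult_right_mono) auto
  then have 2: "cmod z * cmod (csinc z) \<le> e"
    using cmod_mult_csinc_le[of z] by (simp add: e_def)
  have "cmod (csinc z) * cmod (csinc z) \<le> e * e" using 1 by (intro mult_mono) (auto simp: e_def)
  moreover have "(cmod z * cmod (csinc z)) * (cmod z * cmod (csinc z)) \<le> e * e"
    using 2 by (intro mult_mono) (auto simp: e_def)
  ultimately show "(cmod (csinc z))\<^sup>2 * (1 + (cmod z)\<^sup>2) \<le> 2 * exp (2 * pi * \<bar>Im z\<bar>)"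
    unfolding e by (simp add: power2_eq_square algebra_simps)
  have "(cmod z * cmod (csinc z)) * cmod (csinc z) \<le> e * e"
    using 1 2 by (intro mult_mono) (auto simp: e_def)
  then show "cmod z * (cmod (csinc z))\<^sup>2 \<le> exp (2 * pi * \<bar>Im z\<bar>)"
    unfolding e by (simp add: power2_eq_square algebra_simps)
qed

lemma summable_on_int_inverse_square: "(\<lambda>k::int. c / (1 + (of_int k)\<^sup>2) :: real) summable_on UNIV"
proof -
  have s: "summable (\<lambda>n. 1 / (1 + (real n)\<^sup>2))"
  proof (rule summable_comparison_test_ev)
    show "summable (\<lambda>n. 1 / (real n) ^ 2)" using inverse_power_summable[of 2, where 'a = real] by (simp add: field_simps)
    show "\<forall>\<^sub>F n in sequentially. norm (1 / (1 + (real n)\<^sup>2)) \<le> 1 / real n ^ 2"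
      by (rule eventually_sequentiallyI[of 1]) (auto intro!: divide_left_mono mult_pos_pos add_pos_nonneg)
  qed
  have "(\<lambda>k::int. 1 / (1 + (of_int k)\<^sup>2) :: real) summable_on UNIV"
    by (rule summable_on_int) (use s in auto)
  then have "(\<lambda>k::int. c * (1 / (1 + (of_int k)\<^sup>2)) :: real) summable_on UNIV"
    by (rule summable_on_cmult_right)
  then show ?thesis by simp
qed

text \<open>The kernel of the interpolation formula: a value \<open>a\<close> and slope \<open>b\<close> at \<open>n\<close>, double zeros at
  all other integers.\<close>

definition interp_term :: "complex \<Rightarrow> complex \<Rightarrow> int \<Rightarrow> complex \<Rightarrow> complex" where
  "interp_term a b n z = (a + b * (z - of_int n)) * (csinc (z - of_int n))\<^sup>2"

definition interp :: "(int \<Rightarrow> complex) \<Rightarrow> (int \<Rightarrow> complex) \<Rightarrow> complex \<Rightarrow> complex" where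
  "interp A B z = (\<Sum>\<^sub>\<infinity>n. interp_term (A n) (B n) n z)"

text \<open>Replacing \<open>Re z\<close> by its floor makes the decay factor a function of the
  integer \<open>n - \<lfloor>Re z\<rfloor>\<close>, so that its sum over all nodes is the same for
  every \<open>z\<close>. The slope gets no such factor, since \<open>w * csinc w ^ 2\<close> decays
  only like \<open>1 / w\<close>: bounded values suffice, but slopes must be summable.\<close>

lemma interp_term_bound:
  "cmod (interp_term a b n z) \<le> (cmod a * (6 / (1 + (of_int (n - \<lfloor>Re z\<rfloor>))\<^sup>2)) + cmod b) * exp (2 * pi * \<bar>Im z\<bar>)"
proof -
  define w where "w = z - of_int n"
  define E where "E = exp (2 * pi * \<bar>Im z\<bar>)"
  define k :: real where "k = of_int (n - \<lfloor>Re z\<rfloor>)"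
  define s where "s = (cmod (csinc w))\<^sup>2"
  have Im: "Im w = Im z" by (simp add: w_def)
  have 1: "s * (1 + (cmod w)\<^sup>2) \<le> 2 * E" "cmod w * s \<le> E"
    using cmod_csinc_sq_le[of w] unfolding Im E_def s_def by auto
  have "\<bar>k\<bar> \<le> \<bar>Re w\<bar> + 1" unfolding k_def w_def by (simp, linarith)
  also have "\<bar>Re w\<bar> \<le> cmod w" by (rule abs_Re_le_cmod)
  finally have "\<bar>k\<bar>\<^sup>2 \<le> (cmod w + 1)\<^sup>2" by (intro power_mono) auto
  moreover have "0 \<le> (cmod w - 1)\<^sup>2" by simp
  ultimately have "1 + k\<^sup>2 \<le> 3 * (1 + (cmod w)\<^sup>2)"
    using zero_le_power2[of "cmod w"] unfolding power2_abs power2_sum power2_diff one_power2 mult_1_right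
    by argo
  then have "s * (1 + k\<^sup>2) \<le> s * (3 * (1 + (cmod w)\<^sup>2))"
    by (rule mult_left_mono) (simp add: s_def)
  then have "s * (1 + k\<^sup>2) \<le> 6 * E" using 1 by argo
  then have 2: "s \<le> (6 / (1 + k\<^sup>2)) * E"
    by (simp add: pos_le_divide_eq add_pos_nonneg)
  have "cmod (interp_term a b n z) = cmod (a + b * w) * s"
    by (simp add: interp_term_def w_def s_def norm_mult norm_power)
  also have "\<dots> \<le> (cmod a + cmod b * cmod w) * s"
    by (intro mult_right_mono order_trans[OF norm_triangle_ineq]) (auto simp: norm_mult s_def)
  also have "\<dots> = cmod a * s + cmod b * (cmod w * s)" by (simp add: algebra_simps)
  also have "\<dots> \<le> cmod a * ((6 / (1 + k\<^sup>2)) * E) + cmod b * E"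
    using 1 2 by (intro add_mono mult_left_mono) auto
  finally show ?thesis by (simp add: E_def k_def algebra_simps)
qed

lemma holomorphic_interp_term: "interp_term a b n holomorphic_on UNIV"
  using entire_affine[OF holomorphic_csinc, of 1 "- of_int n"]
  unfolding interp_term_def by (auto intro!: holomorphic_intros)

lemma interp_term_of_int: "interp_term a b n (of_int m) = (if n = m then a else 0)"
  using csinc_of_int[of "m - n"] by (simp add: interp_term_def)

lemma deriv_interp_term: "deriv (interp_term a b n) (of_int m) = (if n = m then b else 0)"
proof (rule DERIV_imp_deriv)
  define s where "s = (\<lambda>z. csinc (z - of_int n))"
  have s: "(s has_field_derivative deriv s (of_int m)) (at (of_int m))"
    using entire_affine[OF holomorphic_csinc, of 1 "- of_int n"] holomorphic_derivI[of s UNIV]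
    unfolding s_def by auto
  have sm: "s (of_int m) = (if n = m then 1 else 0)" using csinc_of_int[of "m - n"] by (auto simp: s_def)
  have ds: "deriv s (of_int m) = 0" if "n = m"
  proof -
    have "(s has_field_derivative 0 * 1) (at (of_int m))" unfolding s_def
      by (rule DERIV_chain2[of csinc]) (use that has_field_derivative_csinc_0 in \<open>auto intro!: derivative_eq_intros\<close>)
    then show ?thesis using DERIV_unique s by fastforce
  qed
  have "((\<lambda>z. (a + b * (z - of_int n)) * (s z)\<^sup>2) has_field_derivative (if n = m then b else 0)) (at (of_int m))"
    by (rule derivative_eq_intros refl s | use sm ds in \<open>simp\<close>)+
  then show "(interp_term a b n has_field_derivative (if n = m then b else 0)) (at (of_int m))"
    unfolding interp_term_def s_def .
qed

theorem interp_properties: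
  assumes A: "\<And>n. cmod (A n) \<le> a" and B: "(\<lambda>n. cmod (B n)) summable_on UNIV"
  shows "interp A B holomorphic_on UNIV"
    and "\<And>z. ((\<lambda>n. interp_term (A n) (B n) n z) has_sum interp A B z) UNIV"
    and "\<And>m. interp A B (of_int m) = A m"
    and "\<And>m. deriv (interp A B) (of_int m) = B m"
    and "\<exists>C. \<forall>z. cmod (interp A B z) \<le> C * exp (2 * pi * \<bar>Im z\<bar>)"
proof -
  define S where "S = (\<Sum>\<^sub>\<infinity>k::int. 6 / (1 + (of_int k)\<^sup>2) :: real)"
  define C where "C = a * S + (\<Sum>\<^sub>\<infinity>n. cmod (B n))"
  have a: "a \<ge> 0" using A[of 0] norm_ge_zero[of "A 0"] by (simp del: norm_ge_zero)
  have bd: "(\<Sum>n\<in>F. cmod (interp_term (A n) (B n) n z)) \<le> C * exp (2 * pi * \<bar>Im z\<bar>)" if F: "finite F" for F z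
  proof -
    let ?E = "exp (2 * pi * \<bar>Im z\<bar>)"
    have "(\<Sum>n\<in>F. cmod (interp_term (A n) (B n) n z)) \<le>
      (\<Sum>n\<in>F. (a * (6 / (1 + (of_int (n - \<lfloor>Re z\<rfloor>))\<^sup>2)) + cmod (B n)) * ?E)"
      by (intro sum_mono order_trans[OF interp_term_bound] mult_right_mono add_right_mono A) auto
    also have "\<dots> = (a * (\<Sum>n\<in>F. 6 / (1 + (of_int (n - \<lfloor>Re z\<rfloor>))\<^sup>2)) + (\<Sum>n\<in>F. cmod (B n))) * ?E"
      by (simp only: sum_distrib_left sum.distrib flip: sum_distrib_right)
    also have "(\<Sum>n\<in>F. 6 / (1 + (of_int (n - \<lfloor>Re z\<rfloor>))\<^sup>2)) = (\<Sum>k\<in>(\<lambda>n. n - \<lfloor>Re z\<rfloor>) ` F. 6 / (1 + (of_int k)\<^sup>2) :: real)"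
      by (subst sum.reindex) (auto simp: inj_on_def)
    also have "\<dots> \<le> S" unfolding S_def
      by (rule finite_sum_le_infsum) (use F summable_on_int_inverse_square in \<open>auto simp: add_nonneg_nonneg\<close>)
    also have "(\<Sum>n\<in>F. cmod (B n)) \<le> (\<Sum>\<^sub>\<infinity>n. cmod (B n))"
      by (rule finite_sum_le_infsum) (use F B in auto)
    finally show ?thesis using a unfolding C_def by (simp add: mult_left_mono mult_right_mono)
  qed
  show hs: "((\<lambda>n. interp_term (A n) (B n) n z) has_sum interp A B z) UNIV" for z
    unfolding interp_def using abs_summable_onI_bounded(2)[OF bd] by simp
  show "\<exists>C. \<forall>z. cmod (interp A B z) \<le> C * exp (2 * pi * \<bar>Im z\<bar>)"
    unfolding interp_def using abs_summable_onI_bounded(3)[OF bd] by blast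
  show "interp A B (of_int m) = A m" for m
  proof -
    have "interp A B (of_int m) = infsum (\<lambda>n. interp_term (A n) (B n) n (of_int m)) {m}"
      unfolding interp_def by (rule infsum_cong_neutral) (auto simp: interp_term_of_int)
    then show ?thesis by (simp add: interp_term_of_int)
  qed
  define F where "F = (\<lambda>N z. \<Sum>n\<in>{- int N..int N}. interp_term (A n) (B n) n z)"
  have F: "F N holomorphic_on UNIV" for N
    unfolding F_def by (intro holomorphic_intros holomorphic_interp_term)
  have Flim: "(\<lambda>N. F N z) \<longlonglongrightarrow> interp A B z" for z
    unfolding F_def by (rule has_sum_int_tendsto[OF hs])
  have Fbd: "cmod (F N z) \<le> C * exp (2 * pi * \<bar>Im z\<bar>)" for N z
    unfolding F_def by (rule order_trans[OF norm_sum bd]) auto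
  show "interp A B holomorphic_on UNIV" by (rule entire_bounded_limit(1)[OF F Flim Fbd])
  show "deriv (interp A B) (of_int m) = B m" for m
  proof (rule entire_bounded_limit(2)[OF F Flim Fbd])
    fix N assume "N \<ge> nat \<bar>m\<bar>"
    then have m: "m \<in> {- int N..int N}" by auto
    have d: "(interp_term (A n) (B n) n has_field_derivative (if n = m then B n else 0)) (at (of_int m))" for n
      using holomorphic_derivI[OF holomorphic_interp_term open_UNIV, of "of_int m" "A n" "B n" n]
      by (simp add: deriv_interp_term split: if_splits)
    have "(F N has_field_derivative (\<Sum>n\<in>{- int N..int N}. if n = m then B n else 0)) (at (of_int m))"
      unfolding F_def by (intro DERIV_sum d)
    then show "deriv (F N) (of_int m) = B m"
      using m by (intro DERIV_imp_deriv) (simp add: sum.delta)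
  qed
qed

section \<open>Closure properties of functions of exponential type\<close>

lemma exp_type_at_most_0: "exp_type_at_most \<sigma> (\<lambda>z. 0)"
  unfolding exp_type_at_most_def by (auto intro!: exI[of _ 1])

lemma exp_type_at_most_add:
  assumes "exp_type_at_most \<sigma> f" "exp_type_at_most \<sigma> g"
  shows "exp_type_at_most \<sigma> (\<lambda>z. f z + g z)"
  unfolding exp_type_at_most_def
proof (intro conjI allI impI)
  show "(\<lambda>z. f z + g z) holomorphic_on UNIV"
    using assms by (auto simp: exp_type_at_most_def intro: holomorphic_intros)
  fix \<epsilon> :: real assume "\<epsilon> > 0"
  then obtain C1 C2 where C1: "C1 > 0" "\<And>z. cmod (f z) \<le> C1 * exp ((\<sigma> + \<epsilon>) * cmod z)"
    and C2: "C2 > 0" "\<And>z. cmod (g z) \<le> C2 * exp ((\<sigma> + \<epsilon>) * cmod z)"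
    using assms unfolding exp_type_at_most_def by meson
  have "cmod (f z + g z) \<le> (C1 + C2) * exp ((\<sigma> + \<epsilon>) * cmod z)" for z
    using norm_triangle_mono[OF C1(2) C2(2)] by (simp add: distrib_right)
  then show "\<exists>C>0. \<forall>z. cmod (f z + g z) \<le> C * exp ((\<sigma> + \<epsilon>) * cmod z)"
    using C1(1) C2(1) by (intro exI[of _ "C1 + C2"]) auto
qed

lemma exp_type_at_most_cmult:
  assumes "exp_type_at_most \<sigma> f"
  shows "exp_type_at_most \<sigma> (\<lambda>z. c * f z)"
  unfolding exp_type_at_most_def
proof (intro conjI allI impI)
  show "(\<lambda>z. c * f z) holomorphic_on UNIV"
    using assms by (auto simp: exp_type_at_most_def intro: holomorphic_intros)
  fix \<epsilon> :: real assume "\<epsilon> > 0"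
  then obtain C where C: "C > 0" "\<And>z. cmod (f z) \<le> C * exp ((\<sigma> + \<epsilon>) * cmod z)"
    using assms unfolding exp_type_at_most_def by meson
  have "cmod (c * f z) \<le> ((cmod c + 1) * C) * exp ((\<sigma> + \<epsilon>) * cmod z)" for z
    unfolding norm_mult mult.assoc using C by (intro mult_mono C) auto
  then show "\<exists>C>0. \<forall>z. cmod (c * f z) \<le> C * exp ((\<sigma> + \<epsilon>) * cmod z)"
    using C(1) by (intro exI[of _ "(cmod c + 1) * C"]) (auto intro!: mult_pos_pos add_nonneg_pos)
qed

lemma exp_type_at_most_diff:
  assumes "exp_type_at_most \<sigma> f" "exp_type_at_most \<sigma> g"
  shows "exp_type_at_most \<sigma> (\<lambda>z. f z - g z)"
  using exp_type_at_most_add[OF assms(1) exp_type_at_most_cmult[OF assms(2), of "-1"]] by simp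

lemma exp_type_at_most_sum:
  assumes "\<And>i. i \<in> F \<Longrightarrow> exp_type_at_most \<sigma> (f i)"
  shows "exp_type_at_most \<sigma> (\<lambda>z. \<Sum>i\<in>F. f i z)"
  using assms
  by (induction F rule: infinite_finite_induct) (auto simp: exp_type_at_most_0 exp_type_at_most_add)

lemma exp_type_at_most_shift:
  assumes "exp_type_at_most \<sigma> f" "\<sigma> \<ge> 0"
  shows "exp_type_at_most \<sigma> (\<lambda>z. f (z + b))"
  unfolding exp_type_at_most_def
proof (intro conjI allI impI)
  show "(\<lambda>z. f (z + b)) holomorphic_on UNIV"
    using assms entire_affine[of f 1 b] by (auto simp: exp_type_at_most_def)
  fix \<epsilon> :: real assume \<epsilon>: "\<epsilon> > 0"
  then obtain C where C: "C > 0" "\<And>z. cmod (f z) \<le> C * exp ((\<sigma> + \<epsilon>) * cmod z)"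
    using assms unfolding exp_type_at_most_def by meson
  have "cmod (f (z + b)) \<le> (C * exp ((\<sigma> + \<epsilon>) * cmod b)) * exp ((\<sigma> + \<epsilon>) * cmod z)" for z
  proof -
    have "cmod (f (z + b)) \<le> C * exp ((\<sigma> + \<epsilon>) * cmod (z + b))" by (rule C)
    also have "\<dots> \<le> C * exp ((\<sigma> + \<epsilon>) * (cmod b + cmod z))"
      using C(1) \<epsilon> assms(2) norm_triangle_ineq[of z b] by (auto intro!: mult_left_mono)
    finally show ?thesis by (simp add: distrib_left exp_add mult.assoc)
  qed
  then show "\<exists>C>0. \<forall>z. cmod (f (z + b)) \<le> C * exp ((\<sigma> + \<epsilon>) * cmod z)"
    using C(1) by (intro exI[of _ "C * exp ((\<sigma> + \<epsilon>) * cmod b)"]) auto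
qed

text \<open>Integrating along a radius costs a factor \<open>cmod z\<close>, which half of
  \<epsilon> absorbs.\<close>

lemma exp_type_at_most_primitive:
  assumes "exp_type_at_most \<sigma> f" "\<sigma> \<ge> 0" and F: "\<And>z. (F has_field_derivative f z) (at z)"
  shows "exp_type_at_most \<sigma> F"
  unfolding exp_type_at_most_def
proof (intro conjI allI impI)
  show "F holomorphic_on UNIV" using F by (auto simp: holomorphic_on_open)
  fix \<epsilon> :: real assume \<epsilon>: "\<epsilon> > 0"
  then obtain C where C: "C > 0" "\<And>z. cmod (f z) \<le> C * exp ((\<sigma> + \<epsilon> / 2) * cmod z)"
    using assms half_gt_zero[OF \<epsilon>] unfolding exp_type_at_most_def by meson
  have "cmod (F z) \<le> (cmod (F 0) + C * (2 / \<epsilon>)) * exp ((\<sigma> + \<epsilon>) * cmod z)" for z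
  proof -
    have "cmod (F z - F 0) \<le> (C * exp ((\<sigma> + \<epsilon> / 2) * cmod z)) * cmod (z - 0)"
    proof (rule field_differentiable_bound[where S = "cball 0 (cmod z)" and f' = f])
      fix w :: complex assume "w \<in> cball 0 (cmod z)"
      then have "(\<sigma> + \<epsilon> / 2) * cmod w \<le> (\<sigma> + \<epsilon> / 2) * cmod z"
        using \<epsilon> assms(2) by (intro mult_left_mono) auto
      then show "cmod (f w) \<le> C * exp ((\<sigma> + \<epsilon> / 2) * cmod z)"
        using C(1) by (intro order_trans[OF C(2)] mult_left_mono) auto
      show "(F has_field_derivative f w) (at w within cball 0 (cmod z))"
        using F by (rule has_field_derivative_at_within)
    qed auto
    also have "cmod (z - 0) \<le> (2 / \<epsilon>) * exp (\<epsilon> / 2 * cmod z)"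
      using exp_ge_add_one_self[of "\<epsilon> / 2 * cmod z"] \<epsilon> by (simp add: field_simps)
    also have "C * exp ((\<sigma> + \<epsilon> / 2) * cmod z) * ((2 / \<epsilon>) * exp (\<epsilon> / 2 * cmod z))
        = (C * (2 / \<epsilon>)) * (exp ((\<sigma> + \<epsilon> / 2) * cmod z) * exp (\<epsilon> / 2 * cmod z))"
      by (simp add: mult_ac)
    also have "exp ((\<sigma> + \<epsilon> / 2) * cmod z) * exp (\<epsilon> / 2 * cmod z) = exp ((\<sigma> + \<epsilon>) * cmod z)"
      by (simp add: exp_add[symmetric] algebra_simps)
    finally have "cmod (F z - F 0) \<le> C * (2 / \<epsilon>) * exp ((\<sigma> + \<epsilon>) * cmod z)"
      using C(1) by (simp add: mult_left_mono)
    moreover have "cmod (F 0) * 1 \<le> cmod (F 0) * exp ((\<sigma> + \<epsilon>) * cmod z)"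
      using \<epsilon> assms(2) by (intro mult_left_mono) auto
    moreover have "cmod (F z) \<le> cmod (F 0) + cmod (F z - F 0)"
      by (metis add.commute diff_add_cancel norm_triangle_ineq)
    ultimately show ?thesis by (simp add: distrib_right)
  qed
  then show "\<exists>C>0. \<forall>z. cmod (F z) \<le> C * exp ((\<sigma> + \<epsilon>) * cmod z)"
    using C(1) \<epsilon> by (intro exI[of _ "cmod (F 0) + C * (2 / \<epsilon>)"]) (auto intro!: add_nonneg_pos)
qed

section \<open>Poisson summation for integrable functions of exponential type\<close>

lemma indicator_Ico_int_mult:
  fixes p t :: real
  assumes "p > 0"
  shows "indicator {p * of_int n..<p * of_int n + p} t = (if n = \<lfloor>t / p\<rfloor> then 1 else 0 :: real)"
proof -
  have "t \<in> {p * of_int n..<p * of_int n + p} \<longleftrightarrow> of_int n \<le> t / p \<and> t / p < of_int n + 1"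
    using assms by (auto simp: field_simps)
  also have "\<dots> \<longleftrightarrow> n = \<lfloor>t / p\<rfloor>" by linarith
  finally show ?thesis by (simp add: indicator_def)
qed

lemma integral_indicator_Ico_Icc:
  fixes f :: "real \<Rightarrow> complex"
  assumes [measurable]: "f \<in> borel_measurable borel"
  shows "(\<integral>x. indicator {a..<b} x *\<^sub>R f x \<partial>lborel) = (\<integral>x. indicator {a..b} x *\<^sub>R f x \<partial>lborel)"
proof (rule integral_cong_AE)
  show "AE x in lborel. indicator {a..<b} x *\<^sub>R f x = indicator {a..b} x *\<^sub>R f x"
    using AE_lborel_singleton[of b] by eventually_elim (auto simp: indicator_def)
qed auto

lemma exists_unimodular_factor: "\<exists>c::complex. cmod c \<le> 1 \<and> c * w = of_real (cmod w)"
  by (rule exI[of _ "if w = 0 then 0 else of_real (cmod w) / w"]) (auto simp: norm_divide)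

text \<open>The setting for the difference of two competitors. Band limitation is never expressed
  through a Fourier inversion; it is felt only through the growth of periodizations.\<close>

locale L1_exp_type =
  fixes D :: "complex \<Rightarrow> complex"
  assumes et: "exp_type_at_most (2 * pi) D"
    and integrable_D: "integrable lborel (\<lambda>x. D (of_real x))"
begin

lemma holomorphic_D: "D holomorphic_on UNIV" using et by (simp add: exp_type_at_most_def)

definition L1norm :: real where "L1norm = (\<integral>x. cmod (D (of_real x)) \<partial>lborel)"

lemma L1norm_nonneg: "L1norm \<ge> 0" by (simp add: L1norm_def)

definition primitive :: "complex \<Rightarrow> complex" where
  "primitive = (SOME F. \<forall>z. (F has_field_derivative D z) (at z))"

lemma primitive: "(primitive has_field_derivative D z) (at z)"
proof -
  obtain F where "\<And>z. z \<in> UNIV \<Longrightarrow> (F has_field_derivative D z) (at z within UNIV)"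
    using holomorphic_convex_primitive'[OF convex_UNIV open_UNIV holomorphic_D] by blast
  then have "\<exists>F. \<forall>z. (F has_field_derivative D z) (at z)" by auto
  from someI_ex[OF this] show ?thesis unfolding primitive_def by blast
qed

lemma continuous_D: "continuous_on UNIV (\<lambda>x::real. D (of_real x))"
  by (rule continuous_on_compose2[of UNIV D])
     (auto intro!: holomorphic_on_imp_continuous_on holomorphic_D continuous_intros)

lemma measurable_D [measurable]: "(\<lambda>x::real. D (of_real x)) \<in> borel_measurable borel"
  by (intro borel_measurable_continuous_onI continuous_D)

lemma primitive_diff:
  assumes "a \<le> b"
  shows "primitive (of_real b) - primitive (of_real a) = (\<integral>x. indicator {a..<b} x *\<^sub>R D (of_real x) \<partial>lborel)"
proof -
  have "((\<lambda>x. primitive (of_real x)) has_vector_derivative D (of_real x)) (at x within {a..b})" for x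
    using has_vector_derivative_real_field[OF DERIV_subset[OF primitive subset_UNIV]] by simp
  from integral_FTC_Icc[OF assms this continuous_on_subset[OF continuous_D subset_UNIV]] show ?thesis
    by (subst integral_indicator_Ico_Icc) auto
qed

lemma norm_primitive_diff:
  assumes "a \<le> b"
  shows "cmod (primitive (of_real b) - primitive (of_real a)) \<le> (\<integral>x. indicator {a..<b} x * cmod (D (of_real x)) \<partial>lborel)"
  unfolding primitive_diff[OF assms]
  by (rule order_trans[OF integral_norm_bound]) (simp add: abs_mult)

text \<open>Half-open intervals of length \<open>h \<le> p\<close> at spacing \<open>p\<close> are
  disjoint, so the integrals of \<open>\<bar>D\<bar>\<close> over them add up to at most
  \<open>L1norm\<close>.\<close>

lemma sum_norm_primitive_diff:
  assumes "finite F" "0 < p" "0 \<le> h" "h \<le> p"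
  shows "(\<Sum>n\<in>F. cmod (primitive (of_real (x + p * of_int n + h)) - primitive (of_real (x + p * of_int n)))) \<le> L1norm"
proof -
  let ?I = "\<lambda>n. {x + p * of_int n..<x + p * of_int n + h}"
  have int: "integrable lborel (\<lambda>t. indicator (?I n) t * cmod (D (of_real t)))" for n
  proof -
    have "integrable lborel (\<lambda>t. cmod (D (of_real t)) * indicator (?I n) t)"
      by (intro integrable_real_mult_indicator integrable_norm integrable_D) auto
    then show ?thesis by (simp only: mult.commute)
  qed
  have "(\<Sum>n\<in>F. cmod (primitive (of_real (x + p * of_int n + h)) - primitive (of_real (x + p * of_int n))))
    \<le> (\<Sum>n\<in>F. \<integral>t. indicator (?I n) t * cmod (D (of_real t)) \<partial>lborel)"
    using assms by (intro sum_mono norm_primitive_diff) auto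
  also have "\<dots> = (\<integral>t. (\<Sum>n\<in>F. indicator (?I n) t * cmod (D (of_real t))) \<partial>lborel)"
    by (subst Bochner_Integration.integral_sum) (use int in auto)
  also have "\<dots> \<le> L1norm" unfolding L1norm_def
  proof (rule integral_mono)
    show "integrable lborel (\<lambda>t. \<Sum>n\<in>F. indicator (?I n) t * cmod (D (of_real t)))"
      by (intro Bochner_Integration.integrable_sum int)
    show "integrable lborel (\<lambda>x. cmod (D (of_real x)))" using integrable_D by simp
    fix t
    have "(\<Sum>n\<in>F. indicator (?I n) t) \<le> (\<Sum>n\<in>F. if n = \<lfloor>(t - x) / p\<rfloor> then 1 else 0 :: real)"
      using assms by (intro sum_mono) (auto simp flip: indicator_Ico_int_mult simp: indicator_def)
    also have "\<dots> \<le> 1" using assms(1) by (simp add: sum.delta)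
    finally have "(\<Sum>n\<in>F. indicator (?I n) t) * cmod (D (of_real t)) \<le> 1 * cmod (D (of_real t))"
      by (intro mult_right_mono) auto
    then show "(\<Sum>n\<in>F. indicator (?I n) t * cmod (D (of_real t))) \<le> cmod (D (of_real t))"
      by (simp add: sum_distrib_right)
  qed
  finally show ?thesis .
qed

text \<open>A Plancherel-Polya inequality: samples of an integrable function of exponential type are
  controlled by its integral. The weighted differences \<open>\<Psi> h\<close> of the primitive are
  of type 2\<pi> and bounded by \<open>L1norm\<close> on the line, so the horizontal bound and
  Cauchy's estimate on a unit disc control their derivatives, that is, the variation of the weighted
  sum of values; integrating over a step of length \<open>p\<close> compares that sum with
  \<open>\<Psi> p\<close>. The bound depends on neither the weights nor \<open>F\<close>.\<close>

lemma sum_translates_real: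
  assumes F: "finite F" and p: "0 < p" "p \<le> 1" and c: "\<And>n. cmod (c n) \<le> 1"
  shows "cmod (\<Sum>n\<in>F. c n * D (of_real (x + p * of_int n))) \<le> L1norm * (1 + exp (2 * pi)) / p"
proof -
  define \<Psi> where "\<Psi> = (\<lambda>h z. \<Sum>n\<in>F. c n * (primitive (z + of_real (p * of_int n + h)) - primitive (z + of_real (p * of_int n))))"
  define S where "S = (\<Sum>n\<in>F. c n * D (of_real (x + p * of_int n)))"
  have cX: "cmod (c n * X) \<le> cmod X" for n X
    unfolding norm_mult using c[of n] by (intro mult_left_le_one_le) auto
  have et\<Psi>: "exp_type_at_most (2 * pi) (\<Psi> h)" for h
    unfolding \<Psi>_def
    by (intro exp_type_at_most_sum exp_type_at_most_cmult exp_type_at_most_diff exp_type_at_most_shift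
        exp_type_at_most_primitive[OF et _ primitive]) auto
  have bd: "cmod (\<Psi> h (of_real x)) \<le> L1norm" if "0 \<le> h" "h \<le> p" for h x
  proof -
    have "cmod (\<Psi> h (of_real x)) \<le> (\<Sum>n\<in>F. cmod (primitive (of_real (x + p * of_int n + h)) - primitive (of_real (x + p * of_int n))))"
    proof -
      have "\<Psi> h (of_real x) = (\<Sum>n\<in>F. c n * (primitive (of_real (x + p * of_int n + h)) - primitive (of_real (x + p * of_int n))))"
        by (simp add: \<Psi>_def add.assoc)
      then show ?thesis by (simp only:) (rule order_trans[OF norm_sum sum_mono], rule cX)
    qed
    also have "\<dots> \<le> L1norm" using sum_norm_primitive_diff[OF F p(1) that, of x] by simp
    finally show ?thesis .
  qed
  have d\<Psi>: "(\<Psi> h has_field_derivative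
      (\<Sum>n\<in>F. c n * (D (z + of_real (p * of_int n + h)) - D (z + of_real (p * of_int n))))) (at z)" for h z
    unfolding \<Psi>_def
    by (intro DERIV_sum DERIV_cmult DERIV_diff)
       (use DERIV_shift primitive in \<open>blast intro: DERIV_shift[THEN iffD1]\<close>)+
  have dbd: "cmod (\<Sum>n\<in>F. c n * (D (of_real (x + p * of_int n + h)) - D (of_real (x + p * of_int n)))) \<le> L1norm * exp (2 * pi)"
    if "0 \<le> h" "h \<le> p" for h
  proof -
    have "cmod ((deriv ^^ 1) (\<Psi> h) (of_real x)) \<le> fact 1 * (L1norm * exp (2 * pi)) / 1 ^ 1"
    proof (rule Cauchy_inequality)
      have "\<Psi> h holomorphic_on UNIV" using et\<Psi> by (simp add: exp_type_at_most_def)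
      then show "\<Psi> h holomorphic_on ball (of_real x) 1" "continuous_on (cball (of_real x) 1) (\<Psi> h)"
        by (auto intro!: holomorphic_on_imp_continuous_on elim: holomorphic_on_subset)
      fix w assume w: "cmod (of_real x - w) = 1"
      have "\<bar>Im w\<bar> \<le> 1" using abs_Im_le_cmod[of "of_real x - w"] w by simp
      have "cmod (\<Psi> h w) \<le> L1norm * exp (2 * pi * \<bar>Im w\<bar>)"
        by (rule exp_type_horizontal_bound[OF et\<Psi> bd[OF that]])
      also have "\<dots> \<le> L1norm * exp (2 * pi)"
        using \<open>\<bar>Im w\<bar> \<le> 1\<close> L1norm_nonneg by (intro mult_left_mono) auto
      finally show "cmod (\<Psi> h w) \<le> L1norm * exp (2 * pi)" .
    qed auto
    then show ?thesis using DERIV_imp_deriv[OF d\<Psi>[of h "of_real x"]] by (simp add: add_ac)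
  qed
  \<comment> \<open>The derivative of \<open>u\<close> at \<open>h\<close> is the weighted sum of
    values at \<open>x + h\<close> minus the one at \<open>x\<close>, so the increment of
    \<open>u\<close> over \<open>[0, p]\<close> is the distance from \<open>p * S\<close> to the
    weighted integrals over the cells.\<close>
  define u where "u = (\<lambda>h. (\<Sum>n\<in>F. c n * primitive (of_real (x + p * of_int n) + h)) - h * S)"
  have "cmod (u (of_real p) - u 0) \<le> (L1norm * exp (2 * pi)) * cmod (of_real p - 0)"
  proof (rule field_differentiable_bound[where S = "closed_segment 0 (of_real p)"
        and f' = "\<lambda>w. \<Sum>n\<in>F. c n * (D (of_real (x + p * of_int n) + w) - D (of_real (x + p * of_int n)))"])
    fix w :: complex assume "w \<in> closed_segment 0 (of_real p)"
    then obtain t where t: "0 \<le> t" "t \<le> 1" "w = of_real (t * p)" by (auto simp: in_segment scaleR_conv_of_real)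
    have shift: "((\<lambda>h. primitive (b + h)) has_field_derivative D (b + w)) (at w)" for b
    proof -
      have "((\<lambda>h. primitive (b + h)) has_field_derivative D (b + w) * 1) (at w)"
        by (rule DERIV_chain2[OF primitive]) (auto intro!: derivative_eq_intros)
      then show ?thesis by simp
    qed
    have "(u has_field_derivative (\<Sum>n\<in>F. c n * D (of_real (x + p * of_int n) + w)) - 1 * S) (at w)"
      unfolding u_def
      by (intro DERIV_diff DERIV_sum DERIV_cmult shift DERIV_cmult_right DERIV_ident)
    moreover have "(\<Sum>n\<in>F. c n * D (of_real (x + p * of_int n) + w)) - 1 * S =
       (\<Sum>n\<in>F. c n * (D (of_real (x + p * of_int n) + w) - D (of_real (x + p * of_int n))))"
      by (simp add: S_def sum_subtractf right_diff_distrib)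
    ultimately show "(u has_field_derivative (\<Sum>n\<in>F. c n * (D (of_real (x + p * of_int n) + w) - D (of_real (x + p * of_int n)))))
        (at w within closed_segment 0 (of_real p))"
      by (simp add: has_field_derivative_at_within)
    have "t * p \<le> p" using t p by (intro mult_left_le_one_le) auto
    then show "cmod (\<Sum>n\<in>F. c n * (D (of_real (x + p * of_int n) + w) - D (of_real (x + p * of_int n)))) \<le> L1norm * exp (2 * pi)"
      using t p dbd[of "t * p"] by (simp add: add_ac)
  qed auto
  moreover have "u (of_real p) - u 0 = \<Psi> p (of_real x) - of_real p * S"
    by (simp add: u_def \<Psi>_def right_diff_distrib sum_subtractf add_ac)
  ultimately have "cmod (of_real p * S) \<le> L1norm + (L1norm * exp (2 * pi)) * p"
    using norm_triangle_sub[of "of_real p * S" "\<Psi> p (of_real x)"] bd[of p x] p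
    by (simp add: norm_minus_commute)
  also have "\<dots> \<le> L1norm + (L1norm * exp (2 * pi)) * 1"
    using p L1norm_nonneg by (intro add_left_mono mult_left_mono) auto
  finally have "p * cmod S \<le> L1norm * (1 + exp (2 * pi))"
    using p by (simp add: norm_mult distrib_left)
  then show ?thesis using p by (simp add: S_def field_simps)
qed

text \<open>The weights are chosen at the given \<open>z\<close> to make all terms of the sum
  positive; with these weights fixed, the sum is one function of type 2\<pi>, bounded on the line by
  a constant that does not see the weights.\<close>

lemma sum_translates:
  assumes F: "finite F" and p: "0 < p" "p \<le> 1"
  shows "(\<Sum>n\<in>F. cmod (D (z + of_real (p * of_int n)))) \<le> L1norm * (1 + exp (2 * pi)) / p * exp (2 * pi * \<bar>Im z\<bar>)"
proof -
  define c where "c = (\<lambda>n. SOME c. cmod c \<le> 1 \<and> c * D (z + of_real (p * of_int n)) = of_real (cmod (D (z + of_real (p * of_int n)))))"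
  have c: "cmod (c n) \<le> 1" "c n * D (z + of_real (p * of_int n)) = of_real (cmod (D (z + of_real (p * of_int n))))" for n
    using someI_ex[OF exists_unimodular_factor[of "D (z + of_real (p * of_int n))"]] unfolding c_def by blast+
  define f where "f = (\<lambda>w. \<Sum>n\<in>F. c n * D (w + of_real (p * of_int n)))"
  have "exp_type_at_most (2 * pi) f" unfolding f_def
    by (intro exp_type_at_most_sum exp_type_at_most_cmult exp_type_at_most_shift et) auto
  moreover have "cmod (f (of_real x)) \<le> L1norm * (1 + exp (2 * pi)) / p" for x
    using sum_translates_real[OF F p c(1), where x = x] by (simp add: f_def)
  ultimately have "cmod (f z) \<le> L1norm * (1 + exp (2 * pi)) / p * exp (2 * pi * \<bar>Im z\<bar>)"
    by (rule exp_type_horizontal_bound)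
  moreover have "f z = of_real (\<Sum>n\<in>F. cmod (D (z + of_real (p * of_int n))))"
    by (simp add: f_def c(2) del: of_real_mult)
  then have "cmod (f z) = (\<Sum>n\<in>F. cmod (D (z + of_real (p * of_int n))))"
    by (simp only: norm_of_real) (simp add: sum_nonneg)
  ultimately show ?thesis by simp
qed

lemma horizontal_bound: "\<exists>C. \<forall>z. cmod (D z) \<le> C * exp (2 * pi * \<bar>Im z\<bar>)"
  using sum_translates[of "{0}" 1] by auto

definition translate_sum :: "real \<Rightarrow> complex \<Rightarrow> complex" where
  "translate_sum p z = (\<Sum>\<^sub>\<infinity>n::int. D (z + of_real (p * of_int n)))"

context
  fixes p :: real assumes p: "0 < p" "p \<le> 1"
begin

lemma summable_translates: "(\<lambda>n::int. D (z + of_real (p * of_int n))) summable_on UNIV"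
  by (rule abs_summable_onI_bounded[OF sum_translates[OF _ p]])

lemma translate_sum_bound:
  "cmod (translate_sum p z) \<le> L1norm * (1 + exp (2 * pi)) / p * exp (2 * pi * \<bar>Im z\<bar>)"
  unfolding translate_sum_def by (rule abs_summable_onI_bounded[OF sum_translates[OF _ p]])

lemma holomorphic_translate_sum: "translate_sum p holomorphic_on UNIV"
proof (rule entire_bounded_limit(1))
  show "(\<lambda>z. \<Sum>n\<in>{- int N..int N}. D (z + of_real (p * of_int n))) holomorphic_on UNIV" for N
    using entire_affine[OF holomorphic_D, of 1] by (auto intro!: holomorphic_intros)
  show "(\<lambda>N. \<Sum>n\<in>{- int N..int N}. D (z + of_real (p * of_int n))) \<longlonglongrightarrow> translate_sum p z" for z
    unfolding translate_sum_def by (rule has_sum_int_tendsto) (use summable_translates in auto)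
  show "cmod (\<Sum>n\<in>{- int N..int N}. D (z + of_real (p * of_int n)))
      \<le> L1norm * (1 + exp (2 * pi)) / p * exp (2 * pi * \<bar>Im z\<bar>)" for N z
    by (rule order_trans[OF norm_sum sum_translates[OF _ p]]) auto
qed

lemma translate_sum_periodic: "translate_sum p (z + of_real p) = translate_sum p z"
proof -
  have "translate_sum p z = (\<Sum>\<^sub>\<infinity>n\<in>range (\<lambda>n::int. n + 1). D (z + of_real (p * of_int n)))"
    unfolding translate_sum_def by (rule arg_cong2[where f = infsum]) (auto intro: image_eqI[of _ _ "x - 1" for x])
  also have "\<dots> = (\<Sum>\<^sub>\<infinity>n::int. D (z + of_real (p * of_int (n + 1))))"
    by (subst infsum_reindex) (auto simp: inj_on_def o_def)
  also have "\<dots> = translate_sum p (z + of_real p)"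
    unfolding translate_sum_def by (intro infsum_cong) (simp add: algebra_simps)
  finally show ?thesis by simp
qed

end

end

section \<open>Periodizations and the few Fourier coefficients they have\<close>

lemma integral_periodize:
  fixes g :: "real \<Rightarrow> complex"
  assumes cont: "continuous_on UNIV g" and int: "integrable lborel g" and p: "p > 0"
    and bd: "\<And>F x. finite F \<Longrightarrow> (\<Sum>n\<in>F. cmod (g (x + p * of_int n))) \<le> C"
  shows "(\<integral>x. indicator {0..p} x *\<^sub>R (\<Sum>\<^sub>\<infinity>n::int. g (x + p * of_int n)) \<partial>lborel) = (\<integral>x. g x \<partial>lborel)"
proof -
  have [measurable]: "g \<in> borel_measurable borel" by (rule borel_measurable_continuous_onI[OF cont])
  define P where "P = (\<lambda>x. \<Sum>\<^sub>\<infinity>n::int. g (x + p * of_int n))"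
  define S where "S = (\<lambda>N x. \<Sum>n\<in>{- int N..int N}. g (x + p * of_int n))"
  have SP: "(\<lambda>N. S N x) \<longlonglongrightarrow> P x" for x
    unfolding S_def P_def
    by (rule has_sum_int_tendsto) (use abs_summable_onI_bounded(2)[OF bd] in auto)
  have [measurable]: "S N \<in> borel_measurable borel" for N unfolding S_def by measurable
  have [measurable]: "P \<in> borel_measurable borel"
    by (rule borel_measurable_LIMSEQ_metric[OF _ SP]) auto
  have lim1: "(\<lambda>N. \<integral>x. indicator {0..<p} x *\<^sub>R S N x \<partial>lborel) \<longlonglongrightarrow> (\<integral>x. indicator {0..<p} x *\<^sub>R P x \<partial>lborel)"
  proof (rule integral_dominated_convergence[where w = "\<lambda>x. C * indicator {0..<p} x"])
    show "integrable lborel (\<lambda>x. C * indicator {0..<p} x :: real)" using p by (intro integrable_mult_right integrable_real_indicator) auto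
    show "AE x in lborel. (\<lambda>N. indicator {0..<p} x *\<^sub>R S N x) \<longlonglongrightarrow> indicator {0..<p} x *\<^sub>R P x"
      by (intro AE_I2 tendsto_intros SP)
    show "AE x in lborel. norm (indicator {0..<p} x *\<^sub>R S N x) \<le> C * indicator {0..<p} x" for N
      unfolding S_def by (intro AE_I2) (auto simp: indicator_def intro: order_trans[OF norm_sum bd])
  qed auto
  have lim2: "(\<lambda>N. \<integral>t. (if \<lfloor>t / p\<rfloor> \<in> {- int N..int N} then g t else 0) \<partial>lborel) \<longlonglongrightarrow> (\<integral>t. g t \<partial>lborel)"
  proof (rule integral_dominated_convergence[where w = "\<lambda>t. cmod (g t)"])
    show "AE t in lborel. (\<lambda>N. if \<lfloor>t / p\<rfloor> \<in> {- int N..int N} then g t else 0) \<longlonglongrightarrow> g t"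
    proof (intro AE_I2 tendsto_eventually)
      fix t show "\<forall>\<^sub>F N in sequentially. (if \<lfloor>t / p\<rfloor> \<in> {- int N..int N} then g t else 0) = g t"
        by (rule eventually_sequentiallyI[of "nat \<bar>\<lfloor>t / p\<rfloor>\<bar>"]) auto
    qed
  qed (use int in auto)
  have "(\<integral>x. indicator {0..<p} x *\<^sub>R S N x \<partial>lborel) = (\<integral>t. (if \<lfloor>t / p\<rfloor> \<in> {- int N..int N} then g t else 0) \<partial>lborel)" for N
  proof -
    have i1: "integrable lborel (\<lambda>t. indicator {p * of_int n..<p * of_int n + p} t *\<^sub>R g t)" for n
      using int by (intro integrable_mult_indicator) auto
    have eq: "indicator {p * of_int n..<p * of_int n + p} (p * of_int n + 1 * x) *\<^sub>R g (p * of_int n + 1 * x) =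
       indicator {0..<p} x *\<^sub>R g (x + p * of_int n)" for n x
      by (auto simp: indicator_def add.commute)
    have i2: "integrable lborel (\<lambda>x. indicator {0..<p} x *\<^sub>R g (x + p * of_int n))" for n
      using lborel_integrable_real_affine[OF i1[of n], of 1 "p * of_int n"] unfolding eq by simp
    have "(\<integral>x. indicator {0..<p} x *\<^sub>R S N x \<partial>lborel) = (\<Sum>n\<in>{- int N..int N}. \<integral>x. indicator {0..<p} x *\<^sub>R g (x + p * of_int n) \<partial>lborel)"
      unfolding S_def scaleR_sum_right by (rule Bochner_Integration.integral_sum) (rule i2)
    also have "\<dots> = (\<Sum>n\<in>{- int N..int N}. \<integral>t. indicator {p * of_int n..<p * of_int n + p} t *\<^sub>R g t \<partial>lborel)"
    proof (intro sum.cong refl)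
      fix n
      show "(\<integral>x. indicator {0..<p} x *\<^sub>R g (x + p * of_int n) \<partial>lborel) = (\<integral>t. indicator {p * of_int n..<p * of_int n + p} t *\<^sub>R g t \<partial>lborel)"
        using lborel_integral_real_affine[of 1 "\<lambda>t. indicator {p * of_int n..<p * of_int n + p} t *\<^sub>R g t" "p * of_int n"]
        unfolding eq by simp
    qed
    also have "\<dots> = (\<integral>t. (\<Sum>n\<in>{- int N..int N}. indicator {p * of_int n..<p * of_int n + p} t *\<^sub>R g t) \<partial>lborel)"
      by (rule Bochner_Integration.integral_sum[symmetric]) (rule i1)
    also have "\<dots> = (\<integral>t. (if \<lfloor>t / p\<rfloor> \<in> {- int N..int N} then g t else 0) \<partial>lborel)"
      unfolding indicator_Ico_int_mult[OF p] scaleR_left.sum[symmetric] by (intro Bochner_Integration.integral_cong) (auto simp: sum.delta)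
    finally show ?thesis .
  qed
  with lim1 lim2 have "(\<integral>x. indicator {0..<p} x *\<^sub>R P x \<partial>lborel) = (\<integral>t. g t \<partial>lborel)"
    using LIMSEQ_unique by simp
  then have "(\<integral>x. indicator {0..p} x *\<^sub>R P x \<partial>lborel) = (\<integral>t. g t \<partial>lborel)"
    by (subst (asm) integral_indicator_Ico_Icc) measurable
  then show ?thesis by (simp add: P_def)
qed

text \<open>The growth leaves room for the frequencies -1, 0 and 1 only. In place of a Fourier
  expansion, subtracting \<open>Q 0\<close> and a multiple of the sine turns every integer into a
  double zero, which leaves \<open>(\<alpha> + \<beta> z) sin^2 (\<pi> z)\<close>; periodicity then
  excludes \<beta>.\<close>

lemma periodic_entire_trigonometric:
  assumes hol: "Q holomorphic_on UNIV" and per: "\<And>z. Q (z + 1) = Q z"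
    and bd: "\<And>z. cmod (Q z) \<le> K * exp (2 * pi * \<bar>Im z\<bar>)"
  obtains A B c where "\<And>z. Q z = A + c * sin (of_real (2 * pi) * z) + B * cos (of_real (2 * pi) * z)"
proof -
  have per_int: "Q (z + of_int n) = Q z" for z n
  proof (induction n rule: int_induct[where k = 0])
    case (step1 i) then show ?case using per[of "z + of_int i"] by (simp add: add_ac)
  next
    case (step2 i) then show ?case using per[of "z + of_int (i - 1)"] by (simp add: add_ac)
  qed simp
  define c where "c = deriv Q 0 / of_real (2 * pi)"
  define f where "f = (\<lambda>z. Q z - Q 0 - c * sin (of_real (2 * pi) * z))"
  have sin2: "sin (of_real (2 * pi) * of_int n) = (0::complex)" "cos (of_real (2 * pi) * of_int n) = (1::complex)" for n :: int
  proof -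
    have "sin (of_real pi * of_int n) = (0::complex)" by (simp add: sin_pi_eq_0_iff)
    then show "sin (of_real (2 * pi) * of_int n) = (0::complex)" "cos (of_real (2 * pi) * of_int n) = (1::complex)"
      using sin_double[of "of_real pi * of_int n :: complex"] cos_double_sin[of "of_real pi * of_int n :: complex"]
      by (auto simp: mult.assoc)
  qed
  have sin_bd: "cmod (sin (of_real (2 * pi) * z)) \<le> exp (2 * pi * \<bar>Im z\<bar>)" for z
    using cmod_sin_le_exp[of 1 "of_real (2 * pi) * z"] by (simp add: abs_mult mult.assoc)
  obtain \<alpha> \<beta> where \<alpha>\<beta>: "\<And>z. f z = (\<alpha> + \<beta> * z) * (sin (of_real pi * z))\<^sup>2"
  proof (rule double_zeros_at_integers[of f "2 * K + cmod c"])
    show "f holomorphic_on UNIV" unfolding f_def by (intro holomorphic_intros hol)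
    show "f (of_int n) = 0" for n
      using per_int[of 0 n] unfolding f_def sin2 by simp
    show "deriv f (of_int n) = 0" for n
    proof (rule DERIV_imp_deriv)
      have dQ: "(Q has_field_derivative deriv Q z) (at z)" for z
        using holomorphic_derivI[OF hol] by simp
      have "((\<lambda>z. Q (z + of_int (- n))) has_field_derivative deriv Q 0) (at (of_int n))"
        using DERIV_shift[of Q "deriv Q 0" "of_int n" "of_int (- n)"] dQ[of 0] by simp
      then have "(Q has_field_derivative deriv Q 0) (at (of_int n))"
        by (simp only: per_int)
      then have "(f has_field_derivative deriv Q 0 - 0 - c * (cos (of_real (2 * pi) * of_int n) * (of_real (2 * pi) * 1))) (at (of_int n))"
        unfolding f_def by (intro DERIV_diff DERIV_const DERIV_cmult DERIV_chain2[OF DERIV_sin] DERIV_ident)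
      then show "(f has_field_derivative 0) (at (of_int n))" unfolding sin2 by (simp add: c_def)
    qed
    show "cmod (f z) \<le> (2 * K + cmod c) * (1 + cmod z) * exp (2 * pi * \<bar>Im z\<bar>)" for z
    proof -
      let ?E = "exp (2 * pi * \<bar>Im z\<bar>)"
      have K: "K \<ge> 0" using bd[of 0] norm_ge_zero[of "Q 0"] by (simp del: norm_ge_zero)
      have "cmod (f z) \<le> cmod (Q z) + cmod (Q 0) + cmod (c * sin (of_real (2 * pi) * z))"
        unfolding f_def by (intro order_trans[OF norm_triangle_ineq4] add_right_mono norm_triangle_ineq4)
      also have "\<dots> \<le> K * ?E + K * ?E + cmod c * ?E"
      proof (intro add_mono)
        show "cmod (Q z) \<le> K * ?E" by (rule bd)
        have "cmod (Q 0) \<le> K * 1" using bd[of 0] by simp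
        also have "\<dots> \<le> K * ?E" using K by (intro mult_left_mono) auto
        finally show "cmod (Q 0) \<le> K * ?E" .
        show "cmod (c * sin (of_real (2 * pi) * z)) \<le> cmod c * ?E"
          unfolding norm_mult[of c] by (intro mult_left_mono sin_bd) auto
      qed
      also have "\<dots> = ((2 * K + cmod c) * 1) * ?E" by (simp add: algebra_simps)
      also have "\<dots> \<le> (2 * K + cmod c) * (1 + cmod z) * ?E"
        using K by (intro mult_right_mono mult_left_mono) auto
      finally show ?thesis .
    qed
  qed blast
  have "f (z + 1) = f z" for z
  proof -
    have "sin (of_real (2 * pi) * (z + 1)) = sin (of_real (2 * pi) * z)"
      using sin_add[of "of_real (2 * pi) * z" "of_real (2 * pi) * of_int 1"] unfolding sin2
      by (simp add: distrib_left)
    then show ?thesis unfolding f_def per by simp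
  qed
  \<comment> \<open>At both half-integers the squared sine is 1, so equality of the two values reads
    \<open>\<beta> = 0\<close>.\<close>
  from this[of "1/2"] have "f (1/2 + 1) = f (1/2)" .
  moreover have "sin (of_real pi * (1/2) :: complex) = 1"
    using sin_of_real[of "pi/2", where 'a = complex] by simp
  moreover have "sin (of_real pi * (1/2 + 1) :: complex) = - 1"
  proof -
    have "of_real pi * (1/2 + 1) = complex_of_real (3/2 * pi)" by simp
    then show ?thesis by (simp only: sin_of_real sin_3over2_pi) simp
  qed
  ultimately have "\<beta> = 0" unfolding \<alpha>\<beta> by (simp add: algebra_simps)
  have "Q z = (Q 0 + \<alpha> / 2) + c * sin (of_real (2 * pi) * z) + (- \<alpha> / 2) * cos (of_real (2 * pi) * z)" for z
  proof -
    have S: "(sin (of_real pi * z))\<^sup>2 = (1 - cos (of_real (2 * pi) * z)) / 2"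
      using cos_double_sin[of "of_real pi * z"] by (simp add: mult.assoc)
    have "Q z = Q 0 + c * sin (of_real (2 * pi) * z) + \<alpha> * (sin (of_real pi * z))\<^sup>2"
      using \<alpha>\<beta>[of z] \<open>\<beta> = 0\<close> by (simp add: f_def algebra_simps)
    also have "\<dots> = (Q 0 + \<alpha> / 2) + c * sin (of_real (2 * pi) * z) + (- \<alpha> / 2) * cos (of_real (2 * pi) * z)"
      unfolding S by (simp add: field_simps)
    finally show ?thesis .
  qed
  then show ?thesis by (rule that)
qed

lemma cos_add_int_2pi: "cos (x + of_int n * (2 * pi)) = cos x"
proof -
  have "cos (of_int n * (2 * pi)) = 1" "sin (of_int n * (2 * pi)) = 0"
    by (simp_all add: cos_int_2pin sin_int_2pin mult.commute[of _ "2 * pi"])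
  then show ?thesis by (simp only: cos_add)
qed

lemma integral_trigonometric_period:
  fixes A B c :: complex
  assumes p: "p > 0"
  defines "\<theta> \<equiv> \<lambda>x::real. of_real (2 * pi) * (of_real x / of_real p :: complex)"
  shows "(\<integral>x. indicator {0..p} x *\<^sub>R (A + c * sin (\<theta> x) + B * cos (\<theta> x)) \<partial>lborel) = of_real p * A"
    and "(\<integral>x. indicator {0..p} x *\<^sub>R ((A + c * sin (\<theta> x) + B * cos (\<theta> x)) * cos (\<theta> x)) \<partial>lborel) = of_real p * B / 2"
proof -
  define k where "k = complex_of_real (2 * pi / p)"
  have k: "k \<noteq> 0" using p by (simp add: k_def)
  have \<theta>: "\<theta> x = k * of_real x" for x by (simp add: \<theta>_def k_def)
  have kp: "k * of_real p = of_real (2 * pi)" using p by (simp add: k_def)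
  have sc: "sin (k * of_real p) = 0" "cos (k * of_real p) = 1"
    unfolding kp by (simp_all only: sin_of_real cos_of_real) auto
  have deriv_k: "((\<lambda>z. k * z) has_field_derivative k) (at z within S)" for z S
    by (auto intro!: derivative_eq_intros)
  have vd: "((\<lambda>x. F (of_real x)) has_vector_derivative F' (of_real x)) (at x within {0..p})"
    if "\<And>z. (F has_field_derivative F' z) (at z)" for F F' :: "complex \<Rightarrow> complex" and x
    using has_vector_derivative_real_field[OF DERIV_subset[OF that subset_UNIV]] by simp
  have FTC: "(\<integral>x. indicator {0..p} x *\<^sub>R F' (of_real x) \<partial>lborel) = F (of_real p) - F 0"
    if F: "\<And>z. (F has_field_derivative F' z) (at z)" and cont: "continuous_on UNIV F'" for F F' :: "complex \<Rightarrow> complex"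
    using integral_FTC_Icc[of 0 p "\<lambda>x. F (of_real x)" "\<lambda>x. F' (of_real x)"] p vd[OF F]
      continuous_on_compose2[OF cont, of "{0..p}" of_real] by (auto intro: continuous_intros)
  show "(\<integral>x. indicator {0..p} x *\<^sub>R (A + c * sin (\<theta> x) + B * cos (\<theta> x)) \<partial>lborel) = of_real p * A"
    unfolding \<theta>
    by (subst FTC[where F = "\<lambda>z. A * z - c / k * cos (k * z) + B / k * sin (k * z)"])
       (use k in \<open>auto intro!: derivative_eq_intros deriv_k continuous_intros simp: sc field_simps\<close>)
  have "sin (k * z) ^ 2 + cos (k * z) ^ 2 = 1" for z by simp
  then have s2: "sin (k * z) * sin (k * z) = 1 - cos (k * z) * cos (k * z)" for z
    by (simp add: power2_eq_square eq_diff_eq)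
  show "(\<integral>x. indicator {0..p} x *\<^sub>R ((A + c * sin (\<theta> x) + B * cos (\<theta> x)) * cos (\<theta> x)) \<partial>lborel) = of_real p * B / 2"
    unfolding \<theta>
  proof (subst FTC[where F = "\<lambda>z. A / k * sin (k * z) + c / (2 * k) * (sin (k * z) * sin (k * z)) + B / (2 * k) * (sin (k * z) * cos (k * z)) + B / 2 * z"])
    fix z
    have ds: "((\<lambda>z. sin (k * z)) has_field_derivative cos (k * z) * k) (at z)"
      by (rule DERIV_chain2[OF DERIV_sin deriv_k])
    have dc: "((\<lambda>z. cos (k * z)) has_field_derivative - sin (k * z) * k) (at z)"
      by (rule DERIV_chain2[OF DERIV_cos deriv_k])
    show "((\<lambda>z. A / k * sin (k * z) + c / (2 * k) * (sin (k * z) * sin (k * z)) + B / (2 * k) * (sin (k * z) * cos (k * z)) + B / 2 * z)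
        has_field_derivative (A + c * sin (k * z) + B * cos (k * z)) * cos (k * z)) (at z)"
    proof (rule DERIV_cong)
      show "((\<lambda>z. A / k * sin (k * z) + c / (2 * k) * (sin (k * z) * sin (k * z)) + B / (2 * k) * (sin (k * z) * cos (k * z)) + B / 2 * z)
        has_field_derivative A / k * (cos (k * z) * k) + c / (2 * k) * ((cos (k * z) * k) * sin (k * z) + (cos (k * z) * k) * sin (k * z))
          + B / (2 * k) * ((cos (k * z) * k) * cos (k * z) + (- sin (k * z) * k) * sin (k * z)) + B / 2 * 1) (at z)"
        by (intro DERIV_add DERIV_cmult DERIV_mult ds dc DERIV_ident)
    qed (use k in \<open>simp add: field_simps s2\<close>)
  qed (auto simp: sc intro!: continuous_intros)
qed

context L1_exp_type
begin

text \<open>Unfolding the integral over one period, without and with the cosine as a factor,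
  identifies the mean and the cosine coefficient as integrals of \<open>D\<close> over the line. The
  sine coefficient stays anonymous, because only even combinations of values are taken from here
  on.\<close>

lemma translate_sum_trigonometric:
  assumes p: "0 < p" "p \<le> 1"
  obtains A B c where
    "\<And>z. translate_sum p (of_real p * z) = A + c * sin (of_real (2 * pi) * z) + B * cos (of_real (2 * pi) * z)"
    "(\<integral>x. D (of_real x) \<partial>lborel) = of_real p * A"
    "(\<integral>x. D (of_real x) * cos (of_real (2 * pi) * (of_real x / of_real p)) \<partial>lborel) = of_real p * B / 2"
proof -
  define K where "K = L1norm * (1 + exp (2 * pi)) / p"
  have K: "K \<ge> 0" using p L1norm_nonneg by (simp add: K_def)
  obtain A B c where ABc:
    "\<And>z. translate_sum p (of_real p * z) = A + c * sin (of_real (2 * pi) * z) + B * cos (of_real (2 * pi) * z)"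
  proof (rule periodic_entire_trigonometric[of "\<lambda>z. translate_sum p (of_real p * z)" K])
    show "(\<lambda>z. translate_sum p (of_real p * z)) holomorphic_on UNIV"
      using entire_affine[OF holomorphic_translate_sum[OF p], of "of_real p" 0] by simp
    show "translate_sum p (of_real p * (z + 1)) = translate_sum p (of_real p * z)" for z
      using translate_sum_periodic[OF p] by (simp add: distrib_left)
    show "cmod (translate_sum p (of_real p * z)) \<le> K * exp (2 * pi * \<bar>Im z\<bar>)" for z
    proof -
      have "cmod (translate_sum p (of_real p * z)) \<le> K * exp (2 * pi * \<bar>Im (of_real p * z)\<bar>)"
        unfolding K_def by (rule translate_sum_bound[OF p])
      also have "\<bar>Im (of_real p * z)\<bar> \<le> \<bar>Im z\<bar>" using p by (simp add: abs_mult mult_left_le_one_le)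
      finally show ?thesis using K by (simp add: mult_left_mono)
    qed
  qed blast
  define \<theta> where "\<theta> = (\<lambda>x::real. of_real (2 * pi) * (of_real x / of_real p :: complex))"
  have T: "translate_sum p (of_real x) = A + c * sin (\<theta> x) + B * cos (\<theta> x)" for x
    using ABc[of "of_real x / of_real p"] p by (simp add: \<theta>_def)
  have bd: "(\<Sum>n\<in>F. cmod (D (of_real (x + p * of_int n)))) \<le> K" if "finite F" for F x
    using sum_translates[OF that p, of "of_real x"] by (simp add: K_def)
  have cos_real: "cos (\<theta> x) = of_real (cos (2 * pi * (x / p)))" for x
    unfolding \<theta>_def by (simp flip: of_real_divide of_real_mult cos_of_real)
  have "(\<integral>x. indicator {0..p} x *\<^sub>R (\<Sum>\<^sub>\<infinity>n::int. D (of_real (x + p * of_int n))) \<partial>lborel) = (\<integral>x. D (of_real x) \<partial>lborel)"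
    by (rule integral_periodize[OF continuous_D integrable_D p(1) bd])
  then have "(\<integral>x. indicator {0..p} x *\<^sub>R translate_sum p (of_real x) \<partial>lborel) = (\<integral>x. D (of_real x) \<partial>lborel)"
    by (simp add: translate_sum_def)
  then have 1: "(\<integral>x. D (of_real x) \<partial>lborel) = of_real p * A"
    unfolding T using integral_trigonometric_period(1)[OF p(1), of A c B] by (simp add: \<theta>_def)
  have per: "cos (\<theta> (x + p * of_int n)) = cos (\<theta> x)" for x n
  proof -
    have "2 * pi * ((x + p * of_int n) / p) = 2 * pi * (x / p) + of_int n * (2 * pi)" using p by (simp add: field_simps)
    then have "cos (2 * pi * ((x + p * of_int n) / p)) = cos (2 * pi * (x / p))"
      by (simp only: cos_add_int_2pi)
    then show ?thesis by (simp only: cos_real)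
  qed
  have "(\<integral>x. indicator {0..p} x *\<^sub>R (\<Sum>\<^sub>\<infinity>n::int. D (of_real (x + p * of_int n)) * cos (\<theta> (x + p * of_int n))) \<partial>lborel)
      = (\<integral>x. D (of_real x) * cos (\<theta> x) \<partial>lborel)"
  proof (rule integral_periodize[OF _ _ p(1)])
    show c: "continuous_on UNIV (\<lambda>x. D (of_real x) * cos (\<theta> x))"
      unfolding \<theta>_def using p by (intro continuous_intros continuous_D) auto
    show "integrable lborel (\<lambda>x. D (of_real x) * cos (\<theta> x))"
    proof (rule Bochner_Integration.integrable_bound[OF integrable_D])
      show "AE x in lborel. norm (D (of_real x) * cos (\<theta> x)) \<le> norm (D (of_real x))"
        unfolding cos_real by (intro AE_I2) (simp add: norm_mult mult_left_le)
    qed (use c in \<open>auto intro: borel_measurable_continuous_onI\<close>)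
    show "(\<Sum>n\<in>F. cmod (D (of_real (x + p * of_int n)) * cos (\<theta> (x + p * of_int n)))) \<le> K" if "finite F" for F x
      by (rule order_trans[OF sum_mono bd[OF that, of x]]) (unfold cos_real, simp add: norm_mult mult_left_le del: of_real_add of_real_mult)
  qed
  moreover have "(\<Sum>\<^sub>\<infinity>n::int. D (of_real (x + p * of_int n)) * cos (\<theta> (x + p * of_int n))) = translate_sum p (of_real x) * cos (\<theta> x)" for x
    unfolding per translate_sum_def using summable_translates[OF p, of "of_real x"]
    by (subst infsum_cmult_left) (auto simp del: of_real_mult)
  ultimately have "(\<integral>x. indicator {0..p} x *\<^sub>R (translate_sum p (of_real x) * cos (\<theta> x)) \<partial>lborel) = (\<integral>x. D (of_real x) * cos (\<theta> x) \<partial>lborel)"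
    by simp
  then have "(\<integral>x. D (of_real x) * cos (\<theta> x) \<partial>lborel) = of_real p * B / 2"
    unfolding T using integral_trigonometric_period(2)[OF p(1), of A c B] by (simp add: \<theta>_def)
  with 1 ABc that show ?thesis unfolding \<theta>_def by blast
qed

text \<open>A period \<open>p < 1\<close> leaves no room for the frequency \<open>1/p\<close>.\<close>

lemma integral_cos_eq_0_above:
  assumes p: "0 < p" "p < 1"
  shows "(\<integral>x. D (of_real x) * cos (of_real (2 * pi) * (of_real x / of_real p)) \<partial>lborel) = 0"
proof -
  have p': "p \<le> 1" using p by simp
  obtain A B c where T:
    "\<And>z. translate_sum p (of_real p * z) = A + c * sin (of_real (2 * pi) * z) + B * cos (of_real (2 * pi) * z)"
    and B: "(\<integral>x. D (of_real x) * cos (of_real (2 * pi) * (of_real x / of_real p)) \<partial>lborel) = of_real p * B / 2"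
    by (rule translate_sum_trigonometric[OF p(1) p']) blast
  define K where "K = L1norm * (1 + exp (2 * pi)) / p"
  define d where "d = 2 * pi * (1 - p)"
  have d: "d > 0" using p by (simp add: d_def)
  \<comment> \<open>On the imaginary axis the \<open>B\<close> term grows like
    \<open>exp (2 \<pi> y)\<close>, the periodization only like \<open>exp (2 \<pi> p y)\<close>.
    Adding the values at \<open>iy\<close> and \<open>-iy\<close> removes the sine.\<close>
  have "cmod B \<le> 2 * K * exp (- d * y) + 2 * cmod A * exp (- (2 * pi) * y)" if y: "y \<ge> 0" for y
  proof -
    define Q where "Q = (\<lambda>z. translate_sum p (of_real p * z))"
    define C where "C = cos (of_real (2 * pi) * (\<i> * of_real y))"
    have Cval: "C = of_real ((exp (2 * pi * y) + exp (- (2 * pi * y))) / 2)"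
      by (simp add: C_def cos_exp_eq exp_of_real[symmetric] algebra_simps flip: of_real_mult)
    have "Q (\<i> * of_real y) + Q (- (\<i> * of_real y)) = 2 * A + 2 * B * C"
      unfolding Q_def T C_def by (simp add: algebra_simps)
    then have "2 * B * C = Q (\<i> * of_real y) + Q (- (\<i> * of_real y)) - 2 * A" by (simp add: algebra_simps)
    then have "cmod (2 * B * C) \<le> cmod (Q (\<i> * of_real y)) + cmod (Q (- (\<i> * of_real y))) + cmod (2 * A)"
      by (simp only:) (intro order_trans[OF norm_triangle_ineq4] add_right_mono norm_triangle_ineq)
    also have "\<dots> \<le> K * exp (2 * pi * (p * y)) + K * exp (2 * pi * (p * y)) + 2 * cmod A"
      using translate_sum_bound[OF p(1) p', of "of_real p * (\<i> * of_real y)"]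
        translate_sum_bound[OF p(1) p', of "of_real p * (- (\<i> * of_real y))"] p y
      unfolding Q_def K_def by (intro add_mono) (auto simp: norm_mult abs_mult)
    finally have "2 * cmod B * cmod C \<le> 2 * K * exp (2 * pi * (p * y)) + 2 * cmod A" by (simp add: norm_mult)
    moreover have "2 * cmod B * (exp (2 * pi * y) / 2) \<le> 2 * cmod B * cmod C"
      unfolding Cval norm_of_real by (intro mult_left_mono) auto
    ultimately have "cmod B * exp (2 * pi * y) \<le> 2 * K * exp (2 * pi * (p * y)) + 2 * cmod A" by simp
    then have "cmod B * exp (2 * pi * y) * exp (- (2 * pi) * y) \<le> (2 * K * exp (2 * pi * (p * y)) + 2 * cmod A) * exp (- (2 * pi) * y)"
      by (intro mult_right_mono) auto
    then show ?thesis by (simp add: distrib_right mult.assoc exp_add[symmetric] d_def algebra_simps)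
  qed
  moreover have "((\<lambda>y. 2 * K * exp (- d * y) + 2 * cmod A * exp (- (2 * pi) * y)) \<longlongrightarrow> 0) at_top"
  proof -
    have e: "((\<lambda>y. exp (- c * y)) \<longlongrightarrow> 0) at_top" if "c > 0" for c :: real
      using that by real_asymp
    have "((\<lambda>y. 2 * K * exp (- d * y) + 2 * cmod A * exp (- (2 * pi) * y)) \<longlongrightarrow> 2 * K * 0 + 2 * cmod A * 0) at_top"
      by (intro tendsto_add tendsto_mult_left e d) auto
    then show ?thesis by simp
  qed
  ultimately have "cmod B \<le> 0"
  proof -
    assume bnd: "\<And>y. y \<ge> 0 \<Longrightarrow> cmod B \<le> 2 * K * exp (- d * y) + 2 * cmod A * exp (- (2 * pi) * y)"
      and lim: "((\<lambda>y. 2 * K * exp (- d * y) + 2 * cmod A * exp (- (2 * pi) * y)) \<longlongrightarrow> 0) at_top"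
    show ?thesis
      by (rule tendsto_lowerbound[OF lim], rule eventually_mono[OF eventually_ge_at_top[of 0] bnd], simp_all)
  qed
  with B show ?thesis by simp
qed

text \<open>Type 2\<pi> does permit the frequency 1, so this edge case is reached by continuity: the
  cosine transform vanishes at all frequencies \<open>1 / p > 1\<close>, and it is continuous since
  \<open>D\<close> is integrable.\<close>

lemma integral_cos_eq_0: "(\<integral>x. D (of_real x) * cos (of_real (2 * pi) * of_real x) \<partial>lborel) = 0"
proof -
  define q where "q = (\<lambda>n::nat. real (n + 1) / real (n + 2))"
  have q: "0 < q n" "q n < 1" for n by (auto simp: q_def)
  have qlim: "q \<longlonglongrightarrow> 1" unfolding q_def by real_asymp
  have "(\<lambda>n. \<integral>x. D (of_real x) * cos (of_real (2 * pi) * (of_real x / of_real (q n))) \<partial>lborel)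
      \<longlonglongrightarrow> (\<integral>x. D (of_real x) * cos (of_real (2 * pi) * (of_real x / of_real 1)) \<partial>lborel)"
  proof (rule integral_dominated_convergence[where w = "\<lambda>x. cmod (D (of_real x))"])
    show "AE x in lborel. (\<lambda>n. D (of_real x) * cos (of_real (2 * pi) * (of_real x / of_real (q n)))) \<longlonglongrightarrow>
        D (of_real x) * cos (of_real (2 * pi) * (of_real x / of_real 1))"
      by (intro AE_I2 tendsto_intros qlim) auto
    show "AE x in lborel. norm (D (of_real x) * cos (of_real (2 * pi) * (of_real x / of_real (q n)))) \<le> cmod (D (of_real x))" for n
    proof (intro AE_I2)
      fix x
      have "cos (of_real (2 * pi) * (of_real x / of_real (q n))) = complex_of_real (cos (2 * pi * (x / q n)))"
        by (simp flip: of_real_divide of_real_mult cos_of_real)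
      then show "norm (D (of_real x) * cos (of_real (2 * pi) * (of_real x / of_real (q n)))) \<le> cmod (D (of_real x))"
        by (simp add: norm_mult mult_left_le)
    qed
  qed (use integrable_D q in \<open>auto intro!: borel_measurable_continuous_onI continuous_intros continuous_D simp: less_imp_neq[symmetric]\<close>)
  then show ?thesis unfolding integral_cos_eq_0_above[OF q] by (simp add: LIMSEQ_const_iff)
qed

text \<open>For period 1 the periodization has a mean, a sine and a cosine term; the cosine
  coefficient is the integral just shown to vanish, and the sine is 0 at the origin.\<close>

theorem has_sum_integers_integral:
  "((\<lambda>n::int. D (of_int n)) has_sum (\<integral>x. D (of_real x) \<partial>lborel)) UNIV"
proof -
  obtain A B c where T:
    "\<And>z. translate_sum 1 (of_real 1 * z) = A + c * sin (of_real (2 * pi) * z) + B * cos (of_real (2 * pi) * z)"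
    and A: "(\<integral>x. D (of_real x) \<partial>lborel) = of_real 1 * A"
    and B: "(\<integral>x. D (of_real x) * cos (of_real (2 * pi) * (of_real x / of_real 1)) \<partial>lborel) = of_real 1 * B / 2"
    by (rule translate_sum_trigonometric[OF zero_less_one order_refl]) blast
  have "B = 0" using B integral_cos_eq_0 by simp
  then have "translate_sum 1 0 = (\<integral>x. D (of_real x) \<partial>lborel)" using T[of 0] A by simp
  moreover have "((\<lambda>n::int. D (0 + of_real (1 * of_int n))) has_sum translate_sum 1 0) UNIV"
    unfolding translate_sum_def using summable_translates[of 1 0] by simp
  ultimately show ?thesis by simp
qed

text \<open>Multiplication by \<open>z\<close> supplies the missing multiplicity at the origin, so
  \<open>z * D z = (\<alpha> + \<beta> z) sin^2 (\<pi> z)\<close> and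
  \<open>D x = \<alpha> / x + \<beta>\<close> at half-integers. Samples of \<open>D\<close> are
  absolutely summable: \<beta> is excluded because terms tend to 0, \<alpha> because the harmonic
  series diverges.\<close>

theorem vanishes_if_double_zeros:
  assumes zero: "\<And>n::int. D (of_int n) = 0" and dzero: "\<And>n::int. n \<noteq> 0 \<Longrightarrow> deriv D (of_int n) = 0"
  shows "D z = 0"
proof -
  obtain C where C: "\<And>z. cmod (D z) \<le> C * exp (2 * pi * \<bar>Im z\<bar>)" using horizontal_bound by blast
  have C0: "C \<ge> 0" using C[of 0] norm_ge_zero[of "D 0"] by (simp del: norm_ge_zero)
  obtain \<alpha> \<beta> where \<alpha>\<beta>: "\<And>z. z * D z = (\<alpha> + \<beta> * z) * (sin (of_real pi * z))\<^sup>2"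
  proof (rule double_zeros_at_integers[of "\<lambda>z. z * D z" C])
    show "(\<lambda>z. z * D z) holomorphic_on UNIV" by (intro holomorphic_intros holomorphic_D)
    show "deriv (\<lambda>z. z * D z) (of_int n) = 0" for n
    proof (rule DERIV_imp_deriv)
      have "(D has_field_derivative deriv D (of_int n)) (at (of_int n))"
        using holomorphic_derivI[OF holomorphic_D] by simp
      then have "((\<lambda>z. z * D z) has_field_derivative 1 * D (of_int n) + deriv D (of_int n) * of_int n) (at (of_int n))"
        by (intro DERIV_mult DERIV_ident)
      then show "((\<lambda>z. z * D z) has_field_derivative 0) (at (of_int n))"
        using zero[of n] dzero[of n] by (cases "n = 0") simp_all
    qed
    show "cmod (z * D z) \<le> C * (1 + cmod z) * exp (2 * pi * \<bar>Im z\<bar>)" for z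
    proof -
      have "cmod (z * D z) \<le> (1 + cmod z) * (C * exp (2 * pi * \<bar>Im z\<bar>))"
        unfolding norm_mult using C0 by (intro mult_mono C) auto
      then show ?thesis by (simp add: mult_ac)
    qed
  qed (use zero in auto)
  define x where "x = (\<lambda>n::int. of_int n + 1 / 2 :: real)"
  have sin1: "(sin (of_real pi * of_real (x n)))\<^sup>2 = (1 :: complex)" for n
  proof -
    have "cos (2 * (pi * x n)) = cos (pi + of_int n * (2 * pi))" by (simp add: x_def algebra_simps)
    also have "\<dots> = -1" by (simp only: cos_add_int_2pi cos_pi)
    finally have "(sin (pi * x n))\<^sup>2 = 1" using cos_double_sin[of "pi * x n"] by simp
    then have "complex_of_real ((sin (pi * x n))\<^sup>2) = 1" by simp
    then show ?thesis by (simp add: sin_of_real flip: of_real_mult)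
  qed
  have xD: "of_real (x n) * D (of_real (x n)) = \<alpha> + \<beta> * of_real (x n)" for n
    using \<alpha>\<beta>[of "of_real (x n)"] sin1[of n] by simp
  have "(\<lambda>n. cmod (D (of_real (1/2) + of_real (1 * of_int n)))) summable_on UNIV"
    by (rule abs_summable_onI_bounded(1)[OF sum_translates]) auto
  then have "(\<lambda>n::int. cmod (D (of_real (x n)))) summable_on UNIV" by (simp add: x_def add.commute)
  then have "(\<lambda>n::int. cmod (D (of_real (x n)))) summable_on range int" by (rule summable_on_subset_banach) auto
  then have "(\<lambda>n::nat. cmod (D (of_real (x (int n))))) summable_on UNIV"
    by (subst (asm) summable_on_reindex) (auto simp: o_def)
  then have s: "summable (\<lambda>n. cmod (D (of_real (x (int n)))))"
    by (simp add: summable_on_UNIV_nonneg_real_iff)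
  have "(\<lambda>n. cmod (D (of_real (x (int n))))) \<longlonglongrightarrow> 0" by (rule summable_LIMSEQ_zero[OF s])
  moreover have "(\<lambda>n. cmod (\<alpha> / of_real (x (int n)) + \<beta>)) \<longlonglongrightarrow> cmod (0 + \<beta>)"
  proof (intro tendsto_intros)
    have "(\<lambda>n. cmod \<alpha> / (real n + 1/2)) \<longlonglongrightarrow> 0" by real_asymp
    then show "(\<lambda>n. \<alpha> / of_real (x (int n))) \<longlonglongrightarrow> 0"
      by (intro tendsto_norm_zero_cancel[of "\<lambda>n. \<alpha> / of_real (x (int n))"]) (simp add: norm_divide x_def del: of_real_add)
  qed
  moreover have D: "D (of_real (x (int n))) = \<alpha> / of_real (x (int n)) + \<beta>" for n
  proof -
    have "x (int n) > 0" by (simp add: x_def add_nonneg_pos)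
    then show ?thesis using xD[of "int n"] by (simp add: field_simps)
  qed
  ultimately have "\<beta> = 0" using LIMSEQ_unique by fastforce
  have "\<alpha> = 0"
  proof (rule ccontr)
    assume "\<alpha> \<noteq> 0"
    have "summable (\<lambda>n. 1 / real (Suc n))"
    proof (rule summable_comparison_test)
      have "norm (1 / real (Suc n)) \<le> (1 / cmod \<alpha>) * cmod (D (of_real (x (int n))))" for n
        using \<open>\<alpha> \<noteq> 0\<close> \<open>\<beta> = 0\<close> unfolding D by (simp add: norm_divide x_def frac_le del: of_real_add)
      then show "\<exists>N. \<forall>n\<ge>N. norm (1 / real (Suc n)) \<le> (1 / cmod \<alpha>) * cmod (D (of_real (x (int n))))" by blast
      show "summable (\<lambda>n. (1 / cmod \<alpha>) * cmod (D (of_real (x (int n)))))" using s by (rule summable_mult)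
    qed
    then show False using not_summable_harmonic[where 'a = real] summable_Suc_iff[of "\<lambda>n. inverse (real n)"]
      by (simp add: inverse_eq_divide)
  qed
  have off0: "D w = 0" if "w \<noteq> 0" for w using \<alpha>\<beta>[of w] that \<open>\<alpha> = 0\<close> \<open>\<beta> = 0\<close> by simp
  show ?thesis using off0 zero[of 0] by (cases "z = 0") auto
qed

end

section \<open>A theta-like sum and the error on the negative axis\<close>

lemma summable_if_square_tendsto_0:
  fixes x :: "nat \<Rightarrow> real"
  assumes "(\<lambda>n. (real n)\<^sup>2 * x n) \<longlonglongrightarrow> 0"
  shows "summable (\<lambda>n. \<bar>x n\<bar>)"
proof (rule summable_comparison_test_ev)
  show "summable (\<lambda>n. 1 / (real n) ^ 2)" using inverse_power_summable[of 2, where 'a = real] by (simp add: field_simps)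
  have "\<forall>\<^sub>F n in sequentially. \<bar>(real n)\<^sup>2 * x n\<bar> < 1"
    using tendstoD[OF assms, of 1] by (simp add: dist_real_def)
  then show "\<forall>\<^sub>F n in sequentially. norm \<bar>x n\<bar> \<le> 1 / real n ^ 2"
    using eventually_gt_at_top[of 0]
    by eventually_elim (simp add: abs_mult field_simps)
qed

lemma exp_ge_Taylor:
  fixes x :: real assumes "x \<ge> 0" shows "(\<Sum>k<m. x ^ k / fact k) \<le> exp x"
proof -
  have "(\<lambda>n. x ^ n /\<^sub>R fact n) sums exp x" by (rule exp_converges)
  then have "(\<lambda>n. x ^ n / fact n) sums exp x" by (simp add: field_simps)
  then show ?thesis using assms sum_le_suminf[of "\<lambda>n. x ^ n / fact n" "{..<m}"]
    by (auto simp: sums_iff)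
qed

text \<open>Minus the derivative of \<open>u exp (- a u^2 / 2 - t u)\<close> at
  \<open>u = n\<close>. As a function of \<open>t\<close> it is the Laplace density of the error
  contributed by the node \<open>n\<close>, see \<open>left_error_Laplace\<close>.\<close>

definition theta_term :: "real \<Rightarrow> real \<Rightarrow> nat \<Rightarrow> real" where
  "theta_term a t n = (a * (real n)\<^sup>2 + t * real n - 1) * exp (- (a * (real n)\<^sup>2 / 2 + t * real n))"

definition theta_sum :: "real \<Rightarrow> real \<Rightarrow> real" where
  "theta_sum a t = (\<Sum>n. theta_term a t (Suc n))"

text \<open>One envelope of degree 8 serves all limits and summability claims: two of the powers are
  spent on comparison with \<open>1 / n^2\<close>, which leaves degree 6 for summation.\<close>

lemma gaussian_monomial_tendsto_0:
  assumes a: "a > 0" and t: "t \<ge> 0" and "i + j \<le> 8"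
  shows "(\<lambda>n. real n ^ i * (t + a * real n) ^ j * exp (- (a * (real n)\<^sup>2 / 2 + t * real n))) \<longlonglongrightarrow> 0"
proof (rule Lim_null_comparison)
  show "(\<lambda>n. (1 + t + a) ^ j * ((1 + real n) ^ 8 * exp (- (a * (real n)\<^sup>2 / 2)))) \<longlonglongrightarrow> 0"
    by (rule tendsto_mult_right_zero) (use a in real_asymp)
  show "\<forall>\<^sub>F n in sequentially. norm (real n ^ i * (t + a * real n) ^ j * exp (- (a * (real n)\<^sup>2 / 2 + t * real n)))
      \<le> (1 + t + a) ^ j * ((1 + real n) ^ 8 * exp (- (a * (real n)\<^sup>2 / 2)))"
  proof (intro always_eventually allI)
    fix n
    have "t + a * real n \<le> (1 + t + a) * (1 + real n)"
      using a t by (simp add: algebra_simps)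
    then have "(t + a * real n) ^ j \<le> (1 + t + a) ^ j * (1 + real n) ^ j"
      using a t unfolding power_mult_distrib[symmetric] by (intro power_mono) auto
    then have "real n ^ i * (t + a * real n) ^ j \<le> (1 + real n) ^ i * ((1 + t + a) ^ j * (1 + real n) ^ j)"
      using a t by (intro mult_mono power_mono) auto
    also have "\<dots> = (1 + t + a) ^ j * (1 + real n) ^ (i + j)" by (simp add: power_add)
    also have "\<dots> \<le> (1 + t + a) ^ j * (1 + real n) ^ 8"
      using a t assms(3) by (intro mult_left_mono power_increasing) auto
    finally have "real n ^ i * (t + a * real n) ^ j * exp (- (a * (real n)\<^sup>2 / 2 + t * real n))
        \<le> (1 + t + a) ^ j * (1 + real n) ^ 8 * exp (- (a * (real n)\<^sup>2 / 2))"
    proof (rule mult_mono)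
      show "exp (- (a * (real n)\<^sup>2 / 2 + t * real n)) \<le> exp (- (a * (real n)\<^sup>2 / 2))" using a t by simp
      show "0 \<le> (1 + t + a) ^ j * (1 + real n) ^ 8" using a t by simp
    qed auto
    moreover have "real n ^ i * (t + a * real n) ^ j * exp (- (a * (real n)\<^sup>2 / 2 + t * real n)) \<ge> 0"
      using a t by simp
    ultimately show "norm (real n ^ i * (t + a * real n) ^ j * exp (- (a * (real n)\<^sup>2 / 2 + t * real n)))
      \<le> (1 + t + a) ^ j * ((1 + real n) ^ 8 * exp (- (a * (real n)\<^sup>2 / 2)))"
      by (simp add: mult.assoc)
  qed
qed

lemma summable_gaussian_monomial:
  assumes "a > 0" "t \<ge> 0" "i \<le> 6"
  shows "summable (\<lambda>n. real n ^ i * exp (- (a * (real n)\<^sup>2 / 2 + t * real n)))"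
proof -
  have "(\<lambda>n. (real n)\<^sup>2 * (real n ^ i * exp (- (a * (real n)\<^sup>2 / 2 + t * real n)))) \<longlonglongrightarrow> 0"
    using gaussian_monomial_tendsto_0[of a t "i + 2" 0] assms
    by (simp add: power_add power2_eq_square mult_ac)
  from summable_if_square_tendsto_0[OF this] show ?thesis by simp
qed

lemma summable_theta_term:
  assumes "a > 0" "t \<ge> 0"
  shows "summable (\<lambda>n. theta_term a t n)" "summable (\<lambda>n. theta_term a t (Suc n))"
proof -
  have "summable (\<lambda>n. a * (real n ^ 2 * exp (- (a * (real n)\<^sup>2 / 2 + t * real n))) +
       t * (real n ^ 1 * exp (- (a * (real n)\<^sup>2 / 2 + t * real n))) - real n ^ 0 * exp (- (a * (real n)\<^sup>2 / 2 + t * real n)))"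
    using assms by (intro summable_diff summable_add summable_mult summable_gaussian_monomial) auto
  then show 1: "summable (\<lambda>n. theta_term a t n)"
    by (rule summable_cong[THEN iffD1, rotated]) (simp add: theta_term_def algebra_simps)
  show "summable (\<lambda>n. theta_term a t (Suc n))"
    by (subst summable_Suc_iff[of "theta_term a t"]) (rule 1)
qed

lemma theta_term_nonneg:
  assumes "a \<ge> 0" "t \<ge> 0" "a + t \<ge> 1" "n \<ge> 1"
  shows "theta_term a t n \<ge> 0"
proof -
  have "1 \<le> real n" using assms by simp
  then have "a * 1 \<le> a * (real n)\<^sup>2" "t * 1 \<le> t * real n"
    using assms by (intro mult_left_mono; simp)+
  then show ?thesis using assms unfolding theta_term_def by (intro mult_nonneg_nonneg) auto
qed

lemma theta_sum_nonneg_large: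
  assumes "a > 0" "t \<ge> 0" "a + t \<ge> 1"
  shows "theta_sum a t \<ge> 0"
  unfolding theta_sum_def using assms
  by (intro suminf_nonneg summable_theta_term) (auto intro!: theta_term_nonneg)

lemma decreasing_two_x_minus_1_exp:
  fixes x y :: real assumes "3/2 \<le> x" "x \<le> y"
  shows "(2 * y - 1) * exp (- y) \<le> (2 * x - 1) * exp (- x)"
proof -
  have "(2 * y - 1) = (2 * x - 1) + 2 * (y - x)" by simp
  also have "\<dots> \<le> (2 * x - 1) * (1 + (y - x))"
    using mult_nonneg_nonneg[of "2 * x - 3" "y - x"] assms by (simp add: algebra_simps)
  also have "\<dots> \<le> (2 * x - 1) * exp (y - x)"
    using assms exp_ge_add_one_self[of "y - x"] by (intro mult_left_mono) auto
  finally have "(2 * y - 1) * exp (- y) \<le> (2 * x - 1) * exp (y - x) * exp (- y)" by (intro mult_right_mono) auto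
  then show ?thesis by (simp add: mult.assoc exp_add[symmetric])
qed

lemma max_two_x_minus_1_exp: "(2 * y - 1) * exp (- y) \<le> 2 * exp (- (3/2 :: real))"
proof -
  have "2 * y - 1 \<le> 2 * (1 + (y - 3/2))" by simp
  also have "\<dots> \<le> 2 * exp (y - 3/2)" using exp_ge_add_one_self[of "y - 3/2"] by simp
  finally have "(2 * y - 1) * exp (- y) \<le> 2 * exp (y - 3/2) * exp (- y)" by (intro mult_right_mono) auto
  then show ?thesis by (simp add: mult.assoc exp_add[symmetric])
qed

text \<open>In terms of the exponent \<open>y\<close> the prefactor is at most
  \<open>2 y - 1\<close>, and \<open>(2 y - 1) exp (- y)\<close> peaks at 3/2 and decreases
  afterwards; this removes \<open>t\<close> from the estimate.\<close>

lemma theta_term_le: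
  assumes "a \<ge> 0" "t \<ge> 0"
  shows "theta_term a t n \<le> 2 * exp (- (3/2))"
    and "3/2 \<le> b \<Longrightarrow> b \<le> a * (real n)\<^sup>2 / 2 \<Longrightarrow> theta_term a t n \<le> (2 * b - 1) * exp (- b)"
proof -
  define y where "y = a * (real n)\<^sup>2 / 2 + t * real n"
  have y: "theta_term a t n \<le> (2 * y - 1) * exp (- y)"
    unfolding theta_term_def y_def using assms by (intro mult_right_mono) auto
  show "theta_term a t n \<le> 2 * exp (- (3/2))" by (rule order_trans[OF y max_two_x_minus_1_exp])
  assume b: "3/2 \<le> b" "b \<le> a * (real n)\<^sup>2 / 2"
  then have "b \<le> y" unfolding y_def using assms(2) by (simp add: add_increasing2)
  then show "theta_term a t n \<le> (2 * b - 1) * exp (- b)"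
    by (rule order_trans[OF y decreasing_two_x_minus_1_exp[OF b(1)]])
qed

lemma suminf_le_geometric:
  fixes f :: "nat \<Rightarrow> real"
  assumes "summable f" and "\<And>n. n \<ge> m \<Longrightarrow> f n \<le> C * exp (- c * real n)" and c: "c > 0"
  shows "(\<Sum>n. f n) \<le> (\<Sum>n<m. f n) + C * exp (- c * real m) / (1 - exp (- c))"
proof -
  have e: "norm (exp (- c)) < 1" using c by simp
  have g: "(\<lambda>n. C * exp (- c * real m) * exp (- c) ^ n) sums (C * exp (- c * real m) * (1 / (1 - exp (- c))))"
    by (intro sums_mult geometric_sums e)
  have "(\<Sum>n. f n) = (\<Sum>n. f (n + m)) + (\<Sum>n<m. f n)"
    by (rule suminf_split_initial_segment[OF assms(1)])
  also have "(\<Sum>n. f (n + m)) \<le> (\<Sum>n. C * exp (- c * real m) * exp (- c) ^ n)"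
  proof (rule suminf_le)
    show "summable (\<lambda>n. f (n + m))" using assms(1) by (simp add: summable_iff_shift)
    show "summable (\<lambda>n. C * exp (- c * real m) * exp (- c) ^ n)" using g by (rule sums_summable)
    show "f (n + m) \<le> C * exp (- c * real m) * exp (- c) ^ n" for n
      using assms(2)[of "n + m"] by (simp add: exp_of_nat_mult[symmetric] exp_add[symmetric] mult.assoc algebra_simps)
  qed
  also have "\<dots> = C * exp (- c * real m) / (1 - exp (- c))" using g by (simp add: sums_iff)
  finally show ?thesis by simp
qed

section \<open>Numerical bounds for the theta-like sum\<close>

lemma exp_numeric:
  "exp (- (3/2)) \<le> (2233/10000 :: real)" "exp (- 2) \<le> (1355/10000 :: real)"
  "exp (- (9/2)) \<le> (114/10000 :: real)" "exp (- 8) \<le> (1/2000 :: real)"  "exp (- 4) \<le> (185/10000 :: real)"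
  "exp (- 1) \<le> (3680/10000 :: real)" "exp (-(1/2)) \<le> (607/1000 :: real)"
proof -
  have *: "exp (- x) \<le> 1 / b" if "(\<Sum>k<12. x ^ k / fact k) \<ge> b" "b > 0" "x \<ge> 0" for x b :: real
    using exp_ge_Taylor[of x 12] that by (simp add: exp_minus field_simps)
  show "exp (- (3/2)) \<le> (2233/10000 :: real)"
    using *[of "10000/2233" "3/2"] by (simp add: eval_nat_numeral fact_numeral)
  show 2: "exp (- 2) \<le> (1355/10000 :: real)"
    using *[of "10000/1355" "2"] by (simp add: eval_nat_numeral fact_numeral)
  show "exp (- (9/2)) \<le> (114/10000 :: real)"
    using *[of "10000/114" "9/2"] by (simp add: eval_nat_numeral fact_numeral)
  have "exp (- 4) = exp (- 2) * exp (- 2 :: real)" by (simp add: exp_add[symmetric])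
  also have "\<dots> \<le> (1355/10000) * (1355/10000 :: real)" using 2 by (intro mult_mono) auto
  also have "\<dots> \<le> 185/10000" by simp
  finally show 4: "exp (- 4) \<le> (185/10000 :: real)" .
  have "exp (- 8) = exp (- 4) * exp (- 4 :: real)" by (simp add: exp_add[symmetric])
  also have "\<dots> \<le> (185/10000) * (185/10000 :: real)" using 4 by (intro mult_mono) auto
  also have "\<dots> \<le> 1/2000" by simp
  finally show "exp (- 8) \<le> (1/2000 :: real)" .
  show "exp (- 1) \<le> (3680/10000 :: real)"
    using *[of "10000/3680" "1"] by (simp add: eval_nat_numeral fact_numeral)
  show "exp (- (1/2)) \<le> (607/1000 :: real)"
    using *[of "1000/607" "1/2"] by (simp add: eval_nat_numeral fact_numeral)
qed

text \<open>The target 97/100 instead of 1 is deliberate: the missing 3/100 pays for the defect of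
  the two-sided formula when \<open>a \<le> 2\<close>. The first term is bounded by the global
  maximum, as its exponent may lie below 3/2; two more are evaluated at \<open>a = 1\<close>, the
  rest is a geometric tail.\<close>

lemma theta_sum_le_a_ge_1:
  assumes a: "a \<ge> 1" and t: "t \<ge> 0"
  shows "theta_sum a t \<le> 97/100"
proof -
  let ?f = "\<lambda>n. theta_term a t (Suc n)"
  have *: "?f n \<le> ((real (Suc n))\<^sup>2 - 1) * exp (- ((real (Suc n))\<^sup>2 / 2))" if "n \<ge> 1" for n
  proof -
    have "2 \<le> real (Suc n)" using that by simp
    then have "2 * 2 \<le> real (Suc n) * real (Suc n)" by (intro mult_mono) auto
    then have "3/2 \<le> (real (Suc n))\<^sup>2 / 2" by (simp add: power2_eq_square)
    moreover have "1 * (real (Suc n))\<^sup>2 \<le> a * (real (Suc n))\<^sup>2" using a by (intro mult_right_mono) auto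
    ultimately show ?thesis using theta_term_le(2)[of a t "(real (Suc n))\<^sup>2 / 2" "Suc n"] a t by simp
  qed
  have tail: "?f n \<le> (16 * exp (-2)) * exp (- 2 * real n)" if "n \<ge> 3" for n
  proof -
    define m where "m = real n - 3"
    have m: "m \<ge> 0" using that by (simp add: m_def)
    have n: "real (Suc n) = m + 4" by (simp add: m_def)
    have "16 * (1 + m * (m + 4) / 2) - ((m + 4)\<^sup>2 - 1) = 7 * (m * m) + 16 * m + (8 * m + 1)"
      by (simp add: power2_eq_square field_simps)
    then have "(m + 4)\<^sup>2 - 1 \<le> 16 * (1 + m * (m + 4) / 2)"
      using m zero_le_square[of m] by argo
    also have "\<dots> \<le> 16 * exp (m * (m + 4) / 2)" by (intro mult_left_mono exp_ge_add_one_self) auto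
    finally have "((m + 4)\<^sup>2 - 1) * exp (- ((m + 4)\<^sup>2 / 2)) \<le> 16 * exp (m * (m + 4) / 2) * exp (- ((m + 4)\<^sup>2 / 2))"
      by (intro mult_right_mono) auto
    also have "\<dots> = 16 * exp (- 2 * (m + 4))"
      by (simp add: mult.assoc exp_add[symmetric] power2_eq_square field_simps)
    also have "\<dots> = (16 * exp (-2)) * exp (- 2 * real n)"
      unfolding m_def by (simp add: mult.assoc exp_add[symmetric])
    finally show ?thesis using *[of n] that unfolding n by simp
  qed
  have "theta_sum a t \<le> (\<Sum>n<3. ?f n) + (16 * exp (-2)) * exp (- 2 * real 3) / (1 - exp (- 2))"
    unfolding theta_sum_def using a t tail by (intro suminf_le_geometric summable_theta_term) auto
  also have "(\<Sum>n<3. ?f n) \<le> 2 * exp (- (3/2)) + 3 * exp (- 2) + 8 * exp (- (9/2))"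
    using theta_term_le(1)[of a t "Suc 0"] *[of 1] *[of 2] a t by (simp add: eval_nat_numeral)
  also have "(16 * exp (-2)) * exp (- 2 * real 3) / (1 - exp (- 2)) = 16 * exp (-8) / (1 - exp (-2 :: real))"
    by (simp add: exp_add[symmetric])
  also have "\<dots> \<le> 16 * (1/2000) / (1 - 1355/10000)"
    using exp_numeric by (intro frac_le) auto
  also have "2 * exp (- (3/2)) + 3 * exp (- 2) + 8 * exp (- (9/2)) + 16 * (1/2000) / (1 - 1355/10000) \<le> (97/100 :: real)"
    using exp_numeric(1-3) by simp
  finally show ?thesis by simp
qed

text \<open>Leaves room for the larger defect, up to 37/100, between \<open>a = 2\<close> and
  \<open>a = 4\<close>.\<close>

lemma theta_sum_le_a_ge_2:
  assumes a: "a \<ge> 2" and t: "t \<ge> 0"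
  shows "theta_sum a t \<le> 63/100"
proof -
  let ?f = "\<lambda>n. theta_term a t (Suc n)"
  have tail: "?f n \<le> (8 * exp (-2)) * exp (- 2 * real n)" if "n \<ge> 1" for n
  proof -
    define m where "m = real n - 1"
    have m: "m \<ge> 0" using that by (simp add: m_def)
    have n: "real (Suc n) = m + 2" by (simp add: m_def)
    have "3/2 \<le> (m + 2)\<^sup>2" using m by (simp add: power2_eq_square algebra_simps)
    moreover have "2 * (m + 2)\<^sup>2 \<le> a * (m + 2)\<^sup>2" using a by (intro mult_right_mono) auto
    ultimately have "?f n \<le> (2 * (m + 2)\<^sup>2 - 1) * exp (- ((m + 2)\<^sup>2))"
      using theta_term_le(2)[of a t "(m + 2)\<^sup>2" "Suc n"] a t unfolding n by simp
    also have "\<dots> \<le> 8 * exp (m * (m + 2)) * exp (- ((m + 2)\<^sup>2))"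
    proof (rule mult_right_mono)
    have "2 * (m + 2)\<^sup>2 - 1 \<le> 8 * (1 + m * (m + 2))"
      using m mult_nonneg_nonneg[OF m m] by (simp add: power2_eq_square algebra_simps)
    also have "\<dots> \<le> 8 * exp (m * (m + 2))" by (intro mult_left_mono exp_ge_add_one_self) auto
    finally show "2 * (m + 2)\<^sup>2 - 1 \<le> 8 * exp (m * (m + 2))" .
    qed simp
    also have "8 * exp (m * (m + 2)) * exp (- ((m + 2)\<^sup>2)) = 8 * exp (- 2 * (m + 2))"
      by (simp add: mult.assoc exp_add[symmetric] power2_eq_square field_simps)
    also have "\<dots> = (8 * exp (-2)) * exp (- 2 * real n)"
      unfolding m_def by (simp add: mult.assoc exp_add[symmetric])
    finally show ?thesis by simp
  qed
  have "theta_sum a t \<le> (\<Sum>n<1. ?f n) + (8 * exp (-2)) * exp (- 2 * real 1) / (1 - exp (- 2))"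
    unfolding theta_sum_def using a t tail by (intro suminf_le_geometric summable_theta_term) auto
  also have "(\<Sum>n<1. ?f n) \<le> 2 * exp (- (3/2))"
    using theta_term_le(1)[of a t "Suc 0"] a t by simp
  also have "(8 * exp (-2)) * exp (- 2 * real 1) / (1 - exp (- 2)) = 8 * exp (-4) / (1 - exp (-2 :: real))"
    by (simp add: exp_add[symmetric])
  also have "\<dots> \<le> 8 * (185/10000) / (1 - 1355/10000)"
    using exp_numeric by (intro frac_le) auto
  also have "2 * exp (- (3/2)) + 8 * (185/10000) / (1 - 1355/10000) \<le> (63/100 :: real)"
    using exp_numeric(1) by simp
  finally show ?thesis by simp
qed

text \<open>\<open>a\<close> is eliminated in each term through
  \<open>c exp (- c) \<le> exp (- 1)\<close> for \<open>c = a n^2 / 2\<close>: 736/1000 bounds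
  \<open>2 / e\<close>, and 264/1000 is its complement to 1. A function of \<open>d = t n\<close>
  alone remains.\<close>

lemma theta_sum_le_t_ge_1:
  assumes a: "a > 0" and t: "t \<ge> 1"
  shows "theta_sum a t \<le> 97/100"
proof -
  let ?f = "\<lambda>n. theta_term a t (Suc n)"
  have e54: "exp (5/4) \<ge> (349/100 :: real)"
    using exp_ge_Taylor[of "5/4" 9] by (simp add: eval_nat_numeral fact_numeral)
  have e113: "exp (113/100) \<ge> (309/100 :: real)"
    using exp_ge_Taylor[of "113/100" 9] by (simp add: eval_nat_numeral fact_numeral)
  have *: "?f n \<le> (d - 264/1000) * exp (- d)" if "d = t * real (Suc n)" for n d
  proof -
    define c where "c = a * (real (Suc n))\<^sup>2 / 2"
    have c: "c \<ge> 0" using a by (simp add: c_def)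
    have d: "d \<ge> 1" unfolding that using t mult_mono[of 1 t 1 "real (Suc n)"] by simp
    have "c \<le> exp (c - 1)" using exp_ge_add_one_self[of "c - 1"] by simp
    then have "c * exp (- c) \<le> exp (c - 1) * exp (- c)" by (intro mult_right_mono) auto
    then have "c * exp (- c) \<le> exp (- 1)" by (simp add: exp_add[symmetric])
    then have "2 * c * exp (- c) \<le> 736/1000" using exp_numeric(6) by simp
    moreover have "(d - 1) * exp (- c) \<le> (d - 1) * 1" using c d by (intro mult_left_mono) auto
    ultimately have "(2 * c + d - 1) * exp (- c) \<le> d - 264/1000" by (simp add: algebra_simps)
    then have "(2 * c + d - 1) * exp (- c) * exp (- d) \<le> (d - 264/1000) * exp (- d)" by (intro mult_right_mono) auto
    moreover have "?f n = (2 * c + d - 1) * exp (- c) * exp (- d)"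
      unfolding theta_term_def c_def that by (simp add: mult.assoc exp_add[symmetric])
    ultimately show ?thesis by simp
  qed
  have first: "?f 0 \<le> 29/100"
  proof -
    define d where "d = t * real (Suc 0)"
    have "exp d = exp (5/4) * exp (d - 5/4)" by (simp add: exp_add[symmetric])
    moreover have "(349/100) * (1 + (d - 5/4)) \<le> exp (5/4) * exp (d - 5/4)"
    proof (cases "1 + (d - 5/4) \<ge> 0")
      case True then show ?thesis using e54 exp_ge_add_one_self[of "d - 5/4"] by (intro mult_mono) auto
    next
      case False
      then have "(349/100) * (1 + (d - 5/4)) \<le> 0" by simp
      also have "0 \<le> exp (5/4) * exp (d - 5/4)" by simp
      finally show ?thesis .
    qed
    ultimately have "d - 264/1000 \<le> (29/100) * exp d" using t by (simp add: d_def)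
    then have "(d - 264/1000) * exp (- d) \<le> (29/100) * exp d * exp (- d)" by (intro mult_right_mono) auto
    then show ?thesis using *[OF d_def] by (simp add: mult.assoc exp_add[symmetric])
  qed
  have tail: "?f n \<le> (65/100 * exp (-(1/2))) * exp (- (1/2) * real n)" if "n \<ge> 1" for n
  proof -
    define d where "d = t * real (Suc n)"
    have d: "d \<ge> real (Suc n)" unfolding d_def using t mult_right_mono[of 1 t "real (Suc n)"] by simp
    have "exp (d/2) = exp (113/100) * exp (d/2 - 113/100)" by (simp add: exp_add[symmetric])
    moreover have "(309/100) * (1 + (d/2 - 113/100)) \<le> exp (113/100) * exp (d/2 - 113/100)"
      using e113 exp_ge_add_one_self[of "d/2 - 113/100"] d that by (intro mult_mono) auto
    ultimately have "d - 264/1000 \<le> (65/100) * exp (d/2)" using d that by simp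
    then have "(d - 264/1000) * exp (- d) \<le> (65/100) * exp (d/2) * exp (- d)" by (intro mult_right_mono) auto
    also have "\<dots> = (65/100) * exp (- (d/2))" by (simp add: mult.assoc exp_add[symmetric])
    also have "\<dots> \<le> (65/100) * exp (- (real (Suc n) / 2))" using d by simp
    also have "\<dots> = (65/100 * exp (-(1/2))) * exp (- (1/2) * real n)"
      by (simp add: mult.assoc exp_add[symmetric] add_divide_distrib)
    finally show ?thesis using *[OF d_def] by simp
  qed
  have "theta_sum a t \<le> (\<Sum>n<1. ?f n) + (65/100 * exp (-(1/2))) * exp (- (1/2) * real 1) / (1 - exp (- (1/2)))"
    unfolding theta_sum_def using a t tail by (intro suminf_le_geometric summable_theta_term) auto
  also have "(\<Sum>n<1. ?f n) \<le> 29/100" using first by simp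
  also have "(65/100 * exp (-(1/2))) * exp (- (1/2) * real 1) / (1 - exp (- (1/2))) = 65/100 * exp (-1) / (1 - exp (-(1/2) :: real))"
    by (simp add: mult.assoc exp_add[symmetric])
  also have "\<dots> \<le> 65/100 * (3680/10000) / (1 - 607/1000)"
    using exp_numeric(6,7) by (intro frac_le) auto
  finally show ?thesis by simp
qed

text \<open>A remainder estimate without integrals: the variation of \<open>H\<close> is bounded by
  the drop of \<open>R\<close>, a form that telescopes over consecutive unit intervals.\<close>

lemma DERIV_abs_diff_le:
  fixes H R :: "real \<Rightarrow> real"
  assumes "x \<le> y" and H: "\<And>u. x \<le> u \<Longrightarrow> u \<le> y \<Longrightarrow> (H has_field_derivative H' u) (at u)"
    and R: "\<And>u. x \<le> u \<Longrightarrow> u \<le> y \<Longrightarrow> (R has_field_derivative R' u) (at u)"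
    and le: "\<And>u. x \<le> u \<Longrightarrow> u \<le> y \<Longrightarrow> \<bar>H' u\<bar> \<le> - c * R' u"
  shows "\<bar>H y - H x\<bar> \<le> c * (R x - R y)"
proof -
  have "H y + c * R y \<le> H x + c * R x"
  proof (rule DERIV_nonpos_imp_nonincreasing[OF assms(1)])
    fix u assume u: "x \<le> u" "u \<le> y"
    have "((\<lambda>u. H u + c * R u) has_field_derivative (H' u + c * R' u)) (at u)"
      by (intro DERIV_add DERIV_cmult H R u)
    moreover have "H' u + c * R' u \<le> 0" using le[OF u] by (simp add: abs_le_iff)
    ultimately show "\<exists>l. ((\<lambda>u. H u + c * R u) has_real_derivative l) (at u) \<and> l \<le> 0" by blast
  qed
  moreover have "- H y + c * R y \<le> - H x + c * R x"
  proof (rule DERIV_nonpos_imp_nonincreasing[OF assms(1)])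
    fix u assume u: "x \<le> u" "u \<le> y"
    have "((\<lambda>u. - H u + c * R u) has_field_derivative (- H' u + c * R' u)) (at u)"
      by (intro DERIV_add DERIV_minus DERIV_cmult H R u)
    moreover have "- H' u + c * R' u \<le> 0" using le[OF u] by (simp add: abs_le_iff)
    ultimately show "\<exists>l. ((\<lambda>u. - H u + c * R u) has_real_derivative l) (at u) \<and> l \<le> 0" by blast
  qed
  ultimately show ?thesis by (simp add: abs_le_iff algebra_simps)
qed

text \<open>Euler--Maclaurin of order four for \<open>u \<mapsto> d/du (u exp (-a u\<^sup>2/2 - t u))\<close>, with the kernel
  \<open>v\<^sup>2(1-v)\<^sup>2/24 \<in> [0, 1/384]\<close> centred at \<open>1/768\<close>; \<open>R\<close> below is an antiderivative dominating the
  fifth derivative, obtained from repeated integration by parts.\<close>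

lemma theta_sum_Euler_Maclaurin:
  assumes a: "a > 0" and t: "t \<ge> 0"
  shows "\<bar>theta_sum a t - 1/2 + t / 6 + (12 * a * t - 4 * t ^ 3) / 768\<bar>
    \<le> (6 * t ^ 3 + 62 * a * t + 120 * a\<^sup>2 * (sqrt (2 / a) * (pi / 2))) / 768"
proof -
  define z where "z = (\<lambda>u. t + a * u)"
  define g where "g = (\<lambda>u. exp (- (a * u\<^sup>2 / 2 + t * u)))"
  define F0 where "F0 = (\<lambda>u. u * g u)"
  define F1 where "F1 = (\<lambda>u. (1 - u * z u) * g u)"
  define F2 where "F2 = (\<lambda>u. (- 2 * z u - a * u + u * z u ^ 2) * g u)"
  define F3 where "F3 = (\<lambda>u. (- 3 * a + 3 * z u ^ 2 + 3 * a * u * z u - u * z u ^ 3) * g u)"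
  define F4 where "F4 = (\<lambda>u. (12 * a * z u + 3 * a\<^sup>2 * u - 4 * z u ^ 3 - 6 * a * u * z u ^ 2 + u * z u ^ 4) * g u)"
  define F5 where "F5 = (\<lambda>u. (15 * a\<^sup>2 - 30 * a * z u ^ 2 - 15 * a\<^sup>2 * u * z u + 5 * z u ^ 4 + 10 * a * u * z u ^ 3 - u * z u ^ 5) * g u)"
  \<comment> \<open>\<open>- A\<close> has the derivative \<open>1 / (1 + a u^2 / 2)\<close>, a
    majorant of the Gaussian factor with an elementary antiderivative. The \<pi>/2 in the final
    bound is its value at 0.\<close>
  define A where "A = (\<lambda>u. sqrt (2 / a) * (pi / 2 - arctan (u * sqrt (a / 2))))"
  define R where "R = (\<lambda>u. (u * z u ^ 4 + 6 * z u ^ 3 + 14 * a * u * z u ^ 2 + 62 * a * z u + 43 * a\<^sup>2 * u) * g u + 120 * a\<^sup>2 * A u)"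
  define Q where "Q = (\<lambda>u. (u * z u ^ 5 + 5 * z u ^ 4 + 10 * a * u * z u ^ 3 + 30 * a * z u ^ 2 + 15 * a\<^sup>2 * u * z u + 15 * a\<^sup>2) * g u)"
  have dz: "(z has_field_derivative a) (at u)" for u
    unfolding z_def by (auto intro!: derivative_eq_intros)
  have dg: "(g has_field_derivative - z u * g u) (at u)" for u
    unfolding g_def z_def by (auto intro!: derivative_eq_intros simp: power2_eq_square algebra_simps)
  have d0: "(F0 has_field_derivative F1 u) (at u)" for u
    unfolding F0_def F1_def by (rule derivative_eq_intros dz dg refl | simp)+ (simp add: algebra_simps)
  have d1: "(F1 has_field_derivative F2 u) (at u)" for u
    unfolding F1_def F2_def
    by (rule derivative_eq_intros dz dg refl | simp)+ (simp add: algebra_simps power2_eq_square)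
  have d2: "(F2 has_field_derivative F3 u) (at u)" for u
    unfolding F2_def F3_def
    by (rule derivative_eq_intros dz dg refl | simp)+ (simp add: algebra_simps power2_eq_square power3_eq_cube)
  have d3: "(F3 has_field_derivative F4 u) (at u)" for u
    unfolding F3_def F4_def
    by (rule derivative_eq_intros dz dg refl | simp)+ (simp add: algebra_simps power2_eq_square power3_eq_cube power4_eq_xxxx)
  have d4: "(F4 has_field_derivative F5 u) (at u)" for u
    unfolding F4_def F5_def
    by (rule derivative_eq_intros dz dg refl | simp)+ (simp add: algebra_simps eval_nat_numeral)
  have dA: "(A has_field_derivative - (1 / (1 + a * u\<^sup>2 / 2))) (at u)" for u
  proof -
    have s: "sqrt (2 / a) * sqrt (a / 2) = 1" using a by (simp add: real_sqrt_mult[symmetric])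
    have s2: "(u * sqrt (a / 2))\<^sup>2 = a * u\<^sup>2 / 2" using a by (simp add: power_mult_distrib)
    have "(A has_field_derivative sqrt (2 / a) * (0 - inverse (1 + (u * sqrt (a / 2))\<^sup>2) * (sqrt (a / 2)))) (at u)"
      unfolding A_def by (auto intro!: derivative_eq_intros)
    moreover have "sqrt (2 / a) * (0 - inverse (1 + (u * sqrt (a / 2))\<^sup>2) * (sqrt (a / 2))) = - (1 / (1 + a * u\<^sup>2 / 2))"
      using s unfolding s2 by (simp add: field_simps)
    ultimately show ?thesis by simp
  qed
  define R' where "R' = (\<lambda>u. - Q u + 120 * a\<^sup>2 * g u - 120 * a\<^sup>2 * (1 / (1 + a * u\<^sup>2 / 2)))"
  have dR: "(R has_field_derivative R' u) (at u)" for u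
    unfolding R_def R'_def Q_def
    by (rule derivative_eq_intros dz dg dA refl | simp)+ (simp add: algebra_simps eval_nat_numeral)
  have z0: "z u \<ge> 0" if "u \<ge> 0" for u using a t that by (simp add: z_def)
  have g_le: "g u \<le> 1 / (1 + a * u\<^sup>2 / 2)" if "u \<ge> 0" for u
  proof -
    have "1 + a * u\<^sup>2 / 2 \<le> exp (a * u\<^sup>2 / 2)" by (rule exp_ge_add_one_self)
    also have "\<dots> \<le> exp (a * u\<^sup>2 / 2 + t * u)" using t that by simp
    finally show ?thesis using a unfolding g_def exp_minus
      by (simp add: inverse_eq_divide) (intro divide_left_mono; simp add: add_pos_nonneg)
  qed
  have F5_le: "\<bar>F5 u\<bar> \<le> - R' u" if u: "u \<ge> 0" for u
  proof -
    have nn: "0 \<le> u * z u ^ 5" "0 \<le> 5 * z u ^ 4" "0 \<le> 10 * a * u * z u ^ 3" "0 \<le> 30 * a * z u ^ 2" "0 \<le> 15 * a\<^sup>2 * u * z u"  "0 \<le> 15 * a\<^sup>2"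
      using u z0[OF u] a by simp_all
    have "\<bar>F5 u\<bar> \<le> Q u"
      unfolding F5_def Q_def abs_mult using nn by (intro mult_mono) (auto simp: abs_le_iff g_def)
    moreover have "120 * a\<^sup>2 * g u \<le> 120 * a\<^sup>2 * (1 / (1 + a * u\<^sup>2 / 2))"
      using g_le[OF u] by (intro mult_left_mono) auto
    ultimately show ?thesis by (simp add: R'_def)
  qed
  have step: "\<bar>(F2 (real (Suc n)) - F2 (real n)) / 12 - (F1 (real (Suc n)) + F1 (real n)) / 2 + F0 (real (Suc n)) - F0 (real n)
      - (F4 (real (Suc n)) - F4 (real n)) / 768\<bar> \<le> (1 / 768) * (R (real n) - R (real (Suc n)))" for n :: nat
  proof -
    define v where "v = (\<lambda>u. u - real n)"
    \<comment> \<open>The coefficients of \<open>F4\<close> down to \<open>F0\<close> are the kernel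
      \<open>v^2 (1 - v)^2 / 24\<close> and its successive derivatives with alternating signs, so in
      the derivative of \<open>H\<close> everything cancels but the kernel times \<open>F5\<close>.
      Subtracting \<open>F4 / 768\<close> centres the kernel.\<close>
    define H where "H = (\<lambda>u. (v u)\<^sup>2 * (1 - v u)\<^sup>2 / 24 * F4 u - v u * (1 - v u) * (1 - 2 * v u) / 12 * F3 u
      + (1 - 6 * v u + 6 * (v u)\<^sup>2) / 12 * F2 u - (v u - 1/2) * F1 u + F0 u - F4 u / 768)"
    have dv: "(v has_field_derivative 1) (at u)" for u unfolding v_def by (auto intro!: derivative_eq_intros)
    have dH: "(H has_field_derivative ((v u)\<^sup>2 * (1 - v u)\<^sup>2 / 24 - 1/768) * F5 u) (at u)" for u
      unfolding H_def by (rule derivative_eq_intros dv d0 d1 d2 d3 d4 refl | simp)+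
        (simp add: field_simps eval_nat_numeral)
    have "\<bar>H (real (Suc n)) - H (real n)\<bar> \<le> (1 / 768) * (R (real n) - R (real (Suc n)))"
    proof (rule DERIV_abs_diff_le[OF _ dH dR])
      fix u assume u: "real n \<le> u" "u \<le> real (Suc n)"
      then have v: "0 \<le> v u" "v u \<le> 1" by (auto simp: v_def)
      have "0 \<le> (v u - 1/2)\<^sup>2" by simp
      then have "v u * (1 - v u) \<le> 1/4" by (simp add: power2_eq_square algebra_simps)
      moreover have "0 \<le> v u * (1 - v u)" using v by simp
      ultimately have "(v u * (1 - v u))\<^sup>2 \<le> (1/4)\<^sup>2" by (rule power_mono)
      then have "(v u * (1 - v u))\<^sup>2 \<le> 1/16" by (simp add: power_divide)
      moreover have "0 \<le> (v u * (1 - v u))\<^sup>2" by simp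
      ultimately have "\<bar>(v u)\<^sup>2 * (1 - v u)\<^sup>2 / 24 - 1/768\<bar> \<le> 1/768"
        unfolding power_mult_distrib[symmetric] abs_le_iff by argo
      then have "\<bar>(v u)\<^sup>2 * (1 - v u)\<^sup>2 / 24 - 1/768\<bar> * \<bar>F5 u\<bar> \<le> (1/768) * (- R' u)"
        using F5_le[of u] u by (intro mult_mono) auto
      then show "\<bar>((v u)\<^sup>2 * (1 - v u)\<^sup>2 / 24 - 1/768) * F5 u\<bar> \<le> - (1/768) * R' u"
        by (simp add: abs_mult)
    qed auto
    moreover have "H (real (Suc n)) = F2 (real (Suc n)) / 12 - F1 (real (Suc n)) / 2 + F0 (real (Suc n)) - F4 (real (Suc n)) / 768"
      by (simp add: H_def v_def)
    moreover have "H (real n) = F2 (real n) / 12 + F1 (real n) / 2 + F0 (real n) - F4 (real n) / 768"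
      by (simp add: H_def v_def)
    ultimately show ?thesis by (simp add: add_divide_distrib diff_divide_distrib)
  qed
  define S where "S = (\<lambda>N::nat. (F2 N - F2 0) / 12 - ((\<Sum>n<N. F1 (real (Suc n))) + (F1 0 - F1 N) / 2) + F0 N - F0 0 - (F4 N - F4 0) / 768)"
  have SR: "\<bar>S N\<bar> \<le> (1/768) * (R 0 - R N)" for N
  proof (induction N)
    case 0 show ?case by (simp add: S_def)
  next
    case (Suc N)
    have "S (Suc N) = S N + ((F2 (real (Suc N)) - F2 (real N)) / 12 - (F1 (real (Suc N)) + F1 (real N)) / 2 + F0 (real (Suc N)) - F0 (real N)
      - (F4 (real (Suc N)) - F4 (real N)) / 768)"
      by (simp add: S_def field_simps)
    then have "\<bar>S (Suc N)\<bar> \<le> \<bar>S N\<bar> + \<bar>(F2 (real (Suc N)) - F2 (real N)) / 12 - (F1 (real (Suc N)) + F1 (real N)) / 2 + F0 (real (Suc N)) - F0 (real N)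
      - (F4 (real (Suc N)) - F4 (real N)) / 768\<bar>"
      by (simp only: abs_triangle_ineq)
    then show ?case using Suc.IH step[of N] by argo
  qed
  have R_nonneg: "R N \<ge> 0" if "N \<ge> 0" for N
  proof -
    have "A N \<ge> 0" using arctan_ubound[of "N * sqrt (a / 2)"] a unfolding A_def by (intro mult_nonneg_nonneg) auto
    then show ?thesis unfolding R_def using z0[OF that] a that by (intro add_nonneg_nonneg mult_nonneg_nonneg) (auto simp: g_def)
  qed
  have mono: "(\<lambda>n. real n ^ i * z (real n) ^ j * g (real n)) \<longlonglongrightarrow> 0" if "i + j \<le> 8" for i j
    using gaussian_monomial_tendsto_0[OF a t that] by (simp add: z_def g_def)
  have l0: "(\<lambda>n. F0 (real n)) \<longlonglongrightarrow> 0" using mono[of 1 0] by (simp add: F0_def)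
  have l1: "(\<lambda>n. F1 (real n)) \<longlonglongrightarrow> 0"
  proof -
    have "(\<lambda>n. real n ^ 0 * z (real n) ^ 0 * g (real n) - real n ^ 1 * z (real n) ^ 1 * g (real n)) \<longlonglongrightarrow> 0 - 0"
      by (intro tendsto_diff mono) auto
    then show ?thesis by (simp add: F1_def algebra_simps)
  qed
  have l2: "(\<lambda>n. F2 (real n)) \<longlonglongrightarrow> 0"
  proof -
    have "(\<lambda>n. (- 2) * (real n ^ 0 * z (real n) ^ 1 * g (real n)) - a * (real n ^ 1 * z (real n) ^ 0 * g (real n))
       + real n ^ 1 * z (real n) ^ 2 * g (real n)) \<longlonglongrightarrow> (- 2) * 0 - a * 0 + 0"
      by (intro tendsto_diff tendsto_add tendsto_mult_left mono) auto
    then show ?thesis by (simp add: F2_def algebra_simps)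
  qed
  have l4: "(\<lambda>n. F4 (real n)) \<longlonglongrightarrow> 0"
  proof -
    have "(\<lambda>n. (12 * a) * (real n ^ 0 * z (real n) ^ 1 * g (real n)) + (3 * a\<^sup>2) * (real n ^ 1 * z (real n) ^ 0 * g (real n))
       - 4 * (real n ^ 0 * z (real n) ^ 3 * g (real n)) - (6 * a) * (real n ^ 1 * z (real n) ^ 2 * g (real n))
       + real n ^ 1 * z (real n) ^ 4 * g (real n)) \<longlonglongrightarrow> (12 * a) * 0 + (3 * a\<^sup>2) * 0 - 4 * 0 - (6 * a) * 0 + 0"
      by (intro tendsto_diff tendsto_add tendsto_mult_left mono) auto
    then show ?thesis by (simp add: F4_def algebra_simps)
  qed
  have F1_theta: "F1 (real n) = - theta_term a t n" for n
    by (simp add: F1_def theta_term_def z_def g_def power2_eq_square algebra_simps)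
  have "(\<lambda>N. \<Sum>n<N. theta_term a t (Suc n)) \<longlonglongrightarrow> theta_sum a t"
    unfolding theta_sum_def by (rule summable_LIMSEQ[OF summable_theta_term(2)[OF a t]])
  then have lS: "(\<lambda>N. \<Sum>n<N. F1 (real (Suc n))) \<longlonglongrightarrow> - theta_sum a t"
    unfolding F1_theta sum_negf by (rule tendsto_minus)
  have "S \<longlonglongrightarrow> (0 - F2 0) / 12 - (- theta_sum a t + (F1 0 - 0) / 2) + 0 - F0 0 - (0 - F4 0) / 768"
    unfolding S_def by (intro tendsto_intros l0 l1 l2 l4 lS) auto
  moreover have "(0 - F2 0) / 12 - (- theta_sum a t + (F1 0 - 0) / 2) + 0 - F0 0 - (0 - F4 0) / 768
      = theta_sum a t - 1/2 + t / 6 + (12 * a * t - 4 * t ^ 3) / 768"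
    by (simp add: F0_def F1_def F2_def F4_def z_def g_def field_simps)
  ultimately have lim: "(\<lambda>N. \<bar>S N\<bar>) \<longlonglongrightarrow> \<bar>theta_sum a t - 1/2 + t / 6 + (12 * a * t - 4 * t ^ 3) / 768\<bar>"
    by (metis tendsto_rabs)
  have "\<bar>S N\<bar> \<le> R 0 / 768" for N using SR[of N] R_nonneg[of "real N"] by simp
  then have "\<bar>theta_sum a t - 1/2 + t / 6 + (12 * a * t - 4 * t ^ 3) / 768\<bar> \<le> R 0 / 768"
    by (intro LIMSEQ_le_const2[OF lim]) auto
  also have "R 0 = 6 * t ^ 3 + 62 * a * t + 120 * a\<^sup>2 * (sqrt (2 / a) * (pi / 2))"
    by (simp add: R_def z_def g_def A_def)
  finally show ?thesis .
qed

text \<open>The Euler-Maclaurin expansion is accurate for small \<open>a\<close> and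
  \<open>t\<close>; outside the unit square all terms are nonnegative and the two direct upper
  estimates apply.\<close>

theorem theta_sum_bounds:
  assumes a: "a > 0" and t: "t \<ge> 0"
  shows "0 \<le> theta_sum a t" "theta_sum a t \<le> 97/100"
proof -
  have main: "0 \<le> theta_sum a t \<and> theta_sum a t \<le> 97/100" if a1: "a < 1" and t1: "t < 1"
  proof -
    have "a\<^sup>2 * (sqrt (2 / a) * (pi / 2)) = a * (sqrt a * sqrt 2 * (pi / 2))"
    proof -
      have "a = sqrt a * sqrt a" using a by simp
      then have "a * sqrt (2 / a) = sqrt a * sqrt 2" using a by (simp add: real_sqrt_divide field_simps)
      then show ?thesis by (simp add: power2_eq_square)
    qed
    also have "\<dots> \<le> a * (1 * (1415/1000) * (31416/20000))"
    proof (intro mult_left_mono mult_mono)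
      show "sqrt 2 \<le> 1415/1000" by (rule real_le_lsqrt) (auto simp: power2_eq_square)
      show "pi / 2 \<le> 31416/20000" using pi_approx by simp
    qed (use a a1 in auto)
    \<comment> \<open>267 is \<open>120 sqrt 2 \<pi> / 2\<close> rounded up; a further
      \<open>sqrt a \<le> 1\<close> has been dropped.\<close>
    finally have R: "120 * a\<^sup>2 * (sqrt (2 / a) * (pi / 2)) \<le> 267 * a" using a by (simp add: mult.assoc)
    have EM: "\<bar>theta_sum a t - 1/2 + t / 6 + (12 * a * t - 4 * t ^ 3) / 768\<bar> \<le> (6 * t ^ 3 + 62 * a * t + 267 * a) / 768"
      by (rule order_trans[OF theta_sum_Euler_Maclaurin[OF a t]]) (use R in simp)
    have t3: "t ^ 3 \<le> t" "0 \<le> t ^ 3"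
    proof -
      have "t ^ 3 \<le> t ^ 1" by (rule power_decreasing) (use t t1 in auto)
      then show "t ^ 3 \<le> t" "0 \<le> t ^ 3" using t by simp_all
    qed
    have at: "a * t \<le> t" "0 \<le> a * t"
      using mult_right_mono[of a 1 t] a a1 t by simp_all
    have upper: "theta_sum a t \<le> 97/100"
      using EM t3 at a1 t unfolding abs_le_iff by argo
    have lower: "0 \<le> theta_sum a t"
    \<comment> \<open>From \<open>a + t = 1\<close> on every term is nonnegative; below that line
      \<open>a t \<le> 1/4\<close>, which is what the expansion needs to stay positive.\<close>
    proof (cases "a + t \<ge> 1")
      case True then show ?thesis by (rule theta_sum_nonneg_large[OF a t])
    next
      case False
      then have "a * t \<le> (1 - t) * t" using t by (intro mult_right_mono) auto
      moreover have "0 \<le> (t - 1/2)\<^sup>2" by simp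
      ultimately have "a * t \<le> 1/4" by (simp add: power2_eq_square algebra_simps)
      then show ?thesis using EM t3 False t a unfolding abs_le_iff by argo
    qed
    show ?thesis using lower upper by simp
  qed
  have "0 \<le> theta_sum a t \<and> theta_sum a t \<le> 97/100"
  proof (cases "a < 1 \<and> t < 1")
    case True then show ?thesis using main by simp
  next
    case False
    then have "a \<ge> 1 \<or> t \<ge> 1" by auto
    then show ?thesis
      using theta_sum_nonneg_large[OF a t] theta_sum_le_a_ge_1[of a t] theta_sum_le_t_ge_1[of a t] a t by fastforce
  qed
  then show "0 \<le> theta_sum a t" "theta_sum a t \<le> 97/100" by auto
qed

section \<open>Laplace transform representation of the error on the negative axis\<close>

lemma has_bochner_integral_exp_Ici:
  fixes c :: real assumes c: "c > 0"
  shows "has_bochner_integral lborel (\<lambda>t. indicator {0..} t * exp (- (c * t))) (1 / c)"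
proof -
  have n: "(\<integral>\<^sup>+t. ennreal (exp (- (c * t))) * indicator {0..} t \<partial>lborel) = ennreal (0 - (- exp (- (c * 0)) / c))"
  proof (rule nn_integral_FTC_atLeast)
    show "((\<lambda>t. - exp (- (c * t)) / c) \<longlongrightarrow> 0) at_top" using c by real_asymp
    show "((\<lambda>t. - exp (- (c * t)) / c) has_real_derivative exp (- (c * x))) (at x)" for x
      using c by (auto intro!: derivative_eq_intros)
  qed auto
  show ?thesis
  proof (rule has_bochner_integral_nn_integral)
    show "(\<integral>\<^sup>+t. ennreal (indicator {0..} t * exp (- (c * t))) \<partial>lborel) = ennreal (1 / c)"
      using n by (simp add: ennreal_mult'' ennreal_indicator mult.commute)
  qed (use c in auto)
qed

lemma has_bochner_integral_id_exp_Ici: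
  fixes c :: real assumes c: "c > 0"
  shows "has_bochner_integral lborel (\<lambda>t. indicator {0..} t * (t * exp (- (c * t)))) (1 / c\<^sup>2)"
proof -
  have n: "(\<integral>\<^sup>+t. ennreal (t * exp (- (c * t))) * indicator {0..} t \<partial>lborel) = ennreal (0 - (- (0 / c + 1 / c\<^sup>2) * exp (- (c * 0))))"
  proof (rule nn_integral_FTC_atLeast)
    show "((\<lambda>t. - (t / c + 1 / c\<^sup>2) * exp (- (c * t))) \<longlongrightarrow> 0) at_top" using c by real_asymp
    show "((\<lambda>t. - (t / c + 1 / c\<^sup>2) * exp (- (c * t))) has_real_derivative x * exp (- (c * x))) (at x)" for x
      using c by (auto intro!: derivative_eq_intros simp: field_simps power2_eq_square)
  qed auto
  show ?thesis
  proof (rule has_bochner_integral_nn_integral)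
    have "(\<integral>\<^sup>+t. ennreal (indicator {0..} t * (t * exp (- (c * t)))) \<partial>lborel) = (\<integral>\<^sup>+t. ennreal (t * exp (- (c * t))) * indicator {0..} t \<partial>lborel)"
      by (intro nn_integral_cong) (auto simp: indicator_def)
    then show "(\<integral>\<^sup>+t. ennreal (indicator {0..} t * (t * exp (- (c * t)))) \<partial>lborel) = ennreal (1 / c\<^sup>2)"
      using n by simp
  qed (use c in \<open>auto simp: indicator_def\<close>)
qed

text \<open>Minus the contribution of the node \<open>n\<close> at the point \<open>- y\<close>, in
  units of \<open>sin^2 (\<pi> y) / \<pi>^2\<close>; its share of the origin slope is already merged
  into the first fraction.\<close>

definition left_error_term :: "real \<Rightarrow> real \<Rightarrow> nat \<Rightarrow> real" where
  "left_error_term a y n = exp (- (a * (real n)\<^sup>2 / 2)) * (a * (real n)\<^sup>2 / (y * (real n + y)) - 1 / (real n + y)\<^sup>2)"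

lemma summable_abs_theta_term:
  assumes "a > 0" "t \<ge> 0"
  shows "summable (\<lambda>n. \<bar>theta_term a t (Suc n)\<bar>)"
proof -
  let ?g = "\<lambda>n. exp (- (a * (real n)\<^sup>2 / 2 + t * real n))"
  have s: "summable (\<lambda>n. a * (real n ^ 2 * ?g n) + t * (real n ^ 1 * ?g n) + real n ^ 0 * ?g n)"
    using assms by (intro summable_add summable_mult summable_gaussian_monomial) auto
  have "summable (\<lambda>n. \<bar>theta_term a t n\<bar>)"
  proof (rule summable_comparison_test[OF _ s], intro exI allI impI)
    fix n :: nat
    have "\<bar>a * (real n)\<^sup>2 + t * real n - 1\<bar> \<le> a * (real n)\<^sup>2 + t * real n + 1"
      using assms by (simp add: abs_le_iff)
    then have "\<bar>theta_term a t n\<bar> \<le> (a * (real n)\<^sup>2 + t * real n + 1) * ?g n"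
      unfolding theta_term_def abs_mult by (intro mult_mono) auto
    then show "norm \<bar>theta_term a t n\<bar> \<le> a * (real n ^ 2 * ?g n) + t * (real n ^ 1 * ?g n) + real n ^ 0 * ?g n"
      by (simp add: algebra_simps)
  qed
  then show ?thesis by (subst summable_Suc_iff[of "\<lambda>n. \<bar>theta_term a t n\<bar>"])
qed

text \<open>\<open>1 / (n + y)\<close> and \<open>1 / (n + y)^2\<close> are the Laplace transforms
  of \<open>exp (- n t)\<close> and \<open>t exp (- n t)\<close>, and the factor \<open>y\<close>
  clears the pole at the origin. The densities may change sign, so the interchange of sum and
  integral rests on summability of the absolute integrals.\<close>

lemma left_error_Laplace:
  assumes a: "a > 0" and y: "y > 0"
  shows "summable (\<lambda>n. y * left_error_term a y (Suc n))"
    and "integrable lborel (\<lambda>t. indicator {0..} t * (exp (- (y * t)) * theta_sum a t))"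
    and "(\<Sum>n. y * left_error_term a y (Suc n)) = (\<integral>t. indicator {0..} t * (exp (- (y * t)) * theta_sum a t) \<partial>lborel)"
proof -
  define h where "h = (\<lambda>n t. indicator {0..} t * (exp (- (y * t)) * theta_term a t (Suc n)) :: real)"
  define G where "G = (\<lambda>n. exp (- (a * (real (Suc n))\<^sup>2 / 2)))"
  have h_eq: "h n t = G n * ((a * (real (Suc n))\<^sup>2 - 1) * (indicator {0..} t * exp (- ((real (Suc n) + y) * t)))
      + real (Suc n) * (indicator {0..} t * (t * exp (- ((real (Suc n) + y) * t)))))" for n t
  proof -
    define E where "E = exp (- ((real (Suc n) + y) * t))"
    have e: "exp (- (y * t)) * exp (- (a * (real (Suc n))\<^sup>2 / 2 + t * real (Suc n))) = G n * E"
      unfolding G_def E_def exp_add[symmetric] by (simp add: algebra_simps)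
    have "h n t = indicator {0..} t * (a * (real (Suc n))\<^sup>2 + t * real (Suc n) - 1) *
        (exp (- (y * t)) * exp (- (a * (real (Suc n))\<^sup>2 / 2 + t * real (Suc n))))"
      unfolding h_def theta_term_def by (simp only: mult_ac)
    then show ?thesis unfolding e E_def[symmetric] by (simp add: algebra_simps)
  qed
  have pos: "real (Suc n) + y > 0" for n using y by simp
  have hb: "has_bochner_integral lborel (h n) (y * left_error_term a y (Suc n))" for n
  proof -
    have "has_bochner_integral lborel (h n) (G n * ((a * (real (Suc n))\<^sup>2 - 1) * (1 / (real (Suc n) + y)) + real (Suc n) * (1 / (real (Suc n) + y)\<^sup>2)))"
      unfolding h_eq
      by (intro has_bochner_integral_mult_right has_bochner_integral_add has_bochner_integral_exp_Ici has_bochner_integral_id_exp_Ici pos)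
    moreover have "(a * (real (Suc n))\<^sup>2 - 1) * (1 / m) + real (Suc n) * (1 / m\<^sup>2)
       = y * (a * (real (Suc n))\<^sup>2 / (y * m) - 1 / m\<^sup>2)" if "m = real (Suc n) + y" for m
    proof -
      have "m > 0" using pos that by simp
      then have "(m - y) * (1 / m\<^sup>2) = 1 / m - y / m\<^sup>2"
        by (simp add: field_simps power2_eq_square)
      moreover have "real (Suc n) = m - y" using that by simp
      ultimately have 1: "real (Suc n) * (1 / m\<^sup>2) = 1 / m - y / m\<^sup>2" by (simp only:)
      have "y * (a * (real (Suc n))\<^sup>2 / (y * m)) = a * (real (Suc n))\<^sup>2 / m" using y by simp
      then show ?thesis unfolding 1 right_diff_distrib by (simp add: diff_divide_distrib)
    qed
    ultimately show ?thesis unfolding left_error_term_def G_def by (simp add: mult.left_commute)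
  qed
  have int: "integrable lborel (h n)" for n using hb by (simp add: has_bochner_integral_iff)
  have bound: "(\<integral>t. norm (h n t) \<partial>lborel) \<le> G n * ((a * (real (Suc n))\<^sup>2 + 1) + 1)" for n
  proof -
    let ?H = "\<lambda>t. G n * ((a * (real (Suc n))\<^sup>2 + 1) * (indicator {0..} t * exp (- ((real (Suc n) + y) * t)))
      + real (Suc n) * (indicator {0..} t * (t * exp (- ((real (Suc n) + y) * t)))))"
    have H: "has_bochner_integral lborel ?H (G n * ((a * (real (Suc n))\<^sup>2 + 1) * (1 / (real (Suc n) + y)) + real (Suc n) * (1 / (real (Suc n) + y)\<^sup>2)))"
      by (intro has_bochner_integral_mult_right has_bochner_integral_add has_bochner_integral_exp_Ici has_bochner_integral_id_exp_Ici pos)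
    have "(\<integral>t. norm (h n t) \<partial>lborel) \<le> (\<integral>t. ?H t \<partial>lborel)"
    proof (rule integral_mono)
      show "integrable lborel (\<lambda>t. norm (h n t))" using int by simp
      show "integrable lborel ?H" using H by (simp only: has_bochner_integral_iff)
      fix t
      define p q :: real where "p = indicator {0..} t * exp (- ((real (Suc n) + y) * t))"
        and "q = indicator {0..} t * (t * exp (- ((real (Suc n) + y) * t)))"
      have pq: "p \<ge> 0" "q \<ge> 0" by (auto simp: p_def q_def indicator_def)
      have "\<bar>a * (real (Suc n))\<^sup>2 - 1\<bar> \<le> a * (real (Suc n))\<^sup>2 + 1" using a by (simp add: abs_le_iff)
      then have "\<bar>a * (real (Suc n))\<^sup>2 - 1\<bar> * p \<le> (a * (real (Suc n))\<^sup>2 + 1) * p"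
        using pq by (intro mult_right_mono) auto
      then have "\<bar>(a * (real (Suc n))\<^sup>2 - 1) * p + real (Suc n) * q\<bar> \<le> (a * (real (Suc n))\<^sup>2 + 1) * p + real (Suc n) * q"
        using pq abs_triangle_ineq[of "(a * (real (Suc n))\<^sup>2 - 1) * p" "real (Suc n) * q"] by (simp only: abs_mult abs_of_nonneg abs_of_nat)
      then show "norm (h n t) \<le> ?H t" unfolding h_eq p_def[symmetric] q_def[symmetric] real_norm_def abs_mult[of "G n"]
        by (simp add: G_def mult_left_mono)
    qed
    also have "\<dots> = G n * ((a * (real (Suc n))\<^sup>2 + 1) * (1 / (real (Suc n) + y)) + real (Suc n) * (1 / (real (Suc n) + y)\<^sup>2))"
      using H by (rule has_bochner_integral_integral_eq)
    also have "\<dots> \<le> G n * ((a * (real (Suc n))\<^sup>2 + 1) * 1 + 1)"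
    proof (intro mult_left_mono add_mono)
      show "1 / (real (Suc n) + y) \<le> 1" using y by simp
      have "real (Suc n) * 1 \<le> (real (Suc n) + y) * (real (Suc n) + y)" using y by (intro mult_mono) auto
      then show "real (Suc n) * (1 / (real (Suc n) + y)\<^sup>2) \<le> 1" using pos[of n] by (simp add: power2_eq_square)
    qed (use a in \<open>auto simp: G_def\<close>)
    finally show ?thesis by simp
  qed
  have sbound: "summable (\<lambda>n. G n * ((a * (real (Suc n))\<^sup>2 + 1) + 1))"
  proof -
    have "summable (\<lambda>n. a * (real n ^ 2 * exp (- (a * (real n)\<^sup>2 / 2 + 0 * real n))) + 2 * (real n ^ 0 * exp (- (a * (real n)\<^sup>2 / 2 + 0 * real n))))"
      using a by (intro summable_add summable_mult summable_gaussian_monomial) auto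
    from summable_Suc_iff[THEN iffD2, OF this] show ?thesis
      by (rule summable_cong[THEN iffD1, rotated]) (simp add: G_def algebra_simps)
  qed
  have s2: "summable (\<lambda>n. \<integral>t. norm (h n t) \<partial>lborel)"
  proof (rule summable_comparison_test[OF _ sbound], intro exI allI impI)
    fix n
    have "0 \<le> (\<integral>t. norm (h n t) \<partial>lborel)" by (rule Bochner_Integration.integral_nonneg) simp
    then show "norm (\<integral>t. norm (h n t) \<partial>lborel) \<le> G n * ((a * (real (Suc n))\<^sup>2 + 1) + 1)"
      using bound[of n] by (simp only: real_norm_def abs_of_nonneg)
  qed
  have s1: "AE t in lborel. summable (\<lambda>n. norm (h n t))"
  proof (rule AE_I2)
    fix t
    show "summable (\<lambda>n. norm (h n t))"
    proof (cases "t \<ge> 0")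
      case True
      show ?thesis unfolding h_def real_norm_def abs_mult
        by (rule summable_mult[where c = "\<bar>indicator {0..} t\<bar>", OF summable_mult[OF summable_abs_theta_term[OF a True]]])
    qed (simp add: h_def)
  qed
  have sum_h: "(\<Sum>n. h n t) = indicator {0..} t * (exp (- (y * t)) * theta_sum a t)" for t
  proof (cases "t \<ge> 0")
    case True
    have "(\<Sum>n. h n t) = indicator {0..} t * (\<Sum>n. exp (- (y * t)) * theta_term a t (Suc n))"
      unfolding h_def by (rule suminf_mult, rule summable_mult, rule summable_theta_term(2)[OF a True])
    also have "(\<Sum>n. exp (- (y * t)) * theta_term a t (Suc n)) = exp (- (y * t)) * theta_sum a t"
      unfolding theta_sum_def by (rule suminf_mult, rule summable_theta_term(2)[OF a True])
    finally show ?thesis .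
  qed (simp add: h_def)
  note I = has_bochner_integral_integral_eq[OF hb]
  have "summable (\<lambda>n. \<integral>t. h n t \<partial>lborel)"
    by (rule summable_comparison_test[OF _ s2], intro exI allI impI, rule integral_norm_bound)
  then show "summable (\<lambda>n. y * left_error_term a y (Suc n))" unfolding I .
  show "integrable lborel (\<lambda>t. indicator {0..} t * (exp (- (y * t)) * theta_sum a t))"
    using integrable_suminf[OF int s1 s2] unfolding sum_h .
  show "(\<Sum>n. y * left_error_term a y (Suc n)) = (\<integral>t. indicator {0..} t * (exp (- (y * t)) * theta_sum a t) \<partial>lborel)"
    using integral_suminf[OF int s1 s2] unfolding sum_h I by simp
qed

definition left_error :: "real \<Rightarrow> real \<Rightarrow> real" where
  "left_error a y = (\<Sum>n. left_error_term a y (Suc n))"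

text \<open>Bounds on the density pass to the transform: \<open>0 \<le> theta_sum \<le> w\<close>
  gives \<open>0 \<le> y * left_error \<le> w / y\<close>. Keeping \<open>w\<close> as a parameter
  makes the sharper constant for \<open>a \<ge> 2\<close> available.\<close>

theorem left_error_bounds:
  assumes a: "a > 0" and y: "y > 0" and w: "\<And>t. t \<ge> 0 \<Longrightarrow> theta_sum a t \<le> w"
  shows "summable (\<lambda>n. left_error_term a y (Suc n))" "0 \<le> left_error a y" "left_error a y \<le> w / y\<^sup>2"
proof -
  note L = left_error_Laplace[OF a y]
  show s: "summable (\<lambda>n. left_error_term a y (Suc n))"
    using L(1) y by (simp add: summable_cmult_iff)
  have eq: "y * left_error a y = (\<integral>t. indicator {0..} t * (exp (- (y * t)) * theta_sum a t) \<partial>lborel)"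
    unfolding left_error_def L(3)[symmetric] by (rule suminf_mult[OF s, symmetric])
  have "0 \<le> y * left_error a y" unfolding eq
    by (intro Bochner_Integration.integral_nonneg) (auto simp: indicator_def theta_sum_bounds[OF a])
  then show "0 \<le> left_error a y" using y by (simp add: zero_le_mult_iff)
  have "y * left_error a y \<le> (\<integral>t. w * (indicator {0..} t * exp (- (y * t))) \<partial>lborel)"
    unfolding eq
  proof (rule integral_mono[OF L(2)])
    show "integrable lborel (\<lambda>t. w * (indicator {0..} t * exp (- (y * t))))"
      using has_bochner_integral_exp_Ici[OF y] by (intro integrable_mult_right) (simp add: has_bochner_integral_iff)
    show "indicator {0..} t * (exp (- (y * t)) * theta_sum a t) \<le> w * (indicator {0..} t * exp (- (y * t)))" for t
      using w[of t] by (auto simp: indicator_def mult.commute)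
  qed
  also have "\<dots> = w * (1 / y)"
    using has_bochner_integral_integral_eq[OF has_bochner_integral_exp_Ici[OF y]] by simp
  finally have "y * left_error a y \<le> w / y" by (simp only: times_divide_eq_right mult_1_right)
  then have "y * left_error a y * y \<le> w" using y by (simp only: pos_le_divide_eq)
  then have "left_error a y * y\<^sup>2 \<le> w" by (simp only: power2_eq_square mult_ac)
  then show "left_error a y \<le> w / y\<^sup>2" using y by (simp only: pos_le_divide_eq zero_less_power)
qed

section \<open>The two-sided interpolation formula for the Gaussian\<close>

lemma char_std_normal_lborel:
  "(\<integral>u. of_real (exp (- (u\<^sup>2 / 2))) * iexp (t * u) \<partial>lborel) = of_real (sqrt (2 * pi) * exp (- (t\<^sup>2 / 2)))"
proof -
  have "char std_normal_distribution t = (\<integral>u. std_normal_density u *\<^sub>R iexp (t * u) \<partial>lborel)"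
    unfolding char_def by (subst integral_density) auto
  also have "\<dots> = (\<integral>u. of_real (1 / sqrt (2 * pi)) * (of_real (exp (- (u\<^sup>2 / 2))) * iexp (t * u)) \<partial>lborel)"
    by (intro Bochner_Integration.integral_cong refl) (simp add: std_normal_density_def scaleR_conv_of_real)
  also have "\<dots> = of_real (1 / sqrt (2 * pi)) * (\<integral>u. of_real (exp (- (u\<^sup>2 / 2))) * iexp (t * u) \<partial>lborel)"
    by (rule integral_mult_right_zero)
  finally have "of_real (exp (- (t\<^sup>2 / 2))) = complex_of_real (1 / sqrt (2 * pi)) * (\<integral>u. of_real (exp (- (u\<^sup>2 / 2))) * iexp (t * u) \<partial>lborel)"
    by (simp add: char_std_normal_distribution)
  then show ?thesis by (simp add: field_simps)
qed

lemma integrable_gaussian: "c > 0 \<Longrightarrow> integrable lborel (\<lambda>s::real. exp (- (s\<^sup>2 / (2 * c))))"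
proof -
  assume c: "c > 0"
  have "integrable lborel (\<lambda>u. sqrt (2 * pi) * std_normal_density u)"
    by (intro integrable_mult_right) auto
  then have "integrable lborel (\<lambda>u::real. exp (- (u\<^sup>2 / 2)))"
    by (rule Bochner_Integration.integrable_cong[THEN iffD1, rotated -1]) (auto simp: std_normal_density_def)
  then have "integrable lborel (\<lambda>u::real. exp (- ((0 + (1 / sqrt c) * u)\<^sup>2 / 2)))"
    using c by (intro lborel_integrable_real_affine) auto
  then show ?thesis using c by (simp add: power_divide power_mult_distrib mult.commute)
qed

locale gaussian =
  fixes a :: real assumes a: "a > 0"
begin

text \<open>Up to the normalization \<open>N0\<close>, the Fourier transform of
  \<open>exp (- a x^2 / 2)\<close> in the angular frequency \<open>s\<close>.\<close>

definition w :: "real \<Rightarrow> real" where "w s = exp (- (s\<^sup>2 / (2 * a)))"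

text \<open>Transform of the part of the spectrum above the frequency \<open>2 \<pi> j\<close>,
  shifted back so as to start at 0.\<close>

definition w_tail :: "nat \<Rightarrow> real \<Rightarrow> complex" where
  "w_tail j x = (\<integral>s. indicator {0..} s *\<^sub>R (of_real (w (s + 2 * pi * real j)) * iexp (s * x)) \<partial>lborel)"

lemma w_pos: "w s > 0" by (simp add: w_def)

lemma w_mono: "0 \<le> s \<Longrightarrow> s \<le> t \<Longrightarrow> w t \<le> w s"
  unfolding w_def using a by (auto simp: divide_right_mono power_mono)

lemma w_add_le: "0 \<le> s \<Longrightarrow> 0 \<le> b \<Longrightarrow> w (s + b) \<le> w s * w b"
proof -
  assume s: "0 \<le> s" "0 \<le> b"
  have "s\<^sup>2 + b\<^sup>2 \<le> (s + b)\<^sup>2" using s by (simp add: power2_sum)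
  then have "- ((s + b)\<^sup>2 / (2 * a)) \<le> - (s\<^sup>2 / (2 * a)) + - (b\<^sup>2 / (2 * a))"
    using a by (simp add: field_simps)
  then show ?thesis unfolding w_def exp_add[symmetric] by simp
qed

lemma continuous_w [continuous_intros]: "continuous_on S f \<Longrightarrow> continuous_on S (\<lambda>x. w (f x))"
  unfolding w_def using a by (intro continuous_intros) auto

lemma measurable_w [measurable]: "w \<in> borel_measurable borel" unfolding w_def by measurable

lemma integrable_w: "integrable lborel w" unfolding w_def using integrable_gaussian[OF a] by simp

lemma integrable_w_tail: "b \<ge> 0 \<Longrightarrow> integrable lborel (\<lambda>s. indicator {0..} s *\<^sub>R (of_real (w (s + b)) * iexp (s * x)))"
proof (rule Bochner_Integration.integrable_bound[OF integrable_w])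
  assume b: "b \<ge> 0"
  show "AE s in lborel. norm (indicator {0..} s *\<^sub>R (of_real (w (s + b)) * iexp (s * x))) \<le> norm (w s)"
    using b by (intro AE_I2) (auto simp: indicator_def norm_mult abs_of_pos[OF w_pos] w_mono less_imp_le[OF w_pos])
qed measurable

definition w_mass :: real where "w_mass = (\<integral>s. indicator {0..} s * w s \<partial>lborel)"

lemma w_tail_bound: "cmod (w_tail j x) \<le> w (2 * pi * real j) * w_mass"
proof -
  have iw: "integrable lborel (\<lambda>s. indicator {0..} s * w s)"
    using integrable_real_mult_indicator[OF _ integrable_w, of "{0..}"] by (simp add: mult.commute)
  have "cmod (w_tail j x) \<le> (\<integral>s. w (2 * pi * real j) * (indicator {0..} s * w s) \<partial>lborel)"
    unfolding w_tail_def
  proof (rule order_trans[OF integral_norm_bound], rule integral_mono)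
    show "integrable lborel (\<lambda>s. norm (indicator {0..} s *\<^sub>R (of_real (w (s + 2 * pi * real j)) * iexp (s * x))))"
      by (intro integrable_norm integrable_w_tail) simp
    show "integrable lborel (\<lambda>s. w (2 * pi * real j) * (indicator {0..} s * w s))"
      by (intro integrable_mult_right iw)
    show "norm (indicator {0..} s *\<^sub>R (of_real (w (s + 2 * pi * real j)) * iexp (s * x))) \<le> w (2 * pi * real j) * (indicator {0..} s * w s)" for s
      using w_add_le[of s "2 * pi * real j"] w_pos by (auto simp: indicator_def norm_mult mult.commute less_imp_le)
  qed
  also have "\<dots> = w (2 * pi * real j) * w_mass" unfolding w_mass_def by (rule integral_mult_right_zero)
  finally show ?thesis .
qed

text \<open>The slice of the spectrum between \<open>2 \<pi> m\<close> and
  \<open>2 \<pi> (m + 1)\<close>, shifted to \<open>[0, 2 \<pi>]\<close>; being a compactly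
  supported transform it is entire, unlike a tail it needs no convergence factor.\<close>

definition block :: "nat \<Rightarrow> complex \<Rightarrow> complex" where
  "block m z = integral (cbox 0 (2 * pi)) (\<lambda>s. of_real (w (s + 2 * pi * real m)) * exp (\<i> * of_real s * z))"

lemma holomorphic_block: "block m holomorphic_on UNIV"
proof -
  have "(\<lambda>z. integral (cbox 0 (2 * pi)) (\<lambda>s. of_real (w (s + 2 * pi * real m)) * exp (\<i> * of_real s * z))) holomorphic_on UNIV"
  proof (rule leibniz_rule_holomorphic)
    show "((\<lambda>z. of_real (w (s + 2 * pi * real m)) * exp (\<i> * of_real s * z)) has_field_derivative
        of_real (w (s + 2 * pi * real m)) * (exp (\<i> * of_real s * z) * (\<i> * of_real s))) (at z within UNIV)" for z s
      by (auto intro!: derivative_eq_intros)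
    show "(\<lambda>s. of_real (w (s + 2 * pi * real m)) * exp (\<i> * of_real s * z)) integrable_on cbox 0 (2 * pi)" for z
      by (intro integrable_continuous continuous_intros)
    show "continuous_on (UNIV \<times> cbox 0 (2 * pi)) (\<lambda>(z, s). of_real (w (s + 2 * pi * real m)) * (exp (\<i> * of_real s * z) * (\<i> * of_real s)))"
      by (auto simp: case_prod_beta intro!: continuous_intros)
  qed auto
  then show ?thesis by (simp add: block_def[abs_def])
qed

lemma block_bound:
  "cmod (block m z) \<le> 2 * pi * w (2 * pi * real m) * exp (2 * pi * max 0 (- Im z))"
proof -
  have "cmod (block m z) \<le> (w (2 * pi * real m) * exp (2 * pi * max 0 (- Im z))) * measure lborel (cbox 0 (2 * pi))"
    unfolding block_def
  proof (rule has_integral_bound[OF _ integrable_integral])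
    show "0 \<le> w (2 * pi * real m) * exp (2 * pi * max 0 (- Im z))" by (intro mult_nonneg_nonneg) (auto intro: less_imp_le[OF w_pos])
    show "cmod (of_real (w (s + 2 * pi * real m)) * exp (\<i> * of_real s * z)) \<le> w (2 * pi * real m) * exp (2 * pi * max 0 (- Im z))" if "s \<in> cbox 0 (2 * pi)" for s
    proof -
      have "cmod (exp (\<i> * of_real s * z)) = exp (s * (- Im z))" by simp
      also have "s * (- Im z) \<le> 2 * pi * max 0 (- Im z)"
        using that by (intro order_trans[OF mult_left_mono[of "- Im z" "max 0 (- Im z)"]] mult_right_mono) auto
      finally have "cmod (exp (\<i> * of_real s * z)) \<le> exp (2 * pi * max 0 (- Im z))" by simp
      moreover have "w (s + 2 * pi * real m) \<le> w (2 * pi * real m)" using that by (intro w_mono) auto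
      ultimately show ?thesis using w_pos[of "s + 2 * pi * real m"] w_pos[of "2 * pi * real m"] unfolding norm_mult
        by (intro mult_mono) (auto simp: less_imp_le)
    qed
    show "(\<lambda>s. of_real (w (s + 2 * pi * real m)) * exp (\<i> * of_real s * z)) integrable_on cbox 0 (2 * pi)"
      by (intro integrable_continuous continuous_intros)
  qed
  then show ?thesis by (simp add: mult_ac)
qed

lemma block_real: "block m (of_real x) = w_tail m x - iexp (2 * pi * x) * w_tail (Suc m) x"
proof -
  let ?f = "\<lambda>s. of_real (w (s + 2 * pi * real m)) * iexp (s * x)"
  have 1: "block m (of_real x) = (\<integral>s. indicator {0..2 * pi} s *\<^sub>R ?f s \<partial>lborel)"
  proof -
    have "set_integrable lborel {0..2 * pi} ?f"
      by (intro borel_integrable_atLeastAtMost' continuous_intros)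
    from set_borel_integral_eq_integral(2)[OF this] show ?thesis
      unfolding block_def set_lebesgue_integral_def by (simp add: mult.assoc)
  qed
  also have "\<dots> = (\<integral>s. indicator {0..<2 * pi} s *\<^sub>R ?f s \<partial>lborel)"
    by (rule integral_indicator_Ico_Icc[symmetric]) measurable
  finally have b: "block m (of_real x) = (\<integral>s. indicator {0..<2 * pi} s *\<^sub>R ?f s \<partial>lborel)" .
  have i0: "integrable lborel (\<lambda>s. indicator {0..} s *\<^sub>R ?f s)" by (rule integrable_w_tail) simp
  have i1: "integrable lborel (\<lambda>s. indicator {0..<2 * pi} s *\<^sub>R ?f s)"
  proof (rule Bochner_Integration.integrable_bound[OF i0])
    show "AE s in lborel. norm (indicator {0..<2 * pi} s *\<^sub>R ?f s) \<le> norm (indicator {0..} s *\<^sub>R ?f s)"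
      by (intro AE_I2) (auto simp: indicator_def)
  qed measurable
  have sh: "indicator {2 * pi..} (2 * pi + 1 * s) *\<^sub>R ?f (2 * pi + 1 * s) =
      iexp (2 * pi * x) * (indicator {0..} s *\<^sub>R (of_real (w (s + 2 * pi * real (Suc m))) * iexp (s * x)))" for s
  proof -
    have e1: "2 * pi + 1 * s + 2 * pi * real m = s + 2 * pi * real (Suc m)" by (simp add: algebra_simps)
    have e2: "iexp ((2 * pi + 1 * s) * x) = iexp (2 * pi * x) * iexp (s * x)"
      by (simp add: exp_add[symmetric] algebra_simps)
    have e3: "indicator {2 * pi..} (2 * pi + 1 * s) = (indicator {0..} s :: real)" by (simp add: indicator_def)
    show ?thesis unfolding e1 e2 e3 scaleR_conv_of_real by (simp only: mult_ac)
  qed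
  have "(\<integral>s. indicator {2 * pi..} s *\<^sub>R ?f s \<partial>lborel) = (\<integral>s. indicator {2 * pi..} (2 * pi + 1 * s) *\<^sub>R ?f (2 * pi + 1 * s) \<partial>lborel)"
    using lborel_integral_real_affine[of 1 "\<lambda>s. indicator {2 * pi..} s *\<^sub>R ?f s" "2 * pi"] by simp
  also have "\<dots> = iexp (2 * pi * x) * w_tail (Suc m) x"
    unfolding sh w_tail_def by (rule integral_mult_right_zero)
  finally have 2: "(\<integral>s. indicator {2 * pi..} s *\<^sub>R ?f s \<partial>lborel) = iexp (2 * pi * x) * w_tail (Suc m) x" .
  have "indicator {2 * pi..} s = (indicator {0..} s - indicator {0..<2 * pi} s :: real)" for s :: real
    using pi_ge_two by (auto simp: indicator_def)
  then have "(\<integral>s. indicator {2 * pi..} s *\<^sub>R ?f s \<partial>lborel) = (\<integral>s. indicator {0..} s *\<^sub>R ?f s - indicator {0..<2 * pi} s *\<^sub>R ?f s \<partial>lborel)"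
    by (simp only: scaleR_diff_left)
  also have "\<dots> = w_tail m x - block m (of_real x)"
    unfolding b w_tail_def by (rule Bochner_Integration.integral_diff[OF i0 i1])
  finally show ?thesis unfolding 2 by simp
qed

lemma w_tail_0_sum: "w_tail 0 x + w_tail 0 (- x) = of_real (sqrt (2 * pi * a) * exp (- (a * x\<^sup>2 / 2)))"
proof -
  let ?f = "\<lambda>s. of_real (w s) * iexp (s * x)"
  have f: "integrable lborel ?f"
    by (rule Bochner_Integration.integrable_bound[OF integrable_w]) (auto simp: norm_mult)
  have "w_tail 0 (- x) = (\<integral>s. indicator {..0} (0 + (-1) * s) *\<^sub>R ?f (0 + (-1) * s) \<partial>lborel)"
    unfolding w_tail_def by (intro Bochner_Integration.integral_cong refl) (auto simp: indicator_def w_def)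
  also have "\<dots> = (\<integral>s. indicator {..0} s *\<^sub>R ?f s \<partial>lborel)"
    using lborel_integral_real_affine[of "-1" "\<lambda>s. indicator {..0} s *\<^sub>R ?f s" 0] by simp
  finally have "w_tail 0 x + w_tail 0 (- x) = (\<integral>s. indicator {0..} s *\<^sub>R ?f s \<partial>lborel) + (\<integral>s. indicator {..0} s *\<^sub>R ?f s \<partial>lborel)"
    by (simp add: w_tail_def)
  also have "\<dots> = (\<integral>s. indicator {0..} s *\<^sub>R ?f s + indicator {..0} s *\<^sub>R ?f s \<partial>lborel)"
    by (intro Bochner_Integration.integral_add[symmetric] integrable_mult_indicator f) auto
  also have "\<dots> = (\<integral>s. ?f s \<partial>lborel)"
  proof (rule integral_cong_AE)
    show "AE s in lborel. indicator {0..} s *\<^sub>R ?f s + indicator {..0} s *\<^sub>R ?f s = ?f s"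
      using AE_lborel_singleton[of 0] by eventually_elim (auto simp: indicator_def)
  qed measurable
  also have "\<dots> = \<bar>sqrt a\<bar> *\<^sub>R (\<integral>u. ?f (0 + sqrt a * u) \<partial>lborel)"
    using a by (intro lborel_integral_real_affine) auto
  also have "(\<integral>u. ?f (0 + sqrt a * u) \<partial>lborel) = (\<integral>u. of_real (exp (- (u\<^sup>2 / 2))) * iexp ((sqrt a * x) * u) \<partial>lborel)"
    using a by (intro Bochner_Integration.integral_cong refl) (simp add: w_def power_mult_distrib mult_ac)
  also have "\<dots> = of_real (sqrt (2 * pi) * exp (- ((sqrt a * x)\<^sup>2 / 2)))" by (rule char_std_normal_lborel)
  finally show ?thesis using a by (simp add: scaleR_conv_of_real power_mult_distrib real_sqrt_mult mult_ac)
qed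

lemma summable_w: "summable (\<lambda>m. (real m ^ i) * w (2 * pi * real m))" if "i \<le> 6"
  using summable_gaussian_monomial[of "4 * pi\<^sup>2 / a" 0 i] a that
  by (simp add: w_def power_mult_distrib)

definition N0 :: real where "N0 = 1 / sqrt (2 * pi * a)"

text \<open>With \<open>q = exp (2 \<pi> i z)\<close>, the Gaussian is \<open>N0\<close> times the
  sum of all \<open>q^m * block m z\<close> and their reflections. Here \<open>q^m\<close> is
  replaced by \<open>(m + 1) - m / q\<close>, the combination of 1 and \<open>1 / q\<close> that
  agrees with it to first order at \<open>q = 1\<close>: values and slopes at the integers survive,
  while the frequencies of every slice are folded into \<open>[- 2 \<pi>, 2 \<pi>]\<close>.\<close>

definition K_term :: "nat \<Rightarrow> complex \<Rightarrow> complex" where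
  "K_term m z = block m z * (of_nat (Suc m) - of_nat m * exp (- (2 * of_real pi * \<i> * z)))
     + block m (- z) * (of_nat (Suc m) - of_nat m * exp (2 * of_real pi * \<i> * z))"

text \<open>A slice grows only in the lower half-plane and the folding factor only in the upper one,
  so the product still has type 2\<pi>.\<close>

lemma half_term_bound:
  "cmod (block m z * (of_nat (Suc m) - of_nat m * exp (- (2 * of_real pi * \<i> * z))))
    \<le> 2 * pi * (2 * real m + 1) * w (2 * pi * real m) * exp (2 * pi * \<bar>Im z\<bar>)"
proof -
  define y where "y = Im z"
  have "cmod (of_nat (Suc m) - of_nat m * exp (- (2 * of_real pi * \<i> * z))) \<le> real (Suc m) + real m * exp (2 * pi * y)"
    by (rule order_trans[OF norm_triangle_ineq4]) (simp add: norm_mult y_def del: of_nat_Suc)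
  also have "\<dots> \<le> (2 * real m + 1) * exp (2 * pi * max 0 y)"
  proof -
    have "real (Suc m) * 1 \<le> real (Suc m) * exp (2 * pi * max 0 y)" by (intro mult_left_mono) auto
    moreover have "real m * exp (2 * pi * y) \<le> real m * exp (2 * pi * max 0 y)" by (intro mult_left_mono) auto
    ultimately show ?thesis by (simp add: algebra_simps)
  qed
  finally have "cmod (block m z) * cmod (of_nat (Suc m) - of_nat m * exp (- (2 * of_real pi * \<i> * z)))
     \<le> (2 * pi * w (2 * pi * real m) * exp (2 * pi * max 0 (- y))) * ((2 * real m + 1) * exp (2 * pi * max 0 y))"
    using block_bound[of m z] w_pos[of "2 * pi * real m"] by (intro mult_mono) (auto simp: y_def)
  also have "\<dots> = 2 * pi * (2 * real m + 1) * w (2 * pi * real m) * (exp (2 * pi * max 0 (- y)) * exp (2 * pi * max 0 y))"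
    by (simp only: mult_ac)
  also have "exp (2 * pi * max 0 (- y)) * exp (2 * pi * max 0 y) = exp (2 * pi * \<bar>y\<bar>)"
    by (auto simp: exp_add[symmetric] max_def)
  finally show ?thesis by (simp add: norm_mult y_def)
qed

lemma K_term_bound: "cmod (K_term m z) \<le> 4 * pi * (2 * real m + 1) * w (2 * pi * real m) * exp (2 * pi * \<bar>Im z\<bar>)"
proof -
  have "cmod (K_term m z) \<le> 2 * pi * (2 * real m + 1) * w (2 * pi * real m) * exp (2 * pi * \<bar>Im z\<bar>)
    + 2 * pi * (2 * real m + 1) * w (2 * pi * real m) * exp (2 * pi * \<bar>Im z\<bar>)"
    unfolding K_term_def using half_term_bound[of m z] half_term_bound[of m "- z"]
    by (intro order_trans[OF norm_triangle_ineq] add_mono) auto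
  then show ?thesis by simp
qed

lemma summable_K_bound: "summable (\<lambda>m. 4 * pi * (2 * real m + 1) * w (2 * pi * real m))"
proof -
  have "summable (\<lambda>m. (8 * pi) * (real m ^ 1 * w (2 * pi * real m)) + (4 * pi) * (real m ^ 0 * w (2 * pi * real m)))"
    by (intro summable_add summable_mult summable_w) auto
  then show ?thesis by (rule summable_cong[THEN iffD1, rotated]) (simp add: algebra_simps)
qed

definition K :: "complex \<Rightarrow> complex" where "K z = of_real N0 * (\<Sum>m. K_term m z)"

lemma summable_K_term: "summable (\<lambda>m. K_term m z)"
proof (rule summable_comparison_test)
  show "summable (\<lambda>m. (4 * pi * (2 * real m + 1) * w (2 * pi * real m)) * exp (2 * pi * \<bar>Im z\<bar>))"
    by (intro summable_mult2 summable_K_bound)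
qed (use K_term_bound in blast)

lemma K_properties:
  shows "K holomorphic_on UNIV" "\<exists>C. \<forall>z. cmod (K z) \<le> C * exp (2 * pi * \<bar>Im z\<bar>)"
proof -
  define C where "C = (\<Sum>m. 4 * pi * (2 * real m + 1) * w (2 * pi * real m))"
  have sum_le: "(\<Sum>m<N. cmod (K_term m z)) \<le> C * exp (2 * pi * \<bar>Im z\<bar>)" for N z
  proof -
    have "(\<Sum>m<N. cmod (K_term m z)) \<le> (\<Sum>m<N. (4 * pi * (2 * real m + 1) * w (2 * pi * real m)) * exp (2 * pi * \<bar>Im z\<bar>))"
      by (intro sum_mono K_term_bound)
    also have "\<dots> = (\<Sum>m<N. 4 * pi * (2 * real m + 1) * w (2 * pi * real m)) * exp (2 * pi * \<bar>Im z\<bar>)"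
      by (rule sum_distrib_right[symmetric])
    also have "\<dots> \<le> C * exp (2 * pi * \<bar>Im z\<bar>)" unfolding C_def
      by (intro mult_right_mono sum_le_suminf summable_K_bound) (auto intro!: mult_nonneg_nonneg less_imp_le[OF w_pos])
    finally show ?thesis .
  qed
  have bd: "cmod (\<Sum>m<N. K_term m z) \<le> C * exp (2 * pi * \<bar>Im z\<bar>)" for N z
    by (rule order_trans[OF norm_sum sum_le])
  have lim: "(\<lambda>N. \<Sum>m<N. K_term m z) \<longlonglongrightarrow> (\<Sum>m. K_term m z)" for z
    by (rule summable_LIMSEQ[OF summable_K_term])
  have hol: "(\<lambda>z. \<Sum>m<N. K_term m z) holomorphic_on UNIV" for N
    unfolding K_term_def using entire_affine[OF holomorphic_block, where a = "-1" and b = 0]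
    by (intro holomorphic_intros holomorphic_block) auto
  have "(\<lambda>z. \<Sum>m. K_term m z) holomorphic_on UNIV"
    by (rule entire_bounded_limit(1)[OF hol lim bd])
  then show "K holomorphic_on UNIV" unfolding K_def[abs_def] by (intro holomorphic_intros)
  have "cmod (\<Sum>m. K_term m z) \<le> C * exp (2 * pi * \<bar>Im z\<bar>)" for z
    by (rule LIMSEQ_le_const2[OF tendsto_norm[OF lim]]) (use bd in auto)
  then have "cmod (K z) \<le> (\<bar>N0\<bar> * C) * exp (2 * pi * \<bar>Im z\<bar>)" for z
    unfolding K_def norm_mult norm_of_real mult.assoc by (intro mult_left_mono) auto
  then show "\<exists>C. \<forall>z. cmod (K z) \<le> C * exp (2 * pi * \<bar>Im z\<bar>)" by blast
qed

definition defect :: "real \<Rightarrow> real" where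
  "defect x = 8 * pi\<^sup>2 * N0 * (\<Sum>m. real m * Re (w_tail m x))"

lemma summable_defect: "summable (\<lambda>m. real m * w (2 * pi * real m))"
  using summable_w[of 1] by simp

text \<open>Summation by parts: a slice is \<open>w_tail m - q * w_tail (m + 1)\<close>, which
  collects the coefficient \<open>- m (q - 2 + 1 / q)\<close> at each tail with
  \<open>m \<ge> 1\<close>. As \<open>q - 2 + 1 / q = - 4 sin^2 (\<pi> x)\<close>, this is the
  source of the squared sine in front of \<open>defect\<close>.\<close>

lemma half_sum:
  fixes x :: real
  defines "q \<equiv> iexp (2 * pi * x)"
  shows "(\<Sum>m\<le>M. block m (of_real x) * (of_nat (Suc m) - of_nat m * inverse q)) =
    - (q - 2 + inverse q) * (\<Sum>m\<le>M. of_nat m * w_tail m x) + w_tail 0 x + (of_nat M - of_nat (Suc M) * q) * w_tail (Suc M) x"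
proof (induction M)
  case 0 show ?case by (simp add: block_real q_def)
next
  case (Suc M)
  have q: "q * inverse q = 1" by (simp add: q_def)
  have "(\<Sum>m\<le>Suc M. block m (of_real x) * (of_nat (Suc m) - of_nat m * inverse q)) =
    - (q - 2 + inverse q) * (\<Sum>m\<le>M. of_nat m * w_tail m x) + w_tail 0 x + (of_nat M - of_nat (Suc M) * q) * w_tail (Suc M) x
    + (w_tail (Suc M) x - q * w_tail (Suc (Suc M)) x) * (of_nat (Suc (Suc M)) - of_nat (Suc M) * inverse q)"
    by (simp only: sum.atMost_Suc Suc.IH) (simp only: block_real[of "Suc M" x, folded q_def])
  also have "(w_tail (Suc M) x - q * w_tail (Suc (Suc M)) x) * (of_nat (Suc (Suc M)) - of_nat (Suc M) * inverse q)
    = w_tail (Suc M) x * (of_nat (Suc (Suc M)) - of_nat (Suc M) * inverse q) - of_nat (Suc (Suc M)) * q * w_tail (Suc (Suc M)) x + of_nat (Suc M) * (q * inverse q) * w_tail (Suc (Suc M)) x"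
    by (simp only: ring_distribs mult_ac) simp
  finally show ?case unfolding q by (simp add: algebra_simps)
qed

lemma K_real: "K (of_real x) = of_real (exp (- (a * x\<^sup>2 / 2)) + (sin (pi * x))\<^sup>2 / pi\<^sup>2 * defect x)"
proof -
  define q where "q = iexp (2 * pi * x)"
  have iq: "inverse q = iexp (2 * pi * (- x))" unfolding q_def exp_minus[symmetric] by simp
  have "q + inverse q = 2 * of_real (cos (2 * pi * x))"
    unfolding q_def exp_minus[symmetric] cos_of_real[symmetric] cos_exp_eq by simp
  also have "cos (2 * pi * x) = 1 - 2 * (sin (pi * x))\<^sup>2" using cos_double_sin[of "pi * x"] by (simp add: mult.assoc)
  finally have q2: "q - 2 + inverse q = - 4 * of_real ((sin (pi * x))\<^sup>2)" by (simp add: algebra_simps)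
  have iq2: "inverse q - 2 + inverse (inverse q) = - 4 * of_real ((sin (pi * x))\<^sup>2)" using q2 by (simp add: algebra_simps)
  have cnj_tail: "w_tail m (- x) = cnj (w_tail m x)" for m
    unfolding w_tail_def Bochner_Integration.integral_cnj[symmetric]
    by (intro Bochner_Integration.integral_cong refl) (simp add: exp_cnj)
  have two_re: "w_tail m x + w_tail m (- x) = of_real (2 * Re (w_tail m x))" for m
    unfolding cnj_tail complex_add_cnj by simp
  define rem where "rem = (\<lambda>M. (of_nat M - of_nat (Suc M) * q) * w_tail (Suc M) x + (of_nat M - of_nat (Suc M) * inverse q) * w_tail (Suc M) (- x))"
  have part: "(\<Sum>m\<le>M. K_term m (of_real x)) = of_real (8 * (sin (pi * x))\<^sup>2 * (\<Sum>m\<le>M. real m * Re (w_tail m x)))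
      + (w_tail 0 x + w_tail 0 (- x)) + rem M" for M
  proof -
    have e: "exp (- (2 * of_real pi * \<i> * of_real x)) = inverse q" "exp (2 * of_real pi * \<i> * of_real x) = inverse (inverse q)"
      unfolding q_def by (simp_all add: exp_minus mult_ac)
    have "(\<Sum>m\<le>M. K_term m (of_real x)) = (\<Sum>m\<le>M. block m (of_real x) * (of_nat (Suc m) - of_nat m * inverse q))
      + (\<Sum>m\<le>M. block m (of_real (- x)) * (of_nat (Suc m) - of_nat m * inverse (inverse q)))"
      unfolding K_term_def e by (simp add: sum.distrib)
    also have "\<dots> = 4 * of_real ((sin (pi * x))\<^sup>2) * (\<Sum>m\<le>M. of_nat m * (w_tail m x + w_tail m (- x))) + (w_tail 0 x + w_tail 0 (- x)) + rem M"
      unfolding half_sum[of x M, folded q_def] half_sum[of "- x" M, folded iq] q2 iq2 rem_def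
      by (simp add: sum.distrib algebra_simps)
    also have "(\<Sum>m\<le>M. of_nat m * (w_tail m x + w_tail m (- x))) = of_real (2 * (\<Sum>m\<le>M. real m * Re (w_tail m x)))"
      unfolding two_re by (simp add: sum_distrib_left mult_ac)
    finally show ?thesis by simp
  qed
  have rem0: "rem \<longlonglongrightarrow> 0"
  proof (rule Lim_null_comparison)
    have "(\<lambda>M. real (Suc M) * w (2 * pi * real (Suc M))) \<longlonglongrightarrow> 0"
      using LIMSEQ_Suc[OF summable_LIMSEQ_zero[OF summable_defect]] by simp
    then show "(\<lambda>M. 4 * w_mass * (real (Suc M) * w (2 * pi * real (Suc M)))) \<longlonglongrightarrow> 0" by (rule tendsto_mult_right_zero)
    have nq: "cmod q = 1" "cmod (inverse q) = 1" by (simp_all add: q_def norm_inverse)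
    have c: "cmod (of_nat M - of_nat (Suc M) * p) \<le> 2 * real (Suc M)" if "cmod p = 1" for p M
    proof -
      have "cmod (of_nat M - of_nat (Suc M) * p) \<le> real M + real (Suc M)"
        using norm_triangle_ineq4[of "of_nat M" "of_nat (Suc M) * p"] that by (simp add: norm_mult del: of_nat_Suc)
      then show ?thesis by simp
    qed
    have each: "cmod ((of_nat M - of_nat (Suc M) * p) * w_tail (Suc M) v) \<le> 2 * real (Suc M) * (w (2 * pi * real (Suc M)) * w_mass)"
      if "cmod p = 1" for p M v
      unfolding norm_mult by (intro mult_mono c that w_tail_bound) auto
    show "\<forall>\<^sub>F M in sequentially. norm (rem M) \<le> 4 * w_mass * (real (Suc M) * w (2 * pi * real (Suc M)))"
    proof (intro always_eventually allI)
      fix M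
      have "norm (rem M) \<le> 2 * real (Suc M) * (w (2 * pi * real (Suc M)) * w_mass) + 2 * real (Suc M) * (w (2 * pi * real (Suc M)) * w_mass)"
        unfolding rem_def by (intro order_trans[OF norm_triangle_ineq] add_mono each nq)
      then show "norm (rem M) \<le> 4 * w_mass * (real (Suc M) * w (2 * pi * real (Suc M)))" by (simp only: mult_ac)
    qed
  qed
  have sD: "summable (\<lambda>m. real m * Re (w_tail m x))"
  proof (rule summable_comparison_test)
    show "summable (\<lambda>m. (real m * w (2 * pi * real m)) * w_mass)" by (intro summable_mult2 summable_defect)
    have "norm (real m * Re (w_tail m x)) \<le> (real m * w (2 * pi * real m)) * w_mass" for m
      using order_trans[OF abs_Re_le_cmod w_tail_bound[of m x]] by (simp add: abs_mult mult_left_mono mult.assoc)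
    then show "\<exists>N. \<forall>m\<ge>N. norm (real m * Re (w_tail m x)) \<le> (real m * w (2 * pi * real m)) * w_mass" by blast
  qed
  have "(\<lambda>M. \<Sum>m\<le>M. K_term m (of_real x)) \<longlonglongrightarrow> of_real (8 * (sin (pi * x))\<^sup>2 * (\<Sum>m. real m * Re (w_tail m x)))
      + (w_tail 0 x + w_tail 0 (- x)) + 0"
    unfolding part by (intro tendsto_intros rem0 summable_LIMSEQ' sD)
  moreover have "(\<lambda>M. \<Sum>m\<le>M. K_term m (of_real x)) \<longlonglongrightarrow> (\<Sum>m. K_term m (of_real x))"
    by (rule summable_LIMSEQ'[OF summable_K_term])
  ultimately have "(\<Sum>m. K_term m (of_real x)) = of_real (8 * (sin (pi * x))\<^sup>2 * (\<Sum>m. real m * Re (w_tail m x)))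
      + (w_tail 0 x + w_tail 0 (- x)) + 0"
    by (rule LIMSEQ_unique[rotated])
  then have "K (of_real x) = of_real (N0 * (8 * (sin (pi * x))\<^sup>2 * (\<Sum>m. real m * Re (w_tail m x)) + sqrt (2 * pi * a) * exp (- (a * x\<^sup>2 / 2))))"
    unfolding K_def w_tail_0_sum by simp
  also have "N0 * (8 * (sin (pi * x))\<^sup>2 * (\<Sum>m. real m * Re (w_tail m x)) + sqrt (2 * pi * a) * exp (- (a * x\<^sup>2 / 2)))
    = exp (- (a * x\<^sup>2 / 2)) + (sin (pi * x))\<^sup>2 / pi\<^sup>2 * defect x"
    using a unfolding defect_def N0_def by (simp add: field_simps)
  finally show ?thesis .
qed

end

section \<open>Sign and size of the defect\<close>

lemma gaussian_cube_bound:
  fixes u v :: real assumes "3/2 \<le> v" "v \<le> u"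
  shows "u ^ 3 * exp (- 2 * u) \<le> v ^ 3 * exp (- 2 * v)"
proof -
  have "u / v = 1 + (u - v) / v" using assms by (simp add: field_simps)
  also have "\<dots> \<le> exp ((u - v) / v)" by (rule exp_ge_add_one_self)
  also have "(u - v) / v \<le> (u - v) / (3/2)" using assms by (intro divide_left_mono) auto
  also have "(u - v) / (3/2) = 2 * (u - v) / 3" by simp
  finally have "u / v \<le> exp (2 * (u - v) / 3)" by simp
  then have "(u / v) ^ 3 \<le> exp (2 * (u - v) / 3) ^ 3" using assms by (intro power_mono) auto
  also have "exp (2 * (u - v) / 3) ^ 3 = exp (2 * (u - v))" unfolding exp_of_nat_mult[symmetric] by simp
  also have "\<dots> = exp (2 * u) * exp (- 2 * v)" by (simp add: exp_add[symmetric])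
  finally have "u ^ 3 \<le> v ^ 3 * (exp (2 * u) * exp (- 2 * v))" using assms by (simp add: power_divide field_simps)
  then have "u ^ 3 * exp (- 2 * u) \<le> v ^ 3 * (exp (2 * u) * exp (- 2 * v)) * exp (- 2 * u)"
    by (rule mult_right_mono) simp
  also have "\<dots> = v ^ 3 * exp (- 2 * v) * (exp (2 * u) * exp (- 2 * u))" by (simp only: mult_ac)
  also have "exp (2 * u) * exp (- 2 * u) = 1" by (simp add: exp_add[symmetric])
  finally show ?thesis by simp
qed

lemma pi_square_bounds: "pi\<^sup>2 \<ge> 98/10" "pi\<^sup>2 \<le> 9873/1000" "pi \<ge> 3141/1000" "pi \<le> 31417/10000"
proof -
  show p: "pi \<ge> 3141/1000" "pi \<le> 31417/10000" using pi_approx by simp_all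
  show "pi\<^sup>2 \<ge> 98/10" using power_mono[OF p(1), of 2] by (simp add: power2_eq_square)
  show "pi\<^sup>2 \<le> 9873/1000" using power_mono[OF p(2), of 2] by (simp add: power2_eq_square)
qed

context gaussian
begin

text \<open>Two integrations by parts, using that the kernel is convex beyond \<open>sqrt a\<close>.\<close>

lemma w_tail_Re_bounds:
  assumes m: "a \<le> (2 * pi * real m)\<^sup>2" and x: "x \<noteq> 0"
  shows "0 \<le> Re (w_tail m x)" "Re (w_tail m x) \<le> 4 * pi * real m / a * w (2 * pi * real m) / x\<^sup>2"
proof -
  define b where "b = 2 * pi * real m"
  have b: "b \<ge> 0" "a \<le> b\<^sup>2" using m by (auto simp: b_def)
  define k where "k = (\<lambda>s. w (s + b))"
  define k1 where "k1 = (\<lambda>s. - ((s + b) / a) * k s)"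
  define k2 where "k2 = (\<lambda>s. (((s + b) / a)\<^sup>2 - 1 / a) * k s)"
  define h where "h = (\<lambda>s. k2 s * (1 - cos (s * x)) / x\<^sup>2)"
  define p where "p = (\<lambda>s. k s * cos (s * x) - h s)"
  \<comment> \<open>The boundary terms of the two integrations by parts. \<open>P\<close> vanishes
    at 0 and at infinity, so its derivative \<open>p\<close> integrates to 0; what is left is the
    integral of \<open>h\<close>, nonnegative because \<open>k2 \<ge> 0\<close> past the inflection
    point.\<close>
  define P where "P = (\<lambda>s. k s * sin (s * x) / x + k1 s * (cos (s * x) - 1) / x\<^sup>2)"
  have dk: "(k has_real_derivative k1 s) (at s)" for s
    unfolding k1_def k_def w_def using a by (auto intro!: derivative_eq_intros simp: field_simps)
  have dk1: "(k1 has_real_derivative k2 s) (at s)" for s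
  proof -
    have "((\<lambda>s. - ((s + b) / a)) has_real_derivative - (1 / a)) (at s)" using a by (auto intro!: derivative_eq_intros)
    from DERIV_mult[OF this dk[of s]] have "(k1 has_real_derivative (- (1 / a) * k s + k1 s * - ((s + b) / a))) (at s)"
      by (simp only: k1_def)
    also have "- (1 / a) * k s + k1 s * - ((s + b) / a) = k2 s"
    proof -
      have "- (1 / a) * v + - q * v * - q = (q\<^sup>2 - 1 / a) * v" for q v :: real by (simp add: algebra_simps power2_eq_square)
      then show ?thesis unfolding k1_def k2_def .
    qed
    finally show ?thesis .
  qed
  have dP: "(P has_real_derivative p s) (at s)" for s
  proof -
    have "(P has_real_derivative ((k1 s * sin (s * x) + k s * (cos (s * x) * x)) / x + (k2 s * (cos (s * x) - 1) + k1 s * (- sin (s * x) * x)) / x\<^sup>2)) (at s)"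
      unfolding P_def using x by (auto intro!: derivative_eq_intros dk dk1 simp: mult_ac) (simp add: field_simps eval_nat_numeral)
    also have "(k1 s * sin (s * x) + k s * (cos (s * x) * x)) / x + (k2 s * (cos (s * x) - 1) + k1 s * (- sin (s * x) * x)) / x\<^sup>2 = p s"
      using x by (simp add: p_def h_def power2_eq_square field_simps)
    finally show ?thesis .
  qed
  have k2_nonneg: "k2 s \<ge> 0" if "s \<ge> 0" for s
  proof -
    have "a \<le> (s + b)\<^sup>2" using b that power_mono[of b "s + b" 2] by linarith
    then have "1 / a \<le> ((s + b) / a)\<^sup>2" using a by (simp add: power_divide field_simps power2_eq_square)
    then show ?thesis unfolding k2_def k_def using w_pos[of "s + b"] by simp
  qed
  have lk: "(k \<longlongrightarrow> 0) at_top" "(k1 \<longlongrightarrow> 0) at_top"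
    unfolding k1_def k_def w_def using a by real_asymp+
  have mk: "k \<in> borel_measurable borel" "k1 \<in> borel_measurable borel" "k2 \<in> borel_measurable borel"
    unfolding k_def k1_def k2_def by measurable
  note [measurable] = mk
  have bk2: "has_bochner_integral lborel (\<lambda>s. indicator {0..} s * k2 s) (- k1 0)"
  proof (rule has_bochner_integral_nn_integral)
    show "- k1 0 \<ge> 0" using b a by (simp add: k1_def k_def less_imp_le[OF w_pos])
    have "(\<integral>\<^sup>+s. ennreal (k2 s) * indicator {0..} s \<partial>lborel) = ennreal (0 - k1 0)"
      by (rule nn_integral_FTC_atLeast[OF _ dk1 k2_nonneg lk(2)]) auto
    then show "(\<integral>\<^sup>+s. ennreal (indicator {0..} s * k2 s) \<partial>lborel) = ennreal (- k1 0)"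
      by (simp add: indicator_mult_ennreal mult.commute[of "indicator _ _ :: real"] ennreal_mult'' ennreal_indicator)
  qed (auto simp: indicator_def k2_nonneg)
  have ik2: "integrable lborel (\<lambda>s. indicator {0..} s * k2 s)" using bk2 by (simp add: has_bochner_integral_iff)
  have hb: "0 \<le> h s \<and> h s \<le> (2 / x\<^sup>2) * k2 s" if "s \<ge> 0" for s
  proof -
    have "k2 s * (1 - cos (s * x)) \<le> k2 s * 2" using k2_nonneg[OF that] cos_ge_minus_one[of "s * x"] by (intro mult_left_mono) linarith+
    then have "h s \<le> k2 s * 2 / x\<^sup>2" unfolding h_def by (intro divide_right_mono) auto
    moreover have "0 \<le> h s" unfolding h_def using k2_nonneg[OF that] by auto
    ultimately show ?thesis by (simp add: mult.commute)
  qed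
  have ih: "integrable lborel (\<lambda>s. indicator {0..} s * h s)"
  proof (rule Bochner_Integration.integrable_bound[OF integrable_mult_right[OF ik2, of "2 / x\<^sup>2"]])
    show "AE s in lborel. norm (indicator {0..} s * h s) \<le> norm (2 / x\<^sup>2 * (indicator {0..} s * k2 s))"
    proof (rule AE_I2)
      fix s :: real
      show "norm (indicator {0..} s * h s) \<le> norm (2 / x\<^sup>2 * (indicator {0..} s * k2 s))"
      proof (cases "s \<ge> 0")
        case True then show ?thesis using hb[OF True] k2_nonneg[OF True] by simp
      qed simp
    qed
  qed (simp add: h_def)
  have re: "Re (indicator {0..} s *\<^sub>R (of_real (w (s + 2 * pi * real m)) * iexp (s * x))) = indicator {0..} s * (k s * cos (s * x))" for s
    by (simp add: k_def b_def Re_exp)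
  have ic: "integrable lborel (\<lambda>s. indicator {0..} s * (k s * cos (s * x)))"
    using integrable_Re[OF integrable_w_tail[of "2 * pi * real m" x]] unfolding re by simp
  have Re_eq: "Re (w_tail m x) = (\<integral>s. indicator {0..} s * (k s * cos (s * x)) \<partial>lborel)"
    unfolding w_tail_def re[symmetric] by (rule integral_Re[symmetric], rule integrable_w_tail) simp
  have ip: "integrable lborel (\<lambda>s. indicator {0..} s * p s)"
    using Bochner_Integration.integrable_diff[OF ic ih] by (simp add: p_def right_diff_distrib)
  have "(\<integral>s. indicator {0..} s * p s \<partial>lborel) = (\<integral>s. indicator {0<..} s *\<^sub>R p s \<partial>lborel)"
  proof (rule integral_cong_AE)
    show "AE s in lborel. indicator {0..} s * p s = indicator {0<..} s *\<^sub>R p s"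
      using AE_lborel_singleton[of 0] by eventually_elim (auto simp: indicator_def)
  qed (auto simp: p_def h_def)
  also have "\<dots> = (LBINT s=ereal 0..\<infinity>. p s)"
    unfolding interval_integral_to_infinity_eq set_lebesgue_integral_def ..
  also have "\<dots> = 0 - 0"
  proof (rule interval_integral_FTC_integrable[where F = P])
    show "(P has_vector_derivative p s) (at s)" for s using dP by (simp add: has_real_derivative_iff_has_vector_derivative)
    show "isCont p s" for s
      unfolding p_def h_def k2_def using DERIV_isCont[OF dk, of s] x a by (intro continuous_intros) auto
    have "integrable lborel (\<lambda>s. indicator {0<..} s *\<^sub>R p s)"
      by (rule Bochner_Integration.integrable_bound[OF ip]) (auto simp: indicator_def p_def h_def)
    then show "set_integrable lborel (einterval (ereal 0) \<infinity>) p" unfolding set_integrable_def einterval_eq .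
    have "isCont P 0" by (rule DERIV_isCont[OF dP])
    then have "(P \<longlongrightarrow> P 0) (at_right 0)" by (simp add: continuous_at_imp_continuous_at_within isCont_def filterlim_at_split)
    then show "((P \<circ> real_of_ereal) \<longlongrightarrow> 0) (at_right (ereal 0))" unfolding ereal_tendsto_simps by (simp add: P_def)
    have "(P \<longlongrightarrow> 0) at_top"
    proof (rule Lim_null_comparison)
      have "((\<lambda>s. \<bar>k s\<bar> / \<bar>x\<bar> + 2 * \<bar>k1 s\<bar> / x\<^sup>2) \<longlongrightarrow> \<bar>0\<bar> / \<bar>x\<bar> + 2 * \<bar>0\<bar> / x\<^sup>2) at_top"
        using x by (intro tendsto_intros lk) auto
      then show "((\<lambda>s. \<bar>k s\<bar> / \<bar>x\<bar> + 2 * \<bar>k1 s\<bar> / x\<^sup>2) \<longlongrightarrow> 0) at_top" by simp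
      show "\<forall>\<^sub>F s in at_top. norm (P s) \<le> \<bar>k s\<bar> / \<bar>x\<bar> + 2 * \<bar>k1 s\<bar> / x\<^sup>2"
      proof (intro always_eventually allI)
        fix s
        have "\<bar>k s * sin (s * x)\<bar> \<le> \<bar>k s\<bar> * 1" unfolding abs_mult by (intro mult_left_mono abs_sin_le_one) auto
        then have 1: "\<bar>k s * sin (s * x) / x\<bar> \<le> \<bar>k s\<bar> / \<bar>x\<bar>" by (simp add: divide_right_mono)
        have "\<bar>cos (s * x) - 1\<bar> \<le> 2" using cos_ge_minus_one[of "s * x"] cos_le_one[of "s * x"] by linarith
        then have "\<bar>k1 s * (cos (s * x) - 1)\<bar> \<le> \<bar>k1 s\<bar> * 2" unfolding abs_mult by (intro mult_left_mono) auto
        then have 2: "\<bar>k1 s * (cos (s * x) - 1) / x\<^sup>2\<bar> \<le> 2 * \<bar>k1 s\<bar> / x\<^sup>2" by (simp add: divide_right_mono mult.commute)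
        show "norm (P s) \<le> \<bar>k s\<bar> / \<bar>x\<bar> + 2 * \<bar>k1 s\<bar> / x\<^sup>2" unfolding P_def real_norm_def using 1 2 by linarith
      qed
    qed
    then show "((P \<circ> real_of_ereal) \<longlongrightarrow> 0) (at_left \<infinity>)" unfolding ereal_tendsto_simps .
  qed auto
  finally have p0: "(\<integral>s. indicator {0..} s * p s \<partial>lborel) = 0" by simp
  have "Re (w_tail m x) = (\<integral>s. indicator {0..} s * p s + indicator {0..} s * h s \<partial>lborel)"
    unfolding Re_eq by (intro Bochner_Integration.integral_cong refl) (simp add: p_def algebra_simps)
  also have "\<dots> = (\<integral>s. indicator {0..} s * h s \<partial>lborel)"
    unfolding Bochner_Integration.integral_add[OF ip ih] p0 by simp
  finally have main: "Re (w_tail m x) = (\<integral>s. indicator {0..} s * h s \<partial>lborel)" .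
  show "0 \<le> Re (w_tail m x)" unfolding main by (intro Bochner_Integration.integral_nonneg) (auto simp: indicator_def hb)
  have "Re (w_tail m x) \<le> (\<integral>s. (2 / x\<^sup>2) * (indicator {0..} s * k2 s) \<partial>lborel)"
    unfolding main using hb by (intro integral_mono ih integrable_mult_right ik2) (auto simp: indicator_def)
  also have "\<dots> = (2 / x\<^sup>2) * (- k1 0)" unfolding integral_mult_right_zero has_bochner_integral_integral_eq[OF bk2] ..
  also have "\<dots> = 4 * pi * real m / a * w (2 * pi * real m) / x\<^sup>2" by (simp add: k1_def k_def b_def field_simps)
  finally show "Re (w_tail m x) \<le> 4 * pi * real m / a * w (2 * pi * real m) / x\<^sup>2" .
qed

lemma summable_defect_terms: "summable (\<lambda>m. real m * Re (w_tail m x))"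
proof (rule summable_comparison_test)
  show "summable (\<lambda>m. (real m * w (2 * pi * real m)) * w_mass)" by (intro summable_mult2 summable_defect)
  have "norm (real m * Re (w_tail m x)) \<le> (real m * w (2 * pi * real m)) * w_mass" for m
    using order_trans[OF abs_Re_le_cmod w_tail_bound[of m x]] by (simp add: abs_mult mult_left_mono mult.assoc)
  then show "\<exists>N. \<forall>m\<ge>N. norm (real m * Re (w_tail m x)) \<le> (real m * w (2 * pi * real m)) * w_mass" by blast
qed

lemma abs_defect_le: "\<exists>C. \<forall>x. \<bar>defect x\<bar> \<le> C"
proof -
  have "\<bar>defect x\<bar> \<le> 8 * pi\<^sup>2 * N0 * (\<Sum>m. (real m * w (2 * pi * real m)) * w_mass)" for x
  proof -
    have b: "norm (real m * Re (w_tail m x)) \<le> (real m * w (2 * pi * real m)) * w_mass" for m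
      using order_trans[OF abs_Re_le_cmod w_tail_bound[of m x]] by (simp add: abs_mult mult_left_mono mult.assoc)
    have s: "summable (\<lambda>m. (real m * w (2 * pi * real m)) * w_mass)" by (intro summable_mult2 summable_defect)
    have "norm (\<Sum>m. real m * Re (w_tail m x)) \<le> (\<Sum>m. (real m * w (2 * pi * real m)) * w_mass)"
      by (rule norm_suminf_le[OF b s])
    then show ?thesis unfolding defect_def abs_mult using a by (simp add: N0_def divide_right_mono mult_left_mono)
  qed
  then show ?thesis by blast
qed

text \<open>\<open>36 < (2 \<pi>)^2\<close>, so the inflection point \<open>sqrt a\<close> of the
  spectral Gaussian lies below every frequency \<open>2 \<pi> m\<close> with
  \<open>m \<ge> 1\<close> and each such tail is the cosine transform of a convex function. The tail
  \<open>m = 0\<close> carries the weight 0.\<close>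

lemma defect_bounds:
  assumes a36: "a \<le> 36" and x: "x \<noteq> 0"
  shows "0 \<le> defect x" "x\<^sup>2 * defect x \<le> 32 * pi ^ 3 * N0 / a * (\<Sum>m. (real m)\<^sup>2 * w (2 * pi * real m))"
proof -
  have N0: "N0 > 0" using a by (simp add: N0_def)
  have am: "a \<le> (2 * pi * real m)\<^sup>2" if "m \<ge> 1" for m
  proof -
    have "6 * 1 \<le> 2 * pi * real m" using that pi_gt3 by (intro mult_mono) auto
    then have "6\<^sup>2 \<le> (2 * pi * real m)\<^sup>2" by (intro power_mono) auto
    then show ?thesis using a36 by simp
  qed
  have nn: "0 \<le> real m * Re (w_tail m x)" for m
    using w_tail_Re_bounds(1)[OF am x, of m] by (cases "m = 0") auto
  show "0 \<le> defect x" unfolding defect_def using N0 suminf_nonneg[OF summable_defect_terms nn] by simp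
  have le: "real m * Re (w_tail m x) \<le> (4 * pi / a / x\<^sup>2) * ((real m)\<^sup>2 * w (2 * pi * real m))" for m
  proof (cases "m = 0")
    case False
    then have "real m * Re (w_tail m x) \<le> real m * (4 * pi * real m / a * w (2 * pi * real m) / x\<^sup>2)"
      by (intro mult_left_mono w_tail_Re_bounds(2)[OF am x]) auto
    also have "\<dots> = (4 * pi / a / x\<^sup>2) * ((real m)\<^sup>2 * w (2 * pi * real m))" by (simp add: power2_eq_square)
    finally show ?thesis .
  qed simp
  have s2: "summable (\<lambda>m. (real m)\<^sup>2 * w (2 * pi * real m))" using summable_w[of 2] by simp
  have "(\<Sum>m. real m * Re (w_tail m x)) \<le> (\<Sum>m. (4 * pi / a / x\<^sup>2) * ((real m)\<^sup>2 * w (2 * pi * real m)))"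
    by (intro suminf_le le summable_defect_terms summable_mult s2)
  also have "\<dots> = (4 * pi / a / x\<^sup>2) * (\<Sum>m. (real m)\<^sup>2 * w (2 * pi * real m))" by (rule suminf_mult[OF s2])
  finally have "defect x \<le> 8 * pi\<^sup>2 * N0 * ((4 * pi / a / x\<^sup>2) * (\<Sum>m. (real m)\<^sup>2 * w (2 * pi * real m)))"
    unfolding defect_def using N0 by (intro mult_left_mono) auto
  then have "x\<^sup>2 * defect x \<le> x\<^sup>2 * (8 * pi\<^sup>2 * N0 * ((4 * pi / a / x\<^sup>2) * (\<Sum>m. (real m)\<^sup>2 * w (2 * pi * real m))))"
    by (intro mult_left_mono) auto
  also have "\<dots> = 32 * pi ^ 3 * N0 / a * (\<Sum>m. (real m)\<^sup>2 * w (2 * pi * real m))"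
    using x a by (simp add: field_simps power2_eq_square power3_eq_cube)
  finally show "x\<^sup>2 * defect x \<le> 32 * pi ^ 3 * N0 / a * (\<Sum>m. (real m)\<^sup>2 * w (2 * pi * real m))" .
qed

text \<open>The term \<open>m = 1\<close> dominates: for \<open>a \<le> 4\<close> the rate
  \<open>2 \<pi>^2 / a\<close> is at least 9/2, and all the others together stay below a thousandth
  of it.\<close>

lemma defect_sum_le:
  assumes a4: "a \<le> 4"
  shows "(\<Sum>m. (real m)\<^sup>2 * w (2 * pi * real m)) \<le> 1001/1000 * exp (- (2 * pi\<^sup>2 / a))"
proof -
  define u where "u = 2 * pi\<^sup>2 / a"
  have "4 * (9/2) \<le> 2 * pi\<^sup>2" using pi_square_bounds by simp
  moreover have "a * (9/2) \<le> 4 * (9/2)" using a4 by simp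
  ultimately have u: "u \<ge> 9/2" unfolding u_def using a by (simp add: field_simps)
  have w: "w (2 * pi * real m) = exp (- (u * (real m)\<^sup>2))" for m
    by (simp add: w_def u_def power_mult_distrib)
  have s2: "summable (\<lambda>m. (real m)\<^sup>2 * w (2 * pi * real m))" using summable_w[of 2] by simp
  have tail: "(real m)\<^sup>2 * w (2 * pi * real m) \<le> (exp (- u) * exp (27/2)) * exp (- (23/2) * real m)" if "m \<ge> 2" for m
  proof -
    define r where "r = real m"
    have r: "r \<ge> 2" using that by (simp add: r_def)
    have "0 \<le> (r - 1) * (r - 2)" using r by simp
    then have r2: "3 * (r - 1) \<le> r\<^sup>2 - 1" by (simp add: algebra_simps power2_eq_square)
    have "(9/2) * (3 * (r - 1)) \<le> u * (r\<^sup>2 - 1)" using u r r2 by (intro mult_mono) auto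
    then have e: "exp (- (u * r\<^sup>2)) \<le> exp (- u + 27/2 - 27/2 * r)"
      unfolding exp_le_cancel_iff right_diff_distrib by linarith
    have "r \<le> exp r" using exp_ge_add_one_self[of r] by linarith
    then have "r\<^sup>2 \<le> (exp r)\<^sup>2" using r by (intro power_mono) auto
    also have "(exp r)\<^sup>2 = exp (2 * r)" by (simp add: exp_double)
    finally have "r\<^sup>2 * exp (- (u * r\<^sup>2)) \<le> exp (2 * r) * exp (- u + 27/2 - 27/2 * r)" using e by (intro mult_mono) auto
    also have "\<dots> = (exp (- u) * exp (27/2)) * exp (- (23/2) * r)" by (simp add: exp_add[symmetric])
    finally show ?thesis unfolding w r_def .
  qed
  have "(\<Sum>m. (real m)\<^sup>2 * w (2 * pi * real m)) \<le> (\<Sum>m<2. (real m)\<^sup>2 * w (2 * pi * real m))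
      + (exp (- u) * exp (27/2)) * exp (- (23/2) * real 2) / (1 - exp (- (23/2)))"
    by (rule suminf_le_geometric[OF s2 tail]) auto
  also have "(\<Sum>m<2. (real m)\<^sup>2 * w (2 * pi * real m)) = exp (- u)" by (simp add: numeral_2_eq_2 w[of 1, simplified])
  also have "(exp (- u) * exp (27/2)) * exp (- (23/2) * real 2) = exp (- u) * exp (- (19/2))" by (simp add: exp_add[symmetric])
  also have "exp (- u) + exp (- u) * exp (- (19/2)) / (1 - exp (- (23/2))) = exp (- u) * (1 + exp (- (19/2)) / (1 - exp (- (23/2))))"
    by (simp add: algebra_simps)
  also have "\<dots> \<le> exp (- u) * (1001/1000)"
  proof (intro mult_left_mono)
    have "exp (- (19/2)) \<le> exp (- 8 :: real)" "exp (- (23/2)) \<le> exp (- 8 :: real)" by simp_all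
    then have "exp (- (19/2)) \<le> (1/2000 :: real)" "exp (- (23/2)) \<le> (1/2000 :: real)" using exp_numeric(4) by linarith+
    then have "exp (- (19/2)) / (1 - exp (- (23/2))) \<le> (1/2000) / (1 - 1/2000 :: real)" by (intro frac_le) auto
    also have "\<dots> \<le> 1/1000" by simp
    finally have "exp (- (19/2)) / (1 - exp (- (23/2))) \<le> (1/1000 :: real)" .
    then show "1 + exp (- (19/2)) / (1 - exp (- (23/2))) \<le> (1001/1000 :: real)" by linarith
  qed simp
  finally show ?thesis by (simp add: u_def mult.commute)
qed

text \<open>Squaring removes the root in \<open>N0\<close>: with \<open>u = 2 \<pi>^2 / a\<close>
  the squared bound is a constant times \<open>u^3 exp (- 2 u)\<close>, decreasing beyond 3/2, so it
  can be evaluated at a rational \<open>v \<le> u\<close>. 196/10 lies below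
  \<open>2 \<pi>^2\<close>, and 41/2 above \<open>64 / \<pi>\<close> times the square of
  1001/1000.\<close>

lemma defect_le:
  assumes v: "3/2 \<le> v" "v * a \<le> 196/10" and c: "c \<ge> 0" "41/2 * (v ^ 3 * exp (- 2 * v)) \<le> c\<^sup>2" and a4: "a \<le> 4" and x: "x \<noteq> 0"
  shows "x\<^sup>2 * defect x \<le> c"
proof -
  define u where "u = 2 * pi\<^sup>2 / a"
  define W where "W = 32 * pi ^ 3 * N0 / a"
  have W: "W \<ge> 0" using a by (simp add: W_def N0_def)
  have "v * a \<le> 2 * pi\<^sup>2" using v pi_square_bounds(1) by linarith
  then have vu: "v \<le> u" unfolding u_def using a by (simp add: field_simps)
  have "W\<^sup>2 = 512 * pi ^ 5 / a ^ 3"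
  proof -
    have "N0\<^sup>2 = 1 / (2 * pi * a)" using a by (simp add: N0_def power_divide)
    then have "W\<^sup>2 = 1024 * (pi ^ 3)\<^sup>2 * (1 / (2 * pi * a)) / a\<^sup>2" unfolding W_def by (simp add: power_mult_distrib power_divide)
    also have "\<dots> = 512 * pi ^ 5 / a ^ 3" using a by (simp add: field_simps eval_nat_numeral)
    finally show ?thesis .
  qed
  also have "\<dots> = 64 * u ^ 3 / pi" unfolding u_def using a by (simp add: field_simps eval_nat_numeral)
  finally have W2: "W\<^sup>2 = 64 / pi * u ^ 3" by simp
  have "(W * (1001/1000 * exp (- u)))\<^sup>2 = (64 / pi * (1001/1000)\<^sup>2) * (u ^ 3 * exp (- 2 * u))"
    unfolding power_mult_distrib W2 by (simp add: exp_double[symmetric])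
  also have "\<dots> \<le> 41/2 * (v ^ 3 * exp (- 2 * v))"
  proof (rule mult_mono)
    have "64 / pi \<le> 64 / (3141/1000)" using pi_square_bounds(3) by (intro divide_left_mono) auto
    then have "64 / pi * (1001/1000)\<^sup>2 \<le> 64 / (3141/1000) * (1001/1000)\<^sup>2" by (rule mult_right_mono) simp
    also have "\<dots> \<le> 41/2" by (simp add: power2_eq_square)
    finally show "64 / pi * (1001/1000)\<^sup>2 \<le> 41/2" .
    show "u ^ 3 * exp (- 2 * u) \<le> v ^ 3 * exp (- 2 * v)" by (rule gaussian_cube_bound[OF v(1) vu])
    show "0 \<le> u ^ 3 * exp (- 2 * u)" using v vu by simp
  qed simp
  also have "\<dots> \<le> c\<^sup>2" by (rule c(2))
  finally have "W * (1001/1000 * exp (- u)) \<le> c" using c(1) by (rule power2_le_imp_le)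
  moreover have "x\<^sup>2 * defect x \<le> W * (1001/1000 * exp (- u))"
    unfolding W_def u_def using W a4
    by (intro order_trans[OF defect_bounds(2)[OF _ x]] mult_left_mono defect_sum_le) (auto simp: W_def)
  ultimately show ?thesis by linarith
qed

lemma defect_le_a_le_4:
  assumes "a \<le> 4" "x \<noteq> 0" shows "x\<^sup>2 * defect x \<le> 37/100"
\<comment> \<open>\<open>v\<close> is 196/10 divided by the largest \<open>a\<close> in question;
  likewise 98/10 for \<open>a \<le> 2\<close>.\<close>
proof (rule defect_le[of "49/10"])
  have "exp (49/10) \<ge> (1342/10 :: real)"
    using exp_ge_Taylor[of "49/10" 18] by (simp add: eval_nat_numeral fact_numeral)
  then have "(1342/10)\<^sup>2 \<le> (exp (49/10) :: real)\<^sup>2" by (intro power_mono) auto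
  then have "exp (49/5 :: real) \<ge> (1342/10)\<^sup>2" by (simp add: exp_double[symmetric])
  then have "inverse (exp (49/5 :: real)) \<le> inverse ((1342/10)\<^sup>2)" by (intro le_imp_inverse_le) auto
  then have "exp (- (49/5) :: real) \<le> inverse ((1342/10)\<^sup>2)" by (simp add: exp_minus)
  then have "41/2 * ((49/10) ^ 3 * exp (- (49/5))) \<le> (41/2 * ((49/10) ^ 3 * inverse ((1342/10)\<^sup>2)) :: real)" by simp
  also have "\<dots> \<le> (37/100)\<^sup>2" by (simp add: eval_nat_numeral)
  finally show "41/2 * ((49/10) ^ 3 * exp (- 2 * (49/10))) \<le> (37/100 :: real)\<^sup>2" by simp
qed (use assms in auto)

lemma defect_le_a_le_2:
  assumes "a \<le> 2" "x \<noteq> 0" shows "x\<^sup>2 * defect x \<le> 3/100"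
proof (rule defect_le[of "98/10"])
  have "exp (- (98/5) :: real) \<le> exp (- 8 + (- 8 + (- 2 + - (3/2))))" by simp
  also have "\<dots> = exp (- 8) * (exp (- 8) * (exp (- 2) * exp (- (3/2))))" unfolding exp_add ..
  also have "\<dots> \<le> (1/2000) * ((1/2000) * ((1355/10000) * (2233/10000)))"
    by (intro mult_mono exp_numeric) auto
  finally have "41/2 * ((98/10) ^ 3 * exp (- (98/5))) \<le> (41/2 * ((98/10) ^ 3 * ((1/2000) * ((1/2000) * ((1355/10000) * (2233/10000))))) :: real)" by simp
  also have "\<dots> \<le> (3/100)\<^sup>2" by (simp add: eval_nat_numeral)
  finally show "41/2 * ((98/10) ^ 3 * exp (- 2 * (98/10))) \<le> (3/100 :: real)\<^sup>2" by simp
qed (use assms in auto)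

end

section \<open>Identification of the folded Gaussian with its interpolation series\<close>

lemma has_real_derivative_0_quadratic:
  fixes s :: "real \<Rightarrow> real"
  assumes "\<And>x. \<bar>s x\<bar> \<le> C * (x - c)\<^sup>2"
  shows "(s has_real_derivative 0) (at c)"
  unfolding DERIV_def
proof (rule Lim_null_comparison)
  have "s c = 0" using assms[of c] by simp
  show "\<forall>\<^sub>F h in at 0. norm ((s (c + h) - s c) / h) \<le> C * \<bar>h\<bar>"
  proof (intro eventually_at_filter[THEN iffD2] always_eventually allI impI)
    fix h :: real assume h: "h \<noteq> 0"
    have "norm ((s (c + h) - s c) / h) = \<bar>s (c + h)\<bar> / \<bar>h\<bar>" by (simp add: \<open>s c = 0\<close>)
    also have "\<dots> \<le> C * (c + h - c)\<^sup>2 / \<bar>h\<bar>" by (intro divide_right_mono assms) auto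
    also have "\<dots> = C * (\<bar>h\<bar> * \<bar>h\<bar>) / \<bar>h\<bar>" by (simp add: power2_eq_square)
    also have "\<dots> = C * \<bar>h\<bar>" using h by (simp add: abs_if)
    finally show "norm ((s (c + h) - s c) / h) \<le> C * \<bar>h\<bar>" .
  qed
  have "((\<lambda>h. C * \<bar>h\<bar>) \<longlongrightarrow> C * \<bar>0 :: real\<bar>) (at 0)" by (intro tendsto_intros)
  then show "((\<lambda>h. C * \<bar>h\<bar>) \<longlongrightarrow> 0) (at (0::real))" by simp
qed

lemma abs_sin_pi_le: "\<bar>sin (pi * x)\<bar> \<le> pi * \<bar>x - of_int n\<bar>"
proof -
  have "sin (pi * x) = sin (pi * (x - of_int n) + pi * of_int n)" by (simp add: algebra_simps)
  also have "\<dots> = sin (pi * (x - of_int n)) * cos (pi * of_int n)" unfolding sin_add by simp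
  finally have "\<bar>sin (pi * x)\<bar> = \<bar>sin (pi * (x - of_int n))\<bar> * \<bar>cos (pi * of_int n)\<bar>" by (simp add: abs_mult)
  also have "\<dots> \<le> \<bar>pi * (x - of_int n)\<bar> * 1"
    by (intro mult_mono abs_sin_x_le_abs_x abs_cos_le_one) auto
  finally show ?thesis by (simp add: abs_mult)
qed

text \<open>At a half-integer every node is at distance \<open>\<bar>d\<bar> \<ge> 1/2\<close>, so
  \<open>\<bar>d\<bar> * \<bar>csinc d\<bar>\<close> is small enough to pay for a factor
  \<open>d^2\<close>, and \<open>x \<le> \<bar>d\<bar> (1 + 2 \<bar>n\<bar>)\<close> trades a weight
  on the data for the factor \<open>1 / x\<close>. This decay separates interpolants with equal
  data.\<close>

lemma cmod_interp_half_integer_le: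
  assumes W: "(\<lambda>n. (1 + 2 * \<bar>of_int n\<bar>) * (cmod (A n) + cmod (B n))) summable_on UNIV"
  shows "cmod (interp A B (of_real (real N + 1/2)))
    \<le> (\<Sum>\<^sub>\<infinity>n. (1 + 2 * \<bar>of_int n\<bar>) * (cmod (A n) + cmod (B n))) / (real N + 1/2)"
proof -
  define x where "x = real N + 1/2"
  define V where "V = (\<lambda>n::int. (1 + 2 * \<bar>of_int n\<bar>) * (cmod (A n) + cmod (B n)))"
  have x: "x > 0" by (simp add: x_def)
  have t: "cmod (interp_term (A n) (B n) n (of_real x)) \<le> V n / x" for n
  proof -
    define d where "d = x - of_int n"
    define c where "c = cmod (csinc (of_real d))"
    have "\<bar>2 * d\<bar> \<ge> 1"
    proof -
      have "2 * d = of_int (2 * int N + 1 - 2 * n)" by (simp add: d_def x_def)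
      moreover have "2 * int N + 1 - 2 * n \<noteq> 0" by presburger
      then have "\<bar>2 * int N + 1 - 2 * n\<bar> \<ge> 1" by linarith
      ultimately show ?thesis by (simp only: of_int_abs[symmetric] of_int_1_le_iff)
    qed
    then have d: "\<bar>d\<bar> \<ge> 1/2" by simp
    have c0: "c \<ge> 0" by (simp add: c_def)
    have "pi * (\<bar>d\<bar> * c) \<le> 1" using cmod_mult_csinc_le[of "of_real d"] by (simp add: c_def)
    moreover have "3 * (\<bar>d\<bar> * c) \<le> pi * (\<bar>d\<bar> * c)" using pi_gt3 c0 by (intro mult_right_mono) auto
    ultimately have "\<bar>d\<bar> * c \<le> 1/3" by simp
    then have "(\<bar>d\<bar> * c)\<^sup>2 \<le> (1/3)\<^sup>2" using c0 by (intro power_mono) auto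
    then have c2: "c\<^sup>2 * d\<^sup>2 \<le> 1/9" by (simp add: power_mult_distrib mult.commute power_divide)
    have xd: "x \<le> \<bar>d\<bar> * (1 + 2 * \<bar>of_int n\<bar>)"
    proof -
      have "\<bar>of_int n :: real\<bar> \<le> \<bar>d\<bar> * (2 * \<bar>of_int n\<bar>)" using mult_right_mono[OF d, of "2 * \<bar>of_int n\<bar>"] by simp
      moreover have "x \<le> \<bar>d\<bar> + \<bar>of_int n\<bar>" unfolding d_def by linarith
      ultimately show ?thesis unfolding distrib_left by linarith
    qed
    have "cmod (A n + B n * of_real d) \<le> cmod (A n) + cmod (B n) * \<bar>d\<bar>"
      by (rule order_trans[OF norm_triangle_ineq]) (simp add: norm_mult)
    also have "\<dots> \<le> 2 * \<bar>d\<bar> * (cmod (A n) + cmod (B n))"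
    proof -
      have "cmod (A n) * 1 \<le> cmod (A n) * (2 * \<bar>d\<bar>)" using d by (intro mult_left_mono) auto
      moreover have "cmod (B n) * \<bar>d\<bar> \<le> cmod (B n) * (2 * \<bar>d\<bar>)" by (intro mult_left_mono) auto
      ultimately have "cmod (A n) + cmod (B n) * \<bar>d\<bar> \<le> cmod (A n) * (2 * \<bar>d\<bar>) + cmod (B n) * (2 * \<bar>d\<bar>)" by linarith
      then show ?thesis by (simp add: algebra_simps)
    qed
    finally have n: "cmod (A n + B n * of_real d) \<le> 2 * \<bar>d\<bar> * (cmod (A n) + cmod (B n))" .
    have "cmod (interp_term (A n) (B n) n (of_real x)) * x = cmod (A n + B n * of_real d) * c\<^sup>2 * x"
      by (simp add: interp_term_def norm_mult norm_power c_def d_def)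
    also have "\<dots> \<le> (2 * \<bar>d\<bar> * (cmod (A n) + cmod (B n))) * c\<^sup>2 * (\<bar>d\<bar> * (1 + 2 * \<bar>of_int n\<bar>))"
      using x xd n by (intro mult_mono) auto
    also have "\<dots> = 2 * (c\<^sup>2 * d\<^sup>2) * V n" by (simp add: V_def power2_eq_square)
    also have "\<dots> \<le> 1 * V n" using c2 by (intro mult_right_mono) (auto simp: V_def)
    finally show ?thesis using x by (simp add: field_simps)
  qed
  have "cmod (infsum (\<lambda>n. interp_term (A n) (B n) n (of_real x)) UNIV) \<le> (\<Sum>\<^sub>\<infinity>n. V n) / x"
  proof (rule abs_summable_onI_bounded(3))
    fix F :: "int set" assume F: "finite F"
    have "(\<Sum>n\<in>F. cmod (interp_term (A n) (B n) n (of_real x))) \<le> (\<Sum>n\<in>F. V n) / x"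
      unfolding sum_divide_distrib by (intro sum_mono t)
    also have "\<dots> \<le> (\<Sum>\<^sub>\<infinity>n. V n) / x" using x F W by (intro divide_right_mono finite_sum_le_infsum) (auto simp: V_def)
    finally show "(\<Sum>n\<in>F. cmod (interp_term (A n) (B n) n (of_real x))) \<le> (\<Sum>\<^sub>\<infinity>n. V n) / x" .
  qed
  then show ?thesis by (simp add: interp_def V_def x_def)
qed

lemma sum_int_symmetric:
  fixes f :: "int \<Rightarrow> 'a::comm_monoid_add"
  shows "(\<Sum>n\<in>{- int N..int N}. f n) = f 0 + (\<Sum>n<N. f (int (Suc n)) + f (- int (Suc n)))"
proof (induction N)
  case (Suc N)
  have "{- int (Suc N)..int (Suc N)} = insert (int (Suc N)) (insert (- int (Suc N)) {- int N..int N})" by auto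
  then have "(\<Sum>n\<in>{- int (Suc N)..int (Suc N)}. f n) = f (int (Suc N)) + (f (- int (Suc N)) + (\<Sum>n\<in>{- int N..int N}. f n))"
    by simp
  then show ?case unfolding Suc.IH by (simp only: sum.lessThan_Suc ac_simps)
qed simp

text \<open>In units of \<open>sin^2 (\<pi> x) / \<pi>^2\<close>, the node \<open>n\<close>
  contributes \<open>1 / (n - x)^2\<close> for its value and \<open>a n / (n - x)\<close> for its
  slope. To the latter is added \<open>a n / x\<close>, its share of the slope at the origin, and
  the two combine to \<open>a n^2 / (x (n - x))\<close>.\<close>

definition minor_term :: "real \<Rightarrow> real \<Rightarrow> nat \<Rightarrow> real" where
  "minor_term a x n = exp (- (a * (real n)\<^sup>2 / 2)) * (1 / (real n - x)\<^sup>2 + a * (real n)\<^sup>2 / (x * (real n - x)))"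

definition minor_sum :: "real \<Rightarrow> real \<Rightarrow> real" where
  "minor_sum a x = (\<Sum>n. minor_term a x (Suc n))"

lemma minor_term_uminus: "minor_term a (- y) n = - left_error_term a y n"
  unfolding minor_term_def left_error_term_def mult_minus_right[symmetric] by simp

lemma summable_minor_term:
  assumes a: "a > 0" and x: "x \<noteq> 0"
  shows "summable (\<lambda>n. minor_term a x (Suc n))"
proof -
  have s: "summable (\<lambda>n. exp (- (a * (real n)\<^sup>2 / 2)) * (1 + a / \<bar>x\<bar> * (real n)\<^sup>2))"
  proof -
    have "summable (\<lambda>n. real n ^ 0 * exp (- (a * (real n)\<^sup>2 / 2 + 0 * real n)) + a / \<bar>x\<bar> * (real n ^ 2 * exp (- (a * (real n)\<^sup>2 / 2 + 0 * real n))))"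
      using a by (intro summable_add summable_mult summable_gaussian_monomial) auto
    then show ?thesis by (rule summable_cong[THEN iffD1, rotated]) (simp add: algebra_simps)
  qed
  have "summable (\<lambda>n. minor_term a x n)"
  proof (rule summable_comparison_test[OF _ s], intro exI allI impI)
    fix n assume n: "nat \<lceil>\<bar>x\<bar>\<rceil> + 1 \<le> n"
    then have n1: "real n - x \<ge> 1" by linarith
    have p1: "1 / (real n - x)\<^sup>2 \<le> 1" using n1 by simp
    have "a * (real n)\<^sup>2 / (\<bar>x\<bar> * (real n - x)) \<le> a * (real n)\<^sup>2 / (\<bar>x\<bar> * 1)"
      using n1 x a by (intro divide_left_mono mult_left_mono mult_pos_pos) auto
    then have p2: "\<bar>a * (real n)\<^sup>2 / (x * (real n - x))\<bar> \<le> a / \<bar>x\<bar> * (real n)\<^sup>2" using n1 a by (simp add: abs_mult)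
    have "\<bar>1 / (real n - x)\<^sup>2 + a * (real n)\<^sup>2 / (x * (real n - x))\<bar> \<le> 1 + a / \<bar>x\<bar> * (real n)\<^sup>2"
      using p1 p2 abs_triangle_ineq[of "1 / (real n - x)\<^sup>2" "a * (real n)\<^sup>2 / (x * (real n - x))"] by simp
    then show "norm (minor_term a x n) \<le> exp (- (a * (real n)\<^sup>2 / 2)) * (1 + a / \<bar>x\<bar> * (real n)\<^sup>2)"
      unfolding minor_term_def real_norm_def abs_mult by (simp add: mult_left_mono)
  qed
  then show ?thesis by (simp only: summable_Suc_iff)
qed

lemma minor_sum_uminus: "a > 0 \<Longrightarrow> y > 0 \<Longrightarrow> minor_sum a (- y) = - left_error a y"
  unfolding minor_sum_def left_error_def minor_term_uminus
  by (rule suminf_minus, rule left_error_bounds(1)[of _ _ "97/100"]) (use theta_sum_bounds in auto)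

context gaussian
begin

definition gauss_value :: "int \<Rightarrow> complex" where
  "gauss_value n = of_real (exp (- (a * (of_int n)\<^sup>2 / 2)))"

definition gauss_slope :: "int \<Rightarrow> complex" where
  "gauss_slope n = of_real (- (a * of_int n) * exp (- (a * (of_int n)\<^sup>2 / 2)))"

lemma summable_gauss_data:
  "(\<lambda>n. (1 + 2 * \<bar>of_int n\<bar>) * (cmod (gauss_value n) + cmod (gauss_slope n))) summable_on UNIV"
proof (rule summable_on_int)
  have "summable (\<lambda>n. (real n ^ 0 * exp (- (a * (real n)\<^sup>2 / 2 + 0 * real n)) + (2 + a) * (real n ^ 1 * exp (- (a * (real n)\<^sup>2 / 2 + 0 * real n))))
     + 2 * a * (real n ^ 2 * exp (- (a * (real n)\<^sup>2 / 2 + 0 * real n))))"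
    using a by (intro summable_add summable_mult summable_gaussian_monomial) auto
  then have s: "summable (\<lambda>n. (1 + 2 * real n) * (exp (- (a * (real n)\<^sup>2 / 2)) + a * real n * exp (- (a * (real n)\<^sup>2 / 2))))"
    by (rule summable_cong[THEN iffD1, rotated]) (simp add: algebra_simps power2_eq_square)
  show "summable (\<lambda>n. (1 + 2 * \<bar>of_int (int n)\<bar>) * (cmod (gauss_value (int n)) + cmod (gauss_slope (int n))))"
    and "summable (\<lambda>n. (1 + 2 * \<bar>of_int (- int n)\<bar>) * (cmod (gauss_value (- int n)) + cmod (gauss_slope (- int n))))"
    using s a by (simp_all add: gauss_value_def gauss_slope_def norm_mult)
qed auto

lemma interp_gauss:
  shows "interp gauss_value gauss_slope holomorphic_on UNIV"
    and "\<And>z. ((\<lambda>n. interp_term (gauss_value n) (gauss_slope n) n z) has_sum interp gauss_value gauss_slope z) UNIV"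
    and "\<And>m. interp gauss_value gauss_slope (of_int m) = gauss_value m"
    and "\<And>m. deriv (interp gauss_value gauss_slope) (of_int m) = gauss_slope m"
    and "\<exists>C. \<forall>z. cmod (interp gauss_value gauss_slope z) \<le> C * exp (2 * pi * \<bar>Im z\<bar>)"
proof -
  have A: "cmod (gauss_value n) \<le> 1" for n using a by (simp add: gauss_value_def)
  have B: "(\<lambda>n. cmod (gauss_slope n)) summable_on UNIV"
  proof (rule summable_on_comparison_test[OF summable_gauss_data])
    fix n :: int
    have "1 * cmod (gauss_slope n) \<le> (1 + 2 * \<bar>of_int n\<bar>) * (cmod (gauss_value n) + cmod (gauss_slope n))"
      by (intro mult_mono) auto
    then show "cmod (gauss_slope n) \<le> (1 + 2 * \<bar>of_int n\<bar>) * (cmod (gauss_value n) + cmod (gauss_slope n))" by simp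
  qed auto
  note P = interp_properties[where A = gauss_value and B = gauss_slope, OF A B]
  show "interp gauss_value gauss_slope holomorphic_on UNIV" by (rule P(1))
  show "((\<lambda>n. interp_term (gauss_value n) (gauss_slope n) n z) has_sum interp gauss_value gauss_slope z) UNIV" for z by (rule P(2))
  show "interp gauss_value gauss_slope (of_int m) = gauss_value m" for m by (rule P(3))
  show "deriv (interp gauss_value gauss_slope) (of_int m) = gauss_slope m" for m by (rule P(4))
  show "\<exists>C. \<forall>z. cmod (interp gauss_value gauss_slope z) \<le> C * exp (2 * pi * \<bar>Im z\<bar>)" by (rule P(5))
qed

text \<open>On the real line \<open>K\<close> differs from the Gaussian by
  \<open>sin^2 (\<pi> x)\<close> times a bounded function, a quadratically small perturbation at
  each integer.\<close>

lemma deriv_K_int: "deriv K (of_int n) = gauss_slope n"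
proof -
  obtain C where C: "\<And>x. \<bar>defect x\<bar> \<le> C" using abs_defect_le by blast
  define s where "s = (\<lambda>x. (sin (pi * x))\<^sup>2 / pi\<^sup>2 * defect x)"
  have sb: "\<bar>s x\<bar> \<le> C * (x - of_int n)\<^sup>2" for x
  proof -
    have "(sin (pi * x))\<^sup>2 \<le> (pi * \<bar>x - of_int n\<bar>)\<^sup>2"
      using power_mono[OF abs_sin_pi_le[of x n], of 2] by simp
    then have "(sin (pi * x))\<^sup>2 / pi\<^sup>2 \<le> (x - of_int n)\<^sup>2" by (simp add: power_mult_distrib field_simps)
    then have "(sin (pi * x))\<^sup>2 / pi\<^sup>2 * \<bar>defect x\<bar> \<le> (x - of_int n)\<^sup>2 * C" using C[of x] by (intro mult_mono) auto
    then show ?thesis by (simp add: s_def abs_mult mult.commute)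
  qed
  have "(s has_real_derivative 0) (at (of_int n))" by (rule has_real_derivative_0_quadratic[OF sb])
  moreover have "((\<lambda>x. exp (- (a * x\<^sup>2 / 2))) has_real_derivative (- (a * of_int n) * exp (- (a * (of_int n)\<^sup>2 / 2)))) (at (of_int n))"
    by (auto intro!: derivative_eq_intros)
  ultimately have "((\<lambda>x. exp (- (a * x\<^sup>2 / 2)) + s x) has_real_derivative (- (a * of_int n) * exp (- (a * (of_int n)\<^sup>2 / 2)) + 0)) (at (of_int n))"
    by (intro DERIV_add)
  then have "((\<lambda>x. complex_of_real (exp (- (a * x\<^sup>2 / 2)) + s x)) has_vector_derivative gauss_slope n) (at (of_int n))"
    unfolding gauss_slope_def by (intro has_vector_derivative_of_real) (simp add: has_real_derivative_iff_has_vector_derivative)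
  moreover have "K (of_real x) = of_real (exp (- (a * x\<^sup>2 / 2)) + s x)" for x unfolding s_def by (rule K_real)
  moreover have "((\<lambda>x. K (of_real x)) has_vector_derivative deriv K (of_real (of_int n))) (at (of_int n))"
    by (rule has_vector_derivative_real_field) (rule holomorphic_derivI[OF K_properties(1)], auto)
  ultimately show ?thesis by (auto dest: vector_derivative_unique_at)
qed

text \<open>Equal values and slopes at all integers leave a difference
  \<open>(\<alpha> + \<beta> z) sin^2 (\<pi> z)\<close>. At half-integers the square is 1 and both
  functions tend to 0, which forces \<alpha> and \<beta> to vanish.\<close>

lemma K_eq_interp:
  assumes a36: "a \<le> 36"
  shows "K z = interp gauss_value gauss_slope z"
proof -
  let ?I = "interp gauss_value gauss_slope"
  define f where "f = (\<lambda>z. K z - ?I z)"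
  obtain C1 C2 where C1: "\<And>z. cmod (K z) \<le> C1 * exp (2 * pi * \<bar>Im z\<bar>)" and C2: "\<And>z. cmod (?I z) \<le> C2 * exp (2 * pi * \<bar>Im z\<bar>)"
    using K_properties(2) interp_gauss(5) by blast
  have hf: "f holomorphic_on UNIV" unfolding f_def by (intro holomorphic_intros K_properties interp_gauss)
  have "f (of_int n) = 0" for n
    using K_real[of "of_int n"] by (simp add: f_def interp_gauss gauss_value_def)
  moreover have "deriv f (of_int n) = 0" for n
  proof -
    have "deriv f (of_int n) = deriv K (of_int n) - deriv ?I (of_int n)"
      unfolding f_def using K_properties(1) interp_gauss(1)
      by (intro deriv_diff) (auto simp: holomorphic_on_imp_differentiable_at)
    then show ?thesis by (simp add: deriv_K_int interp_gauss)
  qed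
  moreover have "cmod (f z) \<le> \<bar>C1 + C2\<bar> * (1 + cmod z) * exp (2 * pi * \<bar>Im z\<bar>)" for z
  proof -
    have "cmod (f z) \<le> (C1 + C2) * exp (2 * pi * \<bar>Im z\<bar>)"
      unfolding f_def distrib_right using C1[of z] C2[of z] by (intro order_trans[OF norm_triangle_ineq4]) linarith
    also have "\<dots> \<le> (\<bar>C1 + C2\<bar> * (1 + cmod z)) * exp (2 * pi * \<bar>Im z\<bar>)"
    proof (intro mult_right_mono)
      have "\<bar>C1 + C2\<bar> * 1 \<le> \<bar>C1 + C2\<bar> * (1 + cmod z)" by (intro mult_left_mono) auto
      then show "C1 + C2 \<le> \<bar>C1 + C2\<bar> * (1 + cmod z)"
        using abs_ge_self[of "C1 + C2"] by argo
    qed simp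
    finally show ?thesis .
  qed
  ultimately obtain \<alpha> \<beta> where f: "\<And>z. f z = (\<alpha> + \<beta> * z) * (sin (of_real pi * z))\<^sup>2"
    using double_zeros_at_integers[OF hf] by blast
  define h where "h = (\<lambda>N. \<alpha> + \<beta> * of_real (real N + 1/2))"
  have fh: "f (of_real (real N + 1/2)) = h N" for N
  proof -
    have "sin (pi * (real N + 1/2)) = sin (pi * real N + pi / 2)" by (simp add: algebra_simps)
    also have "\<dots> = cos (pi * real N)" by (simp add: sin_add)
    finally have "(sin (pi * (real N + 1/2)))\<^sup>2 = 1" by (simp flip: power_mult)
    moreover have "sin (of_real pi * of_real y) = complex_of_real (sin (pi * y))" for y
      by (simp flip: sin_of_real)
    ultimately have "(sin (of_real pi * of_real (real N + 1/2)) :: complex)\<^sup>2 = 1"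
      by (simp only: of_real_power[symmetric] of_real_1)
    then show ?thesis unfolding f h_def by simp
  qed
  define W where "W = (\<Sum>\<^sub>\<infinity>n. (1 + 2 * \<bar>of_int n\<bar>) * (cmod (gauss_value n) + cmod (gauss_slope n)))"
  define D where "D = 32 * pi ^ 3 * N0 / a * (\<Sum>m. (real m)\<^sup>2 * w (2 * pi * real m))"
  have h0: "h \<longlonglongrightarrow> 0"
  proof (rule Lim_null_comparison)
    show "(\<lambda>N. exp (- (a * (real N + 1/2)\<^sup>2 / 2)) + D / (real N + 1/2)\<^sup>2 + W / (real N + 1/2)) \<longlonglongrightarrow> 0"
    proof -
      have "(\<lambda>N. exp (- (a * (real N + 1/2)\<^sup>2 / 2))) \<longlonglongrightarrow> 0" using a by real_asymp
      moreover have "(\<lambda>N. 1 / (real N + 1/2)\<^sup>2) \<longlonglongrightarrow> 0" "(\<lambda>N. 1 / (real N + 1/2)) \<longlonglongrightarrow> 0" by real_asymp+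
      ultimately have "(\<lambda>N. exp (- (a * (real N + 1/2)\<^sup>2 / 2)) + D * (1 / (real N + 1/2)\<^sup>2) + W * (1 / (real N + 1/2))) \<longlonglongrightarrow> 0 + D * 0 + W * 0"
        by (intro tendsto_intros)
      then show ?thesis by simp
    qed
    show "\<forall>\<^sub>F N in sequentially. norm (h N) \<le> exp (- (a * (real N + 1/2)\<^sup>2 / 2)) + D / (real N + 1/2)\<^sup>2 + W / (real N + 1/2)"
    proof (intro always_eventually allI)
      fix N
      define x where "x = real N + 1/2"
      have x: "x \<noteq> 0" "x\<^sup>2 > 0" by (auto simp: x_def add_nonneg_eq_0_iff)
      have d: "0 \<le> defect x" "defect x \<le> D / x\<^sup>2"
      proof -
        show "0 \<le> defect x" by (rule defect_bounds(1)[OF a36 x(1)])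
        have "x\<^sup>2 * defect x \<le> D" unfolding D_def by (rule defect_bounds(2)[OF a36 x(1)])
        then show "defect x \<le> D / x\<^sup>2" by (simp only: pos_le_divide_eq[OF x(2)] mult.commute)
      qed
      have s: "(sin (pi * x))\<^sup>2 / pi\<^sup>2 \<le> 1"
      proof -
        have "(sin (pi * x))\<^sup>2 \<le> 1" by (simp add: abs_square_le_1)
        also have "1 \<le> pi\<^sup>2" using pi_square_bounds(1) by simp
        finally show ?thesis by simp
      qed
      have "cmod (K (of_real x)) = exp (- (a * x\<^sup>2 / 2)) + (sin (pi * x))\<^sup>2 / pi\<^sup>2 * defect x"
        unfolding K_real norm_of_real using d by (intro abs_of_nonneg add_nonneg_nonneg) auto
      also have "\<dots> \<le> exp (- (a * x\<^sup>2 / 2)) + 1 * (D / x\<^sup>2)"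
        using d s by (intro add_left_mono mult_mono) auto
      finally have "cmod (K (of_real x)) \<le> exp (- (a * x\<^sup>2 / 2)) + D / x\<^sup>2" by simp
      moreover have "cmod (?I (of_real x)) \<le> W / x"
        unfolding W_def x_def by (rule cmod_interp_half_integer_le[OF summable_gauss_data])
      ultimately have "cmod (f (of_real x)) \<le> exp (- (a * x\<^sup>2 / 2)) + D / x\<^sup>2 + W / x"
        unfolding f_def by (intro order_trans[OF norm_triangle_ineq4]) linarith
      then show "norm (h N) \<le> exp (- (a * (real N + 1/2)\<^sup>2 / 2)) + D / (real N + 1/2)\<^sup>2 + W / (real N + 1/2)"
        unfolding x_def fh .
    qed
  qed
  have "(\<lambda>N. h (Suc N) - h N) \<longlonglongrightarrow> 0 - 0" by (intro tendsto_diff LIMSEQ_Suc h0)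
  moreover have "h (Suc N) - h N = \<beta>" for N by (simp add: h_def algebra_simps)
  ultimately have b: "\<beta> = 0" by (simp add: LIMSEQ_const_iff)
  then have "h = (\<lambda>N. \<alpha>)" by (simp add: h_def)
  then have "\<alpha> = 0" using h0 by (simp add: LIMSEQ_const_iff)
  then have "f z = 0" using f b by simp
  then show ?thesis by (simp add: f_def)
qed

text \<open>The two-sided series consists of the positive nodes, the origin and the negative nodes,
  and the last part is the one-sided series at \<open>- x\<close>, that is
  \<open>- left_error\<close>. Dividing \<open>K_real\<close> by
  \<open>sin^2 (\<pi> x) / \<pi>^2\<close> thus expresses the error on the positive axis through the
  error on the negative one.\<close>

theorem minor_sum_identity:
  assumes a36: "a \<le> 36" and x: "x > 0" "x \<notin> \<int>"
  shows "exp (- (a * x\<^sup>2 / 2)) * pi\<^sup>2 / (sin (pi * x))\<^sup>2 - minor_sum a x = 1 / x\<^sup>2 - left_error a x - defect x"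
proof -
  define q where "q = (sin (pi * x))\<^sup>2 / pi\<^sup>2"
  have xn: "x \<noteq> of_int n" for n using x(2) by auto
  have "sin (pi * x) \<noteq> 0" using x(2) by (auto simp: sin_zero_iff_int2)
  then have q: "q \<noteq> 0" by (simp add: q_def)
  define t where "t = (\<lambda>n::int. exp (- (a * (of_int n)\<^sup>2 / 2)) * (1 / (x - of_int n)\<^sup>2 - a * of_int n / (x - of_int n)))"
  have term_eq: "interp_term (gauss_value n) (gauss_slope n) n (of_real x) = of_real (q * t n)" for n
  proof -
    have ne: "complex_of_real x \<noteq> of_int n" using xn[of n] by (metis of_real_eq_iff of_real_of_int_eq)
    have c: "(csinc (of_real x - of_int n))\<^sup>2 = of_real ((sin (pi * x))\<^sup>2 / (pi * (x - of_int n))\<^sup>2)"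
      unfolding csinc_sq_shift[OF ne] by (simp flip: sin_of_real)
    moreover have "(exp (- (a * (of_int n)\<^sup>2 / 2)) + (- (a * of_int n) * exp (- (a * (of_int n)\<^sup>2 / 2))) * (x - of_int n)) * ((sin (pi * x))\<^sup>2 / (pi * (x - of_int n))\<^sup>2) = q * t n"
    proof -
      have "(g + - c * g * d) * (v / (pi * d)\<^sup>2) = v / pi\<^sup>2 * (g * (1 / d\<^sup>2 - c / d))" if "d \<noteq> 0" for g c d v :: real
        using that by (simp add: field_simps power2_eq_square)
      then show ?thesis unfolding q_def t_def using xn[of n] by simp
    qed
    moreover have "interp_term (gauss_value n) (gauss_slope n) n (of_real x) = of_real ((exp (- (a * (of_int n)\<^sup>2 / 2)) + (- (a * of_int n) * exp (- (a * (of_int n)\<^sup>2 / 2))) * (x - of_int n)) * ((sin (pi * x))\<^sup>2 / (pi * (x - of_int n))\<^sup>2))"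
      unfolding interp_term_def gauss_value_def gauss_slope_def c by (simp del: mult_eq_0_iff)
    ultimately show ?thesis by (simp only:)
  qed
  have "(\<lambda>N. \<Sum>n\<in>{- int N..int N}. interp_term (gauss_value n) (gauss_slope n) n (of_real x)) \<longlonglongrightarrow> K (of_real x)"
    unfolding K_eq_interp[OF a36] by (rule has_sum_int_tendsto[OF interp_gauss(2)])
  then have "(\<lambda>N. complex_of_real (q * (\<Sum>n\<in>{- int N..int N}. t n))) \<longlonglongrightarrow> of_real (exp (- (a * x\<^sup>2 / 2)) + q * defect x)"
    unfolding term_eq K_real q_def[symmetric] of_real_sum[symmetric] sum_distrib_left .
  then have "(\<lambda>N. q * (\<Sum>n\<in>{- int N..int N}. t n)) \<longlonglongrightarrow> exp (- (a * x\<^sup>2 / 2)) + q * defect x"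
    by (simp only: tendsto_of_real_iff)
  then have "(\<lambda>N. q * (\<Sum>n\<in>{- int N..int N}. t n) / q) \<longlonglongrightarrow> (exp (- (a * x\<^sup>2 / 2)) + q * defect x) / q"
    using q by (intro tendsto_divide tendsto_const)
  then have lim1: "(\<lambda>N. \<Sum>n\<in>{- int N..int N}. t n) \<longlonglongrightarrow> exp (- (a * x\<^sup>2 / 2)) / q + defect x"
    using q by (simp add: add_divide_distrib)
  \<comment> \<open>The Gaussian has slope 0 at the origin: \<open>a n / x\<close> is added for the
    node \<open>n\<close> and subtracted for \<open>- n\<close>, which brings both into the shape of
    \<open>minor_term\<close>.\<close>
  have pair: "t (int n) + t (- int n) = minor_term a x n + minor_term a (- x) n" for n
  proof -
    define g where "g = exp (- (a * (real n)\<^sup>2 / 2))"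
    have ne: "x - real n \<noteq> 0" "x + real n \<noteq> 0" "x \<noteq> 0" using x xn[of "int n"] by auto
    have s: "(x - real n)\<^sup>2 = (real n - x)\<^sup>2" by (rule power2_commute)
    have e1: "- (a * real n / (x - real n)) = a * (real n)\<^sup>2 / (x * (real n - x)) - a * real n / x"
    proof -
      have "real n - x \<noteq> 0" using ne by simp
      then show ?thesis using ne by (simp add: field_simps power2_eq_square)
    qed
    have e2: "a * real n / (x + real n) = a * (real n)\<^sup>2 / (- x * (real n + x)) + a * real n / x"
    proof -
      have "a * real n / (x + real n) = - (a * (real n)\<^sup>2 / (x * (real n + x))) + a * real n / x"
      proof -
        have alg: "a * m * j = - (a * m ^ 2 * (i * j)) + a * m * i" if "d * j = 1" "x * i = 1" "m = d - x" for d i j m :: real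
          using that by algebra
        have "(real n + x) * inverse (real n + x) = 1" "x * inverse x = 1" using ne by (simp_all add: add.commute)
        from alg[OF this, of "real n"] show ?thesis
          by (simp add: divide_inverse add.commute[of x])
      qed
      then show ?thesis by simp
    qed
    have "t (int n) = g * (1 / (real n - x)\<^sup>2 + - (a * real n / (x - real n)))"
      unfolding t_def g_def by (simp add: s)
    moreover have "t (- int n) = g * (1 / (real n + x)\<^sup>2 + a * real n / (x + real n))"
      unfolding t_def g_def by (simp add: add.commute[of x])
    ultimately have "t (int n) + t (- int n) = g * ((1 / (real n - x)\<^sup>2 + - (a * real n / (x - real n))) + (1 / (real n + x)\<^sup>2 + a * real n / (x + real n)))"
      by (simp only: distrib_left)
    also have "\<dots> = g * ((1 / (real n - x)\<^sup>2 + a * (real n)\<^sup>2 / (x * (real n - x))) + (1 / (real n - - x)\<^sup>2 + a * (real n)\<^sup>2 / (- x * (real n - - x))))"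
      unfolding e1 e2 by simp
    finally show ?thesis unfolding minor_term_def g_def by (simp only: distrib_left)
  qed
  have t0: "t 0 = 1 / x\<^sup>2" by (simp add: t_def)
  have "(\<lambda>n. minor_term a x (Suc n) + minor_term a (- x) (Suc n)) sums (minor_sum a x + minor_sum a (- x))"
    unfolding minor_sum_def using x a by (intro sums_add summable_sums summable_minor_term) auto
  then have "(\<lambda>N. t 0 + (\<Sum>n<N. t (int (Suc n)) + t (- int (Suc n)))) \<longlonglongrightarrow> 1 / x\<^sup>2 + (minor_sum a x + minor_sum a (- x))"
    unfolding pair t0 sums_def by (intro tendsto_add tendsto_const)
  then have "(\<lambda>N. \<Sum>n\<in>{- int N..int N}. t n) \<longlonglongrightarrow> 1 / x\<^sup>2 + (minor_sum a x + minor_sum a (- x))"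
    unfolding sum_int_symmetric .
  from LIMSEQ_unique[OF lim1 this] show ?thesis
    unfolding minor_sum_uminus[OF a x(1)] q_def by simp
qed

end

section \<open>Error bounds for a single truncated Gaussian\<close>

lemma exp_type_at_mostI:
  assumes hol: "f holomorphic_on UNIV" and bd: "\<And>z. cmod (f z) \<le> C * exp (\<sigma> * \<bar>Im z\<bar>)" and \<sigma>: "\<sigma> \<ge> 0"
  shows "exp_type_at_most \<sigma> f"
  unfolding exp_type_at_most_def
proof (intro conjI allI impI hol)
  fix e :: real assume e: "e > 0"
  show "\<exists>C>0. \<forall>z. norm (f z) \<le> C * exp ((\<sigma> + e) * norm z)"
  proof (intro exI conjI allI)
    fix z
    have "\<sigma> * \<bar>Im z\<bar> \<le> (\<sigma> + e) * cmod z" using e \<sigma> by (intro mult_mono abs_Im_le_cmod) auto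
    then have "(\<bar>C\<bar> + 1) * exp (\<sigma> * \<bar>Im z\<bar>) \<le> (\<bar>C\<bar> + 1) * exp ((\<sigma> + e) * cmod z)" by (intro mult_left_mono) auto
    moreover have "C * exp (\<sigma> * \<bar>Im z\<bar>) \<le> (\<bar>C\<bar> + 1) * exp (\<sigma> * \<bar>Im z\<bar>)" by (intro mult_right_mono) auto
    ultimately show "norm (f z) \<le> (\<bar>C\<bar> + 1) * exp ((\<sigma> + e) * norm z)" using bd[of z] by linarith
  qed auto
qed

section \<open>The squared sinc and the partial fractions of the inverse squared sine\<close>

lemma integrable_csinc_sq: "integrable lborel (\<lambda>x. (csinc (of_real x))\<^sup>2)"
proof (rule Bochner_Integration.integrable_bound)
  have "integrable lborel (\<lambda>x::real. inverse (1 + x\<^sup>2))"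
    using integrable_inverse_1_plus_square by (simp add: set_integrable_def)
  then show "integrable lborel (\<lambda>x::real. 2 * inverse (1 + x\<^sup>2))" by (rule integrable_mult_right)
  show "(\<lambda>x. (csinc (of_real x))\<^sup>2) \<in> borel_measurable lborel"
    using holomorphic_on_imp_continuous_on[OF holomorphic_csinc]
    by (simp, intro borel_measurable_continuous_onI continuous_intros) (auto intro: continuous_on_compose2)
  show "AE x in lborel. norm ((csinc (of_real x))\<^sup>2) \<le> norm (2 * inverse (1 + x\<^sup>2) :: real)"
  proof (rule AE_I2)
    fix x :: real
    have p: "1 + x\<^sup>2 > 0" by (simp add: add_pos_nonneg)
    have "(cmod (csinc (of_real x)))\<^sup>2 * (1 + x\<^sup>2) \<le> 2"
      using cmod_csinc_sq_le(1)[of "of_real x"] by simp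
    then have "(cmod (csinc (of_real x)))\<^sup>2 \<le> 2 / (1 + x\<^sup>2)" using p by (simp only: pos_le_divide_eq)
    then show "norm ((csinc (of_real x))\<^sup>2) \<le> norm (2 * inverse (1 + x\<^sup>2) :: real)" using p by (simp add: norm_power divide_inverse)
  qed
qed

lemma L1_exp_type_csinc_sq: "L1_exp_type (\<lambda>z. (csinc (z + of_real x))\<^sup>2)"
proof
  show "exp_type_at_most (2 * pi) (\<lambda>z. (csinc (z + of_real x))\<^sup>2)"
  proof (rule exp_type_at_most_shift)
    show "exp_type_at_most (2 * pi) (\<lambda>z. (csinc z)\<^sup>2)"
    proof (rule exp_type_at_mostI)
      show "cmod ((csinc z)\<^sup>2) \<le> 2 * exp (2 * pi * \<bar>Im z\<bar>)" for z
      proof -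
        have "(cmod (csinc z))\<^sup>2 * 1 \<le> (cmod (csinc z))\<^sup>2 * (1 + (cmod z)\<^sup>2)" by (intro mult_left_mono) auto
        then show ?thesis using cmod_csinc_sq_le(1)[of z] by (simp add: norm_power)
      qed
    qed (intro holomorphic_intros holomorphic_csinc, simp)
  qed simp
  have "integrable lborel (\<lambda>u. (csinc (of_real (x + 1 * u)))\<^sup>2)"
    using integrable_csinc_sq by (rule lborel_integrable_real_affine) simp
  then show "integrable lborel (\<lambda>u. (csinc (of_real u + of_real x))\<^sup>2)" by (simp add: add.commute)
qed

text \<open>The sum over the integers of a translate of \<open>csinc\<^sup>2\<close> equals its integral,
  hence does not depend on the translation.\<close>

lemma integral_csinc_sq: "(\<integral>x. (csinc (of_real x))\<^sup>2 \<partial>lborel) = 1"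
proof -
  have "((\<lambda>n::int. (csinc (of_int n + of_real 0))\<^sup>2) has_sum (\<integral>x. (csinc (of_real x + of_real 0))\<^sup>2 \<partial>lborel)) UNIV"
    by (rule L1_exp_type.has_sum_integers_integral[OF L1_exp_type_csinc_sq])
  moreover have "((\<lambda>n::int. (csinc (of_int n + of_real 0))\<^sup>2) has_sum 1) UNIV"
  proof -
    have "((\<lambda>n::int. (csinc (of_int n + of_real 0))\<^sup>2) has_sum 1) {0}"
      using has_sum_finite[of "{0::int}" "\<lambda>n. (csinc (of_int n + of_real 0))\<^sup>2"] by simp
    then show ?thesis
      by (rule has_sum_cong_neutral[THEN iffD1, rotated -1]) (auto simp: csinc_of_int)
  qed
  ultimately show ?thesis using has_sum_unique by fastforce
qed

lemma has_sum_csinc_sq: "((\<lambda>n::int. (csinc (of_int n + of_real x))\<^sup>2) has_sum 1) UNIV"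
proof -
  have "(\<integral>u. (csinc (of_real u + of_real x))\<^sup>2 \<partial>lborel) = (\<integral>u. (csinc (of_real (x + 1 * u)))\<^sup>2 \<partial>lborel)"
    by (intro Bochner_Integration.integral_cong refl) (simp add: add.commute)
  also have "\<dots> = 1"
    using lborel_integral_real_affine[of 1 "\<lambda>u. (csinc (of_real u))\<^sup>2" x] integral_csinc_sq by simp
  finally show ?thesis using L1_exp_type.has_sum_integers_integral[OF L1_exp_type_csinc_sq[of x]] by simp
qed

text \<open>The shifted squares of \<open>csinc\<close> sum to 1 at every real point; dividing by
  \<open>sin^2 (\<pi> x) / \<pi>^2\<close> gives the classical expansion.\<close>

lemma sums_inverse_squares_sin:
  fixes x :: real
  assumes x: "x \<notin> \<int>"
  shows "summable (\<lambda>n. 1 / (real (Suc n) - x)\<^sup>2)" "summable (\<lambda>n. 1 / (real (Suc n) + x)\<^sup>2)"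
    and "pi\<^sup>2 / (sin (pi * x))\<^sup>2 = 1 / x\<^sup>2 + (\<Sum>n. 1 / (real (Suc n) - x)\<^sup>2) + (\<Sum>n. 1 / (real (Suc n) + x)\<^sup>2)"
proof -
  define q where "q = (sin (pi * x))\<^sup>2 / pi\<^sup>2"
  have "sin (pi * x) \<noteq> 0" using x by (auto simp: sin_zero_iff_int2)
  then have q: "q \<noteq> 0" by (simp add: q_def)
  define t where "t = (\<lambda>n::int. 1 / (of_int n + x)\<^sup>2)"
  have term_eq: "(csinc (of_int n + of_real x))\<^sup>2 = of_real (q * t n)" for n
  proof -
    have "x \<noteq> of_int (- n)" using x by (metis Ints_of_int)
    then have ne: "complex_of_real x \<noteq> of_int (- n)" by (metis of_real_eq_iff of_real_of_int_eq)
    have "(csinc (of_int n + of_real x))\<^sup>2 = (csinc (of_real x - of_int (- n)))\<^sup>2" by (simp add: add.commute)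
    also have "\<dots> = of_real ((sin (pi * x))\<^sup>2 / (pi * (of_int n + x))\<^sup>2)"
      unfolding csinc_sq_shift[OF ne] by (simp add: add.commute flip: sin_of_real)
    also have "(sin (pi * x))\<^sup>2 / (pi * (of_int n + x))\<^sup>2 = q * t n" by (simp add: q_def t_def power_mult_distrib)
    finally show ?thesis .
  qed
  have "(\<lambda>N. \<Sum>n\<in>{- int N..int N}. complex_of_real (q * t n)) \<longlonglongrightarrow> 1"
    using has_sum_int_tendsto[OF has_sum_csinc_sq[of x]] unfolding term_eq .
  then have "(\<lambda>N. complex_of_real (q * (\<Sum>n\<in>{- int N..int N}. t n))) \<longlonglongrightarrow> of_real 1"
    unfolding of_real_sum[symmetric] sum_distrib_left by simp
  then have "(\<lambda>N. q * (\<Sum>n\<in>{- int N..int N}. t n)) \<longlonglongrightarrow> 1" by (simp only: tendsto_of_real_iff)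
  then have "(\<lambda>N. q * (\<Sum>n\<in>{- int N..int N}. t n) / q - t 0) \<longlonglongrightarrow> 1 / q - t 0"
    using q by (intro tendsto_divide tendsto_diff tendsto_const)
  then have "(\<lambda>N. (\<Sum>n<N. t (int (Suc n)) + t (- int (Suc n)))) \<longlonglongrightarrow> 1 / q - t 0"
    unfolding sum_int_symmetric using q by simp
  then have s: "(\<lambda>n. t (int (Suc n)) + t (- int (Suc n))) sums (1 / q - t 0)" by (simp only: sums_def)
  have tn: "t (int (Suc n)) = 1 / (real (Suc n) + x)\<^sup>2" "t (- int (Suc n)) = 1 / (real (Suc n) - x)\<^sup>2" for n
    unfolding t_def by (simp_all add: power2_commute[of "real (Suc n)"] algebra_simps del: of_nat_Suc)
  have nn: "t n \<ge> 0" for n by (simp add: t_def)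
  show s1: "summable (\<lambda>n. 1 / (real (Suc n) - x)\<^sup>2)" unfolding tn[symmetric]
    by (rule summable_comparison_test'[OF sums_summable[OF s]]) (use nn in \<open>simp add: add_increasing\<close>)
  show s2: "summable (\<lambda>n. 1 / (real (Suc n) + x)\<^sup>2)" unfolding tn[symmetric]
    by (rule summable_comparison_test'[OF sums_summable[OF s]]) (use nn in \<open>simp add: add_increasing2\<close>)
  have "(\<lambda>n. t (int (Suc n)) + t (- int (Suc n))) sums ((\<Sum>n. 1 / (real (Suc n) + x)\<^sup>2) + (\<Sum>n. 1 / (real (Suc n) - x)\<^sup>2))"
    unfolding tn by (intro sums_add summable_sums s1 s2)
  from sums_unique2[OF s this] show "pi\<^sup>2 / (sin (pi * x))\<^sup>2 = 1 / x\<^sup>2 + (\<Sum>n. 1 / (real (Suc n) - x)\<^sup>2) + (\<Sum>n. 1 / (real (Suc n) + x)\<^sup>2)"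
    by (simp add: q_def t_def)
qed

section \<open>The lower inequality for narrow Gaussians, node by node\<close>

lemma exp_minus_ge_rational: "t \<ge> 0 \<Longrightarrow> (2 - t) \<le> (2 + t) * exp (- t)" for t :: real
proof -
  assume t: "t \<ge> 0"
  define f where "f = (\<lambda>t::real. (2 + t) * exp (- t) - (2 - t))"
  have "f 0 \<le> f t"
  proof (rule DERIV_nonneg_imp_nondecreasing[OF t])
    fix u :: real assume u: "0 \<le> u" "u \<le> t"
    have "(f has_real_derivative (1 - (1 + u) * exp (- u))) (at u)"
      unfolding f_def by (auto intro!: derivative_eq_intros simp: algebra_simps)
    moreover have "(1 + u) * exp (- u) \<le> exp u * exp (- u)" by (intro mult_right_mono exp_ge_add_one_self) auto
    then have "(1 + u) * exp (- u) \<le> 1" by (simp add: exp_minus)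
    ultimately show "\<exists>y. (f has_real_derivative y) (at u) \<and> 0 \<le> y" by (intro exI[of _ "1 - (1 + u) * exp (- u)"]) simp
  qed
  then show ?thesis by (simp add: f_def)
qed

lemma exp_minus_le_quadratic: "t \<ge> 0 \<Longrightarrow> exp (- t) * (1 + t + t\<^sup>2 / 2) \<le> 1" for t :: real
proof -
  assume t: "t \<ge> 0"
  have "1 + t + t\<^sup>2 / 2 \<le> exp t" using exp_ge_Taylor[OF t, of 3] by (simp add: eval_nat_numeral)
  then have "exp (- t) * (1 + t + t\<^sup>2 / 2) \<le> exp (- t) * exp t" by (intro mult_left_mono) auto
  then show ?thesis by (simp add: exp_minus)
qed

text \<open>With the right-hand side factored out the claim is
  \<open>exp (- c) (1 + p) \<le> 1\<close>. For nodes beyond \<open>x\<close> the quadratic minorant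
  of \<open>exp c\<close> suffices; for nodes below \<open>x\<close>, where \<open>p\<close> is
  negative, the rational bound \<open>(2 - t) / (2 + t) \<le> exp (- t)\<close> is used. By
  \<open>a \<ge> 4\<close> both come down to polynomial inequalities in the distance. Nodes beyond
  \<open>x\<close> require \<open>x \<ge> 1\<close>, since the share of the origin slope in
  \<open>p\<close> blows up like \<open>1 / x\<close>.\<close>

lemma minor_term_le_direct:
  assumes a: "a \<ge> 4" and x: "x > 0" and n: "n \<ge> 1" "real n \<noteq> x" "x \<ge> 1 \<or> real n < x"
  shows "minor_term a x n \<le> exp (- (a * x\<^sup>2 / 2)) / (real n - x)\<^sup>2"
proof -
  define m where "m = real n"
  have m: "m \<ge> 1" "m \<noteq> x" using n by (auto simp: m_def)
  define c where "c = a * (m\<^sup>2 - x\<^sup>2) / 2"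
  define p where "p = a * m\<^sup>2 * (m - x) / x"
  have eq: "minor_term a x n = exp (- (a * x\<^sup>2 / 2)) / (m - x)\<^sup>2 * (exp (- c) * (1 + p))"
  proof -
    have "exp (- (a * m\<^sup>2 / 2)) = exp (- (a * x\<^sup>2 / 2)) * exp (- c)"
      unfolding exp_add[symmetric] c_def by (simp add: field_simps)
    moreover have "1 / (m - x)\<^sup>2 + a * m\<^sup>2 / (x * (m - x)) = 1 / (m - x)\<^sup>2 * (1 + p)"
    proof -
      have "u * d / x * (1 / d\<^sup>2) = u / (x * d)" if "d \<noteq> 0" for u d :: real using that x by (simp add: power2_eq_square)
      from this[of "m - x" "a * m\<^sup>2"] show ?thesis unfolding p_def using m by (simp add: algebra_simps)
    qed
    ultimately show ?thesis unfolding minor_term_def m_def[symmetric] by simp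
  qed
  have "exp (- c) * (1 + p) \<le> 1"
  proof (cases "m > x")
    case True
    then have x1: "x \<ge> 1" using n(3) by (simp add: m_def)
    define d where "d = m - x"
    have d: "d > 0" "m = x + d" using True by (auto simp: d_def)
    have c0: "c \<ge> 0" unfolding c_def using a x True by (intro divide_nonneg_pos mult_nonneg_nonneg) (auto simp: power_mono)
    have "p \<le> c + c\<^sup>2 / 2"
    proof -
      have "2 * m\<^sup>2 \<le> x * (m + x) * (1 + d * (m + x))"
      proof -
        have "x * (m + x) * (1 + d * (m + x)) - 2 * m\<^sup>2 = 4 * x * d * (x\<^sup>2 - 1) + x * d + d\<^sup>2 * (4 * x\<^sup>2 - 2) + x * d ^ 3"
          unfolding d(2) by (simp add: algebra_simps eval_nat_numeral)
        moreover have "x\<^sup>2 \<ge> 1" using x1 by (simp add: one_le_power)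
        ultimately show ?thesis using d x by (smt (verit) mult_nonneg_nonneg zero_le_power2 zero_le_power)
      qed
      also have "\<dots> \<le> x * (m + x) * (1 + c / 2)"
      proof -
        have "4 * (d * (m + x)) \<le> a * (d * (m + x))" using a d x m by (intro mult_right_mono) auto
        then have "d * (m + x) \<le> c / 2" unfolding c_def d_def by (simp add: power2_eq_square algebra_simps)
        then show ?thesis using x m by (intro mult_left_mono add_left_mono) auto
      qed
      finally have k: "2 * m\<^sup>2 \<le> x * (m + x) * (1 + c / 2)" .
      have "p = a * d / (2 * x) * (2 * m\<^sup>2)" unfolding p_def d_def using x by simp
      also have "\<dots> \<le> a * d / (2 * x) * (x * (m + x) * (1 + c / 2))" using a d x by (intro mult_left_mono k) auto
      also have "\<dots> = c * (1 + c / 2)" unfolding c_def d_def using x by (simp add: field_simps power2_eq_square)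
      also have "\<dots> = c + c\<^sup>2 / 2" by (simp add: algebra_simps power2_eq_square)
      finally show ?thesis .
    qed
    then have "exp (- c) * (1 + p) \<le> exp (- c) * (1 + c + c\<^sup>2 / 2)" by (intro mult_left_mono) auto
    then show ?thesis using exp_minus_le_quadratic[OF c0] by linarith
  next
    case False
    define d where "d = x - m"
    have d: "d > 0" "x = m + d" using False m by (auto simp: d_def)
    define t where "t = - c"
    have t: "t = a * d * (2 * m + d) / 2" unfolding t_def c_def d(2) by (simp add: field_simps power2_eq_square)
    have t0: "t \<ge> 0" unfolding t using a d m by simp
    have k: "t \<le> - p * (1 + t / 2)"
    proof -
      have "x * (2 * m + d) \<le> 2 * m\<^sup>2 * (1 + t / 2)"
      proof -
        have "4 * (d * (2 * m + d)) \<le> a * (d * (2 * m + d))" using a d m by (intro mult_right_mono) auto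
        then have "d * (2 * m + d) \<le> t / 2" unfolding t by (simp add: algebra_simps)
        then have "2 * m\<^sup>2 * (1 + d * (2 * m + d)) \<le> 2 * m\<^sup>2 * (1 + t / 2)" by (intro mult_left_mono) auto
        moreover have "2 * m\<^sup>2 * (1 + d * (2 * m + d)) - x * (2 * m + d) = m * d * (4 * m\<^sup>2 - 3) + d\<^sup>2 * (2 * m\<^sup>2 - 1)"
          unfolding d(2) by (simp add: algebra_simps eval_nat_numeral)
        moreover have "m\<^sup>2 \<ge> 1" using m by (simp add: one_le_power)
        ultimately show ?thesis using d m by (smt (verit) mult_nonneg_nonneg zero_le_power2)
      qed
      then have "a * d / (2 * x) * (x * (2 * m + d)) \<le> a * d / (2 * x) * (2 * m\<^sup>2 * (1 + t / 2))"
        using a d x by (intro mult_left_mono) auto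
      moreover have "a * d / (2 * x) * (x * (2 * m + d)) = t" unfolding t using x by simp
      moreover have "a * d / (2 * x) * (2 * m\<^sup>2 * (1 + t / 2)) = - p * (1 + t / 2)" unfolding p_def d_def using x by (simp add: field_simps)
      ultimately show ?thesis by simp
    qed
    have "(1 + p) * (2 + t) \<le> 2 - t" using k by (simp add: algebra_simps)
    also have "\<dots> \<le> (2 + t) * exp (- t)" by (rule exp_minus_ge_rational[OF t0])
    finally have "(2 + t) * (1 + p) \<le> (2 + t) * exp (- t)" by (simp add: mult.commute)
    then have "1 + p \<le> exp (- t)" using t0 by (simp only: mult_le_cancel_left)
    then have "exp t * (1 + p) \<le> exp t * exp (- t)" by (intro mult_left_mono) auto
    then show ?thesis by (simp add: t_def exp_minus)
  qed
  then have "exp (- (a * x\<^sup>2 / 2)) / (m - x)\<^sup>2 * (exp (- c) * (1 + p)) \<le> exp (- (a * x\<^sup>2 / 2)) / (m - x)\<^sup>2 * 1"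
    by (intro mult_left_mono) auto
  then show ?thesis unfolding eq m_def by simp
qed

lemma minor_sum_le_direct_ge_1:
  assumes a: "a \<ge> 4" and x: "x \<ge> 1" "x \<notin> \<int>"
  shows "minor_sum a x \<le> exp (- (a * x\<^sup>2 / 2)) * pi\<^sup>2 / (sin (pi * x))\<^sup>2"
proof -
  let ?g = "exp (- (a * x\<^sup>2 / 2))"
  note P = sums_inverse_squares_sin[OF x(2)]
  have xn: "real n \<noteq> x" for n using x(2) by auto
  have "minor_sum a x \<le> (\<Sum>n. ?g * (1 / (real (Suc n) - x)\<^sup>2))"
    unfolding minor_sum_def using minor_term_le_direct[OF a, of x] xn x a
    by (intro suminf_le summable_minor_term summable_mult P(1)) (auto simp del: of_nat_Suc)
  also have "\<dots> = ?g * (\<Sum>n. 1 / (real (Suc n) - x)\<^sup>2)" by (rule suminf_mult[OF P(1)])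
  also have "\<dots> \<le> ?g * (pi\<^sup>2 / (sin (pi * x))\<^sup>2)"
    unfolding P(3) using suminf_nonneg[OF P(2)] by (intro mult_left_mono) auto
  finally show ?thesis by simp
qed

text \<open>For \<open>x < 1\<close> the origin slope makes this node exceed its own pole, and the
  pole \<open>1 / x^2\<close> has to help. For \<open>x \<le> 1/2\<close> a surplus of 1/10 is
  retained, to absorb the nodes from 2 on, which carry a factor \<open>1 / x\<close>.\<close>

lemma minor_term_1_le:
  assumes a: "a \<ge> 4" and x: "0 < x" "x < 1"
  shows "minor_term a x 1 \<le> exp (- (a * x\<^sup>2 / 2)) * (1 / x\<^sup>2 + 1 / (1 - x)\<^sup>2 - (if x \<le> 1/2 then 1/10 else 0) / (x\<^sup>2 * (1 - x)\<^sup>2))"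
proof -
  \<comment> \<open>The exponent \<open>a (1 - x^2) / 2\<close> is split into \<open>2 y\<close>,
    its value at \<open>a = 4\<close>, and a surplus \<open>s\<close> that pays for the growth of
    the prefactor with \<open>a\<close>.\<close>
  define y where "y = 1 - x\<^sup>2"
  define s where "s = (a - 4) * y / 2"
  define Q where "Q = 1 + 2 * y + 2 * y\<^sup>2"
  define \<delta> where "\<delta> = (if x \<le> 1/2 then 1/10 else 0 :: real)"
  have x2: "x\<^sup>2 \<le> 1" using x by (simp add: power_le_one)
  have y: "y \<ge> 0" using x2 by (simp add: y_def)
  have s: "s \<ge> 0" using a y by (simp add: s_def)
  have Q: "Q > 0" using y by (simp add: Q_def add_pos_nonneg)
  define N where "N = exp (- (2 * y + s)) * (x\<^sup>2 + a * x * (1 - x))"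
  have eq: "minor_term a x 1 = exp (- (a * x\<^sup>2 / 2)) * (N / (x\<^sup>2 * (1 - x)\<^sup>2))"
  proof -
    have "exp (- (a * 1\<^sup>2 / 2)) = exp (- (a * x\<^sup>2 / 2)) * exp (- (2 * y + s))"
      unfolding exp_add[symmetric] s_def y_def by (simp add: field_simps)
    moreover have "1 / (1 - x)\<^sup>2 + a * 1\<^sup>2 / (x * (1 - x)) = (x\<^sup>2 + a * x * (1 - x)) / (x\<^sup>2 * (1 - x)\<^sup>2)"
    proof -
      have "1 / d\<^sup>2 + a / (x * d) = (x\<^sup>2 + a * x * d) / (x\<^sup>2 * d\<^sup>2)" if "d \<noteq> 0" for d
        using that x by (simp add: field_simps power2_eq_square)
      from this[of "1 - x"] show ?thesis using x by simp
    qed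
    ultimately show ?thesis unfolding minor_term_def N_def by simp
  qed
  have "N \<le> 1 - 2 * x + 2 * x\<^sup>2 - \<delta>"
  proof -
    have "x\<^sup>2 + a * x * (1 - x) \<le> x * (4 - 3 * x) * (1 + s)"
    proof -
      have "x * (4 - 3 * x) * (1 + s) - (x\<^sup>2 + a * x * (1 - x)) = (a - 4) * x * (1 - x)\<^sup>2 * (2 + 3 * x) / 2"
        unfolding s_def y_def by (simp add: field_simps power2_eq_square)
      moreover have "(a - 4) * x * (1 - x)\<^sup>2 * (2 + 3 * x) / 2 \<ge> 0" using a x by simp
      ultimately show ?thesis by linarith
    qed
    then have "N \<le> exp (- (2 * y + s)) * (x * (4 - 3 * x) * (1 + s))" unfolding N_def by (intro mult_left_mono) auto
    also have "\<dots> = exp (- 2 * y) * (x * (4 - 3 * x)) * (exp (- s) * (1 + s))"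
      by (simp add: exp_add[symmetric] exp_diff exp_minus field_simps)
    also have "\<dots> \<le> exp (- 2 * y) * (x * (4 - 3 * x)) * 1"
    proof (rule mult_left_mono)
      have "exp (- s) * (1 + s) \<le> exp (- s) * (1 + s + s\<^sup>2 / 2)" by (intro mult_left_mono) auto
      then show "exp (- s) * (1 + s) \<le> 1" using exp_minus_le_quadratic[OF s] by linarith
      show "0 \<le> exp (- 2 * y) * (x * (4 - 3 * x))" using x by simp
    qed
    also have "\<dots> \<le> (1 / Q) * (x * (4 - 3 * x))"
    proof -
      have "exp (- (2 * y)) * Q \<le> 1" using exp_minus_le_quadratic[of "2 * y"] y by (simp add: Q_def power_mult_distrib)
      then have "exp (- 2 * y) \<le> 1 / Q" using Q by (simp add: pos_le_divide_eq)
      then show ?thesis using x by (simp only: mult_1_right) (intro mult_right_mono, auto)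
    qed
    also have "\<dots> \<le> 1 - 2 * x + 2 * x\<^sup>2 - \<delta>"
    proof (cases "x \<le> 1/2")
      case True
      have "x\<^sup>2 \<le> (1/2)\<^sup>2" using True x by (intro power_mono) auto
      then have y34: "y \<ge> 3/4" by (simp add: y_def power2_eq_square)
      then have "(3/4)\<^sup>2 \<le> y\<^sup>2" by (intro power_mono) auto
      then have Q36: "Q \<ge> 36/10" using y34 by (simp add: Q_def power2_eq_square)
      have "0 \<le> (1/2 - x) * (5/2 - 3 * x)" using True x by simp
      moreover have "(1/2 - x) * (5/2 - 3 * x) = 5/4 - x * (4 - 3 * x)" by (simp add: field_simps)
      ultimately have "x * (4 - 3 * x) \<le> 5/4" by linarith
      then have "x * (4 - 3 * x) \<le> (36/10) * (4/10)" by simp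
      also have "\<dots> \<le> Q * (4/10)" using Q36 by (intro mult_right_mono) auto
      finally have "(1 / Q) * (x * (4 - 3 * x)) \<le> 4/10" using Q by (simp add: pos_divide_le_eq mult.commute)
      moreover have "0 \<le> 2 * (x - 1/2)\<^sup>2" by simp
      then have "1/2 \<le> 1 - 2 * x + 2 * x\<^sup>2" by (simp add: algebra_simps power2_eq_square)
      ultimately show ?thesis using True by (simp add: \<delta>_def)
    next
      case False
      define t where "t = 1 - x"
      have t: "0 < t" "t \<le> 1/2" "x = 1 - t" using False x by (auto simp: t_def)
      have "(1 - 2 * x + 2 * x\<^sup>2) * Q - x * (4 - 3 * x) = t\<^sup>2 * (3 - 12 * t + 30 * t\<^sup>2 - 20 * t ^ 3 + 4 * t ^ 4)"
        unfolding Q_def y_def t(3) by (simp add: algebra_simps eval_nat_numeral)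
      moreover have "0 \<le> 3 - 12 * t + 30 * t\<^sup>2 - 20 * t ^ 3 + 4 * t ^ 4"
      proof -
        have "t\<^sup>2 * t \<le> t\<^sup>2 * (1/2)" using t by (intro mult_left_mono) auto
        then have "t ^ 3 \<le> t\<^sup>2 / 2" by (simp add: eval_nat_numeral)
        moreover have "0 \<le> 20 * (t - 3/10)\<^sup>2" by simp
        then have "0 \<le> 20 * t\<^sup>2 - 12 * t + 18/10" by (simp add: algebra_simps power2_eq_square)
        moreover have "0 \<le> t ^ 4" using t by simp
        ultimately show ?thesis by linarith
      qed
      ultimately have "x * (4 - 3 * x) \<le> (1 - 2 * x + 2 * x\<^sup>2) * Q" using t by (smt (verit) mult_nonneg_nonneg zero_le_power2)
      then show ?thesis using Q False by (simp add: \<delta>_def pos_divide_le_eq)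
    qed
    finally show ?thesis .
  qed
  then have "N / (x\<^sup>2 * (1 - x)\<^sup>2) \<le> (1 - 2 * x + 2 * x\<^sup>2 - \<delta>) / (x\<^sup>2 * (1 - x)\<^sup>2)" by (intro divide_right_mono) auto
  also have "\<dots> = 1 / x\<^sup>2 + 1 / (1 - x)\<^sup>2 - \<delta> / (x\<^sup>2 * (1 - x)\<^sup>2)"
  proof -
    have "(d\<^sup>2 + x\<^sup>2 - \<delta>) / (x\<^sup>2 * d\<^sup>2) = 1 / x\<^sup>2 + 1 / d\<^sup>2 - \<delta> / (x\<^sup>2 * d\<^sup>2)" if "d \<noteq> 0" for d
      using that x by (simp add: diff_divide_distrib add_divide_distrib)
    from this[of "1 - x"] show ?thesis using x by (simp add: power2_eq_square algebra_simps)
  qed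
  finally show ?thesis unfolding eq \<delta>_def by (intro mult_left_mono) auto
qed

text \<open>The bound is the one for \<open>a = 4\<close>. With \<open>b = a / 2\<close>, the
  surplus \<open>b - 2\<close> is absorbed by the exponential because
  \<open>n^2 - 1 \<ge> 1\<close>.\<close>

lemma minor_term_ge_2_le:
  assumes a: "a \<ge> 4" and x: "0 < x" "x < 1" and n: "n \<ge> 2"
  shows "minor_term a x n \<le> exp (- (a * x\<^sup>2 / 2)) / x * ((1 + 8 * real n) * exp (- 2 * ((real n)\<^sup>2 - 1)))"
proof -
  define m where "m = real n"
  have m: "m \<ge> 2" using n by (simp add: m_def)
  define b where "b = a / 2"
  have b: "b \<ge> 2" using a by (simp add: b_def)
  have "m - x \<ge> 1" using m x by simp
  then have "1 / (m - x)\<^sup>2 \<le> 1" by simp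
  also have "1 \<le> 1 / x" using x by simp
  finally have 1: "1 / (m - x)\<^sup>2 \<le> 1 / x" .
  have "m * m \<le> m * (2 * (m - x))" using m x by (intro mult_left_mono) auto
  then have "m\<^sup>2 / (m - x) \<le> 2 * m" using \<open>m - x \<ge> 1\<close> by (simp add: pos_divide_le_eq power2_eq_square mult_ac)
  then have "a / x * (m\<^sup>2 / (m - x)) \<le> a / x * (2 * m)" using a x by (intro mult_left_mono) auto
  then have 2: "a * m\<^sup>2 / (x * (m - x)) \<le> 1 / x * (2 * a * m)" by (simp add: mult_ac)
  have "minor_term a x n \<le> exp (- (a * m\<^sup>2 / 2)) * (1 / x + 1 / x * (2 * a * m))"
    unfolding minor_term_def m_def[symmetric] using 1 2 by (intro mult_left_mono add_mono) auto
  also have "\<dots> = 1 / x * ((1 + 4 * b * m) * exp (- (a * m\<^sup>2 / 2)))" by (simp add: b_def algebra_simps)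
  also have "\<dots> \<le> 1 / x * (exp (- (a * x\<^sup>2 / 2)) * ((1 + 8 * m) * exp (- 2 * (m\<^sup>2 - 1))))"
  proof (rule mult_left_mono)
    have m2: "m\<^sup>2 - 1 \<ge> 1" using power_mono[of 2 m 2] m by (simp add: power2_eq_square)
    have "m * (b * 4) \<le> m * (8 * (b - 1))" using m b by (intro mult_left_mono) auto
    then have "1 + 4 * b * m \<le> (1 + 8 * m) * (1 + (b - 2))" using b by (simp add: algebra_simps)
    also have "\<dots> \<le> (1 + 8 * m) * exp ((b - 2) * (m\<^sup>2 - 1))"
    proof (rule mult_left_mono)
      have "1 + (b - 2) \<le> exp (b - 2)" by (rule exp_ge_add_one_self)
      also have "b - 2 \<le> (b - 2) * (m\<^sup>2 - 1)" using mult_left_mono[OF m2, of "b - 2"] b by simp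
      finally show "1 + (b - 2) \<le> exp ((b - 2) * (m\<^sup>2 - 1))" by simp
    qed (use m in simp)
    finally have "(1 + 4 * b * m) * exp (- (a * m\<^sup>2 / 2)) \<le> (1 + 8 * m) * exp ((b - 2) * (m\<^sup>2 - 1)) * exp (- (a * m\<^sup>2 / 2))"
      by (rule mult_right_mono) simp
    also have "\<dots> = (1 + 8 * m) * exp (- 2 * (m\<^sup>2 - 1)) * exp (- b)"
      unfolding mult.assoc exp_add[symmetric] by (simp add: b_def algebra_simps)
    also have "\<dots> \<le> (1 + 8 * m) * exp (- 2 * (m\<^sup>2 - 1)) * exp (- (a * x\<^sup>2 / 2))"
    proof (rule mult_left_mono)
      have "a * x\<^sup>2 \<le> a * 1" using a x by (intro mult_left_mono power_le_one) auto
      then show "exp (- b) \<le> exp (- (a * x\<^sup>2 / 2))" by (simp add: b_def)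
    qed (use m in simp)
    finally show "(1 + 4 * b * m) * exp (- (a * m\<^sup>2 / 2)) \<le> exp (- (a * x\<^sup>2 / 2)) * ((1 + 8 * m) * exp (- 2 * (m\<^sup>2 - 1)))"
      by (simp only: mult_ac)
  qed (use x in simp)
  finally show ?thesis by (simp add: m_def)
qed

lemma summable_tail_numeric:
  shows "summable (\<lambda>k. (1 + 8 * real (k + 2)) * exp (- 2 * ((real (k + 2))\<^sup>2 - 1)))"
    and "(\<Sum>k. (1 + 8 * real (k + 2)) * exp (- 2 * ((real (k + 2))\<^sup>2 - 1))) \<le> 1/20"
proof -
  let ?f = "\<lambda>k. (1 + 8 * real (k + 2)) * exp (- 2 * ((real (k + 2))\<^sup>2 - 1))"
  have b: "?f k \<le> (9 * exp (- 6)) * exp (- 7 * real k)" if "k \<ge> 1" for k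
  proof -
    define m where "m = real (k + 2)"
    have m: "m \<ge> 3" using that by (simp add: m_def)
    have "0 \<le> (m - 1) * (m - 3)" using m by simp
    then have m2: "4 * m - 4 \<le> m\<^sup>2 - 1" by (simp add: algebra_simps power2_eq_square)
    have "m \<le> exp m" using exp_ge_add_one_self[of m] by linarith
    then have "1 + 8 * m \<le> 9 * exp m" using m by linarith
    then have "?f k \<le> (9 * exp m) * exp (- 2 * (4 * m - 4))" unfolding m_def[symmetric] using m2 m by (intro mult_mono) auto
    also have "\<dots> = (9 * exp (- 6)) * exp (- 7 * real k)" unfolding mult.assoc exp_add[symmetric] by (simp add: m_def algebra_simps)
    finally show ?thesis .
  qed
  show s: "summable ?f"
  proof (rule summable_comparison_test)
    have "summable (\<lambda>k. (9 * exp (- 6)) * (exp (- 7) ^ k) :: real)" by (intro summable_mult summable_geometric) simp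
    moreover have "exp (- 7 * real k) = exp (- 7) ^ k" for k
      using exp_of_nat_mult[of k "- 7 :: real"] by (simp add: mult.commute)
    ultimately show "summable (\<lambda>k. (9 * exp (- 6)) * exp (- 7 * real k))" by simp
    show "\<exists>N. \<forall>k\<ge>N. norm (?f k) \<le> (9 * exp (- 6)) * exp (- 7 * real k)" using b by (intro exI[of _ 1]) (auto simp del: of_nat_add)
  qed
  have "suminf ?f \<le> (\<Sum>k<1. ?f k) + (9 * exp (- 6)) * exp (- 7 * real 1) / (1 - exp (- 7))"
    by (rule suminf_le_geometric[OF s b]) auto
  also have "(\<Sum>k<1. ?f k) = 17 * exp (- 6)" by simp
  also have "17 * exp (- 6) + (9 * exp (- 6)) * exp (- 7 * real 1) / (1 - exp (- 7)) \<le> 1/20"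
  proof -
    have "exp (- 6 :: real) = exp (- 4) * exp (- 2)" unfolding exp_add[symmetric] by simp
    also have "\<dots> \<le> (185/10000) * (1355/10000)" by (intro mult_mono exp_numeric) auto
    finally have e6: "exp (- 6 :: real) \<le> 251/100000" by simp
    have "exp (- 7 :: real) \<le> exp (- 4)" by simp
    then have e7: "exp (- 7 :: real) \<le> 185/10000" using exp_numeric(5) by linarith
    have "exp (- 7) / (1 - exp (- 7)) \<le> (185/10000) / (1 - 185/10000 :: real)" using e7 by (intro frac_le) auto
    then have "exp (- 7) / (1 - exp (- 7)) \<le> (1/50 :: real)" by (rule order_trans) simp
    then have "(9 * exp (- 6)) * (exp (- 7) / (1 - exp (- 7))) \<le> (9 * (251/100000)) * (1/50 :: real)" using e6 e7 by (intro mult_mono) auto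
    then show ?thesis using e6 by simp
  qed
  finally show "suminf ?f \<le> 1/20" .
qed

text \<open>The nodes from 2 on add at most \<open>g / (20 x)\<close>. For
  \<open>x \<le> 1/2\<close> the surplus kept at node 1 covers this, for larger \<open>x\<close> the
  pole at -1 does, since \<open>1 / (1 + x)^2 \<ge> 1/4\<close>.\<close>

lemma minor_sum_le_direct_lt_1:
  assumes a: "a \<ge> 4" and x: "0 < x" "x < 1"
  shows "minor_sum a x \<le> exp (- (a * x\<^sup>2 / 2)) * pi\<^sup>2 / (sin (pi * x))\<^sup>2"
proof -
  define g where "g = exp (- (a * x\<^sup>2 / 2))"
  have g: "g > 0" by (simp add: g_def)
  have xZ: "x \<notin> \<int>" using x by (auto elim!: Ints_cases)
  note P = sums_inverse_squares_sin[OF xZ]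
  have sm: "summable (\<lambda>n. minor_term a x (Suc n))" using a x by (intro summable_minor_term) auto
  have "minor_sum a x = (\<Sum>k. minor_term a x (Suc (k + 1))) + (\<Sum>n<1. minor_term a x (Suc n))"
    unfolding minor_sum_def by (rule suminf_split_initial_segment[OF sm])
  also have "(\<Sum>k. minor_term a x (Suc (k + 1))) \<le> (\<Sum>k. g / x * ((1 + 8 * real (k + 2)) * exp (- 2 * ((real (k + 2))\<^sup>2 - 1))))"
  proof (intro suminf_le summable_mult summable_tail_numeric)
    show "minor_term a x (Suc (k + 1)) \<le> g / x * ((1 + 8 * real (k + 2)) * exp (- 2 * ((real (k + 2))\<^sup>2 - 1)))" for k
      using minor_term_ge_2_le[OF a x, of "k + 2"] by (simp add: g_def)
    show "summable (\<lambda>k. minor_term a x (Suc (k + 1)))" using sm by (subst summable_iff_shift)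
  qed
  also have "\<dots> = g / x * (\<Sum>k. (1 + 8 * real (k + 2)) * exp (- 2 * ((real (k + 2))\<^sup>2 - 1)))"
    by (rule suminf_mult[OF summable_tail_numeric(1)])
  also have "\<dots> \<le> g / x * (1/20)" using g x by (intro mult_left_mono summable_tail_numeric) auto
  finally have "minor_sum a x \<le> g / x * (1/20) + minor_term a x 1" by simp
  also have "\<dots> \<le> g / x * (1/20) + g * (1 / x\<^sup>2 + 1 / (1 - x)\<^sup>2 - (if x \<le> 1/2 then 1/10 else 0) / (x\<^sup>2 * (1 - x)\<^sup>2))"
    unfolding g_def by (intro add_left_mono minor_term_1_le a x)
  also have "\<dots> = g * (1 / x\<^sup>2 + 1 / (1 - x)\<^sup>2 + (1 / (20 * x) - (if x \<le> 1/2 then 1/10 else 0) / (x\<^sup>2 * (1 - x)\<^sup>2)))"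
    by (simp add: algebra_simps)
  also have "\<dots> \<le> g * (1 / x\<^sup>2 + 1 / (1 - x)\<^sup>2 + 1 / (1 + x)\<^sup>2)"
  proof (intro mult_left_mono add_left_mono)
    show "1 / (20 * x) - (if x \<le> 1/2 then 1/10 else 0) / (x\<^sup>2 * (1 - x)\<^sup>2) \<le> 1 / (1 + x)\<^sup>2"
    proof (cases "x \<le> 1/2")
      case True
      have "x\<^sup>2 * (1 - x)\<^sup>2 \<le> x\<^sup>2 * 1" using x by (intro mult_left_mono power_le_one) auto
      also have "\<dots> \<le> x * 2" using x by (simp add: power2_eq_square)
      finally have "(1/10) / (x * 2) \<le> (1/10) / (x\<^sup>2 * (1 - x)\<^sup>2)" using x by (intro divide_left_mono) auto
      moreover have "(1/10) / (x * 2) = 1 / (20 * x)" by simp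
      moreover have "0 \<le> 1 / (1 + x)\<^sup>2" by simp
      ultimately show ?thesis using True by (simp only: if_True)
    next
      case False
      have "1 / (20 * x) \<le> 1 / 10" using False x by (simp add: field_simps)
      moreover have "(1 + x)\<^sup>2 \<le> 2\<^sup>2" using x by (intro power_mono) auto
      then have "1 / 4 \<le> 1 / (1 + x)\<^sup>2" using x by (intro divide_left_mono) auto
      ultimately have "1 / (20 * x) \<le> 1 / (1 + x)\<^sup>2" by linarith
      then show ?thesis using False by simp
    qed
  qed (use g in simp)
  also have "\<dots> \<le> g * (pi\<^sup>2 / (sin (pi * x))\<^sup>2)"
  proof (rule mult_left_mono)
    have "1 / (1 - x)\<^sup>2 \<le> (\<Sum>n. 1 / (real (Suc n) - x)\<^sup>2)"
      using sum_le_suminf[OF P(1), of "{0}"] by simp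
    moreover have "1 / (1 + x)\<^sup>2 \<le> (\<Sum>n. 1 / (real (Suc n) + x)\<^sup>2)"
      using sum_le_suminf[OF P(2), of "{0}"] by simp
    ultimately show "1 / x\<^sup>2 + 1 / (1 - x)\<^sup>2 + 1 / (1 + x)\<^sup>2 \<le> pi\<^sup>2 / (sin (pi * x))\<^sup>2" unfolding P(3) by linarith
  qed (use g in simp)
  finally show ?thesis by (simp add: g_def)
qed

section \<open>The upper inequality for narrow Gaussians\<close>

lemma sin_ge_cubic:
  fixes s :: real assumes "0 \<le> s" "s\<^sup>2 \<le> 5/2"
  shows "s * (1 - 3 * s\<^sup>2 / 16) \<le> sin s"
proof -
  have "\<bar>sin s - (\<Sum>m<5. sin_coeff m * s ^ m)\<bar> \<le> inverse (fact 5) * \<bar>s\<bar> ^ 5" by (rule Maclaurin_sin_bound)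
  also have "(\<Sum>m<5. sin_coeff m * s ^ m) = s - s ^ 3 / 6"
  proof -
    have "{..<5} = {0, 1, 2, 3, 4 :: nat}" by auto
    moreover have "sin_coeff 0 = 0" "sin_coeff 1 = 1" "sin_coeff 2 = 0" "sin_coeff 3 = - 1 / 6" "sin_coeff 4 = 0"
      by (simp_all add: sin_coeff_def fact_numeral)
    ultimately show ?thesis by simp
  qed
  finally have "\<bar>sin s - (s - s ^ 3 / 6)\<bar> \<le> s ^ 5 / 120" using assms by (simp add: eval_nat_numeral)
  then have "s - s ^ 3 / 6 - s ^ 5 / 120 \<le> sin s" by linarith
  \<comment> \<open>The quintic term is charged to the cubic one:
    \<open>1/6 + (5/2) / 120 = 3/16\<close>.\<close>
  moreover have "s ^ 3 * s\<^sup>2 \<le> s ^ 3 * (5/2)" using assms by (intro mult_left_mono) auto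
  then have "s ^ 5 \<le> s ^ 3 * (5/2)" by (simp add: eval_nat_numeral)
  moreover have "s * (1 - 3 * s\<^sup>2 / 16) = s - 3 * s ^ 3 / 16" by (simp add: algebra_simps eval_nat_numeral)
  ultimately show ?thesis by linarith
qed

text \<open>186/100 bounds \<open>3 \<pi>^2 / 16\<close> from above, and
  \<open>\<pi>^2 / 4 \<le> 5/2\<close> brings \<open>\<pi> d\<close> into the range of the cubic
  bound.\<close>

lemma sin_pi_ge:
  assumes "\<bar>d\<bar> \<le> 1/2"
  shows "(pi * \<bar>d\<bar> * (1 - 186/100 * d\<^sup>2))\<^sup>2 \<le> (sin (pi * d))\<^sup>2" "1 - 186/100 * d\<^sup>2 \<ge> 1/2" "d\<^sup>2 \<le> 1/4"
    "pi * \<bar>d\<bar> * (1 - 186/100 * d\<^sup>2) \<le> \<bar>sin (pi * d)\<bar>"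
proof -
  have "\<bar>d\<bar>\<^sup>2 \<le> (1/2)\<^sup>2" using assms by (intro power_mono) auto
  then show d2: "d\<^sup>2 \<le> 1/4" by (simp add: power2_eq_square)
  then show 1: "1 - 186/100 * d\<^sup>2 \<ge> 1/2" by simp
  define s where "s = pi * \<bar>d\<bar>"
  have s0: "s \<ge> 0" by (simp add: s_def)
  have s2: "s\<^sup>2 = pi\<^sup>2 * d\<^sup>2" by (simp add: s_def power_mult_distrib)
  have "pi\<^sup>2 * d\<^sup>2 \<le> (9873/1000) * (1/4)" using pi_square_bounds(2) d2 by (intro mult_mono) auto
  then have "s\<^sup>2 \<le> 5/2" by (simp add: s2)
  then have "s * (1 - 3 * s\<^sup>2 / 16) \<le> sin s" by (rule sin_ge_cubic[OF s0])
  moreover have "pi\<^sup>2 * d\<^sup>2 \<le> (9873/1000) * d\<^sup>2" using pi_square_bounds(2) by (intro mult_right_mono) auto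
  then have "1 - 186/100 * d\<^sup>2 \<le> 1 - 3 * s\<^sup>2 / 16" unfolding s2 using zero_le_power2[of d] by linarith
  then have "s * (1 - 186/100 * d\<^sup>2) \<le> s * (1 - 3 * s\<^sup>2 / 16)" using s0 by (rule mult_left_mono)
  ultimately have "s * (1 - 186/100 * d\<^sup>2) \<le> sin s" by linarith
  moreover have "\<bar>sin (pi * d)\<bar> = \<bar>sin s\<bar>" by (simp add: s_def abs_if)
  ultimately show 3: "pi * \<bar>d\<bar> * (1 - 186/100 * d\<^sup>2) \<le> \<bar>sin (pi * d)\<bar>" by (simp only: s_def[symmetric])
  have "(pi * \<bar>d\<bar> * (1 - 186/100 * d\<^sup>2))\<^sup>2 \<le> \<bar>sin (pi * d)\<bar>\<^sup>2" using 3 1 by (intro power_mono) auto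
  then show "(pi * \<bar>d\<bar> * (1 - 186/100 * d\<^sup>2))\<^sup>2 \<le> (sin (pi * d))\<^sup>2" by simp
qed

text \<open>Nodes beyond \<open>x\<close> contribute nonnegatively. Those at least 1/2 below may be
  negative but are tiny: \<open>x \<le> 3 n (x - n)\<close> tames the quotient, and
  \<open>a \<ge> 36\<close> makes \<open>a n^2\<close> times the Gaussian factor at most
  \<open>4 exp (- 9 n)\<close>.\<close>

lemma minor_term_ge:
  assumes a: "a \<ge> 36" and x: "x > 0" and n: "n \<ge> 1" "real n > x \<or> x - real n \<ge> 1/2"
  shows "- (12 * exp (- 8 * real n)) / x\<^sup>2 \<le> minor_term a x n"
proof (cases "real n > x")
  case True
  have "0 \<le> minor_term a x n" unfolding minor_term_def using True a x by (intro mult_nonneg_nonneg add_nonneg_nonneg) auto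
  moreover have "- (12 * exp (- 8 * real n)) / x\<^sup>2 \<le> 0" by simp
  ultimately show ?thesis by linarith
next
  case False
  define m where "m = real n"
  have m: "m \<ge> 1" "x - m \<ge> 1/2" using n False by (auto simp: m_def)
  define u where "u = a * m\<^sup>2 / 2"
  have m2: "m\<^sup>2 \<ge> m" using m by (simp add: power2_eq_square)
  have "36 * m \<le> a * m\<^sup>2" using a m m2 by (intro mult_mono) auto
  then have u: "u \<ge> 18 * m" by (simp add: u_def)
  have "m * (1/2) \<le> m * (x - m)" using m by (intro mult_left_mono) auto
  moreover have "1 * (x - m) \<le> m * (x - m)" using m by (intro mult_right_mono) auto
  ultimately have xm: "x \<le> 3 * m * (x - m)" using m by (simp add: algebra_simps)
  have "u / 2 \<le> exp (u / 2)" using exp_ge_add_one_self[of "u / 2"] by linarith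
  then have "(2 * u) * exp (- u) \<le> (4 * exp (u / 2)) * exp (- u)" by (intro mult_right_mono) auto
  also have "\<dots> = 4 * exp (- (u / 2))" unfolding mult.assoc exp_add[symmetric] by simp
  also have "\<dots> \<le> 4 * exp (- 9 * m)" using u by simp
  finally have g: "a * m\<^sup>2 * exp (- u) \<le> 4 * exp (- 9 * m)" by (simp add: u_def)
  have "m \<le> exp m" using exp_ge_add_one_self[of m] by linarith
  have "x\<^sup>2 * - minor_term a x n = x\<^sup>2 * (exp (- u) * (a * m\<^sup>2 / (x * (x - m)) - 1 / (x - m)\<^sup>2))"
  proof -
    have "x * (m - x) = - (x * (x - m))" by (simp add: algebra_simps)
    moreover have "(m - x)\<^sup>2 = (x - m)\<^sup>2" by (rule power2_commute)
    moreover have "x\<^sup>2 * - (E * (P + - Q)) = x\<^sup>2 * (E * (Q - P))" for E P Q :: real by (simp add: algebra_simps)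
    ultimately show ?thesis unfolding minor_term_def m_def[symmetric] u_def by (simp only: divide_minus_right)
  qed
  also have "\<dots> \<le> x\<^sup>2 * (exp (- u) * (a * m\<^sup>2 / (x * (x - m))))" by (intro mult_left_mono) auto
  also have "\<dots> = (a * m\<^sup>2 * exp (- u)) * (x / (x - m))" using x by (simp add: power2_eq_square)
  also have "\<dots> \<le> (4 * exp (- 9 * m)) * (3 * m)"
    using xm m x by (intro mult_mono[OF g]) (auto simp: pos_divide_le_eq)
  also have "\<dots> \<le> (4 * exp (- 9 * m)) * (3 * exp m)" using \<open>m \<le> exp m\<close> by (intro mult_left_mono) auto
  also have "\<dots> = 12 * exp (- 8 * m)" by (simp add: exp_add[symmetric])
  finally have "x\<^sup>2 * - minor_term a x n \<le> 12 * exp (- 8 * m)" .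
  then have "- minor_term a x n \<le> 12 * exp (- 8 * m) / x\<^sup>2" using x by (simp add: pos_le_divide_eq mult.commute)
  then show ?thesis by (simp add: m_def)
qed

lemma tail_12_sums: "(\<lambda>n. 12 * exp (- 8 * real (Suc n))) sums (12 * exp (- 8) / (1 - exp (- 8)))"
  and tail_12_le: "12 * exp (- 8) / (1 - exp (- 8)) \<le> (1/100 :: real)"
proof -
  have "(\<lambda>n. (12 * exp (- 8)) * exp (- 8 :: real) ^ n) sums ((12 * exp (- 8)) * (1 / (1 - exp (- 8))))"
    by (intro sums_mult geometric_sums) simp
  moreover have "exp (- 8 * real (Suc n)) = exp (- 8) * exp (- 8) ^ n" for n
    using exp_of_nat_mult[of "Suc n" "- 8 :: real"] by (simp add: mult.commute)
  ultimately show "(\<lambda>n. 12 * exp (- 8 * real (Suc n))) sums (12 * exp (- 8) / (1 - exp (- 8)))"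
    by (simp only: mult.assoc times_divide_eq_right mult_1_right)
  have "12 * exp (- 8) / (1 - exp (- 8)) \<le> 12 * (1/2000) / (1 - 1/2000 :: real)"
    using exp_numeric(4) by (intro frac_le) auto
  also have "\<dots> \<le> 1/100" by simp
  finally show "12 * exp (- 8) / (1 - exp (- 8)) \<le> (1/100 :: real)" .
qed

text \<open>The singular term at the integer nearest to \<open>x\<close> cancels against the pole of
  \<open>\<pi>\<^sup>2 / sin\<^sup>2\<close> up to the second order Taylor remainder of \<open>u \<mapsto> u e\<^sup>-\<^sup>a\<^sup>u\<^sup>2\<^sup>/\<^sup>2\<close>.\<close>

lemma nearest_term_Taylor:
  assumes a: "a \<ge> 36" and x: "x \<ge> 1/2" and m: "m = real n" "n \<ge> 1" "\<bar>x - m\<bar> \<le> 1/2" "x \<noteq> m"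
  shows "x\<^sup>2 * (exp (- (a * x\<^sup>2 / 2)) / (m - x)\<^sup>2 - minor_term a x n) \<le> 47/100"
proof -
  define G where "G = (\<lambda>u. exp (- (a * u\<^sup>2 / 2)))"
  define D where "D = (\<lambda>k::nat. if k = 0 then (\<lambda>u. u * G u) else if k = 1 then (\<lambda>u. (1 - a * u\<^sup>2) * G u) else (\<lambda>u. a * u * (a * u\<^sup>2 - 3) * G u))"
  have dG: "(G has_real_derivative - (a * u) * G u) (at u)" for u
    unfolding G_def by (auto intro!: derivative_eq_intros)
  have DD: "(D k has_real_derivative D (Suc k) u) (at u)" if "k < 2" for k u
  proof -
    have "k = 0 \<or> k = 1" using that by linarith
    then show ?thesis
    proof (elim disjE, goal_cases)
      case 1
      have "((\<lambda>u. u * G u) has_real_derivative (1 * G u + - (a * u) * G u * u)) (at u)" by (intro DERIV_mult DERIV_ident dG)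
      also have "1 * G u + - (a * u) * G u * u = (1 - a * u\<^sup>2) * G u" by (simp add: algebra_simps power2_eq_square)
      finally show ?thesis using 1 by (simp add: D_def)
    next
      case 2
      have "((\<lambda>u. 1 - a * u\<^sup>2) has_real_derivative - (2 * a * u)) (at u)" by (auto intro!: derivative_eq_intros)
      from DERIV_mult[OF this dG] have "((\<lambda>u. (1 - a * u\<^sup>2) * G u) has_real_derivative (- (2 * a * u) * G u + - (a * u) * G u * (1 - a * u\<^sup>2))) (at u)" .
      also have "- (2 * a * u) * G u + - (a * u) * G u * (1 - a * u\<^sup>2) = a * u * (a * u\<^sup>2 - 3) * G u" by (simp add: algebra_simps)
      finally show ?thesis using 2 by (simp add: D_def)
    qed
  qed
  have "\<exists>t. (if x < m then x < t \<and> t < m else m < t \<and> t < x) \<and> D 0 x = (\<Sum>k<2. D k m / fact k * (x - m) ^ k) + D 2 t / fact 2 * (x - m) ^ 2"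
    using m by (intro Taylor[of 2 D "D 0" "min x m" "max x m"]) (auto simp: DD)
  then obtain t where t: "if x < m then x < t \<and> t < m else m < t \<and> t < x"
    and T: "D 0 x = (\<Sum>k<2. D k m / fact k * (x - m) ^ k) + D 2 t / fact 2 * (x - m) ^ 2" by blast
  have T': "x * G x = m * G m + (1 - a * m\<^sup>2) * G m * (x - m) + a * t * (a * t\<^sup>2 - 3) * G t / 2 * (x - m)\<^sup>2"
    using T by (simp add: D_def numeral_2_eq_2)
  have m1: "m \<ge> 1" using m by simp
  have tx: "t \<ge> 1/2" "x \<le> 3/2 * t" using t x m m1 by (auto split: if_splits)
  have "x\<^sup>2 * (G x / (m - x)\<^sup>2 - minor_term a x n) = x * (a * t * (a * t\<^sup>2 - 3) * G t / 2)"
  proof -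
    define d where "d = m - x"
    have d: "d \<noteq> 0" "x = m - d" using m by (auto simp: d_def)
    have "x\<^sup>2 * (G x / d\<^sup>2 - minor_term a x n) = x\<^sup>2 * (G x / d\<^sup>2 - G m * (1 / d\<^sup>2 + a * m\<^sup>2 / (x * d)))"
      unfolding minor_term_def m(1)[symmetric] G_def d_def ..
    also have "\<dots> = x * (x * G x - x * G m - a * m\<^sup>2 * d * G m) / d\<^sup>2"
      using d(1) x by (simp add: field_simps power2_eq_square)
    also have "x * G x - x * G m - a * m\<^sup>2 * d * G m = a * t * (a * t\<^sup>2 - 3) * G t / 2 * d\<^sup>2"
    proof -
      have "x - m = - d" by (simp add: d_def)
      then have "x * G x = m * G m + (1 - a * m\<^sup>2) * G m * (- d) + a * t * (a * t\<^sup>2 - 3) * G t / 2 * d\<^sup>2"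
        using T' by (simp only: power2_minus)
      moreover have "x * G m = m * G m - d * G m" using arg_cong[OF d(2), of "\<lambda>z. z * G m"] by (simp only: left_diff_distrib)
      moreover have "(1 - a * m\<^sup>2) * G m * (- d) = a * m\<^sup>2 * d * G m - d * G m" by (simp add: algebra_simps)
      ultimately show ?thesis by linarith
    qed
    also have "x * (a * t * (a * t\<^sup>2 - 3) * G t / 2 * d\<^sup>2) / d\<^sup>2 = x * (a * t * (a * t\<^sup>2 - 3) * G t / 2)" using d(1) by simp
    finally show ?thesis unfolding d_def .
  qed
  also have "\<dots> \<le> (3/2 * t) * (a * t * (a * t\<^sup>2 - 3) * G t / 2)"
  proof (rule mult_right_mono[OF tx(2)])
    have "(1/2)\<^sup>2 \<le> t\<^sup>2" using tx by (intro power_mono) auto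
    then have "36 * (1/4) \<le> a * t\<^sup>2" using a by (intro mult_mono) (auto simp: power2_eq_square)
    then show "0 \<le> a * t * (a * t\<^sup>2 - 3) * G t / 2" using a tx by (simp add: G_def)
  qed
  also have "\<dots> = 3/4 * ((a * t\<^sup>2) * (a * t\<^sup>2 - 3) * exp (- (a * t\<^sup>2 / 2)))" by (simp add: G_def power2_eq_square)
  \<comment> \<open>With \<open>v = a t^2 \<ge> 36 / 4\<close> the function
    \<open>v (v - 3) exp (- v / 2)\<close> is largest at \<open>v = 9\<close>, where the polynomial
    factor is 54.\<close>
  also have "\<dots> \<le> 3/4 * (54 * exp (- (9/2)))"
  proof (rule mult_left_mono)
    define h where "h = a * t\<^sup>2 - 9"
    have "(1/2)\<^sup>2 \<le> t\<^sup>2" using tx by (intro power_mono) auto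
    then have "36 * (1/4) \<le> a * t\<^sup>2" using a by (intro mult_mono) (auto simp: power2_eq_square)
    then have h: "h \<ge> 0" by (simp add: h_def)
    have at: "a * t\<^sup>2 = 9 + h" by (simp add: h_def)
    have "(9 + h) * (9 + h - 3) * exp (- ((9 + h) / 2)) = ((9 + h) * (6 + h) * exp (- (h / 2))) * exp (- (9/2))"
      by (simp add: exp_add[symmetric] add_divide_distrib mult.assoc)
    also have "\<dots> \<le> 54 * exp (- (9/2))"
    proof (rule mult_right_mono)
      have "(9 + h) * (6 + h) \<le> 54 * (1 + h / 2 + (h / 2)\<^sup>2 / 2)" using h by (simp add: field_simps power2_eq_square)
      then have "(9 + h) * (6 + h) * exp (- (h / 2)) \<le> 54 * (1 + h / 2 + (h / 2)\<^sup>2 / 2) * exp (- (h / 2))" by (rule mult_right_mono) simp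
      also have "\<dots> = 54 * (exp (- (h / 2)) * (1 + h / 2 + (h / 2)\<^sup>2 / 2))" by simp
      also have "\<dots> \<le> 54 * 1" using h by (intro mult_left_mono exp_minus_le_quadratic) auto
      finally show "(9 + h) * (6 + h) * exp (- (h / 2)) \<le> 54" by simp
    qed simp
    finally show "(a * t\<^sup>2) * (a * t\<^sup>2 - 3) * exp (- (a * t\<^sup>2 / 2)) \<le> 54 * exp (- (9/2))" unfolding at .
  qed simp
  also have "\<dots> \<le> 47/100" using exp_numeric(3) by simp
  finally show ?thesis by (simp add: G_def)
qed

text \<open>The constant 13 may be crude, since it later meets the factor
  \<open>x^2 g \<le> 185/10000\<close>.\<close>

lemma inverse_square_sin_le_nearest:
  assumes d: "\<bar>d\<bar> \<le> 1/2" "d \<noteq> 0"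
  shows "pi\<^sup>2 / (sin (pi * d))\<^sup>2 \<le> 1 / d\<^sup>2 + 13"
proof -
  define v where "v = d\<^sup>2"
  have v: "0 < v" "v \<le> 1/4" using sin_pi_ge(3)[OF d(1)] d by (auto simp: v_def)
  define r where "r = 1 - 186/100 * v"
  have r: "r \<ge> 1/2" using v by (simp add: r_def)
  have "pi\<^sup>2 * (v * r\<^sup>2) \<le> (sin (pi * d))\<^sup>2"
    using sin_pi_ge(1)[OF d(1)] by (simp add: v_def r_def power_mult_distrib mult.assoc)
  moreover have "0 < pi\<^sup>2 * (v * r\<^sup>2)" using v r by simp
  ultimately have "pi\<^sup>2 / (sin (pi * d))\<^sup>2 \<le> pi\<^sup>2 / (pi\<^sup>2 * (v * r\<^sup>2))"
    by (intro divide_left_mono) (auto intro!: mult_pos_pos)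
  also have "\<dots> = 1 / (v * r\<^sup>2)" by simp
  also have "\<dots> \<le> 1 / v + 13"
  proof -
    have "0 \<le> (4497/100) * (v - 1/4)\<^sup>2" by simp
    then have "0 \<le> 4497/100 * v\<^sup>2 - 4497/200 * v + 4497/1600" by (simp add: power2_eq_square algebra_simps)
    then have "0 \<le> 928/100 - 4491/100 * v + 4497/100 * v\<^sup>2" using v by linarith
    then have "0 \<le> v * (928/100 - 4491/100 * v + 4497/100 * v\<^sup>2)" using v by (intro mult_nonneg_nonneg) auto
    moreover have "(1 + 13 * v) * r\<^sup>2 = 1 + 928/100 * v - 449004/10000 * v\<^sup>2 + 449748/10000 * v ^ 3"
      unfolding r_def by (simp add: field_simps eval_nat_numeral)
    moreover have "v * (928/100 - 4491/100 * v + 4497/100 * v\<^sup>2) = 928/100 * v - 4491/100 * v\<^sup>2 + 4497/100 * v ^ 3"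
      by (simp add: algebra_simps eval_nat_numeral)
    moreover have "0 \<le> v\<^sup>2" "0 \<le> v ^ 3" using v by auto
    ultimately have "1 \<le> (1 + 13 * v) * r\<^sup>2" by linarith
    then show ?thesis using v r by (simp add: field_simps)
  qed
  finally show ?thesis by (simp add: v_def)
qed

text \<open>For \<open>x < 1/2\<close> all nodes contribute nonnegatively, and the Gaussian factor
  alone outweighs the excess of \<open>\<pi>^2 / sin^2\<close> over \<open>1 / x^2\<close>.
  Otherwise the budget, in units of \<open>1 / x^2\<close>, is 47/100 for the nearest node against
  its pole, 13 times 185/10000 for the rest of \<open>\<pi>^2 / sin^2\<close>, and 1/100 for all
  other nodes.\<close>

lemma minor_defect_le_direct:
  assumes a: "a \<ge> 36" and x: "x > 0" "x \<notin> \<int>"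
  shows "exp (- (a * x\<^sup>2 / 2)) * pi\<^sup>2 / (sin (pi * x))\<^sup>2 - minor_sum a x \<le> 1 / x\<^sup>2"
proof (cases "x < 1/2")
  case True
  define g where "g = exp (- (a * x\<^sup>2 / 2))"
  have s0: "sin (pi * x) \<noteq> 0" using x(2) by (auto simp: sin_zero_iff_int2)
  have "0 \<le> minor_sum a x" unfolding minor_sum_def
  proof (intro suminf_nonneg summable_minor_term)
    show "0 \<le> minor_term a x (Suc n)" for n
      unfolding minor_term_def using True a x by (intro mult_nonneg_nonneg add_nonneg_nonneg) auto
  qed (use a x in auto)
  moreover have "g * pi\<^sup>2 / (sin (pi * x))\<^sup>2 \<le> 1 / x\<^sup>2"
  proof -
    define v where "v = x\<^sup>2"
    have d: "\<bar>x\<bar> \<le> 1/2" using True x by simp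
    have v: "0 \<le> v" "v \<le> 1/4" using sin_pi_ge(3)[OF d] by (auto simp: v_def)
    have "36 * x\<^sup>2 \<le> a * x\<^sup>2" using a by (intro mult_right_mono) auto
    then have "g \<le> exp (2 * (- (9 * v)))" by (simp add: g_def v_def)
    also have "\<dots> = (exp (- (9 * v)))\<^sup>2" by (rule exp_double)
    finally have g: "g \<le> (exp (- (9 * v)))\<^sup>2" .
    have e: "exp (- (9 * v)) \<le> 1 - 186/100 * v"
    proof -
      have "exp (- (9 * v)) * (1 + 9 * v) \<le> exp (- (9 * v)) * exp (9 * v)" by (intro mult_left_mono exp_ge_add_one_self) auto
      then have "exp (- (9 * v)) * (1 + 9 * v) \<le> 1" by (simp add: exp_minus)
      also have "1 \<le> (1 - 186/100 * v) * (1 + 9 * v)"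
      proof -
        have "v * v \<le> v * (1/4)" using v by (intro mult_left_mono) auto
        then show ?thesis using v by (simp add: algebra_simps)
      qed
      finally show ?thesis using v by (simp only: mult_le_cancel_right)
    qed
    have "g * pi\<^sup>2 * x\<^sup>2 \<le> (1 - 186/100 * v)\<^sup>2 * pi\<^sup>2 * x\<^sup>2"
      using order_trans[OF g power_mono[OF e]] by (intro mult_right_mono) auto
    also have "\<dots> = (pi * \<bar>x\<bar> * (1 - 186/100 * x\<^sup>2))\<^sup>2" by (simp add: power_mult_distrib v_def)
    also have "\<dots> \<le> (sin (pi * x))\<^sup>2" by (rule sin_pi_ge(1)[OF d])
    finally have "g * pi\<^sup>2 * x\<^sup>2 \<le> (sin (pi * x))\<^sup>2" .
    then show ?thesis using s0 x by (simp add: field_simps)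
  qed
  ultimately show ?thesis by (simp add: g_def)
next
  case False
  define g where "g = exp (- (a * x\<^sup>2 / 2))"
  define n where "n = nat \<lfloor>x + 1/2\<rfloor>"
  define m where "m = real n"
  have x12: "x \<ge> 1/2" using False by simp
  have xm: "x \<noteq> m" using x(2) by (auto simp: m_def)
  have n1: "n \<ge> 1" using x12 unfolding n_def by linarith
  have mi: "m = of_int \<lfloor>x + 1/2\<rfloor>" using x12 unfolding m_def n_def by simp
  have md: "\<bar>x - m\<bar> \<le> 1/2" unfolding mi by linarith
  have "sin (pi * x) = sin (pi * (x - m) + pi * of_int \<lfloor>x + 1/2\<rfloor>)" by (simp add: mi algebra_simps)
  also have "\<dots> = sin (pi * (x - m)) * cos (pi * of_int \<lfloor>x + 1/2\<rfloor>)" unfolding sin_add by simp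
  finally have "(sin (pi * x))\<^sup>2 = (sin (pi * (x - m)))\<^sup>2 * (cos (pi * of_int \<lfloor>x + 1/2\<rfloor>))\<^sup>2" by (simp only: power_mult_distrib)
  also have "(cos (pi * of_int \<lfloor>x + 1/2\<rfloor>))\<^sup>2 = 1" by (simp add: cos_squared_eq)
  finally have s: "pi\<^sup>2 / (sin (pi * x))\<^sup>2 \<le> 1 / (m - x)\<^sup>2 + 13"
    using inverse_square_sin_le_nearest[OF md] xm by (simp add: power2_commute[of m])
  define h where "h = (\<lambda>k. (if k = n - 1 then minor_term a x n else 0) + (- 1 / x\<^sup>2) * (12 * exp (- 8 * real (Suc k))))"
  have hs: "h sums (minor_term a x n + (- 1 / x\<^sup>2) * (12 * exp (- 8) / (1 - exp (- 8))))"
    unfolding h_def by (intro sums_add sums_mult tail_12_sums sums_single)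
  have "suminf h \<le> minor_sum a x" unfolding minor_sum_def
  proof (rule suminf_le)
    show "h k \<le> minor_term a x (Suc k)" for k
    proof (cases "k = n - 1")
      case True
      then have "Suc k = n" using n1 by simp
      then show ?thesis using True by (simp add: h_def)
    next
      case False
      have "real (Suc k) > x \<or> x - real (Suc k) \<ge> 1/2"
      proof (rule ccontr)
        assume "\<not> ?thesis"
        then have "\<lfloor>x + 1/2\<rfloor> = int (Suc k)" using x12 by (simp add: floor_eq_iff)
        then show False using False by (simp add: n_def)
      qed
      then show ?thesis using minor_term_ge[OF a x(1), of "Suc k"] False by (simp add: h_def del: of_nat_Suc)
    qed
    show "summable h" using hs by (rule sums_summable)
    show "summable (\<lambda>n. minor_term a x (Suc n))" using a x by (intro summable_minor_term) auto
  qed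
  then have ms: "minor_term a x n - (12 * exp (- 8) / (1 - exp (- 8))) / x\<^sup>2 \<le> minor_sum a x"
    using hs by (simp add: sums_iff mult.commute)
  have x2: "x\<^sup>2 > 0" using x by simp
  have "x\<^sup>2 * (g * pi\<^sup>2 / (sin (pi * x))\<^sup>2 - minor_sum a x) \<le> x\<^sup>2 * (g * (1 / (m - x)\<^sup>2 + 13) - (minor_term a x n - (12 * exp (- 8) / (1 - exp (- 8))) / x\<^sup>2))"
    using mult_left_mono[OF s, of g] ms by (intro mult_left_mono diff_mono) (auto simp: g_def)
  also have "\<dots> = x\<^sup>2 * (g / (m - x)\<^sup>2 - minor_term a x n) + 13 * (x\<^sup>2 * g) + 12 * exp (- 8) / (1 - exp (- 8))"
  proof -
    have "x\<^sup>2 * (g * (A + 13) - (M - E / x\<^sup>2)) = x\<^sup>2 * (g * A - M) + 13 * (x\<^sup>2 * g) + E" for A M E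
      using x2 by (simp add: algebra_simps)
    from this[of "1 / (m - x)\<^sup>2" "minor_term a x n" "12 * exp (- 8) / (1 - exp (- 8))"] show ?thesis by simp
  qed
  also have "\<dots> \<le> 47/100 + 13 * (185/10000) + 1/100"
  proof (intro add_mono mult_left_mono tail_12_le)
    show "x\<^sup>2 * (g / (m - x)\<^sup>2 - minor_term a x n) \<le> 47/100"
      unfolding g_def by (rule nearest_term_Taylor[OF a x12 m_def n1 md xm])
    have "x\<^sup>2 \<ge> (1/2)\<^sup>2" using x12 by (intro power_mono) auto
    then have q: "x\<^sup>2 \<ge> 1/4" by (simp add: power2_eq_square)
    have "36 * x\<^sup>2 \<le> a * x\<^sup>2" using a by (intro mult_right_mono) auto
    then have "g \<le> exp (- 18 * x\<^sup>2)" by (simp add: g_def)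
    moreover have "x\<^sup>2 \<le> exp (x\<^sup>2)" using exp_ge_add_one_self[of "x\<^sup>2"] by linarith
    ultimately have "x\<^sup>2 * g \<le> exp (x\<^sup>2) * exp (- 18 * x\<^sup>2)" by (intro mult_mono) (auto simp: g_def)
    also have "\<dots> = exp (- 17 * x\<^sup>2)" by (simp add: exp_add[symmetric])
    also have "\<dots> \<le> exp (- 4)" using q by simp
    finally show "x\<^sup>2 * g \<le> 185/10000" using exp_numeric(5) by linarith
  qed simp
  also have "\<dots> \<le> 1" by simp
  finally have "x\<^sup>2 * (g * pi\<^sup>2 / (sin (pi * x))\<^sup>2 - minor_sum a x) \<le> 1" .
  then have "g * pi\<^sup>2 / (sin (pi * x))\<^sup>2 - minor_sum a x \<le> 1 / x\<^sup>2" using x2 by (simp only: pos_le_divide_eq mult.commute)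
  then show ?thesis by (simp add: g_def)
qed

text \<open>Up to \<open>a = 36\<close> the identity gives the second inequality at once, as it
  subtracts two nonnegative terms from \<open>1 / x^2\<close>. The first asks these terms to add up
  to at most \<open>1 / x^2\<close>: 97/100 + 3/100 for \<open>a \<le> 2\<close> and 63/100 + 37/100
  up to 4.\<close>

theorem minor_defect_bounds:
  assumes a: "a > 0" and x: "x > 0" "x \<notin> \<int>"
  shows "minor_sum a x \<le> exp (- (a * x\<^sup>2 / 2)) * pi\<^sup>2 / (sin (pi * x))\<^sup>2"
    and "exp (- (a * x\<^sup>2 / 2)) * pi\<^sup>2 / (sin (pi * x))\<^sup>2 - minor_sum a x \<le> 1 / x\<^sup>2"
proof -
  interpret gaussian a by standard (rule a)
  have x2: "x\<^sup>2 > 0" using x by simp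
  have le: "left_error a x \<le> w' / x\<^sup>2" if "\<And>t. t \<ge> 0 \<Longrightarrow> theta_sum a t \<le> w'" for w'
    by (rule left_error_bounds(3)[OF a x(1) that])
  show "exp (- (a * x\<^sup>2 / 2)) * pi\<^sup>2 / (sin (pi * x))\<^sup>2 - minor_sum a x \<le> 1 / x\<^sup>2"
  proof (cases "a \<le> 36")
    case True
    then show ?thesis
      using minor_sum_identity[OF True x] defect_bounds(1)[OF True, of x] x
        left_error_bounds(2)[OF a x(1) theta_sum_bounds(2)[OF a]] by simp
  qed (use minor_defect_le_direct[OF _ x] in auto)
  show "minor_sum a x \<le> exp (- (a * x\<^sup>2 / 2)) * pi\<^sup>2 / (sin (pi * x))\<^sup>2"
  proof (cases "a \<le> 4")
    case True
    have "\<exists>w' c. left_error a x \<le> w' / x\<^sup>2 \<and> x\<^sup>2 * defect x \<le> c \<and> w' + c \<le> 1"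
    proof (cases "a \<le> 2")
      case True
      show ?thesis using le[of "97/100"] theta_sum_bounds(2)[OF a] defect_le_a_le_2[OF True, of x] x
        by (intro exI[of _ "97/100"] exI[of _ "3/100"]) auto
    next
      case False
      then show ?thesis using le[of "63/100"] theta_sum_le_a_ge_2[of a] defect_le_a_le_4[OF \<open>a \<le> 4\<close>, of x] x
        by (intro exI[of _ "63/100"] exI[of _ "37/100"]) auto
    qed
    then obtain w' c where w: "left_error a x \<le> w' / x\<^sup>2" and c: "x\<^sup>2 * defect x \<le> c" and wc: "w' + c \<le> 1" by blast
    have "defect x \<le> c / x\<^sup>2" using c x2 by (simp only: pos_le_divide_eq mult.commute)
    moreover have "w' / x\<^sup>2 + c / x\<^sup>2 \<le> 1 / x\<^sup>2" unfolding add_divide_distrib[symmetric] using wc x2 by (intro divide_right_mono) auto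
    ultimately have "0 \<le> 1 / x\<^sup>2 - left_error a x - defect x" using w by linarith
    then show ?thesis using minor_sum_identity[OF _ x] True by simp
  next
    case False
    then show ?thesis using minor_sum_le_direct_ge_1[of a x] minor_sum_le_direct_lt_1[of a x] x by (cases "x \<ge> 1") auto
  qed
qed

text \<open>For \<open>t > 0\<close> it balances the slopes at the positive integers. At
  \<open>t = 0\<close> every summand vanishes, but the limit from the right is 1: the series is a
  Riemann sum for the integral of \<open>2 \<pi> t u exp (- \<pi> t u^2)\<close> over
  \<open>u > 0\<close>. With this value the case \<open>t = 0\<close> is Beurling's one-sided
  approximation of the unit step.\<close>

definition origin_slope :: "real \<Rightarrow> real" where
  "origin_slope t = (if t = 0 then 1 else \<Sum>n. 2 * pi * t * real (Suc n) * exp (- (pi * t * (real (Suc n))\<^sup>2)))"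

definition node_term :: "real \<Rightarrow> real \<Rightarrow> nat \<Rightarrow> real" where
  "node_term t x n = exp (- (pi * t * (real n)\<^sup>2)) * (1 / (real n - x)\<^sup>2 + 2 * pi * t * real n / (real n - x))"

definition minor_series :: "real \<Rightarrow> real \<Rightarrow> real" where
  "minor_series t x = origin_slope t / x + (\<Sum>n. node_term t x (Suc n))"

text \<open>The error in units of \<open>sin^2 (\<pi> x) / \<pi>^2\<close>, the factor common to all
  interpolation terms off the integers.\<close>

definition gap :: "real \<Rightarrow> real \<Rightarrow> real" where
  "gap t x = (if x > 0 then exp (- (pi * t * x\<^sup>2)) * pi\<^sup>2 / (sin (pi * x))\<^sup>2 else 0) - minor_series t x"

lemma summable_slope_terms:
  assumes t: "t \<ge> 0" shows "summable (\<lambda>n. 2 * pi * t * real (Suc n) * exp (- (pi * t * (real (Suc n))\<^sup>2)))"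
proof (cases "t = 0")
  case False
  then have "summable (\<lambda>n. real n ^ 1 * exp (- ((2 * pi * t) * (real n)\<^sup>2 / 2 + 0 * real n)))"
    using t by (intro summable_gaussian_monomial) auto
  then have "summable (\<lambda>n. (2 * pi * t) * (real n * exp (- (pi * t * (real n)\<^sup>2))))"
    by (intro summable_mult) (simp add: mult.assoc)
  then have "summable (\<lambda>n. (2 * pi * t) * (real (Suc n) * exp (- (pi * t * (real (Suc n))\<^sup>2))))"
    by (simp only: summable_Suc_iff[of "\<lambda>n. (2 * pi * t) * (real n * exp (- (pi * t * (real n)\<^sup>2)))"])
  then show ?thesis by (simp only: mult.assoc)
qed simp

lemma minor_term_eq_node_term:
  assumes x: "x \<noteq> 0" "real n \<noteq> x"
  shows "minor_term (2 * pi * t) x n = node_term t x n + (1 / x) * (2 * pi * t * real n * exp (- (pi * t * (real n)\<^sup>2)))"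
proof -
  define d where "d = real n - x"
  have d: "d \<noteq> 0" "x = real n - d" using x by (auto simp: d_def)
  have "c * (real n)\<^sup>2 / (x * d) = c * real n / d + (1 / x) * (c * real n)" for c
  proof -
    have "c * (real n)\<^sup>2 = c * real n * (x + d)" by (simp add: d(2) power2_eq_square)
    then show ?thesis using x(1) d(1) by (simp add: add_divide_distrib distrib_left)
  qed
  then have "minor_term (2 * pi * t) x n = exp (- (pi * t * (real n)\<^sup>2)) * (1 / d\<^sup>2 + (2 * pi * t * real n / d + (1 / x) * (2 * pi * t * real n)))"
    unfolding minor_term_def d_def[symmetric] by simp
  also have "\<dots> = exp (- (pi * t * (real n)\<^sup>2)) * (1 / d\<^sup>2 + 2 * pi * t * real n / d) + (1 / x) * (2 * pi * t * real n * exp (- (pi * t * (real n)\<^sup>2)))"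
    by (simp only: distrib_left mult_ac add.assoc)
  finally show ?thesis unfolding node_term_def d_def .
qed

lemma summable_node_term:
  assumes t: "t \<ge> 0" and x: "x \<notin> \<int>"
  shows "summable (\<lambda>n. node_term t x (Suc n))"
proof (cases "t = 0")
  case True
  then show ?thesis using sums_inverse_squares_sin(1)[OF x] by (simp add: node_term_def)
next
  case False
  have x0: "x \<noteq> 0" "real n \<noteq> x" for n using x by auto
  have "summable (\<lambda>n. minor_term (2 * pi * t) x (Suc n) - (1 / x) * (2 * pi * t * real (Suc n) * exp (- (pi * t * (real (Suc n))\<^sup>2))))"
    using t False x0 by (intro summable_diff summable_mult summable_minor_term summable_slope_terms) auto
  then show ?thesis unfolding minor_term_eq_node_term[OF x0] by simp
qed

lemma minor_series_eq_minor_sum: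
  assumes t: "t > 0" and x: "x \<notin> \<int>"
  shows "minor_series t x = minor_sum (2 * pi * t) x"
proof -
  have x0: "x \<noteq> 0" "real n \<noteq> x" for n using x by auto
  have t0: "t \<ge> 0" using t by simp
  have "minor_sum (2 * pi * t) x = (\<Sum>n. node_term t x (Suc n)) + (\<Sum>n. (1 / x) * (2 * pi * t * real (Suc n) * exp (- (pi * t * (real (Suc n))\<^sup>2))))"
    unfolding minor_sum_def minor_term_eq_node_term[OF x0]
    by (rule suminf_add[symmetric], rule summable_node_term[OF t0 x], rule summable_mult, rule summable_slope_terms[OF t0])
  also have "(\<Sum>n. (1 / x) * (2 * pi * t * real (Suc n) * exp (- (pi * t * (real (Suc n))\<^sup>2)))) = (1 / x) * origin_slope t"
    using t by (subst suminf_mult[OF summable_slope_terms[OF t0]]) (simp add: origin_slope_def)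
  finally show ?thesis by (simp add: minor_series_def)
qed

text \<open>Comparison from both sides with the telescoping terms
  \<open>1 / ((n + y) (n + 1 + y))\<close>. These two inequalities settle the case
  \<open>t = 0\<close> of the gap bounds.\<close>

lemma inverse_squares_telescope:
  assumes y: "y > (0::real)" and s: "summable (\<lambda>n. 1 / (real (Suc n) + y)\<^sup>2)"
  shows "(\<Sum>n. 1 / (real (Suc n) + y)\<^sup>2) \<le> 1 / y" "1 / y \<le> 1 / y\<^sup>2 + (\<Sum>n. 1 / (real (Suc n) + y)\<^sup>2)"
proof -
  define f where "f = (\<lambda>n. 1 / (real n + y))"
  have fl: "f \<longlonglongrightarrow> 0" unfolding f_def by real_asymp
  have sf: "(\<lambda>n. f n - f (Suc n)) sums (1 / y)" using telescope_sums'[OF fl] by (simp add: f_def)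
  have dif: "f n - f (Suc n) = 1 / ((real n + y) * (real (Suc n) + y))" for n
    unfolding f_def using y by (subst diff_frac_eq) (auto simp: add_nonneg_eq_0_iff)
  have "(\<Sum>n. 1 / (real (Suc n) + y)\<^sup>2) \<le> (\<Sum>n. f n - f (Suc n))"
  proof (intro suminf_le s sums_summable[OF sf])
    show "1 / (real (Suc n) + y)\<^sup>2 \<le> f n - f (Suc n)" for n
      unfolding dif power2_eq_square using y by (intro divide_left_mono mult_right_mono mult_pos_pos) auto
  qed
  then show "(\<Sum>n. 1 / (real (Suc n) + y)\<^sup>2) \<le> 1 / y" using sf by (simp add: sums_iff)
  have s': "(\<lambda>n. 1 / (real n + y)\<^sup>2) sums ((\<Sum>n. 1 / (real (Suc n) + y)\<^sup>2) + 1 / (real 0 + y)\<^sup>2)"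
    by (rule sums_Suc) (rule summable_sums[OF s])
  have "(\<Sum>n. f n - f (Suc n)) \<le> (\<Sum>n. 1 / (real n + y)\<^sup>2)"
  proof (intro suminf_le sums_summable[OF s'] sums_summable[OF sf])
    show "f n - f (Suc n) \<le> 1 / (real n + y)\<^sup>2" for n
      unfolding dif power2_eq_square using y by (intro divide_left_mono mult_left_mono mult_pos_pos) auto
  qed
  then show "1 / y \<le> 1 / y\<^sup>2 + (\<Sum>n. 1 / (real (Suc n) + y)\<^sup>2)" using sf s' by (simp add: sums_iff)
qed

theorem gap_bounds:
  assumes t: "t \<ge> 0" and x: "x \<notin> \<int>"
  shows "0 \<le> gap t x" "gap t x \<le> 1 / x\<^sup>2"
proof -
  have x0: "x \<noteq> 0" using x by auto
  have "0 \<le> gap t x \<and> gap t x \<le> 1 / x\<^sup>2"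
  proof (cases "t = 0")
    case True
    have g0: "gap t x = (if x > 0 then pi\<^sup>2 / (sin (pi * x))\<^sup>2 else 0) - (1 / x + (\<Sum>n. 1 / (real (Suc n) - x)\<^sup>2))"
      unfolding True gap_def minor_series_def origin_slope_def node_term_def by simp
    show ?thesis
    proof (cases "x > 0")
      case True
      note P = sums_inverse_squares_sin[OF x]
      note T = inverse_squares_telescope[OF True P(2)]
      have "gap t x = 1 / x\<^sup>2 + (\<Sum>n. 1 / (real (Suc n) + x)\<^sup>2) - 1 / x" unfolding g0 using True P(3) by simp
      then show ?thesis using T by simp
    next
      case False
      define y where "y = - x"
      have y: "y > 0" "x = - y" using False x0 by (auto simp: y_def)
      have eq: "(\<lambda>n. 1 / (real (Suc n) - x)\<^sup>2) = (\<lambda>n. 1 / (real (Suc n) + y)\<^sup>2)" by (simp add: y_def)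
      note T = inverse_squares_telescope[OF y(1) sums_inverse_squares_sin(1)[OF x, unfolded eq]]
      have "gap t x = 1 / y - (\<Sum>n. 1 / (real (Suc n) + y)\<^sup>2)" unfolding g0 eq using False y by simp
      then show ?thesis using T by (simp add: y(2))
    qed
  next
    case False
    then have t0: "t > 0" "2 * pi * t > 0" using t by auto
    show ?thesis
    proof (cases "x > 0")
      case True
      have "gap t x = exp (- ((2 * pi * t) * x\<^sup>2 / 2)) * pi\<^sup>2 / (sin (pi * x))\<^sup>2 - minor_sum (2 * pi * t) x"
        unfolding gap_def minor_series_eq_minor_sum[OF t0(1) x] using True by simp
      then show ?thesis using minor_defect_bounds[OF t0(2) True x] by simp
    next
      case False
      define y where "y = - x"
      have y: "y > 0" "x = - y" using False x0 by (auto simp: y_def)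
      have "gap t x = left_error (2 * pi * t) y"
        unfolding gap_def minor_series_eq_minor_sum[OF t0(1) x] unfolding y(2) minor_sum_uminus[OF t0(2) y(1)] using y by simp
      moreover have "theta_sum (2 * pi * t) s \<le> 1" if "s \<ge> 0" for s using theta_sum_bounds(2)[OF t0(2) that] by simp
      ultimately show ?thesis using left_error_bounds(2,3)[OF t0(2) y(1), of 1] by (simp add: y(2))
    qed
  qed
  then show "0 \<le> gap t x" "gap t x \<le> 1 / x\<^sup>2" by auto
qed

section \<open>Domination by the weight 1 / (1 + sqrt t)\<close>

lemma exp_weight_le: "t \<ge> 0 \<Longrightarrow> c > 0 \<Longrightarrow> exp (- (c * t)) \<le> (3/2 + 1 / (2 * c)) * (1 / (1 + sqrt t))"
proof -
  assume t: "t \<ge> 0" and c: "c > 0"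
  have "0 \<le> (sqrt t - 1)\<^sup>2" by simp
  then have "sqrt t \<le> (1 + t) / 2" using t by (simp add: power2_diff)
  then have "1 + sqrt t \<le> 3/2 + t / 2" by simp
  also have "\<dots> \<le> (3/2 + 1 / (2 * c)) * (1 + c * t)"
    using t c by (simp add: field_simps)
  also have "\<dots> \<le> (3/2 + 1 / (2 * c)) * exp (c * t)" using c by (intro mult_left_mono exp_ge_add_one_self) (auto simp: add_nonneg_nonneg)
  finally have "(1 + sqrt t) * exp (- (c * t)) \<le> (3/2 + 1 / (2 * c)) * exp (c * t) * exp (- (c * t))"
    by (rule mult_right_mono) simp
  also have "\<dots> = 3/2 + 1 / (2 * c)" unfolding mult.assoc exp_add[symmetric] by simp
  finally show ?thesis using t by (simp add: pos_le_divide_eq mult.commute add_pos_nonneg)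
qed

lemma exp_weight_le_4: "t \<ge> 0 \<Longrightarrow> c \<ge> 1/5 \<Longrightarrow> exp (- (c * t)) \<le> 4 * (1 / (1 + sqrt t))"
proof -
  assume t: "t \<ge> 0" and c: "c \<ge> 1/5"
  have "exp (- (c * t)) \<le> exp (- ((1/5) * t))" using mult_right_mono[OF c t] by simp
  also have "\<dots> \<le> 4 * (1 / (1 + sqrt t))" using exp_weight_le[OF t, of "1/5"] by simp
  finally show ?thesis .
qed

text \<open>Decay in \<open>t\<close> comes from the inequality already proved, taken at
  \<open>x = 1/2\<close>: there the origin slope enters with the factor 2 and all node terms are
  nonnegative, so twice the slope is at most \<open>\<pi>^2 exp (- \<pi> t / 4)\<close>.\<close>

lemma origin_slope_bounds:
  assumes t: "t \<ge> 0"
  shows "0 \<le> origin_slope t" "origin_slope t \<le> 20 * (1 / (1 + sqrt t))"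
proof -
  show "0 \<le> origin_slope t" unfolding origin_slope_def using t suminf_nonneg[OF summable_slope_terms[OF t]] by simp
  have "origin_slope t \<le> 5 * exp (- ((pi / 4) * t))"
  proof (cases "t = 0")
    case False
    then have t0: "t > 0" "2 * pi * t > 0" using t by auto
    have half: "1/2 \<notin> (\<int> :: real set)" by (auto elim!: Ints_cases)
    have s: "summable (\<lambda>n. minor_term (2 * pi * t) (1/2) (Suc n))" using t0 by (intro summable_minor_term) auto
    have "2 * (2 * pi * t * real (Suc n) * exp (- (pi * t * (real (Suc n))\<^sup>2))) \<le> minor_term (2 * pi * t) (1/2) (Suc n)" for n
    proof -
      define m where "m = real (Suc n)"
      have m: "m \<ge> 1" by (simp add: m_def)
      have "node_term t (1/2) (Suc n) \<ge> 0" unfolding node_term_def m_def[symmetric] using m t by simp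
      moreover have "(1/2::real) \<noteq> 0" "real (Suc n) \<noteq> 1/2" using m by (auto simp: m_def)
      ultimately show ?thesis using minor_term_eq_node_term[of "1/2" "Suc n" t] by simp
    qed
    then have "(\<Sum>n. 2 * (2 * pi * t * real (Suc n) * exp (- (pi * t * (real (Suc n))\<^sup>2)))) \<le> minor_sum (2 * pi * t) (1/2)"
      unfolding minor_sum_def by (intro suminf_le s summable_mult summable_slope_terms t)
    also have "(\<Sum>n. 2 * (2 * pi * t * real (Suc n) * exp (- (pi * t * (real (Suc n))\<^sup>2)))) = 2 * origin_slope t"
      using t0 by (subst suminf_mult[OF summable_slope_terms[OF t]]) (simp add: origin_slope_def)
    also have "minor_sum (2 * pi * t) (1/2) \<le> exp (- ((2 * pi * t) * (1/2)\<^sup>2 / 2)) * pi\<^sup>2 / (sin (pi * (1/2)))\<^sup>2"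
      by (rule minor_defect_bounds(1)[OF t0(2) _ half]) simp
    also have "\<dots> = exp (- ((pi / 4) * t)) * pi\<^sup>2" by (simp add: power2_eq_square)
    also have "\<dots> \<le> exp (- ((pi / 4) * t)) * 10" using pi_square_bounds(2) by (intro mult_left_mono) auto
    finally show ?thesis by simp
  qed (simp add: origin_slope_def)
  also have "\<dots> \<le> 5 * (4 * (1 / (1 + sqrt t)))" using t pi_gt3 by (intro mult_left_mono exp_weight_le_4) auto
  finally show "origin_slope t \<le> 20 * (1 / (1 + sqrt t))" by simp
qed

lemma slope_term_le:
  assumes t: "t \<ge> 0" and n: "n \<ge> 1"
  shows "2 * pi * t * real n * exp (- (pi * t * (real n)\<^sup>2)) \<le> 16 * (1 / (1 + sqrt t))"
    "exp (- (pi * t * (real n)\<^sup>2)) \<le> 4 * (1 / (1 + sqrt t))"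
proof -
  define u where "u = pi * t * (real n)\<^sup>2"
  have "1 \<le> (real n)\<^sup>2" using n by (simp add: one_le_power)
  then have "pi * t * 1 \<le> u" unfolding u_def using t by (intro mult_left_mono) auto
  then have u: "pi * t \<le> u" by simp
  have "real n * 1 \<le> (real n)\<^sup>2" unfolding power2_eq_square using n by (intro mult_left_mono) auto
  then have "2 * pi * t * real n \<le> 2 * pi * t * (real n)\<^sup>2" using t by (intro mult_left_mono) auto
  also have "\<dots> = 4 * (u / 2)" by (simp add: u_def)
  also have "\<dots> \<le> 4 * exp (u / 2)" using exp_ge_add_one_self[of "u / 2"] by linarith
  finally have "2 * pi * t * real n * exp (- u) \<le> 4 * exp (u / 2) * exp (- u)" by (rule mult_right_mono) simp
  also have "\<dots> = 4 * exp (- (u / 2))" unfolding mult.assoc exp_add[symmetric] by simp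
  also have "\<dots> \<le> 4 * exp (- ((pi / 2) * t))" using u by simp
  also have "\<dots> \<le> 4 * (4 * (1 / (1 + sqrt t)))" using t pi_gt3 by (intro mult_left_mono exp_weight_le_4) auto
  finally show "2 * pi * t * real n * exp (- (pi * t * (real n)\<^sup>2)) \<le> 16 * (1 / (1 + sqrt t))" by (simp add: u_def)
  have "exp (- u) \<le> exp (- (pi * t))" using u by simp
  also have "\<dots> \<le> 4 * (1 / (1 + sqrt t))" using t pi_gt3 by (intro exp_weight_le_4) auto
  finally show "exp (- (pi * t * (real n)\<^sup>2)) \<le> 4 * (1 / (1 + sqrt t))" by (simp add: u_def)
qed

lemma interp_term_real:
  assumes x: "x \<notin> \<int>"
  shows "interp_term (of_real a) (of_real b) n (of_real x)
    = of_real ((sin (pi * x))\<^sup>2 / pi\<^sup>2 * (a / (x - of_int n)\<^sup>2 + b / (x - of_int n)))"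
proof -
  have xn: "x \<noteq> of_int n" using x by auto
  then have ne: "complex_of_real x \<noteq> of_int n" by (metis of_real_eq_iff of_real_of_int_eq)
  have c: "(csinc (of_real x - of_int n))\<^sup>2 = of_real ((sin (pi * x))\<^sup>2 / (pi * (x - of_int n))\<^sup>2)"
    unfolding csinc_sq_shift[OF ne] by (simp flip: sin_of_real)
  have "(a + b * d) * (v / (pi * d)\<^sup>2) = v / pi\<^sup>2 * (a / d\<^sup>2 + b / d)" if "d \<noteq> 0" for d v :: real
    using that by (simp add: field_simps power2_eq_square)
  from this[of "x - of_int n" "(sin (pi * x))\<^sup>2"] xn
  have "(a + b * (x - of_int n)) * ((sin (pi * x))\<^sup>2 / (pi * (x - of_int n))\<^sup>2) = (sin (pi * x))\<^sup>2 / pi\<^sup>2 * (a / (x - of_int n)\<^sup>2 + b / (x - of_int n))"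
    by simp
  moreover have "interp_term (of_real a) (of_real b) n (of_real x) = of_real ((a + b * (x - of_int n)) * ((sin (pi * x))\<^sup>2 / (pi * (x - of_int n))\<^sup>2))"
    unfolding interp_term_def c by (simp del: mult_eq_0_iff)
  ultimately show ?thesis by (simp only:)
qed

section \<open>Touching at the nodes and comparison of competitors\<close>

lemma real_on_reals_deriv:
  assumes hol: "f holomorphic_on UNIV" and re: "real_on_reals f"
  shows "((\<lambda>x. Re (f (of_real x))) has_real_derivative Re (deriv f (of_real x))) (at x)"
    "deriv f (of_real x) = of_real (Re (deriv f (of_real x)))"
proof -
  have v: "((\<lambda>x. f (of_real x)) has_vector_derivative deriv f (of_real x)) (at x)"
    by (rule has_vector_derivative_real_field) (rule holomorphic_derivI[OF hol], auto)
  from bounded_linear.has_vector_derivative[OF bounded_linear_Re v]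
  show r: "((\<lambda>x. Re (f (of_real x))) has_real_derivative Re (deriv f (of_real x))) (at x)"
    by (simp add: has_real_derivative_iff_has_vector_derivative)
  have "complex_of_real (Re (f (of_real x))) = f (of_real x)" for x
    using re by (intro of_real_Re) (auto simp: real_on_reals_def)
  moreover have "((\<lambda>x. complex_of_real (Re (f (of_real x)))) has_vector_derivative of_real (Re (deriv f (of_real x)))) (at x)"
    using r by (intro has_vector_derivative_of_real) (simp add: has_real_derivative_iff_has_vector_derivative)
  ultimately show "deriv f (of_real x) = of_real (Re (deriv f (of_real x)))"
    using v by (auto dest: vector_derivative_unique_at)
qed

text \<open>At a node the nonnegative error vanishes and so has a local minimum. A unit
  neighbourhood of a nonzero integer avoids the origin, the one point where no inequality is
  assumed.\<close>

lemma touching_derivative: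
  assumes f: "f holomorphic_on UNIV" "real_on_reals f" and le: "\<And>x. x \<noteq> 0 \<Longrightarrow> Re (f (of_real x)) \<le> gr x"
    and n: "n \<noteq> (0::int)" "Re (f (of_int n)) = gr (of_int n)" and d: "(gr has_real_derivative d) (at (of_int n))"
  shows "Re (deriv f (of_int n)) = d"
proof -
  have der: "((\<lambda>x. gr x - Re (f (of_real x))) has_real_derivative d - Re (deriv f (of_real (of_int n)))) (at (of_int n))"
    by (intro DERIV_diff d real_on_reals_deriv f)
  have "d - Re (deriv f (of_real (of_int n))) = 0"
  proof (rule DERIV_local_min[OF der zero_less_one], intro allI impI)
    fix y :: real assume "\<bar>of_int n - y\<bar> < 1"
    moreover have "\<bar>of_int n :: real\<bar> \<ge> 1" using n(1) by linarith
    ultimately have "y \<noteq> 0" by auto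
    then show "gr (of_int n) - Re (f (of_real (of_int n))) \<le> gr y - Re (f (of_real y))" using le[of y] n(2) by simp
  qed
  then show ?thesis by simp
qed

text \<open>The integral of \<open>l - L\<close> is the sum of its values at the integers, all of them nonnegative.
  If it vanishes, both functions touch the target at the nonzero integers, so their difference
  has double zeros there.\<close>

lemma extremal_core:
  fixes l L :: "complex \<Rightarrow> complex" and gr :: "real \<Rightarrow> real"
  assumes l: "exp_type_at_most (2 * pi) l" "real_on_reals l"
    and L: "exp_type_at_most (2 * pi) L" "real_on_reals L"
    and rl: "\<And>x. x \<noteq> 0 \<Longrightarrow> Re (l (of_real x)) \<le> gr x" "integrable lborel (\<lambda>x. gr x - Re (l (of_real x)))"
    and rL: "\<And>x. x \<noteq> 0 \<Longrightarrow> Re (L (of_real x)) \<le> gr x" "integrable lborel (\<lambda>x. gr x - Re (L (of_real x)))"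
    and node: "\<And>n::int. n \<noteq> 0 \<Longrightarrow> Re (l (of_int n)) = gr (of_int n)"
    and diff: "\<And>n::int. n \<noteq> 0 \<Longrightarrow> \<exists>d. (gr has_real_derivative d) (at (of_int n))"
    and zero: "Re (L 0) \<le> Re (l 0)"
  shows "(\<integral>x. gr x - Re (l (of_real x)) \<partial>lborel) \<le> (\<integral>x. gr x - Re (L (of_real x)) \<partial>lborel)"
    and "(\<integral>x. gr x - Re (L (of_real x)) \<partial>lborel) \<le> (\<integral>x. gr x - Re (l (of_real x)) \<partial>lborel) \<Longrightarrow> L = l"
proof -
  define D where "D = (\<lambda>z. l z - L z)"
  define I where "I = (\<integral>x. gr x - Re (L (of_real x)) \<partial>lborel) - (\<integral>x. gr x - Re (l (of_real x)) \<partial>lborel)"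
  have re: "l (of_real x) = of_real (Re (l (of_real x)))" "L (of_real x) = of_real (Re (L (of_real x)))" for x
    using l(2) L(2) by (simp_all add: real_on_reals_def)
  have Dre: "D (of_real x) = of_real ((gr x - Re (L (of_real x))) - (gr x - Re (l (of_real x))))" for x
    unfolding D_def using re[of x] by simp
  interpret L1_exp_type D
  proof
    show "exp_type_at_most (2 * pi) D" unfolding D_def by (rule exp_type_at_most_diff[OF l(1) L(1)])
    show "integrable lborel (\<lambda>x. D (of_real x))" unfolding Dre
      by (intro integrable_of_real Bochner_Integration.integrable_diff rL rl)
  qed
  have ID: "(\<integral>x. D (of_real x) \<partial>lborel) = of_real I"
    unfolding Dre I_def Bochner_Integration.integral_diff[OF rL(2) rl(2), symmetric]
    by (rule integral_of_real, intro Bochner_Integration.integrable_diff rL rl)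
  define e where "e = (\<lambda>n::int. Re (l (of_int n)) - Re (L (of_int n)))"
  have De: "D (of_int n) = of_real (e n)" for n using Dre[of "of_int n"] by (simp add: e_def)
  have e0: "e n \<ge> 0" for n
    using node[of n] rL(1)[of "of_int n"] zero by (cases "n = 0") (auto simp: e_def)
  have "(\<lambda>N. complex_of_real (\<Sum>n\<in>{- int N..int N}. e n)) \<longlonglongrightarrow> of_real I"
    using has_sum_int_tendsto[OF has_sum_integers_integral] unfolding De ID of_real_sum .
  then have lim: "(\<lambda>N. \<Sum>n\<in>{- int N..int N}. e n) \<longlonglongrightarrow> I" by (simp only: tendsto_of_real_iff)
  have eI: "e m \<le> I" for m
  proof (rule LIMSEQ_le_const[OF lim], intro exI allI impI)
    fix N assume "nat \<bar>m\<bar> \<le> N"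
    then have "m \<in> {- int N..int N}" by auto
    then show "e m \<le> (\<Sum>n\<in>{- int N..int N}. e n)" by (intro member_le_sum e0) auto
  qed
  show "(\<integral>x. gr x - Re (l (of_real x)) \<partial>lborel) \<le> (\<integral>x. gr x - Re (L (of_real x)) \<partial>lborel)"
    using eI[of 0] e0[of 0] by (simp add: I_def)
  assume "(\<integral>x. gr x - Re (L (of_real x)) \<partial>lborel) \<le> (\<integral>x. gr x - Re (l (of_real x)) \<partial>lborel)"
  then have ez: "e n = 0" for n using eI[of n] e0[of n] by (simp add: I_def)
  have hl: "l holomorphic_on UNIV" "L holomorphic_on UNIV" using l(1) L(1) by (auto simp: exp_type_at_most_def)
  have "deriv D (of_int n) = 0" if n: "n \<noteq> 0" for n :: int
  proof -
    obtain d where d: "(gr has_real_derivative d) (at (of_int n))" using diff[OF n] by blast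
    have "Re (L (of_int n)) = gr (of_int n)" using ez[of n] node[OF n] by (simp add: e_def)
    then have "Re (deriv l (of_int n)) = Re (deriv L (of_int n))"
      using touching_derivative[OF hl(1) l(2) rl(1) n node[OF n] d] touching_derivative[OF hl(2) L(2) rL(1) n _ d] by simp
    then have "deriv l (of_int n) = deriv L (of_int n)"
      using real_on_reals_deriv(2)[OF hl(1) l(2), of "of_int n"] real_on_reals_deriv(2)[OF hl(2) L(2), of "of_int n"] by simp
    moreover have "deriv D (of_int n) = deriv l (of_int n) - deriv L (of_int n)"
      unfolding D_def using hl by (intro deriv_diff) (auto simp: holomorphic_on_imp_differentiable_at)
    ultimately show ?thesis by simp
  qed
  then have "D z = 0" for z using vanishes_if_double_zeros[of z] De ez by simp
  then show "L = l" by (auto simp: D_def fun_eq_iff)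
qed

section \<open>Mixtures of Gaussians\<close>

lemma Re_theta3:
  assumes t: "t > 0"
  shows "Re (theta3 0 (\<i> * of_real t)) = 1 + 2 * (\<Sum>n. exp (- (pi * t * (real (Suc n))\<^sup>2)))"
    and "summable (\<lambda>n. exp (- (pi * t * (real (Suc n))\<^sup>2)))"
proof -
  define f where "f = (\<lambda>n::int. exp (- (pi * t * (of_int n)\<^sup>2)))"
  have "summable (\<lambda>n. real n ^ 0 * exp (- ((2 * pi * t) * (real n)\<^sup>2 / 2 + 0 * real n)))"
    using t by (intro summable_gaussian_monomial) auto
  then have s: "summable (\<lambda>n. exp (- (pi * t * (real n)\<^sup>2)))" by (simp add: mult.assoc)
  then show s1: "summable (\<lambda>n. exp (- (pi * t * (real (Suc n))\<^sup>2)))" by (subst summable_Suc_iff)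
  have "f summable_on UNIV" using s by (intro summable_on_int) (auto simp: f_def)
  then have hs: "(f has_sum infsum f UNIV) UNIV" by simp
  have "(\<lambda>N. f 0 + (\<Sum>n<N. f (int (Suc n)) + f (- int (Suc n)))) \<longlonglongrightarrow> infsum f UNIV"
    using has_sum_int_tendsto[OF hs] unfolding sum_int_symmetric .
  moreover have "(\<lambda>N. f 0 + (\<Sum>n<N. f (int (Suc n)) + f (- int (Suc n)))) \<longlonglongrightarrow> 1 + 2 * (\<Sum>n. exp (- (pi * t * (real (Suc n))\<^sup>2)))"
  proof -
    have "f (int (Suc n)) + f (- int (Suc n)) = 2 * exp (- (pi * t * (real (Suc n))\<^sup>2))" for n
      unfolding f_def by (simp del: of_nat_Suc)
    moreover have "f 0 = 1" by (simp add: f_def)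
    moreover have "(\<lambda>N. \<Sum>n<N. 2 * exp (- (pi * t * (real (Suc n))\<^sup>2))) \<longlonglongrightarrow> 2 * (\<Sum>n. exp (- (pi * t * (real (Suc n))\<^sup>2)))"
      unfolding sums_def[symmetric] by (intro sums_mult summable_sums s1)
    ultimately show ?thesis by (simp only:) (intro tendsto_add tendsto_const)
  qed
  ultimately have inf: "infsum f UNIV = 1 + 2 * (\<Sum>n. exp (- (pi * t * (real (Suc n))\<^sup>2)))" by (rule LIMSEQ_unique)
  have q: "exp (of_real pi * \<i> * (\<i> * of_real t)) powi (n\<^sup>2) * exp (2 * of_real pi * \<i> * of_int n * 0) = complex_of_real (f n)" for n
  proof -
    have "of_real pi * \<i> * (\<i> * of_real t) = complex_of_real (- (pi * t))" by (simp add: complex_eq_iff)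
    then have "exp (of_real pi * \<i> * (\<i> * of_real t)) = complex_of_real (exp (- (pi * t)))" by (simp only: exp_of_real)
    moreover have "complex_of_real (exp (- (pi * t))) powi (n\<^sup>2) = complex_of_real (exp (- (pi * t)) powi (n\<^sup>2))" by simp
    moreover have "exp (- (pi * t)) powi (n\<^sup>2) = f n"
      unfolding f_def using exp_power_int[of "- (pi * t)" "n\<^sup>2"] by (simp add: mult.commute)
    ultimately show ?thesis by simp
  qed
  have "theta3 0 (\<i> * of_real t) = (\<Sum>\<^sub>\<infinity>n. complex_of_real (f n))"
    unfolding theta3_def Let_def q ..
  also have "\<dots> = of_real (infsum f UNIV)" by (rule infsumI[OF has_sum_bounded_linear[OF bounded_linear_of_real hs]])
  finally show "Re (theta3 0 (\<i> * of_real t)) = 1 + 2 * (\<Sum>n. exp (- (pi * t * (real (Suc n))\<^sup>2)))"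
    by (simp only: Re_complex_of_real inf)
qed

definition wt :: "real \<Rightarrow> real" where "wt t = 1 / (1 + sqrt t)"

definition sin_factor :: "real \<Rightarrow> real" where "sin_factor x = (sin (pi * x))\<^sup>2 / pi\<^sup>2"

lemma sin_factor_pos: "x \<notin> \<int> \<Longrightarrow> sin_factor x > 0"
proof -
  assume "x \<notin> \<int>"
  then have "sin (pi * x) \<noteq> 0" by (auto simp: sin_zero_iff_int2)
  then show ?thesis by (simp add: sin_factor_def)
qed

lemma AE_noninteger: "AE x in lborel. x \<notin> (\<int> :: real set)"
proof (rule AE_not_in, rule countable_imp_null_set_lborel)
  show "countable (\<int> :: real set)" unfolding Ints_def by (rule countable_image) simp
qed

lemma csinc_sq_real:
  assumes "x \<notin> \<int>" shows "(csinc (of_real x))\<^sup>2 = of_real (sin_factor x * (1 / x\<^sup>2))"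
proof -
  have ne: "complex_of_real x \<noteq> of_int 0" using assms by auto
  show ?thesis using csinc_sq_shift[OF ne] by (simp add: sin_factor_def power_mult_distrib flip: sin_of_real)
qed

lemma
  shows integrable_Re_csinc_sq: "integrable lborel (\<lambda>x. Re ((csinc (of_real x))\<^sup>2))"
    and integral_Re_csinc_sq: "(\<integral>x. Re ((csinc (of_real x))\<^sup>2) \<partial>lborel) = 1"
  using integrable_Re[OF integrable_csinc_sq] integral_Re[OF integrable_csinc_sq] integral_csinc_sq by simp_all

lemma measurable_gap: "(\<lambda>(x, t). sin_factor x * gap t x) \<in> borel_measurable (borel \<Otimes>\<^sub>M borel)"
  unfolding sin_factor_def gap_def minor_series_def origin_slope_def node_term_def case_prod_beta by measurable

lemma measurable_gap_section: "(\<lambda>x. sin_factor x * gap t x) \<in> borel_measurable borel"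
  unfolding sin_factor_def gap_def minor_series_def origin_slope_def node_term_def by measurable

lemma sin_factor_gap_bounds:
  assumes "t \<ge> 0" "x \<notin> \<int>"
  shows "0 \<le> sin_factor x * gap t x" "sin_factor x * gap t x \<le> Re ((csinc (of_real x))\<^sup>2)"
proof -
  note g = gap_bounds[OF assms] and s = sin_factor_pos[OF assms(2)]
  show "0 \<le> sin_factor x * gap t x" using g s by simp
  have "sin_factor x * gap t x \<le> sin_factor x * (1 / x\<^sup>2)" using g s by (intro mult_left_mono) auto
  then show "sin_factor x * gap t x \<le> Re ((csinc (of_real x))\<^sup>2)"
    unfolding csinc_sq_real[OF assms(2)] Re_complex_of_real .
qed

lemma integrable_gap_section: "t \<ge> 0 \<Longrightarrow> integrable lborel (\<lambda>x. sin_factor x * gap t x)"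
proof (rule Bochner_Integration.integrable_bound[OF integrable_Re_csinc_sq])
  assume t: "t \<ge> 0"
  show "AE x in lborel. norm (sin_factor x * gap t x) \<le> norm (Re ((csinc (of_real x))\<^sup>2))"
    using AE_noninteger
  proof eventually_elim
    fix x :: real assume "x \<notin> \<int>"
    from sin_factor_gap_bounds[OF t this] show "norm (sin_factor x * gap t x) \<le> norm (Re ((csinc (of_real x))\<^sup>2))"
      unfolding real_norm_def by linarith
  qed
qed (simp add: measurable_gap_section)

section \<open>Interpolation data and minorant of a mixture\<close>

locale gaussian_mixture =
  fixes \<nu> :: "real measure"
  assumes sets_mix: "sets \<nu> = sets (restrict_space borel {0..})"
    and wt_finite: "(\<integral>\<^sup>+t. ennreal (1 / (1 + sqrt t)) \<partial>\<nu>) < \<infinity>"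
begin

lemma space_mix: "space \<nu> = {0..}"
  using sets_eq_imp_space_eq[OF sets_mix] by (simp add: space_restrict_space)

lemma measurable_mix: "f \<in> borel_measurable borel \<Longrightarrow> f \<in> borel_measurable \<nu>"
  unfolding measurable_cong_sets[OF sets_mix refl] by (rule measurable_restrict_space1)

lemma AE_mix_nonneg: "AE t in \<nu>. t \<ge> 0" by (rule AE_I2) (simp add: space_mix)

lemma wt_pos: "t \<ge> 0 \<Longrightarrow> wt t > 0" by (simp add: wt_def add_pos_nonneg)

lemma measurable_wt: "wt \<in> borel_measurable borel" unfolding wt_def by measurable

lemma integrable_wt: "integrable \<nu> wt"
proof (rule integrableI_nonneg)
  show "AE t in \<nu>. 0 \<le> wt t" using AE_mix_nonneg by eventually_elim (simp add: less_imp_le wt_pos)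
  show "(\<integral>\<^sup>+t. ennreal (wt t) \<partial>\<nu>) < \<infinity>" using wt_finite by (simp add: wt_def)
qed (rule measurable_mix[OF measurable_wt])

definition wt_mass :: real where "wt_mass = (\<integral>t. wt t \<partial>\<nu>)"

lemma integral_wt_bound:
  assumes m: "f \<in> borel_measurable borel" and b: "\<And>t. t \<ge> 0 \<Longrightarrow> \<bar>f t\<bar> \<le> C * wt t"
  shows "integrable \<nu> f" "\<bar>\<integral>t. f t \<partial>\<nu>\<bar> \<le> C * wt_mass"
proof -
  have iC: "integrable \<nu> (\<lambda>t. C * wt t)" by (intro integrable_mult_right integrable_wt)
  show i: "integrable \<nu> f"
  proof (rule Bochner_Integration.integrable_bound[OF iC])
    show "AE t in \<nu>. norm (f t) \<le> norm (C * wt t)" using AE_mix_nonneg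
      by eventually_elim (use b in \<open>auto intro: order_trans[OF b abs_ge_self]\<close>)
  qed (rule measurable_mix[OF m])
  have "\<bar>\<integral>t. f t \<partial>\<nu>\<bar> \<le> (\<integral>t. \<bar>f t\<bar> \<partial>\<nu>)" using integral_norm_bound[of \<nu> f] by simp
  also have "\<dots> \<le> (\<integral>t. C * wt t \<partial>\<nu>)" by (rule integral_mono[OF integrable_abs[OF i] iC]) (simp add: b space_mix)
  also have "\<dots> = C * wt_mass" by (simp add: wt_mass_def)
  finally show "\<bar>\<integral>t. f t \<partial>\<nu>\<bar> \<le> C * wt_mass" .
qed

text \<open>The weight is bounded below on each \<open>[0, i]\<close>, so its integrability gives
  these sets finite mass. Sigma-finiteness is what the exchange of integrals over \<open>x\<close>
  and \<open>t\<close> rests on.\<close>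

sublocale sigma_finite_measure \<nu>
proof
  have [measurable]: "(\<lambda>t. t) \<in> borel_measurable \<nu>" by (rule measurable_mix) simp
  define A where "A = (\<lambda>i::nat. {t \<in> space \<nu>. t \<le> real i})"
  have As: "A i \<in> sets \<nu>" for i unfolding A_def by measurable
  have fin: "emeasure \<nu> (A i) \<noteq> \<infinity>" for i
  proof
    assume inf: "emeasure \<nu> (A i) = \<infinity>"
    have "ennreal (wt (real i)) * emeasure \<nu> (A i) = (\<integral>\<^sup>+t. ennreal (wt (real i)) * indicator (A i) t \<partial>\<nu>)"
      by (rule nn_integral_cmult_indicator[OF As, symmetric])
    also have "\<dots> \<le> (\<integral>\<^sup>+t. ennreal (1 / (1 + sqrt t)) \<partial>\<nu>)"
    proof (rule nn_integral_mono)
      fix t assume "t \<in> space \<nu>"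
      then have t: "t \<ge> 0" by (simp add: space_mix)
      have "wt (real i) \<le> 1 / (1 + sqrt t)" if "t \<le> real i"
        unfolding wt_def using that t by (intro divide_left_mono) (auto simp: add_pos_nonneg)
      then show "ennreal (wt (real i)) * indicator (A i) t \<le> ennreal (1 / (1 + sqrt t))"
        by (auto simp: A_def indicator_def intro: ennreal_leI)
    qed
    finally have "ennreal (wt (real i)) * emeasure \<nu> (A i) < \<infinity>" using wt_finite by (rule le_less_trans)
    then show False using inf wt_pos[of "real i"] by (simp add: ennreal_mult_eq_top_iff ennreal_eq_0_iff)
  qed
  have "(\<Union>i. A i) = space \<nu>" unfolding A_def using real_arch_simple by blast
  then show "\<exists>A. countable A \<and> A \<subseteq> sets \<nu> \<and> \<Union> A = space \<nu> \<and> (\<forall>a\<in>A. emeasure \<nu> a \<noteq> \<infinity>)"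
    using As fin by (intro exI[of _ "range A"]) auto
qed

definition node_mass :: "nat \<Rightarrow> real" where "node_mass k = (\<integral>t. exp (- (pi * t * (real k)\<^sup>2)) \<partial>\<nu>)"
definition slope_mass :: "nat \<Rightarrow> real" where "slope_mass k = (\<integral>t. 2 * pi * t * real k * exp (- (pi * t * (real k)\<^sup>2)) \<partial>\<nu>)"
definition origin_mass :: real where "origin_mass = (\<integral>t. origin_slope t \<partial>\<nu>)"

lemma node_mass:
  assumes k: "k \<ge> 1"
  shows "integrable \<nu> (\<lambda>t. exp (- (pi * t * (real k)\<^sup>2)))" "0 \<le> node_mass k" "node_mass k \<le> 4 * wt_mass"
proof -
  have b: "\<bar>exp (- (pi * t * (real k)\<^sup>2))\<bar> \<le> 4 * wt t" if "t \<ge> 0" for t using slope_term_le(2)[OF that k] by (simp add: wt_def)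
  have m: "(\<lambda>t. exp (- (pi * t * (real k)\<^sup>2))) \<in> borel_measurable borel" by measurable
  show "integrable \<nu> (\<lambda>t. exp (- (pi * t * (real k)\<^sup>2)))" by (rule integral_wt_bound(1)[OF m b])
  show "0 \<le> node_mass k" unfolding node_mass_def by (intro Bochner_Integration.integral_nonneg) simp
  show "node_mass k \<le> 4 * wt_mass" using integral_wt_bound(2)[OF m b] unfolding node_mass_def by linarith
qed

lemma slope_mass:
  assumes k: "k \<ge> 1"
  shows "integrable \<nu> (\<lambda>t. 2 * pi * t * real k * exp (- (pi * t * (real k)\<^sup>2)))" "0 \<le> slope_mass k"
proof -
  have b: "\<bar>2 * pi * t * real k * exp (- (pi * t * (real k)\<^sup>2))\<bar> \<le> 16 * wt t" if "t \<ge> 0" for t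
    using slope_term_le(1)[OF that k] that by (simp add: wt_def abs_mult)
  have m: "(\<lambda>t. 2 * pi * t * real k * exp (- (pi * t * (real k)\<^sup>2))) \<in> borel_measurable borel" by measurable
  show "integrable \<nu> (\<lambda>t. 2 * pi * t * real k * exp (- (pi * t * (real k)\<^sup>2)))" by (rule integral_wt_bound(1)[OF m b])
  show "0 \<le> slope_mass k" unfolding slope_mass_def by (intro integral_nonneg_AE) (use AE_mix_nonneg in eventually_elim, simp)
qed

lemma integrable_origin_slope: "integrable \<nu> origin_slope"
proof (rule integral_wt_bound(1))
  show "origin_slope \<in> borel_measurable borel" unfolding origin_slope_def by measurable
  show "\<bar>origin_slope t\<bar> \<le> 20 * wt t" if "t \<ge> 0" for t using origin_slope_bounds[OF that] by (simp add: wt_def)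
qed

lemma summable_slope_mass: "summable (\<lambda>n. slope_mass (Suc n))"
proof (rule summableI_nonneg_bounded)
  show "0 \<le> slope_mass (Suc n)" for n by (rule slope_mass(2)) simp
  fix N
  have "(\<Sum>n<N. slope_mass (Suc n)) = (\<integral>t. (\<Sum>n<N. 2 * pi * t * real (Suc n) * exp (- (pi * t * (real (Suc n))\<^sup>2))) \<partial>\<nu>)"
    unfolding slope_mass_def by (rule Bochner_Integration.integral_sum[symmetric]) (rule slope_mass(1), simp)
  also have "\<dots> \<le> (\<integral>t. origin_slope t \<partial>\<nu>)"
  proof (rule integral_mono[OF _ integrable_origin_slope])
    show "integrable \<nu> (\<lambda>t. \<Sum>n<N. 2 * pi * t * real (Suc n) * exp (- (pi * t * (real (Suc n))\<^sup>2)))"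
      by (rule Bochner_Integration.integrable_sum) (rule slope_mass(1), simp)
    fix t assume "t \<in> space \<nu>"
    then have t: "t \<ge> 0" by (simp add: space_mix)
    show "(\<Sum>n<N. 2 * pi * t * real (Suc n) * exp (- (pi * t * (real (Suc n))\<^sup>2))) \<le> origin_slope t"
    proof (cases "t = 0")
      case False
      then show ?thesis unfolding origin_slope_def using t
        by (simp only: if_False) (intro sum_le_suminf summable_slope_terms, auto)
    qed (simp add: origin_slope_def)
  qed
  finally show "(\<Sum>n<N. slope_mass (Suc n)) \<le> origin_mass" by (simp add: origin_mass_def)
qed

definition node_value :: "int \<Rightarrow> real" where "node_value n = (if n \<ge> 1 then node_mass (nat n) else 0)"
text \<open>An atom of \<nu> at 0 contributes its full mass to the slope at the origin, although it
  adds nothing to the other slopes.\<close>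

definition node_slope :: "int \<Rightarrow> real" where
  "node_slope n = (if n \<ge> 1 then - slope_mass (nat n) else if n = 0 then origin_mass else 0)"
definition minorant :: "complex \<Rightarrow> complex" where
  "minorant = interp (\<lambda>n. of_real (node_value n)) (\<lambda>n. of_real (node_slope n))"

lemma minorant_interp:
  shows minorant_holomorphic: "minorant holomorphic_on UNIV"
    and minorant_has_sum: "((\<lambda>n. interp_term (of_real (node_value n)) (of_real (node_slope n)) n z) has_sum minorant z) UNIV"
    and minorant_of_int: "minorant (of_int m) = of_real (node_value m)"
    and minorant_exp_type: "exp_type_at_most (2 * pi) minorant"
proof -
  have H: "0 \<le> 4 * wt_mass" using node_mass[of 1] by simp
  have A: "cmod (of_real (node_value n)) \<le> 4 * wt_mass" for n
    using H node_mass(2,3)[of "nat n"] by (auto simp: node_value_def)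
  have B: "(\<lambda>n. cmod (of_real (node_slope n))) summable_on UNIV"
  proof (rule summable_on_int)
    have "(\<lambda>n. cmod (of_real (node_slope (int (Suc n))))) = (\<lambda>n. slope_mass (Suc n))"
      using slope_mass(2)[of "Suc _"] by (intro ext) (simp add: node_slope_def nat_add_distrib del: of_nat_Suc)
    then have "summable (\<lambda>n. cmod (of_real (node_slope (int (Suc n)))))" using summable_slope_mass by simp
    then show "summable (\<lambda>n. cmod (of_real (node_slope (int n))))" by (simp only: summable_Suc_iff[of "\<lambda>n. cmod (of_real (node_slope (int n)))"])
    have "(\<lambda>n. cmod (of_real (node_slope (- int (Suc n))))) = (\<lambda>n. 0)" by (simp add: node_slope_def)
    then have "summable (\<lambda>n. cmod (of_real (node_slope (- int (Suc n)))))" by simp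
    then show "summable (\<lambda>n. cmod (of_real (node_slope (- int n))))" by (simp only: summable_Suc_iff[of "\<lambda>n. cmod (of_real (node_slope (- int n)))"])
  qed simp
  note P = interp_properties[where A = "\<lambda>n. of_real (node_value n)" and B = "\<lambda>n. of_real (node_slope n)", OF A B, folded minorant_def]
  show "minorant holomorphic_on UNIV" by (rule P(1))
  show "((\<lambda>n. interp_term (of_real (node_value n)) (of_real (node_slope n)) n z) has_sum minorant z) UNIV" by (rule P(2))
  show "minorant (of_int m) = of_real (node_value m)" by (rule P(3))
  obtain C where "\<And>z. cmod (minorant z) \<le> C * exp (2 * pi * \<bar>Im z\<bar>)" using P(5) by blast
  then show "exp_type_at_most (2 * pi) minorant" by (rule exp_type_at_mostI[OF P(1)]) simp
qed

text \<open>Values come with the summable factor \<open>1 / (n - x)^2\<close>, slopes only with the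
  bounded one \<open>1 / \<delta>\<close>, where \<delta> is the distance from \<open>x\<close> to
  the integers. Accordingly the interchange uses a uniform bound on the \<open>node_mass\<close> and
  summability of the \<open>slope_mass\<close>.\<close>

lemma integral_minor_series:
  assumes x: "x \<notin> \<int>"
  shows "integrable \<nu> (\<lambda>t. minor_series t x)"
    and "(\<lambda>n. node_mass (Suc n) / (real (Suc n) - x)\<^sup>2 + slope_mass (Suc n) / (real (Suc n) - x)) sums
      ((\<integral>t. minor_series t x \<partial>\<nu>) - origin_mass / x)"
proof -
  define \<delta> where "\<delta> = min (x - of_int \<lfloor>x\<rfloor>) (of_int \<lfloor>x\<rfloor> + 1 - x)"
  have "x \<noteq> of_int \<lfloor>x\<rfloor>" using x by (metis Ints_of_int)
  then have \<delta>: "\<delta> > 0" unfolding \<delta>_def by linarith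
  have \<delta>n: "\<delta> \<le> \<bar>real n - x\<bar>" for n
  proof (cases "int n \<le> \<lfloor>x\<rfloor>")
    case True then have "real n \<le> of_int \<lfloor>x\<rfloor>" by linarith
    then show ?thesis unfolding \<delta>_def by linarith
  next
    case False then have "real n \<ge> of_int \<lfloor>x\<rfloor> + 1" by linarith
    then show ?thesis unfolding \<delta>_def by linarith
  qed
  define p where "p = (\<lambda>n. 1 / (real (Suc n) - x)\<^sup>2)"
  define r where "r = (\<lambda>n. 1 / (real (Suc n) - x))"
  define e where "e = (\<lambda>n t. exp (- (pi * t * (real (Suc n))\<^sup>2)))"
  define b where "b = (\<lambda>n t. 2 * pi * t * real (Suc n) * exp (- (pi * t * (real (Suc n))\<^sup>2)))"
  have p: "summable p" "p n \<ge> 0" for n unfolding p_def by (rule sums_inverse_squares_sin(1)[OF x], simp)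
  have r: "\<bar>r n\<bar> \<le> 1 / \<delta>" for n
  proof -
    have "1 / \<bar>real (Suc n) - x\<bar> \<le> 1 / \<delta>" using \<delta> \<delta>n[of "Suc n"] by (intro divide_left_mono mult_pos_pos) auto
    then show ?thesis by (simp add: r_def)
  qed
  have nt: "node_term t x (Suc n) = p n * e n t + r n * b n t" for n t
    unfolding node_term_def p_def r_def e_def b_def by (simp add: algebra_simps del: of_nat_Suc)
  have ie: "integrable \<nu> (e n)" and ib: "integrable \<nu> (b n)" for n
    unfolding e_def b_def by (rule node_mass(1), simp, rule slope_mass(1), simp)
  have eb: "e n t \<ge> 0" "e n t \<le> 1" "b n t \<ge> 0" if "t \<ge> 0" for n t using that by (auto simp: e_def b_def)
  have nm: "node_mass (Suc n) = (\<integral>t. e n t \<partial>\<nu>)" "slope_mass (Suc n) = (\<integral>t. b n t \<partial>\<nu>)" for n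
    unfolding node_mass_def slope_mass_def e_def b_def by (rule refl)+
  have i: "integrable \<nu> (\<lambda>t. node_term t x (Suc n))" for n
    unfolding nt by (intro Bochner_Integration.integrable_add integrable_mult_right ie ib)
  have nb: "norm (node_term t x (Suc n)) \<le> p n * e n t + (1 / \<delta>) * b n t" if "t \<ge> 0" for n t
  proof -
    have "\<bar>p n * e n t\<bar> = p n * e n t" using p(2) eb[OF that] by simp
    moreover have "\<bar>r n * b n t\<bar> \<le> (1 / \<delta>) * b n t" using r[of n] eb[OF that] \<delta> by (simp only: abs_mult) (intro mult_mono, auto)
    ultimately show ?thesis unfolding nt real_norm_def by linarith
  qed
  have sAE: "AE t in \<nu>. summable (\<lambda>n. norm (node_term t x (Suc n)))" using AE_mix_nonneg
  proof eventually_elim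
    fix t :: real assume t: "t \<ge> 0"
    have "summable (\<lambda>n. p n + (1 / \<delta>) * b n t)"
      unfolding b_def by (intro summable_add p summable_mult summable_slope_terms t)
    moreover have "norm (norm (node_term t x (Suc n))) \<le> p n + (1 / \<delta>) * b n t" for n
    proof -
      have "p n * e n t \<le> p n * 1" using p(2) eb[OF t] by (intro mult_left_mono) auto
      then show ?thesis using nb[OF t, of n] by simp
    qed
    ultimately show "summable (\<lambda>n. norm (node_term t x (Suc n)))" by (rule summable_comparison_test'[where N = 0])
  qed
  have sI: "summable (\<lambda>n. \<integral>t. norm (node_term t x (Suc n)) \<partial>\<nu>)"
  proof (rule summable_comparison_test'[where N = 0])
    show "summable (\<lambda>n. (4 * wt_mass) * p n + (1 / \<delta>) * slope_mass (Suc n))"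
      by (intro summable_add summable_mult p summable_slope_mass)
    fix n
    have "(\<integral>t. norm (node_term t x (Suc n)) \<partial>\<nu>) \<le> (\<integral>t. p n * e n t + (1 / \<delta>) * b n t \<partial>\<nu>)"
    proof (rule integral_mono[OF integrable_norm[OF i]])
      show "integrable \<nu> (\<lambda>t. p n * e n t + (1 / \<delta>) * b n t)"
        by (intro Bochner_Integration.integrable_add integrable_mult_right ie ib)
      show "norm (node_term t x (Suc n)) \<le> p n * e n t + (1 / \<delta>) * b n t" if "t \<in> space \<nu>" for t
        using that by (intro nb) (simp add: space_mix)
    qed
    also have "\<dots> = p n * node_mass (Suc n) + (1 / \<delta>) * slope_mass (Suc n)"
      unfolding nm
      by (subst Bochner_Integration.integral_add) (auto intro!: integrable_mult_right ie ib)
    also have "p n * node_mass (Suc n) \<le> p n * (4 * wt_mass)" using p(2) node_mass(3)[of "Suc n"] by (intro mult_left_mono) auto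
    finally have "(\<integral>t. norm (node_term t x (Suc n)) \<partial>\<nu>) \<le> (4 * wt_mass) * p n + (1 / \<delta>) * slope_mass (Suc n)" by (simp only: mult.commute)
    moreover have "0 \<le> (\<integral>t. norm (node_term t x (Suc n)) \<partial>\<nu>)" by (intro Bochner_Integration.integral_nonneg) simp
    ultimately show "norm (\<integral>t. norm (node_term t x (Suc n)) \<partial>\<nu>) \<le> (4 * wt_mass) * p n + (1 / \<delta>) * slope_mass (Suc n)" by simp
  qed
  have iS: "integrable \<nu> (\<lambda>t. \<Sum>n. node_term t x (Suc n))" by (rule integrable_suminf[OF i sAE sI])
  have iO: "integrable \<nu> (\<lambda>t. origin_slope t / x)" by (intro integrable_divide integrable_origin_slope)
  show "integrable \<nu> (\<lambda>t. minor_series t x)" unfolding minor_series_def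
    by (rule Bochner_Integration.integrable_add[OF iO iS])
  have "(\<integral>t. minor_series t x \<partial>\<nu>) = origin_mass / x + (\<integral>t. (\<Sum>n. node_term t x (Suc n)) \<partial>\<nu>)"
    unfolding minor_series_def Bochner_Integration.integral_add[OF iO iS] by (simp add: origin_mass_def)
  moreover have "(\<lambda>n. \<integral>t. node_term t x (Suc n) \<partial>\<nu>) sums (\<integral>t. (\<Sum>n. node_term t x (Suc n)) \<partial>\<nu>)"
    by (rule sums_integral[OF i sAE sI])
  moreover have "(\<integral>t. node_term t x (Suc n) \<partial>\<nu>) = node_mass (Suc n) / (real (Suc n) - x)\<^sup>2 + slope_mass (Suc n) / (real (Suc n) - x)" for n
  proof -
    have "(\<integral>t. node_term t x (Suc n) \<partial>\<nu>) = p n * node_mass (Suc n) + r n * slope_mass (Suc n)"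
      unfolding nt nm
      by (subst Bochner_Integration.integral_add) (auto intro!: integrable_mult_right ie ib)
    then show ?thesis by (simp add: p_def r_def del: of_nat_Suc)
  qed
  ultimately show "(\<lambda>n. node_mass (Suc n) / (real (Suc n) - x)\<^sup>2 + slope_mass (Suc n) / (real (Suc n) - x)) sums
      ((\<integral>t. minor_series t x \<partial>\<nu>) - origin_mass / x)" by simp
qed

lemma minorant_real:
  assumes x: "x \<notin> \<int>"
  shows "minorant (of_real x) = of_real (sin_factor x * (\<integral>t. minor_series t x \<partial>\<nu>))"
proof -
  define f where "f = (\<lambda>n::int. sin_factor x * (node_value n / (x - of_int n)\<^sup>2 + node_slope n / (x - of_int n)))"
  have "(\<lambda>N. \<Sum>n\<in>{- int N..int N}. complex_of_real (f n)) \<longlonglongrightarrow> minorant (of_real x)"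
    using has_sum_int_tendsto[OF minorant_has_sum[of "of_real x"]] unfolding interp_term_real[OF x] f_def sin_factor_def .
  then have 1: "(\<lambda>N. complex_of_real (f 0 + (\<Sum>n<N. f (int (Suc n)) + f (- int (Suc n))))) \<longlonglongrightarrow> minorant (of_real x)"
    unfolding of_real_sum[symmetric] sum_int_symmetric .
  have f0: "f 0 = sin_factor x * (origin_mass / x)" by (simp add: f_def node_value_def node_slope_def)
  have fn: "f (int (Suc n)) + f (- int (Suc n)) = sin_factor x * (node_mass (Suc n) / (real (Suc n) - x)\<^sup>2 + slope_mass (Suc n) / (real (Suc n) - x))" for n
  proof -
    have "(x - real (Suc n))\<^sup>2 = (real (Suc n) - x)\<^sup>2" by (rule power2_commute)
    moreover have "- slope_mass (Suc n) / (x - real (Suc n)) = slope_mass (Suc n) / (real (Suc n) - x)"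
      using minus_divide_divide[of "slope_mass (Suc n)" "real (Suc n) - x"] by simp
    moreover have "f (- int (Suc n)) = 0" by (simp add: f_def node_value_def node_slope_def)
    ultimately show ?thesis by (simp add: f_def node_value_def node_slope_def del: of_nat_Suc minus_divide_left)
  qed
  have "(\<lambda>N. f 0 + (\<Sum>n<N. f (int (Suc n)) + f (- int (Suc n)))) \<longlonglongrightarrow> f 0 + sin_factor x * ((\<integral>t. minor_series t x \<partial>\<nu>) - origin_mass / x)"
    unfolding fn by (intro tendsto_add tendsto_const) (simp only: sums_def[symmetric] sums_mult[OF integral_minor_series(2)[OF x]])
  then have "(\<lambda>N. complex_of_real (f 0 + (\<Sum>n<N. f (int (Suc n)) + f (- int (Suc n))))) \<longlonglongrightarrow> of_real (f 0 + sin_factor x * ((\<integral>t. minor_series t x \<partial>\<nu>) - origin_mass / x))"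
    by (rule tendsto_of_real)
  from LIMSEQ_unique[OF 1 this] show ?thesis unfolding f0 by (simp add: algebra_simps)
qed

lemma minorant_real_on_reals: "real_on_reals minorant"
  unfolding real_on_reals_def
proof
  fix x :: real
  show "minorant (of_real x) \<in> \<real>"
  proof (cases "x \<in> \<int>")
    case True
    then obtain n where "x = of_int n" by (auto elim: Ints_cases)
    then show ?thesis using minorant_of_int[of n] by simp
  qed (simp add: minorant_real)
qed

text \<open>A real-valued stand-in for the extended-real mixture, equal to it off the origin. The
  value 0 at the origin is a default; statements about \<open>target\<close> exclude that point or
  hold almost everywhere.\<close>

definition target :: "real \<Rightarrow> real" where "target x = (if x > 0 then (\<integral>t. exp (- (pi * t * x\<^sup>2)) \<partial>\<nu>) else 0)"

lemma integrable_target: "x \<noteq> 0 \<Longrightarrow> integrable \<nu> (\<lambda>t. exp (- (pi * t * x\<^sup>2)))"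
proof (rule integral_wt_bound(1))
  assume x: "x \<noteq> 0"
  show "\<bar>exp (- (pi * t * x\<^sup>2))\<bar> \<le> (3/2 + 1 / (2 * (pi * x\<^sup>2))) * wt t" if "t \<ge> 0" for t
    using exp_weight_le[OF that, of "pi * x\<^sup>2"] x by (simp add: wt_def mult_ac)
qed measurable

lemma target_minus_minorant:
  assumes x: "x \<notin> \<int>"
  shows "integrable \<nu> (\<lambda>t. sin_factor x * gap t x)"
    and "target x - Re (minorant (of_real x)) = (\<integral>t. sin_factor x * gap t x \<partial>\<nu>)"
proof -
  have x0: "x \<noteq> 0" using x by auto
  have "sin (pi * x) \<noteq> 0" using sin_factor_pos[OF x] by (auto simp: sin_factor_def)
  then have s: "sin_factor x * (pi\<^sup>2 / (sin (pi * x))\<^sup>2) = 1" by (simp add: sin_factor_def)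
  have iE: "integrable \<nu> (\<lambda>t. if x > 0 then exp (- (pi * t * x\<^sup>2)) else 0)" using integrable_target[OF x0] by (cases "x > 0") auto
  have eq: "sin_factor x * gap t x = (if x > 0 then exp (- (pi * t * x\<^sup>2)) else 0) - sin_factor x * minor_series t x" for t
  proof -
    have "sin_factor x * (E * pi\<^sup>2 / (sin (pi * x))\<^sup>2) = E" for E
    proof -
      have "sin_factor x * (E * pi\<^sup>2 / (sin (pi * x))\<^sup>2) = E * (sin_factor x * (pi\<^sup>2 / (sin (pi * x))\<^sup>2))" by simp
      then show ?thesis unfolding s by simp
    qed
    then show ?thesis by (simp add: gap_def right_diff_distrib)
  qed
  note iM = integrable_mult_right[OF integral_minor_series(1)[OF x], of "sin_factor x"]
  show "integrable \<nu> (\<lambda>t. sin_factor x * gap t x)" unfolding eq by (rule Bochner_Integration.integrable_diff[OF iE iM])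
  show "target x - Re (minorant (of_real x)) = (\<integral>t. sin_factor x * gap t x \<partial>\<nu>)"
    unfolding eq Bochner_Integration.integral_diff[OF iE iM] minorant_real[OF x] by (simp add: target_def)
qed

end

section \<open>The integral of the error of a single Gaussian\<close>

lemma has_bochner_integral_half_gaussian:
  assumes t: "t > 0"
  shows "has_bochner_integral lborel (\<lambda>x. if x > 0 then exp (- (pi * t * x\<^sup>2)) else 0) (1 / (2 * sqrt t))"
proof -
  define c where "c = sqrt (pi * t)"
  have c: "c > 0" "c\<^sup>2 = pi * t" using t by (auto simp: c_def)
  have "has_bochner_integral lborel (\<lambda>x. indicator {0..} (0 + c * x) *\<^sub>R exp (- (0 + c * x)\<^sup>2)) ((sqrt pi / 2) /\<^sub>R \<bar>c\<bar>)"
    using gaussian_moment_0 c by (subst (asm) lborel_has_bochner_integral_real_affine_iff[of c _ _ 0]) auto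
  moreover have "(sqrt pi / 2) /\<^sub>R \<bar>c\<bar> = 1 / (2 * sqrt t)" using c t by (simp add: c_def real_sqrt_mult field_simps)
  ultimately have "has_bochner_integral lborel (\<lambda>x. indicator {0..} (0 + c * x) *\<^sub>R exp (- (0 + c * x)\<^sup>2)) (1 / (2 * sqrt t))" by (simp only:)
  moreover have "has_bochner_integral lborel (\<lambda>x. indicator {0..} (0 + c * x) *\<^sub>R exp (- (0 + c * x)\<^sup>2)) (1 / (2 * sqrt t)) \<longleftrightarrow> ?thesis"
  proof (rule has_bochner_integral_discrete_difference[where X = "{0}"])
    show "indicator {0..} (0 + c * x) *\<^sub>R exp (- (0 + c * x)\<^sup>2) = (if x > 0 then exp (- (pi * t * x\<^sup>2)) else 0)" if "x \<notin> {0}" for x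
    proof (cases "x > 0")
      case True
      then have "0 \<le> c * x" using c by simp
      then show ?thesis using True c by (simp add: power_mult_distrib)
    next
      case False
      then have "c * x < 0" using that c by (simp add: mult_pos_neg)
      then show ?thesis using False by simp
    qed
  qed simp_all
  ultimately show ?thesis by (simp only:)
qed

lemma measurable_entire:
  assumes "f holomorphic_on UNIV" shows "(\<lambda>x. f (complex_of_real x)) \<in> borel_measurable borel"
proof (rule borel_measurable_continuous_onI)
  show "continuous_on UNIV (\<lambda>x. f (complex_of_real x))"
    by (rule continuous_on_compose2[OF holomorphic_on_imp_continuous_on[OF assms]]) (auto intro!: continuous_intros)
qed

lemma measurable_gap_weight: "(\<lambda>t. sin_factor x * gap t x) \<in> borel_measurable borel"
  unfolding sin_factor_def gap_def minor_series_def origin_slope_def node_term_def by measurable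

lemma minorant_weight_pos:
  assumes t: "t > 0" shows "minorant_weight t = 1 / (2 * sqrt t) - (\<Sum>n. exp (- (pi * t * (real (Suc n))\<^sup>2)))"
proof -
  have "- (1 + 2 * S) / 2 + 1 / 2 + w = w - S" for S w :: real by (simp add: field_simps)
  then show ?thesis using t unfolding minorant_weight_def Re_theta3(1)[OF t] by simp
qed

text \<open>For \<open>t > 0\<close> the mixture construction is applied to the point mass at
  \<open>t\<close>: its minorant is then integrable of type 2\<pi>, and Poisson summation evaluates
  the integral as the sum of the node values, half of the theta series without its central term. At
  \<open>t = 0\<close> the unit step is not integrable; instead the errors at \<open>x\<close> and
  \<open>- x\<close> add up to the squared sinc of integral 1, whence the value 1/2.\<close>

theorem integral_gap:
  assumes t: "t \<ge> 0"
  shows "(\<integral>x. sin_factor x * gap t x \<partial>lborel) = minorant_weight t"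
proof (cases "t = 0")
  case True
  define f where "f = (\<lambda>x. sin_factor x * gap t x)"
  have i: "integrable lborel f" unfolding f_def by (rule integrable_gap_section[OF t])
  have i': "integrable lborel (\<lambda>x. f (0 + (-1) * x))" by (rule lborel_integrable_real_affine[OF i]) simp
  have "(\<integral>x. f x \<partial>lborel) = (\<integral>x. f (0 + (-1) * x) \<partial>lborel)"
    using lborel_integral_real_affine[of "-1" f 0] by simp
  then have "2 * (\<integral>x. f x \<partial>lborel) = (\<integral>x. f x + f (0 + (-1) * x) \<partial>lborel)"
    unfolding Bochner_Integration.integral_add[OF i i'] by simp
  also have "\<dots> = (\<integral>x. Re ((csinc (of_real x))\<^sup>2) \<partial>lborel)"
  proof (rule integral_cong_AE)
    show "AE x in lborel. f x + f (0 + (-1) * x) = Re ((csinc (of_real x))\<^sup>2)" using AE_noninteger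
    proof eventually_elim
      fix x :: real assume x: "x \<notin> \<int>"
      then have x0: "x \<noteq> 0" by auto
      have s: "sin_factor (- x) = sin_factor x" by (simp add: sin_factor_def)
      have P: "pi\<^sup>2 / (sin (pi * x))\<^sup>2 = 1 / x\<^sup>2 + (\<Sum>n. 1 / (real (Suc n) - x)\<^sup>2) + (\<Sum>n. 1 / (real (Suc n) + x)\<^sup>2)"
        by (rule sums_inverse_squares_sin(3)[OF x])
      have "gap t x + gap t (- x) = 1 / x\<^sup>2"
        unfolding True gap_def minor_series_def origin_slope_def node_term_def using P x0 by (cases "x > 0") auto
      then have "f x + f (0 + (-1) * x) = sin_factor x * (1 / x\<^sup>2)"
        unfolding f_def using s by (simp add: distrib_left[symmetric])
      then show "f x + f (0 + (-1) * x) = Re ((csinc (of_real x))\<^sup>2)" unfolding csinc_sq_real[OF x] Re_complex_of_real .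
    qed
  qed (use i i' integrable_Re_csinc_sq in auto)
  finally show ?thesis using True by (simp add: f_def integral_Re_csinc_sq minorant_weight_def)
next
  case False
  then have t0: "t > 0" using t by simp
  define S where "S = restrict_space borel {0 :: real..}"
  have tS: "t \<in> space S" using t by (simp add: S_def space_restrict_space)
  have mS: "f \<in> borel_measurable S" if "f \<in> borel_measurable borel" for f :: "real \<Rightarrow> 'b::topological_space"
    unfolding S_def using that by (rule measurable_restrict_space1)
  interpret pm: gaussian_mixture "return S t"
  proof
    show "sets (return S t) = sets (restrict_space borel {0..})" by (simp add: S_def)
    have "(\<integral>\<^sup>+s. ennreal (1 / (1 + sqrt s)) \<partial>return S t) = ennreal (1 / (1 + sqrt t))"
      by (rule nn_integral_return[OF tS mS]) measurable
    then show "(\<integral>\<^sup>+s. ennreal (1 / (1 + sqrt s)) \<partial>return S t) < \<infinity>" by simp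
  qed
  have ret: "(\<integral>s. f s \<partial>return S t) = f t" if "f \<in> borel_measurable borel" for f :: "real \<Rightarrow> real"
    by (rule integral_return[OF tS mS[OF that]])
  have tg: "pm.target x = (if x > 0 then exp (- (pi * t * x\<^sup>2)) else 0)" for x
    unfolding pm.target_def by (subst ret) auto
  define r where "r = (\<lambda>x. pm.target x - sin_factor x * gap t x)"
  have hg: "has_bochner_integral lborel pm.target (1 / (2 * sqrt t))"
    unfolding tg[abs_def] by (rule has_bochner_integral_half_gaussian[OF t0])
  have ir: "integrable lborel r" unfolding r_def
    using hg by (intro Bochner_Integration.integrable_diff integrable_gap_section t) (simp add: has_bochner_integral_iff)
  have Ir: "(\<integral>x. r x \<partial>lborel) = 1 / (2 * sqrt t) - (\<integral>x. sin_factor x * gap t x \<partial>lborel)"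
    unfolding r_def using hg integrable_gap_section[OF t]
    by (subst Bochner_Integration.integral_diff) (auto simp: has_bochner_integral_iff)
  have ae: "AE x in lborel. complex_of_real (r x) = pm.minorant (of_real x)" using AE_noninteger
  proof eventually_elim
    fix x :: real assume x: "x \<notin> \<int>"
    have "pm.target x - Re (pm.minorant (of_real x)) = sin_factor x * gap t x"
      unfolding pm.target_minus_minorant(2)[OF x] by (rule ret[OF measurable_gap_weight])
    then have "r x = Re (pm.minorant (of_real x))" by (simp add: r_def)
    moreover have "complex_of_real (Re (pm.minorant (of_real x))) = pm.minorant (of_real x)"
      using pm.minorant_real_on_reals by (intro of_real_Re) (auto simp: real_on_reals_def)
    ultimately show "complex_of_real (r x) = pm.minorant (of_real x)" by simp
  qed
  have irc: "integrable lborel (\<lambda>x. complex_of_real (r x))" by (intro integrable_of_real ir)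
  have mm: "(\<lambda>x. pm.minorant (of_real x)) \<in> borel_measurable lborel"
    using measurable_entire[OF pm.minorant_holomorphic] by simp
  interpret L1_exp_type pm.minorant
  proof
    show "integrable lborel (\<lambda>x. pm.minorant (of_real x))"
      by (rule Bochner_Integration.integrable_cong_AE_imp[OF irc mm ae])
  qed (rule pm.minorant_exp_type)
  have Im: "(\<integral>x. pm.minorant (of_real x) \<partial>lborel) = of_real (\<integral>x. r x \<partial>lborel)"
    using integral_cong_AE[OF _ mm ae] borel_measurable_integrable[OF irc] by (simp add: integral_complex_of_real)
  have nv: "pm.node_value 0 = 0" "pm.node_value (int (Suc n)) = exp (- (pi * t * (real (Suc n))\<^sup>2))" "pm.node_value (- int (Suc n)) = 0" for n
    unfolding pm.node_value_def pm.node_mass_def by (simp_all add: nat_add_distrib ret del: of_nat_Suc)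
  have "(\<lambda>N. complex_of_real (pm.node_value 0 + (\<Sum>n<N. pm.node_value (int (Suc n)) + pm.node_value (- int (Suc n))))) \<longlonglongrightarrow> of_real (\<integral>x. r x \<partial>lborel)"
    using has_sum_int_tendsto[OF has_sum_integers_integral] unfolding pm.minorant_of_int Im of_real_sum[symmetric] sum_int_symmetric .
  then have "(\<lambda>N. \<Sum>n<N. exp (- (pi * t * (real (Suc n))\<^sup>2))) \<longlonglongrightarrow> (\<integral>x. r x \<partial>lborel)"
    unfolding tendsto_of_real_iff nv by simp
  then have "(\<integral>x. r x \<partial>lborel) = (\<Sum>n. exp (- (pi * t * (real (Suc n))\<^sup>2)))"
    unfolding sums_def[symmetric] by (rule sums_unique)
  then show ?thesis unfolding Ir minorant_weight_pos[OF t0] by linarith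
qed

text \<open>For \<open>t \<le> 1\<close> the upper bound is the integral 1 of the squared sinc, for
  larger \<open>t\<close> the integral \<open>1 / (2 sqrt t)\<close> of the half Gaussian.\<close>

lemma minorant_weight_bounds:
  assumes t: "t \<ge> 0"
  shows "0 \<le> minorant_weight t" "minorant_weight t \<le> 2 * wt t"
proof -
  have ae: "AE x in lborel. 0 \<le> sin_factor x * gap t x \<and> sin_factor x * gap t x \<le> Re ((csinc (of_real x))\<^sup>2)"
    using AE_noninteger by eventually_elim (use sin_factor_gap_bounds[OF t] in blast)
  show "0 \<le> minorant_weight t" unfolding integral_gap[OF t, symmetric]
    by (rule integral_nonneg_AE) (use ae in eventually_elim, blast)
  have "(\<integral>x. sin_factor x * gap t x \<partial>lborel) \<le> (\<integral>x. Re ((csinc (of_real x))\<^sup>2) \<partial>lborel)"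
    by (rule integral_mono_AE[OF integrable_gap_section[OF t] integrable_Re_csinc_sq]) (use ae in eventually_elim, blast)
  then have le1: "minorant_weight t \<le> 1" unfolding integral_gap[OF t] integral_Re_csinc_sq .
  show "minorant_weight t \<le> 2 * wt t"
  proof (cases "t \<le> 1")
    case True
    then have "1 / 2 \<le> 1 / (1 + sqrt t)" using t by (intro divide_left_mono) (auto simp: add_pos_nonneg)
    then show ?thesis using le1 by (simp add: wt_def)
  next
    case False
    then have t1: "t > 0" "sqrt t \<ge> 1" by auto
    have "minorant_weight t = 1 / (2 * sqrt t) - (\<Sum>n. exp (- (pi * t * (real (Suc n))\<^sup>2)))"
      by (rule minorant_weight_pos[OF t1(1)])
    also have "\<dots> \<le> 1 / (2 * sqrt t)" using suminf_nonneg[OF Re_theta3(2)[OF t1(1)]] by simp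
    also have "\<dots> \<le> 1 / (1 + sqrt t)"
    proof (rule divide_left_mono)
      show "0 < 2 * sqrt t * (1 + sqrt t)" using t1 by (intro mult_pos_pos) linarith+
    qed (use t1 in auto)
    also have "\<dots> \<le> 2 * wt t"
    proof -
      have "0 \<le> 1 / (1 + sqrt t)" using t1 by (intro divide_nonneg_nonneg) linarith+
      then show ?thesis unfolding wt_def by linarith
    qed
    finally show ?thesis .
  qed
qed

lemma majorant_weight_eq: "majorant_weight t = 1 - minorant_weight t"
  by (simp add: majorant_weight_def minorant_weight_def)

text \<open>Prepares differentiation under the integral at the positive integers: the second order
  remainder is dominated, uniformly near the node, by a multiple of the weight. 288 is half of 4
  times 144, the latter from \<open>16 u^2 + 8 u \<le> 144 exp (u / 2)\<close>.\<close>

lemma gaussian_Taylor: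
  assumes t: "t \<ge> 0" and c: "c \<ge> 1" and x: "\<bar>x - c\<bar> < 1/2"
  shows "\<bar>exp (- (pi * t * x\<^sup>2)) - exp (- (pi * t * c\<^sup>2)) + 2 * pi * t * c * exp (- (pi * t * c\<^sup>2)) * (x - c)\<bar> \<le> 288 * (x - c)\<^sup>2 * wt t"
proof (cases "x = c")
  case False
  define a where "a = 2 * pi * t"
  have a: "a \<ge> 0" using t by (simp add: a_def)
  define G where "G = (\<lambda>u. exp (- (a * u\<^sup>2 / 2)))"
  have Ga: "exp (- (pi * t * u\<^sup>2)) = G u" for u by (simp add: G_def a_def)
  define D where "D = (\<lambda>k::nat. if k = 0 then G else if k = 1 then (\<lambda>u. - (a * u) * G u) else (\<lambda>u. (a\<^sup>2 * u\<^sup>2 - a) * G u))"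
  have dG: "(G has_real_derivative - (a * u) * G u) (at u)" for u
    unfolding G_def by (auto intro!: derivative_eq_intros)
  have DD: "(D k has_real_derivative D (Suc k) u) (at u)" if "k < 2" for k u
  proof -
    have "k = 0 \<or> k = 1" using that by linarith
    then show ?thesis
    proof (elim disjE, goal_cases)
      case 1 then show ?case using dG by (simp add: D_def)
    next
      case 2
      have "((\<lambda>u. - (a * u)) has_real_derivative - a) (at u)" by (auto intro!: derivative_eq_intros)
      from DERIV_mult[OF this dG] have "((\<lambda>u. - (a * u) * G u) has_real_derivative (- a * G u + - (a * u) * G u * - (a * u))) (at u)" .
      also have "- a * G u + - (a * u) * G u * - (a * u) = (a\<^sup>2 * u\<^sup>2 - a) * G u" by (simp add: algebra_simps power2_eq_square)
      finally show ?case using 2 by (simp add: D_def)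
    qed
  qed
  have "\<exists>s. (if x < c then x < s \<and> s < c else c < s \<and> s < x) \<and> D 0 x = (\<Sum>k<2. D k c / fact k * (x - c) ^ k) + D 2 s / fact 2 * (x - c) ^ 2"
    using False by (intro Taylor[of 2 D "D 0" "min x c" "max x c"]) (auto simp: DD)
  then obtain s where s: "if x < c then x < s \<and> s < c else c < s \<and> s < x"
    and T: "D 0 x = (\<Sum>k<2. D k c / fact k * (x - c) ^ k) + D 2 s / fact 2 * (x - c) ^ 2" by blast
  have s12: "s \<ge> 1/2" using s x c by (auto split: if_splits)
  define u where "u = a * s\<^sup>2 / 2"
  have u0: "u \<ge> 0" using a by (simp add: u_def)
  have s2: "1/4 \<le> s\<^sup>2" using power_mono[OF s12, of 2] by (simp add: power2_eq_square)
  have "a * (1/4) \<le> a * s\<^sup>2" using a s2 by (intro mult_left_mono) auto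
  then have au: "a \<le> 8 * u" by (simp add: u_def)
  have "(\<Sum>k<3. (u / 2) ^ k / fact k) \<le> exp (u / 2)" using u0 by (intro exp_ge_Taylor) auto
  then have e: "1 + u / 2 + u\<^sup>2 / 8 \<le> exp (u / 2)" by (simp add: eval_nat_numeral)
  have "a\<^sup>2 * s\<^sup>2 = a * (2 * u)" by (simp add: u_def power2_eq_square)
  also have "\<dots> \<le> 8 * u * (2 * u)" using au u0 by (intro mult_right_mono) auto
  also have "\<dots> = 16 * u\<^sup>2" by (simp add: power2_eq_square)
  finally have "a\<^sup>2 * s\<^sup>2 \<le> 16 * u\<^sup>2" .
  moreover have "0 \<le> a\<^sup>2 * s\<^sup>2" by simp
  ultimately have "\<bar>a\<^sup>2 * s\<^sup>2 - a\<bar> \<le> 16 * u\<^sup>2 + 8 * u" using au a by linarith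
  also have "\<dots> \<le> 144 * exp (u / 2)" using e u0 zero_le_power2[of u] by linarith
  finally have "\<bar>a\<^sup>2 * s\<^sup>2 - a\<bar> * exp (- u) \<le> 144 * exp (u / 2) * exp (- u)" by (rule mult_right_mono) simp
  also have "\<dots> = 144 * exp (- (u / 2))" unfolding mult.assoc exp_add[symmetric] by simp
  also have "\<dots> \<le> 144 * exp (- ((pi / 8) * t))" using au by (simp add: a_def)
  also have "\<dots> \<le> 144 * (4 * wt t)" unfolding wt_def using t pi_gt3 by (intro mult_left_mono exp_weight_le_4) auto
  finally have D2: "\<bar>(a\<^sup>2 * s\<^sup>2 - a) * G s\<bar> \<le> 576 * wt t" by (simp add: abs_mult G_def u_def)
  have "G x = G c + - (a * c) * G c * (x - c) + (a\<^sup>2 * s\<^sup>2 - a) * G s / 2 * (x - c)\<^sup>2"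
    using T by (simp add: D_def numeral_2_eq_2)
  then have "G x - G c + a * c * G c * (x - c) = (a\<^sup>2 * s\<^sup>2 - a) * G s / 2 * (x - c)\<^sup>2" by simp
  then have "\<bar>G x - G c + a * c * G c * (x - c)\<bar> = \<bar>(a\<^sup>2 * s\<^sup>2 - a) * G s\<bar> / 2 * (x - c)\<^sup>2"
    by (simp only: abs_mult abs_divide abs_numeral abs_power2)
  also have "\<dots> \<le> 576 * wt t / 2 * (x - c)\<^sup>2" using D2 by (intro mult_right_mono divide_right_mono) auto
  finally show ?thesis unfolding Ga by (simp add: a_def mult_ac)
qed simp

section \<open>Extremality of the mixture minorant\<close>

context gaussian_mixture
begin

lemma integrable_minorant_weight: "integrable \<nu> minorant_weight"
proof (rule Bochner_Integration.integrable_bound[OF integrable_mult_right[OF integrable_wt, of 2]])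
  have "(\<lambda>t. \<integral>x. sin_factor x * gap t x \<partial>lborel) \<in> borel_measurable borel"
    unfolding sin_factor_def gap_def minor_series_def origin_slope_def node_term_def by measurable
  then have "(\<lambda>t. \<integral>x. sin_factor x * gap t x \<partial>lborel) \<in> borel_measurable \<nu>" by (rule measurable_mix)
  then show "minorant_weight \<in> borel_measurable \<nu>"
    by (rule measurable_cong[THEN iffD1, rotated]) (simp add: integral_gap space_mix)
  show "AE t in \<nu>. norm (minorant_weight t) \<le> norm (2 * wt t)" using AE_mix_nonneg
  proof eventually_elim
    fix t :: real assume "t \<ge> 0"
    from minorant_weight_bounds[OF this] show "norm (minorant_weight t) \<le> norm (2 * wt t)" unfolding real_norm_def by linarith
  qed
qed

lemma measurable_target: "target \<in> borel_measurable borel"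
proof -
  have [measurable]: "snd \<in> borel_measurable (borel \<Otimes>\<^sub>M \<nu>)" using measurable_compose[OF measurable_snd measurable_mix[of "\<lambda>t. t"]] by simp
  have "(\<lambda>x. \<integral>t. exp (- (pi * t * x\<^sup>2)) \<partial>\<nu>) \<in> borel_measurable borel"
    by (rule borel_measurable_lebesgue_integral) (unfold case_prod_beta, measurable)
  then show ?thesis unfolding target_def by measurable
qed

lemma minorant_le_target:
  assumes x: "x \<noteq> 0" shows "Re (minorant (of_real x)) \<le> target x"
proof (cases "x \<in> \<int>")
  case True
  then obtain n where n: "x = of_int n" by (auto elim: Ints_cases)
  have "minorant (of_real x) = of_real (node_value n)" using minorant_of_int[of n] n by simp
  then show ?thesis using n x by (auto simp: node_value_def target_def node_mass_def)
next
  case False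
  have "0 \<le> (\<integral>t. sin_factor x * gap t x \<partial>\<nu>)"
    by (rule integral_nonneg_AE) (use AE_mix_nonneg in eventually_elim, use sin_factor_gap_bounds[OF _ False] in blast)
  then show ?thesis using target_minus_minorant(2)[OF False] by simp
qed

lemma minorant_node: "n \<noteq> 0 \<Longrightarrow> minorant (of_int n) = of_real (target (of_int n))"
  unfolding minorant_of_int by (auto simp: node_value_def target_def node_mass_def)

text \<open>The gap is nonnegative off the integers, so Tonelli exchanges the integrals, and
  integrability of the error follows from that of \<open>minorant_weight\<close>.\<close>

lemma has_bochner_integral_target_minus_minorant:
  "has_bochner_integral lborel (\<lambda>x. target x - Re (minorant (of_real x))) (\<integral>t. minorant_weight t \<partial>\<nu>)"
proof (rule has_bochner_integral_nn_integral)
  interpret pair_sigma_finite lborel \<nu> ..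
  have id: "(\<lambda>p. (fst p, snd p)) \<in> lborel \<Otimes>\<^sub>M \<nu> \<rightarrow>\<^sub>M borel \<Otimes>\<^sub>M borel"
    using measurable_compose[OF measurable_snd measurable_mix[of "\<lambda>t. t"], of lborel] measurable_fst[of lborel \<nu>]
    by (intro measurable_Pair) auto
  have jm: "(\<lambda>p. sin_factor (fst p) * gap (snd p) (fst p)) \<in> borel_measurable (lborel \<Otimes>\<^sub>M \<nu>)"
    using measurable_compose[OF id measurable_gap] by simp
  show "(\<lambda>x. target x - Re (minorant (of_real x))) \<in> borel_measurable lborel"
    using measurable_target measurable_entire[OF minorant_holomorphic] by simp
  show "AE x in lborel. 0 \<le> target x - Re (minorant (of_real x))"
    using AE_lborel_singleton[of 0] by eventually_elim (use minorant_le_target in simp)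
  have W0: "AE t in \<nu>. 0 \<le> minorant_weight t" using AE_mix_nonneg by eventually_elim (rule minorant_weight_bounds(1))
  then show "0 \<le> (\<integral>t. minorant_weight t \<partial>\<nu>)" by (rule integral_nonneg_AE)
  have "(\<integral>\<^sup>+x. ennreal (target x - Re (minorant (of_real x))) \<partial>lborel) = (\<integral>\<^sup>+x. \<integral>\<^sup>+t. ennreal (sin_factor x * gap t x) \<partial>\<nu> \<partial>lborel)"
  proof (rule nn_integral_cong_AE)
    show "AE x in lborel. ennreal (target x - Re (minorant (of_real x))) = (\<integral>\<^sup>+t. ennreal (sin_factor x * gap t x) \<partial>\<nu>)"
      using AE_noninteger
    proof eventually_elim
      fix x :: real assume x: "x \<notin> \<int>"
      have "AE t in \<nu>. 0 \<le> sin_factor x * gap t x" using AE_mix_nonneg by eventually_elim (rule sin_factor_gap_bounds(1)[OF _ x])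
      then show "ennreal (target x - Re (minorant (of_real x))) = (\<integral>\<^sup>+t. ennreal (sin_factor x * gap t x) \<partial>\<nu>)"
        unfolding target_minus_minorant(2)[OF x] by (rule nn_integral_eq_integral[OF target_minus_minorant(1)[OF x], symmetric])
    qed
  qed
  also have "\<dots> = (\<integral>\<^sup>+t. \<integral>\<^sup>+x. ennreal (sin_factor x * gap t x) \<partial>lborel \<partial>\<nu>)"
    by (rule Fubini'[symmetric]) (use jm in \<open>simp add: case_prod_beta\<close>)
  also have "\<dots> = (\<integral>\<^sup>+t. ennreal (minorant_weight t) \<partial>\<nu>)"
  proof (rule nn_integral_cong)
    fix t assume "t \<in> space \<nu>"
    then have t: "t \<ge> 0" by (simp add: space_mix)
    have "AE x in lborel. 0 \<le> sin_factor x * gap t x" using AE_noninteger by eventually_elim (rule sin_factor_gap_bounds(1)[OF t])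
    then show "(\<integral>\<^sup>+x. ennreal (sin_factor x * gap t x) \<partial>lborel) = ennreal (minorant_weight t)"
      unfolding integral_gap[OF t, symmetric] by (rule nn_integral_eq_integral[OF integrable_gap_section[OF t]])
  qed
  also have "\<dots> = ennreal (\<integral>t. minorant_weight t \<partial>\<nu>)" by (rule nn_integral_eq_integral[OF integrable_minorant_weight W0])
  finally show "(\<integral>\<^sup>+x. ennreal (target x - Re (minorant (of_real x))) \<partial>lborel) = ennreal (\<integral>t. minorant_weight t \<partial>\<nu>)" .
qed

text \<open>On the negative axis the target vanishes identically. At a positive integer the
  derivative is \<open>- slope_mass\<close>, since the Taylor remainder stays quadratically small
  after integration against \<nu>.\<close>

lemma target_differentiable:
  assumes n: "n \<noteq> 0" shows "\<exists>d. (target has_real_derivative d) (at (of_int n))"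
proof (cases "n > 0")
  case False
  have "((\<lambda>x. 0) has_real_derivative 0) (at (of_int n))" by simp
  then have "(target has_real_derivative 0) (at (of_int n))"
    by (rule has_field_derivative_transform_within_open[of _ _ _ "{..<0}"]) (use False n in \<open>auto simp: target_def\<close>)
  then show ?thesis by blast
next
  case True
  define k where "k = nat n"
  define c where "c = real k"
  have k: "k \<ge> 1" "of_int n = c" using True by (auto simp: k_def c_def)
  have c1: "c \<ge> 1" using k by (simp add: c_def)
  define d where "d = - slope_mass k"
  define s where "s = (\<lambda>x. target x - target c - d * (x - c))"
  have sb: "\<bar>s x\<bar> \<le> 288 * wt_mass * (x - c)\<^sup>2" if x: "\<bar>x - c\<bar> < 1/2" for x
  proof -
    have x0: "x > 0" using x c1 by linarith
    let ?f = "\<lambda>t. exp (- (pi * t * x\<^sup>2)) - exp (- (pi * t * c\<^sup>2)) + 2 * pi * t * c * exp (- (pi * t * c\<^sup>2)) * (x - c)"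
    have i1: "integrable \<nu> (\<lambda>t. exp (- (pi * t * x\<^sup>2)))" "integrable \<nu> (\<lambda>t. exp (- (pi * t * c\<^sup>2)))"
      using x0 c1 by (auto intro: integrable_target)
    have i2: "integrable \<nu> (\<lambda>t. 2 * pi * t * c * exp (- (pi * t * c\<^sup>2)))" unfolding c_def by (rule slope_mass(1)[OF k(1)])
    have "(\<integral>t. ?f t \<partial>\<nu>) = s x"
      using x0 c1 Bochner_Integration.integral_add[OF Bochner_Integration.integrable_diff[OF i1] integrable_mult_left[OF i2, of "x - c"]]
        Bochner_Integration.integral_diff[OF i1]
      by (simp add: s_def target_def d_def slope_mass_def c_def[symmetric])
    moreover have "\<bar>\<integral>t. ?f t \<partial>\<nu>\<bar> \<le> (288 * (x - c)\<^sup>2) * wt_mass"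
      by (rule integral_wt_bound(2)) (measurable, rule gaussian_Taylor[OF _ c1 x])
    ultimately show ?thesis by (simp add: mult_ac)
  qed
  \<comment> \<open>Cut off outside the neighbourhood, because
    \<open>has_real_derivative_0_quadratic\<close> asks for a global bound.\<close>
  define s' where "s' = (\<lambda>x. if \<bar>x - c\<bar> < 1/2 then s x else 0)"
  have "0 \<le> wt_mass" unfolding wt_mass_def by (rule integral_nonneg_AE) (use AE_mix_nonneg in eventually_elim, simp add: less_imp_le wt_pos)
  then have "\<bar>s' x\<bar> \<le> (288 * wt_mass) * (x - c)\<^sup>2" for x using sb[of x] by (simp add: s'_def)
  then have "(s' has_real_derivative 0) (at c)" by (rule has_real_derivative_0_quadratic)
  then have "(s has_real_derivative 0) (at c)"
    by (rule has_field_derivative_transform_within_open[of _ _ _ "ball c (1/2)"]) (auto simp: s'_def dist_real_def abs_minus_commute)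
  then have "((\<lambda>x. s x + (target c + d * (x - c))) has_real_derivative 0 + d) (at c)"
    by (intro DERIV_add) (auto intro!: derivative_eq_intros)
  then show ?thesis unfolding k(2) s_def by auto
qed

lemma mixture_eq_target: "x \<noteq> 0 \<Longrightarrow> truncated_gaussian_mixture \<nu> x = ereal (target x)"
proof -
  assume x: "x \<noteq> 0"
  have "(\<integral>\<^sup>+t. ennreal (exp (- pi * t * x\<^sup>2)) \<partial>\<nu>) = ennreal (\<integral>t. exp (- (pi * t * x\<^sup>2)) \<partial>\<nu>)"
    using nn_integral_eq_integral[OF integrable_target[OF x]] by simp
  moreover have "0 \<le> (\<integral>t. exp (- (pi * t * x\<^sup>2)) \<partial>\<nu>)" by (intro Bochner_Integration.integral_nonneg) simp
  ultimately show ?thesis using x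
    by (cases "x > 0") (simp_all add: truncated_gaussian_mixture_def target_def xplus0_def sgn_if enn2ereal_ennreal zero_ereal_def[symmetric] one_ereal_def[symmetric])
qed

lemma L1_dist_mixture:
  assumes "L holomorphic_on UNIV"
  shows "L1_dist (truncated_gaussian_mixture \<nu>) L = (\<integral>\<^sup>+x. ennreal \<bar>target x - Re (L (of_real x))\<bar> \<partial>lborel)"
  unfolding L1_dist_def
proof (rule nn_integral_cong_AE)
  show "AE x in lborel. e2ennreal \<bar>truncated_gaussian_mixture \<nu> x - ereal (Re (L (of_real x)))\<bar> = ennreal \<bar>target x - Re (L (of_real x))\<bar>"
    using AE_lborel_singleton[of 0] by eventually_elim (simp add: mixture_eq_target)
qed

lemma L1_dist_le_imp:
  assumes L: "L holomorphic_on UNIV" and fin: "L1_dist (truncated_gaussian_mixture \<nu>) L < \<infinity>"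
  shows "integrable lborel (\<lambda>x. target x - Re (L (of_real x)))"
proof (rule integrableI_bounded)
  show "(\<lambda>x. target x - Re (L (of_real x))) \<in> borel_measurable lborel"
    using measurable_target measurable_entire[OF L] by simp
  show "(\<integral>\<^sup>+x. ennreal (norm (target x - Re (L (of_real x)))) \<partial>lborel) < \<infinity>"
    using fin unfolding L1_dist_mixture[OF L] by simp
qed

lemma L1_dist_integrable:
  assumes L: "L holomorphic_on UNIV" and i: "integrable lborel (\<lambda>x. target x - Re (L (of_real x)))"
  shows "L1_dist (truncated_gaussian_mixture \<nu>) L = ennreal (\<integral>x. \<bar>target x - Re (L (of_real x))\<bar> \<partial>lborel)"
  unfolding L1_dist_mixture[OF L] by (rule nn_integral_eq_integral[OF integrable_abs[OF i]]) simp

lemma mixture_has_derivative: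
  assumes "(target has_real_derivative d) (at (of_int n))" "n \<noteq> 0"
  shows "((\<lambda>x. real_of_ereal (truncated_gaussian_mixture \<nu> x)) has_real_derivative d) (at (of_int n))"
  by (rule has_field_derivative_transform_within_open[OF assms(1), of "- {0}"]) (use assms(2) in \<open>auto simp: mixture_eq_target\<close>)

lemma has_bochner_integral_mixture:
  assumes "has_bochner_integral lborel (\<lambda>x. target x - Re (L (of_real x))) I"
  shows "has_bochner_integral lborel (\<lambda>x. real_of_ereal (truncated_gaussian_mixture \<nu> x - ereal (Re (L (of_real x))))) I"
    "has_bochner_integral lborel (\<lambda>x. real_of_ereal (ereal (Re (L (of_real x))) - truncated_gaussian_mixture \<nu> x)) (- I)"
proof -
  show "has_bochner_integral lborel (\<lambda>x. real_of_ereal (truncated_gaussian_mixture \<nu> x - ereal (Re (L (of_real x))))) I"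
    using assms by (subst has_bochner_integral_discrete_difference[where X = "{0}" and g = "\<lambda>x. target x - Re (L (of_real x))"]) (simp_all add: mixture_eq_target)
  show "has_bochner_integral lborel (\<lambda>x. real_of_ereal (ereal (Re (L (of_real x))) - truncated_gaussian_mixture \<nu> x)) (- I)"
    using has_bochner_integral_minus[OF assms]
    by (subst has_bochner_integral_discrete_difference[where X = "{0}" and g = "\<lambda>x. - (target x - Re (L (of_real x)))"]) (simp_all add: mixture_eq_target)
qed

lemma L1_dist_one_sided:
  assumes L: "L holomorphic_on UNIV" and i: "integrable lborel (\<lambda>x. target x - Re (L (of_real x)))"
  shows "(\<And>x. x \<noteq> 0 \<Longrightarrow> Re (L (of_real x)) \<le> target x) \<Longrightarrow>
      L1_dist (truncated_gaussian_mixture \<nu>) L = ennreal (\<integral>x. target x - Re (L (of_real x)) \<partial>lborel)"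
    and "(\<And>x. x \<noteq> 0 \<Longrightarrow> target x \<le> Re (L (of_real x))) \<Longrightarrow>
      L1_dist (truncated_gaussian_mixture \<nu>) L = ennreal (\<integral>x. Re (L (of_real x)) - target x \<partial>lborel)"
proof -
  have m: "(\<lambda>x. target x) \<in> borel_measurable lborel" "(\<lambda>x. Re (L (of_real x))) \<in> borel_measurable lborel"
    using measurable_target measurable_entire[OF L] by simp_all
  show "L1_dist (truncated_gaussian_mixture \<nu>) L = ennreal (\<integral>x. target x - Re (L (of_real x)) \<partial>lborel)"
    if le: "\<And>x. x \<noteq> 0 \<Longrightarrow> Re (L (of_real x)) \<le> target x"
  proof -
    have "AE x in lborel. \<bar>target x - Re (L (of_real x))\<bar> = target x - Re (L (of_real x))"
      using AE_lborel_singleton[of 0] by eventually_elim (simp add: le)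
    then have "(\<integral>x. \<bar>target x - Re (L (of_real x))\<bar> \<partial>lborel) = (\<integral>x. target x - Re (L (of_real x)) \<partial>lborel)"
      by (rule integral_cong_AE[rotated -1]) (intro borel_measurable_abs borel_measurable_diff m)+
    then show ?thesis by (simp only: L1_dist_integrable[OF L i])
  qed
  show "L1_dist (truncated_gaussian_mixture \<nu>) L = ennreal (\<integral>x. Re (L (of_real x)) - target x \<partial>lborel)"
    if le: "\<And>x. x \<noteq> 0 \<Longrightarrow> target x \<le> Re (L (of_real x))"
  proof -
    have "AE x in lborel. \<bar>target x - Re (L (of_real x))\<bar> = Re (L (of_real x)) - target x"
      using AE_lborel_singleton[of 0] by eventually_elim (use le in force)
    then have "(\<integral>x. \<bar>target x - Re (L (of_real x))\<bar> \<partial>lborel) = (\<integral>x. Re (L (of_real x)) - target x \<partial>lborel)"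
      by (rule integral_cong_AE[rotated -1]) (intro borel_measurable_abs borel_measurable_diff m)+
    then show ?thesis by (simp only: L1_dist_integrable[OF L i])
  qed
qed

lemma entire_limit_0:
  assumes "L holomorphic_on UNIV" "X \<longlonglongrightarrow> 0"
  shows "(\<lambda>k. Re (L (of_real (X k)))) \<longlonglongrightarrow> Re (L 0)"
proof -
  have "isCont L 0" using holomorphic_on_imp_continuous_on[OF assms(1)] by (simp add: continuous_on_eq_continuous_at)
  moreover have "(\<lambda>k. complex_of_real (X k)) \<longlonglongrightarrow> 0" using tendsto_of_real[OF assms(2), where 'a = complex] by simp
  ultimately have "(\<lambda>k. L (of_real (X k))) \<longlonglongrightarrow> L 0" by (rule isCont_tendsto_compose)
  then show ?thesis by (rule tendsto_Re)
qed

text \<open>The bound at the origin is a limit from the left, where the target vanishes. The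
  inequality at 0 itself compares only with half the total mass, which may be infinite.\<close>

lemma minorant_ofD:
  assumes "minorant_of (2 * pi) (truncated_gaussian_mixture \<nu>) L"
  shows "exp_type_at_most (2 * pi) L" "real_on_reals L" "L holomorphic_on UNIV"
    "\<And>x. x \<noteq> 0 \<Longrightarrow> Re (L (of_real x)) \<le> target x" "Re (L 0) \<le> 0"
proof -
  show 1: "exp_type_at_most (2 * pi) L" "real_on_reals L" using assms by (auto simp: minorant_of_def)
  show h: "L holomorphic_on UNIV" using 1 by (simp add: exp_type_at_most_def)
  show le: "Re (L (of_real x)) \<le> target x" if "x \<noteq> 0" for x
  proof -
    have "ereal (Re (L (of_real x))) \<le> truncated_gaussian_mixture \<nu> x" using assms by (auto simp: minorant_of_def)
    then show ?thesis by (simp add: mixture_eq_target[OF that])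
  qed
  have "(\<lambda>k. - inverse (real (Suc k))) \<longlonglongrightarrow> 0" using tendsto_minus[OF LIMSEQ_inverse_real_of_nat] by simp
  from entire_limit_0[OF h this] show "Re (L 0) \<le> 0"
  proof (rule LIMSEQ_le_const2, intro exI allI impI)
    fix k :: nat
    have neg: "- inverse (real (Suc k)) < 0" by simp
    then have "target (- inverse (real (Suc k))) = 0" by (simp add: target_def del: of_nat_Suc)
    then show "Re (L (of_real (- inverse (real (Suc k))))) \<le> 0" using le[of "- inverse (real (Suc k))"] neg by linarith
  qed
qed

lemma minorant_of_minorant: "minorant_of (2 * pi) (truncated_gaussian_mixture \<nu>) minorant"
  unfolding minorant_of_def
proof (intro conjI allI minorant_exp_type minorant_real_on_reals)
  fix x :: real
  show "ereal (Re (minorant (of_real x))) \<le> truncated_gaussian_mixture \<nu> x"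
  proof (cases "x = 0")
    case True
    have "minorant (of_real x) = 0" using minorant_of_int[of 0] True by (simp add: node_value_def)
    moreover have "0 \<le> truncated_gaussian_mixture \<nu> x" unfolding True truncated_gaussian_mixture_def xplus0_def
      by (intro ereal_0_le_mult) auto
    ultimately show ?thesis by (simp add: zero_ereal_def[symmetric])
  qed (simp add: mixture_eq_target minorant_le_target)
qed

lemma minorant_optimal:
  assumes L: "minorant_of (2 * pi) (truncated_gaussian_mixture \<nu>) L"
  shows "L1_dist (truncated_gaussian_mixture \<nu>) minorant \<le> L1_dist (truncated_gaussian_mixture \<nu>) L"
    and "L1_dist (truncated_gaussian_mixture \<nu>) L \<le> L1_dist (truncated_gaussian_mixture \<nu>) minorant \<Longrightarrow> L = minorant"
proof -
  let ?g = "truncated_gaussian_mixture \<nu>"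
  note LD = minorant_ofD[OF L]
  have im: "integrable lborel (\<lambda>x. target x - Re (minorant (of_real x)))"
    using has_bochner_integral_target_minus_minorant by (simp add: has_bochner_integral_iff)
  have dm: "L1_dist ?g minorant = ennreal (\<integral>x. target x - Re (minorant (of_real x)) \<partial>lborel)"
    by (rule L1_dist_one_sided(1)[OF minorant_holomorphic im minorant_le_target])
  have "L1_dist ?g minorant \<le> L1_dist ?g L \<and> (L1_dist ?g L \<le> L1_dist ?g minorant \<longrightarrow> L = minorant)"
  proof (cases "L1_dist ?g L < \<infinity>")
    case True
    note iL = L1_dist_le_imp[OF LD(3) True]
    have dL: "L1_dist ?g L = ennreal (\<integral>x. target x - Re (L (of_real x)) \<partial>lborel)"
      by (rule L1_dist_one_sided(1)[OF LD(3) iL LD(4)])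
    have node: "Re (minorant (of_int n)) = target (of_int n)" if "n \<noteq> 0" for n using minorant_node[OF that] by simp
    have zero: "Re (L 0) \<le> Re (minorant 0)" using LD(5) minorant_of_int[of 0] by (simp add: node_value_def)
    note core = extremal_core[OF minorant_exp_type minorant_real_on_reals LD(1,2) minorant_le_target im LD(4) iL node target_differentiable zero]
    have "0 \<le> (\<integral>x. target x - Re (minorant (of_real x)) \<partial>lborel)"
      by (rule integral_nonneg_AE) (use AE_lborel_singleton[of 0] in eventually_elim, simp add: minorant_le_target)
    then have "L1_dist ?g L \<le> L1_dist ?g minorant \<Longrightarrow> (\<integral>x. target x - Re (L (of_real x)) \<partial>lborel) \<le> (\<integral>x. target x - Re (minorant (of_real x)) \<partial>lborel)"
      unfolding dL dm by (simp only: ennreal_le_iff)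
    then show ?thesis using core(2) ennreal_leI[OF core(1)] unfolding dL dm by blast
  next
    case False
    then have "L1_dist ?g L = \<infinity>" using less_top[of "L1_dist ?g L"] unfolding infinity_ennreal_def by blast
    then show ?thesis by (simp add: dm top_unique)
  qed
  then show "L1_dist ?g minorant \<le> L1_dist ?g L" "L1_dist ?g L \<le> L1_dist ?g minorant \<Longrightarrow> L = minorant"
    by (rule conjunct1, rule conjunct2[THEN mp])
qed

lemma extremal_minorant_iff: "extremal_minorant (2 * pi) (truncated_gaussian_mixture \<nu>) l \<longleftrightarrow> l = minorant"
  unfolding extremal_minorant_def using minorant_of_minorant minorant_optimal by blast

lemma interpolates_off_zeroI:
  assumes K: "K holomorphic_on UNIV" "real_on_reals K"
    and node: "\<And>n::int. n \<noteq> 0 \<Longrightarrow> K (of_int n) = of_real (target (of_int n))"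
    and touch: "\<And>n d. n \<noteq> 0 \<Longrightarrow> (target has_real_derivative d) (at (of_int n)) \<Longrightarrow> Re (deriv K (of_int n)) = d"
  shows "interpolates_off_zero (truncated_gaussian_mixture \<nu>) K"
  unfolding interpolates_off_zero_def
proof (intro allI impI)
  fix n :: int assume n: "n \<noteq> 0"
  obtain d where d: "(target has_real_derivative d) (at (of_int n))" using target_differentiable[OF n] by blast
  have "deriv K (of_int n) = of_real d" using real_on_reals_deriv(2)[OF K, of "of_int n"] touch[OF n d] by simp
  then have "(K has_field_derivative of_real d) (at (of_int n))"
    using holomorphic_derivI[OF K(1) open_UNIV, of "of_int n"] by simp
  moreover have "truncated_gaussian_mixture \<nu> (of_int n) = ereal (target (of_int n))" using n by (intro mixture_eq_target) simp
  ultimately show "\<exists>y d. truncated_gaussian_mixture \<nu> (of_int n) = ereal y \<and> K (of_int n) = of_real y \<and>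
      ((\<lambda>x. real_of_ereal (truncated_gaussian_mixture \<nu> x)) has_real_derivative d) (at (of_int n)) \<and>
      (K has_field_derivative of_real d) (at (of_int n))"
    using node[OF n] mixture_has_derivative[OF d n] by blast
qed

lemma interpolates_minorant: "interpolates_off_zero (truncated_gaussian_mixture \<nu>) minorant"
proof (rule interpolates_off_zeroI[OF minorant_holomorphic minorant_real_on_reals minorant_node])
  fix n :: int and d assume n: "n \<noteq> 0" and d: "(target has_real_derivative d) (at (of_int n))"
  show "Re (deriv minorant (of_int n)) = d"
    by (rule touching_derivative[OF minorant_holomorphic minorant_real_on_reals minorant_le_target n _ d]) (simp_all add: minorant_node[OF n])
qed

end

section \<open>The majorant of a mixture of finite mass\<close>

lemma csinc_of_real: "csinc (of_real x) = of_real (if x = 0 then 1 else sin (pi * x) / (pi * x))"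
  by (simp add: csinc_def flip: sin_of_real)

locale finite_gaussian_mixture = gaussian_mixture +
  assumes finite_mass: "(\<integral>\<^sup>+t. 1 \<partial>\<nu>) < \<infinity>"
begin

lemma integrable_one: "integrable \<nu> (\<lambda>t. 1 :: real)"
  using finite_mass by (intro integrableI_bounded) auto

definition mass :: real where "mass = (\<integral>t. 1 \<partial>\<nu>)"

lemma mass_nonneg: "mass \<ge> 0" unfolding mass_def by (intro Bochner_Integration.integral_nonneg) simp

text \<open>The upper half of \<open>gap_bounds\<close>, integrated against \<nu>, says that the
  error of \<open>minorant\<close> is at most \<open>mass\<close> times the squared sinc. Adding
  that square keeps values and slopes at the nonzero integers and lifts the value at 0 to the
  right-hand limit of the target.\<close>

definition majorant :: "complex \<Rightarrow> complex" where "majorant z = minorant z + of_real mass * (csinc z)\<^sup>2"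

lemma majorant_exp_type: "exp_type_at_most (2 * pi) majorant"
proof -
  have "exp_type_at_most (2 * pi) (\<lambda>z. (csinc z)\<^sup>2)" using L1_exp_type_csinc_sq[of 0] unfolding L1_exp_type_def by simp
  then show ?thesis unfolding majorant_def[abs_def] by (intro exp_type_at_most_add minorant_exp_type exp_type_at_most_cmult)
qed

lemma majorant_holomorphic: "majorant holomorphic_on UNIV"
  using majorant_exp_type by (simp add: exp_type_at_most_def)

lemma majorant_real_on_reals: "real_on_reals majorant"
  using minorant_real_on_reals by (auto simp: real_on_reals_def majorant_def csinc_of_real)

lemma majorant_of_int: "majorant (of_int n) = of_real (if n = 0 then mass else node_value n)"
  unfolding majorant_def minorant_of_int using csinc_of_int[of n] by (simp add: node_value_def)

lemma majorant_node: "n \<noteq> 0 \<Longrightarrow> majorant (of_int n) = of_real (target (of_int n))"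
  using majorant_of_int[of n] minorant_node[of n] unfolding minorant_of_int by simp

lemma target_le_majorant:
  assumes x: "x \<noteq> 0" shows "target x \<le> Re (majorant (of_real x))"
proof (cases "x \<in> \<int>")
  case True
  then obtain n where n: "x = of_int n" by (auto elim: Ints_cases)
  then show ?thesis using majorant_node[of n] x by simp
next
  case False
  have "(\<integral>t. sin_factor x * gap t x \<partial>\<nu>) \<le> (\<integral>t. Re ((csinc (of_real x))\<^sup>2) * 1 \<partial>\<nu>)"
  proof (rule integral_mono[OF target_minus_minorant(1)[OF False] integrable_mult_right[OF integrable_one]])
    fix t assume "t \<in> space \<nu>"
    then show "sin_factor x * gap t x \<le> Re ((csinc (of_real x))\<^sup>2) * 1"
      using sin_factor_gap_bounds(2)[OF _ False, of t] by (simp add: space_mix)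
  qed
  also have "\<dots> = Re ((csinc (of_real x))\<^sup>2) * mass" unfolding mass_def by (rule integral_mult_right_zero)
  finally show ?thesis using target_minus_minorant(2)[OF False] by (simp add: majorant_def mult.commute)
qed

lemma has_bochner_integral_target_minus_majorant:
  "has_bochner_integral lborel (\<lambda>x. target x - Re (majorant (of_real x))) (- (\<integral>t. majorant_weight t \<partial>\<nu>))"
proof -
  have "has_bochner_integral lborel (\<lambda>x. mass * Re ((csinc (of_real x))\<^sup>2)) (mass * 1)"
    using integrable_Re_csinc_sq integral_Re_csinc_sq by (intro has_bochner_integral_mult_right) (simp add: has_bochner_integral_iff)
  from has_bochner_integral_diff[OF has_bochner_integral_target_minus_minorant this]
  have "has_bochner_integral lborel (\<lambda>x. target x - Re (majorant (of_real x))) ((\<integral>t. minorant_weight t \<partial>\<nu>) - mass * 1)"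
    by (simp add: majorant_def algebra_simps)
  moreover have "(\<integral>t. majorant_weight t \<partial>\<nu>) = mass - (\<integral>t. minorant_weight t \<partial>\<nu>)"
    unfolding majorant_weight_eq mass_def by (rule Bochner_Integration.integral_diff[OF integrable_one integrable_minorant_weight])
  ultimately show ?thesis by simp
qed

text \<open>By dominated convergence \<open>mass\<close> is the limit of the target from the right,
  and continuity of \<open>L\<close> transfers it to 0. The inequality at 0 itself gives only half
  of this.\<close>

lemma majorant_ofD:
  assumes "majorant_of (2 * pi) (truncated_gaussian_mixture \<nu>) L"
  shows "exp_type_at_most (2 * pi) L" "real_on_reals L" "L holomorphic_on UNIV"
    "\<And>x. x \<noteq> 0 \<Longrightarrow> target x \<le> Re (L (of_real x))" "mass \<le> Re (L 0)"
proof -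
  show 1: "exp_type_at_most (2 * pi) L" "real_on_reals L" using assms by (auto simp: majorant_of_def)
  show h: "L holomorphic_on UNIV" using 1 by (simp add: exp_type_at_most_def)
  show le: "target x \<le> Re (L (of_real x))" if "x \<noteq> 0" for x
  proof -
    have "truncated_gaussian_mixture \<nu> x \<le> ereal (Re (L (of_real x)))" using assms by (auto simp: majorant_of_def)
    then show ?thesis by (simp add: mixture_eq_target[OF that])
  qed
  have X: "(\<lambda>k. inverse (real (Suc k))) \<longlonglongrightarrow> 0" by (rule LIMSEQ_inverse_real_of_nat)
  have "(\<lambda>k. \<integral>t. exp (- (pi * t * (inverse (real (Suc k)))\<^sup>2)) \<partial>\<nu>) \<longlonglongrightarrow> (\<integral>t. 1 \<partial>\<nu>)"
  proof (rule integral_dominated_convergence[where w = "\<lambda>t. 1"])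
    show "AE t in \<nu>. (\<lambda>k. exp (- (pi * t * (inverse (real (Suc k)))\<^sup>2))) \<longlonglongrightarrow> 1"
    proof (rule AE_I2)
      fix t
      have "(\<lambda>k. exp (- (pi * t * (inverse (real (Suc k)))\<^sup>2))) \<longlonglongrightarrow> exp (- (pi * t * 0\<^sup>2))" by (intro tendsto_intros X)
      then show "(\<lambda>k. exp (- (pi * t * (inverse (real (Suc k)))\<^sup>2))) \<longlonglongrightarrow> 1" by simp
    qed
    show "AE t in \<nu>. norm (exp (- (pi * t * (inverse (real (Suc k)))\<^sup>2))) \<le> 1" for k
      using AE_mix_nonneg by eventually_elim simp
    show "(\<lambda>t. exp (- (pi * t * (inverse (real (Suc k)))\<^sup>2))) \<in> borel_measurable \<nu>" for k by (rule measurable_mix) measurable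
  qed (use integrable_one in auto)
  then have "(\<lambda>k. target (inverse (real (Suc k)))) \<longlonglongrightarrow> mass" by (simp add: target_def mass_def del: of_nat_Suc)
  then show "mass \<le> Re (L 0)"
    by (rule LIMSEQ_le[OF _ entire_limit_0[OF h X]]) (intro exI allI impI le, simp)
qed

lemma majorant_of_majorant: "majorant_of (2 * pi) (truncated_gaussian_mixture \<nu>) majorant"
  unfolding majorant_of_def
proof (intro conjI allI majorant_exp_type majorant_real_on_reals)
  fix x :: real
  show "truncated_gaussian_mixture \<nu> x \<le> ereal (Re (majorant (of_real x)))"
  proof (cases "x = 0")
    case True
    have "(\<integral>\<^sup>+t. ennreal 1 \<partial>\<nu>) = ennreal mass" unfolding mass_def by (rule nn_integral_eq_integral[OF integrable_one]) simp
    then have "truncated_gaussian_mixture \<nu> x = ereal (1/2) * ereal mass"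
      unfolding True truncated_gaussian_mixture_def xplus0_def using mass_nonneg by (simp add: enn2ereal_ennreal)
    moreover have "Re (majorant (of_real x)) = mass" using majorant_of_int[of 0] True by simp
    ultimately show ?thesis using mass_nonneg by simp
  qed (simp add: mixture_eq_target target_le_majorant)
qed

text \<open>The comparison of minorants is applied to the negatives of the target, of
  \<open>majorant\<close> and of \<open>L\<close>, which turns \<open>mass \<le> Re (L 0)\<close>
  into the inequality required at the origin.\<close>

lemma majorant_optimal:
  assumes L: "majorant_of (2 * pi) (truncated_gaussian_mixture \<nu>) L"
  shows "L1_dist (truncated_gaussian_mixture \<nu>) majorant \<le> L1_dist (truncated_gaussian_mixture \<nu>) L"
    and "L1_dist (truncated_gaussian_mixture \<nu>) L \<le> L1_dist (truncated_gaussian_mixture \<nu>) majorant \<Longrightarrow> L = majorant"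
proof -
  let ?g = "truncated_gaussian_mixture \<nu>"
  note LD = majorant_ofD[OF L]
  have im: "integrable lborel (\<lambda>x. target x - Re (majorant (of_real x)))"
    using has_bochner_integral_target_minus_majorant by (simp add: has_bochner_integral_iff)
  have dm: "L1_dist ?g majorant = ennreal (\<integral>x. Re (majorant (of_real x)) - target x \<partial>lborel)"
    by (rule L1_dist_one_sided(2)[OF majorant_holomorphic im target_le_majorant])
  have "L1_dist ?g majorant \<le> L1_dist ?g L \<and> (L1_dist ?g L \<le> L1_dist ?g majorant \<longrightarrow> L = majorant)"
  proof (cases "L1_dist ?g L < \<infinity>")
    case True
    note iL = L1_dist_le_imp[OF LD(3) True]
    have dL: "L1_dist ?g L = ennreal (\<integral>x. Re (L (of_real x)) - target x \<partial>lborel)"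
      by (rule L1_dist_one_sided(2)[OF LD(3) iL LD(4)])
    define M' where "M' = (\<lambda>z. - majorant z)"
    define L' where "L' = (\<lambda>z. - L z)"
    define tg where "tg = (\<lambda>x. - target x)"
    have M'1: "exp_type_at_most (2 * pi) M'" "real_on_reals M'" and L'1: "exp_type_at_most (2 * pi) L'" "real_on_reals L'"
      unfolding M'_def L'_def using exp_type_at_most_cmult[OF majorant_exp_type, of "-1"] exp_type_at_most_cmult[OF LD(1), of "-1"]
        majorant_real_on_reals LD(2) by (simp_all add: real_on_reals_def)
    have diffs: "(\<lambda>x. tg x - Re (M' (of_real x))) = (\<lambda>x. Re (majorant (of_real x)) - target x)"
      "(\<lambda>x. tg x - Re (L' (of_real x))) = (\<lambda>x. Re (L (of_real x)) - target x)"
      by (simp_all add: tg_def M'_def L'_def)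
    have i1: "integrable lborel (\<lambda>x. tg x - Re (M' (of_real x)))" "integrable lborel (\<lambda>x. tg x - Re (L' (of_real x)))"
      unfolding diffs using integrable_minus[OF im] integrable_minus[OF iL] by simp_all
    have le: "Re (M' (of_real x)) \<le> tg x" "Re (L' (of_real x)) \<le> tg x" if "x \<noteq> 0" for x
      using target_le_majorant[OF that] LD(4)[OF that] by (simp_all add: tg_def M'_def L'_def)
    have node: "Re (M' (of_int n)) = tg (of_int n)" if "n \<noteq> 0" for n using majorant_node[OF that] by (simp add: tg_def M'_def)
    have zero: "Re (L' 0) \<le> Re (M' 0)" using LD(5) majorant_of_int[of 0] by (simp add: M'_def L'_def)
    have df: "\<exists>d. (tg has_real_derivative d) (at (of_int n))" if "n \<noteq> 0" for n
      using target_differentiable[OF that] DERIV_minus unfolding tg_def by blast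
    note core = extremal_core[OF M'1 L'1 le(1) i1(1) le(2) i1(2) node df zero, unfolded diffs]
    have "0 \<le> (\<integral>x. Re (majorant (of_real x)) - target x \<partial>lborel)"
      by (rule integral_nonneg_AE) (use AE_lborel_singleton[of 0] in eventually_elim, simp add: target_le_majorant)
    then have "L1_dist ?g L \<le> L1_dist ?g majorant \<Longrightarrow> (\<integral>x. Re (L (of_real x)) - target x \<partial>lborel) \<le> (\<integral>x. Re (majorant (of_real x)) - target x \<partial>lborel)"
      unfolding dL dm by (simp only: ennreal_le_iff)
    moreover have "L' = M' \<Longrightarrow> L = majorant" unfolding L'_def M'_def by (simp add: fun_eq_iff)
    ultimately show ?thesis using core(2) ennreal_leI[OF core(1)] unfolding dL dm by blast
  next
    case False
    then have "L1_dist ?g L = \<infinity>" using less_top[of "L1_dist ?g L"] unfolding infinity_ennreal_def by blast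
    then show ?thesis by (simp add: dm top_unique)
  qed
  then show "L1_dist ?g majorant \<le> L1_dist ?g L" "L1_dist ?g L \<le> L1_dist ?g majorant \<Longrightarrow> L = majorant"
    by (rule conjunct1, rule conjunct2[THEN mp])
qed

lemma extremal_majorant_iff: "extremal_majorant (2 * pi) (truncated_gaussian_mixture \<nu>) m \<longleftrightarrow> m = majorant"
  unfolding extremal_majorant_def using majorant_of_majorant majorant_optimal by blast

lemma interpolates_majorant: "interpolates_off_zero (truncated_gaussian_mixture \<nu>) majorant"
proof (rule interpolates_off_zeroI[OF majorant_holomorphic majorant_real_on_reals majorant_node])
  fix n :: int and d assume n: "n \<noteq> 0" and d: "(target has_real_derivative d) (at (of_int n))"
  have h: "(\<lambda>z. - majorant z) holomorphic_on UNIV" by (intro holomorphic_intros majorant_holomorphic)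
  have r: "real_on_reals (\<lambda>z. - majorant z)" using majorant_real_on_reals by (simp add: real_on_reals_def)
  have "Re (deriv (\<lambda>z. - majorant z) (of_int n)) = - d"
    by (rule touching_derivative[OF h r _ n _ DERIV_minus[OF d]]) (simp_all add: target_le_majorant majorant_node[OF n])
  moreover have "deriv (\<lambda>z. - majorant z) (of_int n) = - deriv majorant (of_int n)"
    by (intro DERIV_imp_deriv DERIV_minus holomorphic_derivI[OF majorant_holomorphic open_UNIV]) simp
  ultimately show "Re (deriv majorant (of_int n)) = d" by simp
qed

lemma integrable_majorant_weight: "integrable \<nu> majorant_weight"
  unfolding majorant_weight_eq[abs_def] by (rule Bochner_Integration.integrable_diff[OF integrable_one integrable_minorant_weight])

end

theorem theorem4:
  fixes \<nu> :: "real measure" and g :: "real \<Rightarrow> ereal"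
  assumes \<nu>: "sets \<nu> = sets (restrict_space borel {0..})"
    and g: "g = truncated_gaussian_mixture \<nu>"
  shows
    "((\<integral>\<^sup>+t. ennreal (1 / (1 + sqrt t)) \<partial>\<nu>) < \<infinity> \<longrightarrow>
        (\<exists>!l. extremal_minorant (2 * pi) g l) \<and>
        (\<forall>l. extremal_minorant (2 * pi) g l \<longrightarrow>
           interpolates_off_zero g l \<and>
           integrable lborel (\<lambda>x. real_of_ereal (g x - ereal (Re (l (complex_of_real x))))) \<and>
           integrable \<nu> minorant_weight \<and>
           (\<integral>x. real_of_ereal (g x - ereal (Re (l (complex_of_real x)))) \<partial>lborel)
             = (\<integral>t. minorant_weight t \<partial>\<nu>)))
     \<and>
     ((\<integral>\<^sup>+t. 1 \<partial>\<nu>) < \<infinity> \<longrightarrow>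
        (\<exists>!m. extremal_majorant (2 * pi) g m) \<and>
        (\<forall>m. extremal_majorant (2 * pi) g m \<longrightarrow>
           interpolates_off_zero g m \<and>
           integrable lborel (\<lambda>x. real_of_ereal (ereal (Re (m (complex_of_real x))) - g x)) \<and>
           integrable \<nu> majorant_weight \<and>
           (\<integral>x. real_of_ereal (ereal (Re (m (complex_of_real x))) - g x) \<partial>lborel)
             = (\<integral>t. majorant_weight t \<partial>\<nu>)))"
proof (intro conjI[of "_ \<longrightarrow> _" "_ \<longrightarrow> _"] impI)
  assume "(\<integral>\<^sup>+t. ennreal (1 / (1 + sqrt t)) \<partial>\<nu>) < \<infinity>"
  then interpret gaussian_mixture \<nu> by unfold_locales (use \<nu> in auto)
  show "(\<exists>!l. extremal_minorant (2 * pi) g l) \<and> (\<forall>l. extremal_minorant (2 * pi) g l \<longrightarrow> interpolates_off_zero g l \<and>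
      integrable lborel (\<lambda>x. real_of_ereal (g x - ereal (Re (l (complex_of_real x))))) \<and> integrable \<nu> minorant_weight \<and>
      (\<integral>x. real_of_ereal (g x - ereal (Re (l (complex_of_real x)))) \<partial>lborel) = (\<integral>t. minorant_weight t \<partial>\<nu>))"
    unfolding g extremal_minorant_iff
    using interpolates_minorant integrable_minorant_weight
      has_bochner_integral_mixture(1)[OF has_bochner_integral_target_minus_minorant]
    by (simp add: has_bochner_integral_iff)
next
  \<comment> \<open>Since the weight is at most 1, finite mass implies the condition of the first
    part, so the minorant is available as the base of the majorant.\<close>
  assume fin: "(\<integral>\<^sup>+t. 1 \<partial>\<nu>) < \<infinity>"
  have sp: "space \<nu> = {0..}" using sets_eq_imp_space_eq[OF \<nu>] by (simp add: space_restrict_space)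
  have "(\<integral>\<^sup>+t. ennreal (1 / (1 + sqrt t)) \<partial>\<nu>) \<le> (\<integral>\<^sup>+t. 1 \<partial>\<nu>)"
  proof (rule nn_integral_mono)
    fix t assume "t \<in> space \<nu>"
    then have "0 \<le> sqrt t" by (simp add: sp)
    then have "1 / (1 + sqrt t) \<le> 1" by (subst divide_le_eq_1_pos) linarith+
    then show "ennreal (1 / (1 + sqrt t)) \<le> 1" using ennreal_leI by fastforce
  qed
  then have "(\<integral>\<^sup>+t. ennreal (1 / (1 + sqrt t)) \<partial>\<nu>) < \<infinity>" using fin by (rule le_less_trans)
  then interpret finite_gaussian_mixture \<nu> by unfold_locales (use \<nu> fin in auto)
  show "(\<exists>!m. extremal_majorant (2 * pi) g m) \<and> (\<forall>m. extremal_majorant (2 * pi) g m \<longrightarrow> interpolates_off_zero g m \<and>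
      integrable lborel (\<lambda>x. real_of_ereal (ereal (Re (m (complex_of_real x))) - g x)) \<and> integrable \<nu> majorant_weight \<and>
      (\<integral>x. real_of_ereal (ereal (Re (m (complex_of_real x))) - g x) \<partial>lborel) = (\<integral>t. majorant_weight t \<partial>\<nu>))"
    unfolding g extremal_majorant_iff
    using interpolates_majorant integrable_majorant_weight
      has_bochner_integral_mixture(2)[OF has_bochner_integral_target_minus_majorant]
    by (simp add: has_bochner_integral_iff)
qed

end
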